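(* Let $\mathcal{H}$ be a separable infinite-dimensional Hilbert space, let $\mathcal{B}(\mathcal{H})$ be the algebra of bounded operators on $\mathcal{H}$ and $\mathcal{Q}(\mathcal{H})=\mathcal{B}(\mathcal{H})/\mathcal{K}(\mathcal{H})$ the Calkin algebra. Let $\mathcal{A}$ be a finitely generated unital $C^*$-algebra for which there exists a unital $*$-homomorphism $\rho:\mathcal{A}\to\mathcal{Q}(\mathcal{H})$ that has no ucp lift to $\mathcal{B}(\mathcal{H})$. Then there is $n\in\mathbb{N}$ and a four-dimensional operator subsystem $\mathcal{S}$ of $M_{n+1}(\mathcal{A})$ for which $(\rho\otimes\mathrm{id}_{n+1})_{|\mathcal{S}}:\mathcal{S}\to\mathcal{Q}(\mathcal{H})\otimes M_{n+1}$ has no ucp lift to $\mathcal{B}(\mathcal{H})\otimes M_{n+1}$. In particular, $\mathcal{S}$ does not have the lifting property.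
   Context: "Ucp" means unital completely positive. $\mathcal{K}(\mathcal{H})$ is the ideal of compact operators and $\pi:\mathcal{B}(\mathcal{H})\to\mathcal{Q}(\mathcal{H})$ is the canonical quotient map. An operator subsystem of a unital $C^*$-algebra is a self-adjoint linear subspace containing the unit. $M_{n+1}(\mathcal{A})$ is identified with $\mathcal{A}\otimes M_{n+1}$, and $\mathrm{id}_{n+1}$ is the identity map on $M_{n+1}=M_{n+1}(\mathbb{C})$. "Finitely generated" means finitely generated as a $C^*$-algebra. A ucp lift to $\mathcal{B}(\mathcal{H})$ of a ucp map $\varphi:\mathcal{T}\to\mathcal{Q}(\mathcal{H})$ on an operator system (or unital $C^*$-algebra) $\mathcal{T}$ is a ucp map $\psi:\mathcal{T}\to\mathcal{B}(\mathcal{H})$ with $\pi\circ\psi=\varphi$. A ucp lift to $\mathcal{B}(\mathcal{H})\otimes M_{n+1}$ of a ucp map $\varphi:\mathcal{T}\to\mathcal{Q}(\mathcal{H})\otimes M_{n+1}$ is a ucp map $\psi:\mathcal{T}\to\mathcal{B}(\mathcal{H})\otimes M_{n+1}$ with $(\pi\otimes\mathrm{id}_{n+1})\circ\psi=\varphi$. An operator system $\mathcal{S}$ has the lifting property (LP) if, whenever $\mathcal{C}$ is a unital $C^*$-algebra, $\mathcal{I}$ is an ideal of $\mathcal{C}$ and $\varphi:\mathcal{S}\to\mathcal{C}/\mathcal{I}$ is ucp, there exists a ucp map $\psi:\mathcal{S}\to\mathcal{C}$ such that $q\circ\psi=\varphi$, where $q:\mathcal{C}\to\mathcal{C}/\mathcal{I}$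 is the canonical quotient map. *)

theory Defs
  imports
    "HOL-Analysis.Analysis"
    "HOL-Algebra.QuotRing"
    "Jordan_Normal_Form.VS_Connect"
begin

section \<open>Complex Hilbert spaces\<close>

text \<open>The norm, the metric and the real vector space structure are inherited from
  \<^class>\<open>real_inner\<close>; the inner product \<open>cinner\<close> is antilinear in its first argument.\<close>

class chilbert_space = real_inner + complete_space +
  fixes scaleC :: "complex \<Rightarrow> 'a \<Rightarrow> 'a" (infixr \<open>*\<^sub>C\<close> 75)
    and cinner :: "'a \<Rightarrow> 'a \<Rightarrow> complex"
  assumes scaleC_add_right: "a *\<^sub>C (x + y) = a *\<^sub>C x + a *\<^sub>C y"
    and scaleC_add_left: "(a + b) *\<^sub>C x = a *\<^sub>C x + b *\<^sub>C x"
    and scaleC_scaleC: "a *\<^sub>C b *\<^sub>C x = (a * b) *\<^sub>C x"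
    and scaleR_scaleC: "r *\<^sub>R x = complex_of_real r *\<^sub>C x"
    and cinner_commute: "cinner x y = cnj (cinner y x)"
    and cinner_add_right: "cinner x (y + z) = cinner x y + cinner x z"
    and cinner_scaleC_right: "cinner x (a *\<^sub>C y) = a * cinner x y"
    and inner_eq_Re_cinner: "inner x y = Re (cinner x y)"

lemma scaleC_one: "1 *\<^sub>C (x::'a::chilbert_space) = x"
  using scaleR_scaleC[of 1 x] by simp

global_interpretation complex_vector:
  vector_space "scaleC :: complex \<Rightarrow> 'a \<Rightarrow> 'a::chilbert_space"
  by unfold_locales
    (simp_all add: scaleC_add_right scaleC_add_left scaleC_scaleC scaleC_one)

lemma cinner_self: "cinner x x = complex_of_real ((norm (x::'a::chilbert_space))\<^sup>2)"
proof -
  have "Im (cinner x x) = 0"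
    using arg_cong[OF cinner_commute[of x x], of Im] by simp
  then show ?thesis
    by (simp add: complex_eq_iff power2_norm_eq_inner inner_eq_Re_cinner)
qed

lemma norm_scaleC: "norm (a *\<^sub>C (x::'a::chilbert_space)) = cmod a * norm x"
proof -
  have "cinner (a *\<^sub>C x) (a *\<^sub>C x) = a * cnj (a * cinner x x)"
    by (subst cinner_scaleC_right, subst cinner_commute, subst cinner_scaleC_right, simp)
  also have "\<dots> = complex_of_real ((cmod a * norm x)\<^sup>2)"
    using complex_norm_square[of a] by (simp add: cinner_self power_mult_distrib)
  finally have "(norm (a *\<^sub>C x))\<^sup>2 = (cmod a * norm x)\<^sup>2"
    by (simp only: cinner_self of_real_eq_iff)
  then show ?thesis
    by (simp add: power2_eq_iff_nonneg)
qed


section \<open>Unital C*-algebras\<close>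

text \<open>Algebras are records over an explicit carrier, extending the modules of
  \<^theory>\<open>HOL-Algebra.Module\<close> over the field \<^term>\<open>class_ring :: complex ring\<close>, so that
  quotients by ideals and matrix algebras are again of this form and one can quantify over
  all C*-algebras carried by a type.\<close>

record 'a cstar = "(complex, 'a) module" +
  star :: "'a \<Rightarrow> 'a"
  nrm :: "'a \<Rightarrow> real"

text \<open>The case distinction makes the distance total, as \<^locale>\<open>Metric_space\<close> demands
  symmetry and nonnegativity off the carrier as well.\<close>

definition cstar_dist :: "'a cstar \<Rightarrow> 'a \<Rightarrow> 'a \<Rightarrow> real" where
  "cstar_dist A x y =
     (if x \<in> carrier A \<and> y \<in> carrier A then nrm A (x \<ominus>\<^bsub>A\<^esub> y) else 0)"

abbreviation cstar_closed :: "'a cstar \<Rightarrow> 'a set \<Rightarrow> bool" where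
  "cstar_closed A B \<equiv> closedin (Metric_space.mtopology (carrier A) (cstar_dist A)) B"

locale unital_cstar_algebra = ring A + M: module "class_ring :: complex ring" A
  for A :: "'a cstar" (structure) +
  assumes smult_mult_left:
      "x \<in> carrier A \<Longrightarrow> y \<in> carrier A \<Longrightarrow> (c \<odot> x) \<otimes> y = c \<odot> (x \<otimes> y)"
    and smult_mult_right:
      "x \<in> carrier A \<Longrightarrow> y \<in> carrier A \<Longrightarrow> x \<otimes> (c \<odot> y) = c \<odot> (x \<otimes> y)"
    and star_closed: "x \<in> carrier A \<Longrightarrow> star A x \<in> carrier A"
    and star_star: "x \<in> carrier A \<Longrightarrow> star A (star A x) = x"
    and star_add:
      "x \<in> carrier A \<Longrightarrow> y \<in> carrier A \<Longrightarrow> star A (x \<oplus> y) = star A x \<oplus> star A y"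
    and star_smult: "x \<in> carrier A \<Longrightarrow> star A (c \<odot> x) = cnj c \<odot> star A x"
    and star_mult:
      "x \<in> carrier A \<Longrightarrow> y \<in> carrier A \<Longrightarrow> star A (x \<otimes> y) = star A y \<otimes> star A x"
    and nrm_nonneg: "x \<in> carrier A \<Longrightarrow> 0 \<le> nrm A x"
    and nrm_eq_zero: "x \<in> carrier A \<Longrightarrow> nrm A x = 0 \<longleftrightarrow> x = \<zero>"
    and nrm_add: "x \<in> carrier A \<Longrightarrow> y \<in> carrier A \<Longrightarrow> nrm A (x \<oplus> y) \<le> nrm A x + nrm A y"
    and nrm_smult: "x \<in> carrier A \<Longrightarrow> nrm A (c \<odot> x) = cmod c * nrm A x"
    and nrm_mult: "x \<in> carrier A \<Longrightarrow> y \<in> carrier A \<Longrightarrow> nrm A (x \<otimes> y) \<le> nrm A x * nrm A y"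
    and cstar_identity: "x \<in> carrier A \<Longrightarrow> nrm A (star A x \<otimes> x) = (nrm A x)\<^sup>2"
    and complete: "Metric_space.mcomplete (carrier A) (cstar_dist A)"

definition cstar_subalgebra :: "'a cstar \<Rightarrow> 'a set \<Rightarrow> bool" where
  "cstar_subalgebra A B \<longleftrightarrow>
     submodule (class_ring :: complex ring) B A \<and>
     (\<forall>x\<in>B. \<forall>y\<in>B. x \<otimes>\<^bsub>A\<^esub> y \<in> B) \<and> (\<forall>x\<in>B. star A x \<in> B) \<and> cstar_closed A B"

definition cstar_generated :: "'a cstar \<Rightarrow> 'a set \<Rightarrow> 'a set" where
  "cstar_generated A G = \<Inter>{B. cstar_subalgebra A B \<and> G \<subseteq> B}"

definition finitely_generated_cstar :: "'a cstar \<Rightarrow> bool" where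
  "finitely_generated_cstar A \<longleftrightarrow>
     (\<exists>G. finite G \<and> G \<subseteq> carrier A \<and> cstar_generated A G = carrier A)"

definition unital_star_hom :: "'a cstar \<Rightarrow> 'b cstar \<Rightarrow> ('a \<Rightarrow> 'b) \<Rightarrow> bool" where
  "unital_star_hom A B \<rho> \<longleftrightarrow>
     \<rho> \<in> Ring.ring_hom A B \<and> \<rho> \<in> module_hom (class_ring :: complex ring) A B \<and>
     (\<forall>x\<in>carrier A. \<rho> (star A x) = star B (\<rho> x))"

text \<open>Ideals of C*-algebras are closed and two-sided.\<close>

definition cstar_ideal :: "'a set \<Rightarrow> 'a cstar \<Rightarrow> bool" where
  "cstar_ideal I A \<longleftrightarrow> ideal I A \<and> cstar_closed A I"

text \<open>The ring structure is that of \<^term>\<open>A Quot I\<close>, and the quotient map is \<^term>\<open>a_r_coset A I\<close>.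
  The scalar multiple is not the image \<open>(\<odot>) c ` X\<close>, which is no coset when \<open>c = 0\<close>.\<close>

definition cstar_quotient :: "'a cstar \<Rightarrow> 'a set \<Rightarrow> 'a set cstar" where
  "cstar_quotient A I =
     \<lparr>carrier = a_rcosets\<^bsub>A\<^esub> I, mult = rcoset_mult A I, one = I +>\<^bsub>A\<^esub> \<one>\<^bsub>A\<^esub>,
      zero = I, add = set_add A,
      smult = (\<lambda>c X. \<Union>x\<in>X. I +>\<^bsub>A\<^esub> (c \<odot>\<^bsub>A\<^esub> x)),
      star = (\<lambda>X. star A ` X),
      nrm = (\<lambda>X. INF x\<in>X. nrm A x)\<rparr>"


section \<open>Matrix algebras\<close>

definition mat_carrier :: "nat \<Rightarrow> 'a set \<Rightarrow> (nat \<times> nat \<Rightarrow> 'a) set" where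
  "mat_carrier n S = ({..<n} \<times> {..<n}) \<rightarrow>\<^sub>E S"

definition column_nrm :: "nat \<Rightarrow> 'a cstar \<Rightarrow> (nat \<Rightarrow> 'a) \<Rightarrow> real" where
  "column_nrm n A v = sqrt (nrm A (\<Oplus>\<^bsub>A\<^esub>i\<in>{..<n}. star A (v i) \<otimes>\<^bsub>A\<^esub> v i))"

text \<open>The C*-norm of \<open>M\<^sub>n(A)\<close> is the operator norm for its action on the Hilbert
  \<open>A\<close>-module \<open>A\<^sup>n\<close> of columns.\<close>

definition mat_cstar :: "nat \<Rightarrow> 'a cstar \<Rightarrow> (nat \<times> nat \<Rightarrow> 'a) cstar" where
  "mat_cstar n A =
     \<lparr>carrier = mat_carrier n (carrier A),
      mult = (\<lambda>X Y. \<lambda>(i, j)\<in>{..<n} \<times> {..<n}. \<Oplus>\<^bsub>A\<^esub>k\<in>{..<n}. X (i, k) \<otimes>\<^bsub>A\<^esub> Y (k, j)),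
      one = (\<lambda>(i, j)\<in>{..<n} \<times> {..<n}. if i = j then \<one>\<^bsub>A\<^esub> else \<zero>\<^bsub>A\<^esub>),
      zero = (\<lambda>(i, j)\<in>{..<n} \<times> {..<n}. \<zero>\<^bsub>A\<^esub>),
      add = (\<lambda>X Y. \<lambda>(i, j)\<in>{..<n} \<times> {..<n}. X (i, j) \<oplus>\<^bsub>A\<^esub> Y (i, j)),
      smult = (\<lambda>c X. \<lambda>(i, j)\<in>{..<n} \<times> {..<n}. c \<odot>\<^bsub>A\<^esub> X (i, j)),
      star = (\<lambda>X. \<lambda>(i, j)\<in>{..<n} \<times> {..<n}. star A (X (j, i))),
      nrm = (\<lambda>X. SUP v\<in>{v \<in> {..<n} \<rightarrow>\<^sub>E carrier A. column_nrm n A v \<le> 1}.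
                   column_nrm n A (\<lambda>i. \<Oplus>\<^bsub>A\<^esub>j\<in>{..<n}. X (i, j) \<otimes>\<^bsub>A\<^esub> v j))\<rparr>"

text \<open>The amplification \<open>\<phi> \<otimes> id\<^sub>n\<close>.\<close>

definition mat_map :: "nat \<Rightarrow> ('a \<Rightarrow> 'b) \<Rightarrow> (nat \<times> nat \<Rightarrow> 'a) \<Rightarrow> (nat \<times> nat \<Rightarrow> 'b)" where
  "mat_map n \<phi> X = (\<lambda>(i, j)\<in>{..<n} \<times> {..<n}. \<phi> (X (i, j)))"


section \<open>Operator systems, ucp maps and the lifting property\<close>

definition operator_subsystem :: "'a cstar \<Rightarrow> 'a set \<Rightarrow> bool" where
  "operator_subsystem A S \<longleftrightarrow>
     submodule (class_ring :: complex ring) S A \<and> (\<forall>x\<in>S. star A x \<in> S) \<and> \<one>\<^bsub>A\<^esub> \<in> S"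

definition has_dimension :: "'a cstar \<Rightarrow> 'a set \<Rightarrow> nat \<Rightarrow> bool" where
  "has_dimension A S d \<longleftrightarrow>
     vectorspace.fin_dim (class_ring :: complex ring) (A\<lparr>carrier := S\<rparr>) \<and>
     vectorspace.dim (class_ring :: complex ring) (A\<lparr>carrier := S\<rparr>) = d"

definition positive_cone :: "'a cstar \<Rightarrow> 'a set" where
  "positive_cone A = {star A b \<otimes>\<^bsub>A\<^esub> b | b. b \<in> carrier A}"

definition ucp_map :: "'a cstar \<Rightarrow> 'a set \<Rightarrow> 'b cstar \<Rightarrow> ('a \<Rightarrow> 'b) \<Rightarrow> bool" where
  "ucp_map A S B \<phi> \<longleftrightarrow>
     \<phi> \<in> module_hom (class_ring :: complex ring) (A\<lparr>carrier := S\<rparr>) B \<and>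
     \<phi> \<one>\<^bsub>A\<^esub> = \<one>\<^bsub>B\<^esub> \<and>
     (\<forall>k. \<forall>X \<in> mat_carrier k S \<inter> positive_cone (mat_cstar k A).
        mat_map k \<phi> X \<in> positive_cone (mat_cstar k B))"

text \<open>A ucp map on \<open>S \<subseteq> A\<close> into the codomain of \<open>p : B \<rightarrow> Q\<close> lifts to \<open>B\<close>.\<close>

definition has_ucp_lift ::
    "'a cstar \<Rightarrow> 'a set \<Rightarrow> 'b cstar \<Rightarrow> ('b \<Rightarrow> 'c) \<Rightarrow> ('a \<Rightarrow> 'c) \<Rightarrow> bool" where
  "has_ucp_lift A S B p \<phi> \<longleftrightarrow> (\<exists>\<psi>. ucp_map A S B \<psi> \<and> (\<forall>x\<in>S. p (\<psi> x) = \<phi> x))"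

text \<open>The first argument is the type carrying the test algebras \<open>C\<close>. For finite-dimensional
  \<open>S\<close>, every type with at least continuum many elements gives the same notion: a test instance
  \<open>(C, I, \<phi>)\<close> may be replaced by \<open>(C\<^sub>0, C\<^sub>0 \<inter> I, \<phi>)\<close>, where \<open>C\<^sub>0\<close> is the separable
  C*-subalgebra generated by the unit and preimages of \<open>\<phi>\<close> of a basis of \<open>S\<close>, and a separable
  C*-algebra has at most continuum many elements.\<close>

definition lifting_property :: "'c itself \<Rightarrow> 'a cstar \<Rightarrow> 'a set \<Rightarrow> bool" where
  "lifting_property _ A S \<longleftrightarrow>
     (\<forall>(C :: 'c cstar) I \<phi>.
        unital_cstar_algebra C \<and> cstar_ideal I C \<and> ucp_map A S (cstar_quotient C I) \<phi> \<longrightarrow>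
        has_ucp_lift A S C (\<lambda>x. I +>\<^bsub>C\<^esub> x) \<phi>)"


section \<open>Bounded operators and the Calkin algebra\<close>

text \<open>\<^typ>\<open>'h \<Rightarrow>\<^sub>L 'h\<close> consists of the bounded real-linear operators, with the operator norm.\<close>

definition bounded_clinear_ops :: "('h::chilbert_space \<Rightarrow>\<^sub>L 'h) set" where
  "bounded_clinear_ops = {T. \<forall>c x. blinfun_apply T (c *\<^sub>C x) = c *\<^sub>C blinfun_apply T x}"

lift_definition scaleC_blinfun :: "complex \<Rightarrow> ('h::chilbert_space \<Rightarrow>\<^sub>L 'h) \<Rightarrow> ('h \<Rightarrow>\<^sub>L 'h)"
  is "\<lambda>c T x. c *\<^sub>C T x"
proof -
  fix c :: complex and T :: "'h \<Rightarrow> 'h"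
  assume "bounded_linear T"
  moreover have "bounded_linear (\<lambda>x::'h. c *\<^sub>C x)"
    by (rule bounded_linear_intro[where K = "cmod c"])
      (simp_all add: scaleC_add_right scaleR_scaleC scaleC_scaleC norm_scaleC mult.commute)
  ultimately show "bounded_linear (\<lambda>x. c *\<^sub>C T x)"
    by (rule bounded_linear_compose[rotated])
qed

definition adjoint_op :: "('h::chilbert_space \<Rightarrow>\<^sub>L 'h) \<Rightarrow> ('h \<Rightarrow>\<^sub>L 'h)" where
  "adjoint_op T = (THE T'. T' \<in> bounded_clinear_ops \<and>
     (\<forall>x y. cinner (blinfun_apply T' x) y = cinner x (blinfun_apply T y)))"

definition bounded_ops :: "('h::chilbert_space \<Rightarrow>\<^sub>L 'h) cstar" where
  "bounded_ops =
     \<lparr>carrier = bounded_clinear_ops, mult = (o\<^sub>L), one = id_blinfun, zero = 0, add = (+),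
      smult = scaleC_blinfun, star = adjoint_op, nrm = norm\<rparr>"

definition compact_ops :: "('h::chilbert_space \<Rightarrow>\<^sub>L 'h) set" where
  "compact_ops = {T \<in> bounded_clinear_ops. compact (closure (blinfun_apply T ` cball 0 1))}"

definition calkin :: "('h::chilbert_space \<Rightarrow>\<^sub>L 'h) set cstar" where
  "calkin = cstar_quotient bounded_ops compact_ops"

definition calkin_map :: "('h::chilbert_space \<Rightarrow>\<^sub>L 'h) \<Rightarrow> ('h \<Rightarrow>\<^sub>L 'h) set" where
  "calkin_map T = compact_ops +>\<^bsub>bounded_ops\<^esub> T"

end

theory Submission
  imports Defs
begin

text \<open>Put \<open>N = n + 1\<close> and write \<open>M\<close> for the matrix algebra \<open>M\<^sub>N(A)\<close>. For \<open>x\<close> in \<open>M\<close> let \<open>S\<close> be the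
  span of \<open>1\<close>, \<open>x\<close>, \<open>x\<^sup>*\<close> and \<open>x\<^sup>* x + x x\<^sup>*\<close>. This small operator system already forces
  multiplicativity. If \<open>\<psi>\<close> is a ucp lift of \<open>\<rho> \<otimes> id\<close> on \<open>S\<close>, extend it to a ucp map \<open>\<Psi>\<close> on all
  of \<open>M\<close>. The Schwarz inequality gives \<open>\<Psi>(x\<^sup>* x) \<ge> \<Psi>(x)\<^sup>* \<Psi>(x)\<close> and \<open>\<Psi>(x x\<^sup>*) \<ge> \<Psi>(x) \<Psi>(x)\<^sup>*\<close>.
  The sum of the two differences is compact, because \<open>\<Psi>\<close> agrees with a lift of a homomorphism on
  \<open>x\<close> and on \<open>x\<^sup>* x + x x\<^sup>*\<close>. Two positive operators with compact sum are compact, so \<open>x\<close> and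
  \<open>x\<^sup>*\<close> lie in the multiplicative domain of \<open>\<Psi>\<close> modulo the compact operators
  (\<open>mult_domainI_system\<close>).

  The elements of this domain at which \<open>\<Psi>\<close> lifts \<open>\<rho> \<otimes> id\<close>, and whose adjoints are of this kind
  too, form a *-algebra, and the elements of \<open>A\<close> with diagonal matrix in it form a C*-subalgebra
  of \<open>A\<close> (\<open>mult_domain_all\<close>). It remains to choose \<open>x\<close> so that this *-algebra contains the
  diagonal copy of \<open>A\<close>: for generators \<open>g\<close> of \<open>A\<close> a large enough matrix with the \<open>g k\<close> in the
  first row and units above the diagonal generates all matrix units and then the \<open>g k\<close>
  themselves (\<open>gen_mat_generates\<close>); the four spanning elements of \<open>S\<close> are then also linearly
  independent (\<open>gen_mat_independent\<close>). Hence \<open>\<Psi>\<close> lifts \<open>\<rho> \<otimes> id\<close> on the diagonal copy of \<open>A\<close>, and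
  its upper left corner is a ucp lift of \<open>\<rho>\<close> (\<open>lift_of_system_lift\<close>), contrary to the
  hypothesis.

  The extension of \<open>\<psi>\<close> is Arveson's theorem (\<open>arveson_extension\<close>). A completely positive map into
  operators is a positive functional on finitely supported matrices indexed by vectors, and
  positive functionals extend from a cofinal subspace by the theorem of M. Riesz and Krein.
  Cofinality holds because \<open>r 1 - a\<^sup>* a\<close> is a square for large \<open>r\<close>, which is the existence of
  square roots near \<open>1\<close> in a C*-algebra. The extension is handled as a positive semidefinite
  kernel; Stinespring's dilation space occurs only through formal linear combinations and the
  Cauchy--Schwarz inequality. Since positivity in a matrix algebra over the bounded operators
  means to be of the form \<open>c\<^sup>* c\<close>, complete positivity of the corner needs a factorisation of
  positive operator matrices, obtained from a Cholesky decomposition over a countable dense set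
  (\<open>psd_operator_matrix_factor\<close>); this is where separability enters.

  For the lifting property, the test algebra is \<open>M\<^sub>N(B(H))\<close> with its ideal of matrices with
  compact entries. The map \<open>\<rho> \<otimes> id\<close> becomes a ucp map into the quotient, and a ucp lift of it
  would be a ucp lift of \<open>\<rho> \<otimes> id\<close> to \<open>M\<^sub>N(B(H))\<close> (\<open>no_lifting_property\<close>).\<close>

section \<open>Hilbert space preliminaries\<close>

lemma cinner_add_left: "cinner (x + y) z = cinner x z + cinner (y::'h::chilbert_space) z"
  by (metis cinner_commute cinner_add_right complex_cnj_add)

lemma cinner_scaleC_left: "cinner (a *\<^sub>C x) y = cnj a * cinner (x::'h::chilbert_space) y"
  by (metis cinner_commute cinner_scaleC_right complex_cnj_mult)

lemma cinner_zero_right [simp]: "cinner (x::'h::chilbert_space) 0 = 0"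
  using cinner_add_right[of x 0 0] by simp

lemma cinner_zero_left [simp]: "cinner 0 (x::'h::chilbert_space) = 0"
  using cinner_add_left[of 0 0 x] by simp

lemma cinner_minus_right: "cinner (x::'h::chilbert_space) (- y) = - cinner x y"
  using cinner_add_right[of x y "- y"] by (simp add: add_eq_0_iff)

lemma cinner_minus_left: "cinner (- x) y = - cinner (x::'h::chilbert_space) y"
  using cinner_add_left[of x "- x" y] by (simp add: add_eq_0_iff)

lemma cinner_diff_right: "cinner (x::'h::chilbert_space) (y - z) = cinner x y - cinner x z"
  using cinner_add_right[of x y "- z"] by (simp add: cinner_minus_right)

lemma cinner_diff_left: "cinner (x - y) z = cinner (x::'h::chilbert_space) z - cinner y z"
  using cinner_add_left[of x "- y" z] by (simp add: cinner_minus_left)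

lemma cinner_sum_right: "cinner (x::'h::chilbert_space) (\<Sum>i\<in>I. f i) = (\<Sum>i\<in>I. cinner x (f i))"
  by (induction I rule: infinite_finite_induct) (simp_all add: cinner_add_right)

lemma cinner_sum_left: "cinner (\<Sum>i\<in>I. f i) (x::'h::chilbert_space) = (\<Sum>i\<in>I. cinner (f i) x)"
  by (induction I rule: infinite_finite_induct) (simp_all add: cinner_add_left)

lemma scaleC_zero_left [simp]: "0 *\<^sub>C (x::'h::chilbert_space) = 0"
  by (rule complex_vector.scale_zero_left)

lemma scaleC_minus1: "(-1) *\<^sub>C (x::'h::chilbert_space) = - x"
  using complex_vector.scale_minus_left[of 1 x] by (simp add: scaleC_one)

lemma cmod_cinner_le: "cmod (cinner x y) \<le> norm (x::'h::chilbert_space) * norm y"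
proof (cases "cinner x y = 0")
  case False
  define u where "u = cnj (cinner x y) / complex_of_real (cmod (cinner x y))"
  have u: "cmod u = 1"
    using False by (simp add: u_def norm_divide)
  have "cinner x (u *\<^sub>C y) = complex_of_real (cmod (cinner x y))"
    using False complex_norm_square[of "cinner x y"]
    by (simp add: cinner_scaleC_right u_def power2_eq_square mult.commute[of "cnj _"] divide_eq_eq)
  then have "cmod (cinner x y) = inner x (u *\<^sub>C y)"
    by (simp add: inner_eq_Re_cinner)
  also have "\<dots> \<le> norm x * norm (u *\<^sub>C y)"
    using norm_cauchy_schwarz by blast
  finally show ?thesis
    by (simp add: norm_scaleC u)
qed simp

lemma cinner_ext:
  assumes "\<And>x. cinner x y = cinner x (z::'h::chilbert_space)"
  shows "y = z"
proof -
  have "cinner (y - z) (y - z) = 0"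
    using assms[of "y - z"] by (simp add: cinner_diff_right)
  then show ?thesis
    by (simp add: cinner_self)
qed


text \<open>The representing vector minimises \<open>\<parallel>x\<parallel>\<^sup>2 - 2 g x\<close>: minimising sequences are Cauchy by
  the parallelogram law, and the first variation at the minimum is the claimed identity.\<close>

lemma riesz_representation_real:
  fixes g :: "'a::{real_inner, complete_space} \<Rightarrow> real"
  assumes g: "bounded_linear g"
  shows "\<exists>y. \<forall>x. g x = inner y x"
proof -
  interpret g: bounded_linear g by (rule g)
  define J where "J x = inner x x - 2 * g x" for x
  obtain K where K: "\<And>x. norm (g x) \<le> norm x * K"
    using g.bounded by blast
  have J_lower: "- (K\<^sup>2) \<le> J x" for x
  proof -
    have "2 * g x \<le> 2 * (norm x * K)"
      using K[of x] by (simp add: abs_le_iff)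
    moreover have "0 \<le> (norm x - K)\<^sup>2" by simp
    ultimately show ?thesis
      unfolding J_def power2_norm_eq_inner[symmetric] power2_diff by (simp add: algebra_simps)
  qed
  define m where "m = Inf (range J)"
  have bdd: "bdd_below (range J)"
    using J_lower by (auto intro!: bdd_belowI)
  have m_le: "m \<le> J x" for x
    unfolding m_def by (rule cInf_lower[OF _ bdd]) simp
  have "\<exists>x. J x < m + 1 / real (Suc n)" for n
    using cInf_lessD[of "range J" "m + 1 / real (Suc n)"] unfolding m_def by force
  then obtain X where X: "\<And>n. J (X n) < m + 1 / real (Suc n)"
    by metis
  have parallelogram: "(norm (x - y))\<^sup>2 / 2 = J x + J y - 2 * J ((1/2) *\<^sub>R (x + y))" for x y
    unfolding J_def power2_norm_eq_inner
    by (simp add: g.scaleR g.add inner_add inner_diff inner_commute field_simps)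
  have X_close: "(norm (X i - X j))\<^sup>2 \<le> 4 / real (Suc n)" if "n \<le> i" "n \<le> j" for i j n
  proof -
    have "1 / real (Suc i) \<le> 1 / real (Suc n)" "1 / real (Suc j) \<le> 1 / real (Suc n)"
      using that by (simp_all add: frac_le)
    moreover have "4 / real (Suc n) = 4 * (1 / real (Suc n))" by simp
    ultimately show ?thesis
      using parallelogram[of "X i" "X j"] X[of i] X[of j] m_le[of "(1/2) *\<^sub>R (X i + X j)"]
      by linarith
  qed
  have "Cauchy X"
  proof (rule metric_CauchyI)
    fix e :: real assume e: "0 < e"
    obtain n where n: "4 / e\<^sup>2 < real (Suc n)"
      using reals_Archimedean2 by (metis less_SucI of_nat_Suc less_trans lessI of_nat_less_iff)
    then have "4 / real (Suc n) < e\<^sup>2"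
      using e by (simp add: field_simps)
    then have "dist (X i) (X j) < e" if "n \<le> i" "n \<le> j" for i j
      using X_close[OF that] e unfolding dist_norm
      by (meson le_less_trans less_imp_le power2_less_imp_less)
    then show "\<exists>M. \<forall>i\<ge>M. \<forall>j\<ge>M. dist (X i) (X j) < e" by blast
  qed
  then obtain y where y: "X \<longlonglongrightarrow> y"
    using Cauchy_convergent convergent_def by blast
  have "(\<lambda>n. J (X n)) \<longlonglongrightarrow> J y"
    unfolding J_def by (intro tendsto_intros y g.tendsto)
  moreover have "(\<lambda>n. m + 1 / real (Suc n)) \<longlonglongrightarrow> m + 0"
    by (intro tendsto_intros LIMSEQ_Suc[OF lim_1_over_n])
  ultimately have "J y \<le> m + 0"
    using X by (meson LIMSEQ_le less_imp_le)
  then have Jy: "J y \<le> J z" for z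
    using m_le[of z] by simp
  have "g x = inner y x" for x
  proof -
    define d where "d = inner y x - g x"
    have var: "0 \<le> 2 * t * d + t\<^sup>2 * inner x x" for t
      using Jy[of "y + t *\<^sub>R x"] unfolding J_def d_def
      by (simp add: g.scaleR g.add inner_add inner_commute power2_eq_square algebra_simps)
    define s where "s = inner x x + 1"
    have s: "0 < s" "inner x x < s" by (simp_all add: s_def add_nonneg_pos)
    have "0 \<le> 2 * (- d / s) * d + (- d / s)\<^sup>2 * inner x x" by (rule var)
    also have "(- d / s)\<^sup>2 * inner x x \<le> (- d / s)\<^sup>2 * s"
      using s by (intro mult_left_mono) auto
    also have "2 * (- d / s) * d + (- d / s)\<^sup>2 * s = - (d\<^sup>2 / s)"
      using s by (simp add: power2_eq_square field_simps)
    finally have "d\<^sup>2 / s \<le> 0" by simp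
    then have "d = 0"
      using s by (simp add: divide_le_0_iff)
    then show ?thesis by (simp add: d_def)
  qed
  then show ?thesis by blast
qed

lemma riesz_representation:
  fixes f :: "'h::chilbert_space \<Rightarrow> complex"
  assumes add: "\<And>x y. f (x + y) = f x + f y" and scale: "\<And>c x. f (c *\<^sub>C x) = c * f x"
    and bound: "\<And>x. cmod (f x) \<le> K * norm x"
  shows "\<exists>y. \<forall>x. f x = cinner y x"
proof -
  have "bounded_linear (\<lambda>x. Re (f x))"
  proof (rule bounded_linear_intro[where K = K])
    show "Re (f (x + y)) = Re (f x) + Re (f y)" for x y by (simp add: add)
    show "Re (f (r *\<^sub>R x)) = r *\<^sub>R Re (f x)" for r x by (simp add: scaleR_scaleC scale)
    show "norm (Re (f x)) \<le> norm x * K" for x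
      using bound[of x] abs_Re_le_cmod[of "f x"] by (simp add: mult.commute)
  qed
  then obtain y where y: "\<And>x. Re (f x) = Re (cinner y x)"
    using riesz_representation_real[of "\<lambda>x. Re (f x)"] unfolding inner_eq_Re_cinner by metis
  have "f x = cinner y x" for x
    using y[of x] y[of "\<i> *\<^sub>C x"] by (simp add: scale cinner_scaleC_right complex_eq_iff)
  then show ?thesis by blast
qed

lemma bounded_clinear_opsD: "T \<in> bounded_clinear_ops \<Longrightarrow> T (c *\<^sub>C x) = c *\<^sub>C T x"
  by (simp add: bounded_clinear_ops_def)

lemma operator_of_bounded_form:
  fixes B :: "'h::chilbert_space \<Rightarrow> 'h \<Rightarrow> complex"
  assumes add1: "\<And>x x' y. B (x + x') y = B x y + B x' y"
    and scale1: "\<And>c x y. B (c *\<^sub>C x) y = cnj c * B x y"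
    and add2: "\<And>x y y'. B x (y + y') = B x y + B x y'"
    and scale2: "\<And>c x y. B x (c *\<^sub>C y) = c * B x y"
    and bound: "\<And>x y. cmod (B x y) \<le> K * norm x * norm y"
  shows "\<exists>T \<in> bounded_clinear_ops. \<forall>x y. cinner x (blinfun_apply T y) = B x y"
proof -
  have "\<exists>z. \<forall>x. cnj (B x y) = cinner z x" for y
    by (rule riesz_representation[where K = "K * norm y"])
      (use bound[of _ y] in \<open>simp_all add: add1 scale1 mult_ac\<close>)
  then obtain t where t: "\<And>x y. cnj (B x y) = cinner (t y) x"
    by metis
  have t': "cinner x (t y) = B x y" for x y
    by (subst cinner_commute) (simp flip: t)
  have lin: "t (y + y') = t y + t y'" "t (c *\<^sub>C y) = c *\<^sub>C t y" for c y y'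
    by (rule cinner_ext; simp add: t' cinner_add_right cinner_scaleC_right add2 scale2)+
  have "norm (t y) \<le> norm y * \<bar>K\<bar>" for y
  proof -
    have "complex_of_real ((norm (t y))\<^sup>2) = B (t y) y"
      by (simp add: cinner_self flip: t')
    then have "(norm (t y))\<^sup>2 = cmod (B (t y) y)"
      by (metis abs_of_nonneg norm_of_real zero_le_power2)
    also have "\<dots> \<le> K * norm (t y) * norm y" by (rule bound)
    also have "\<dots> \<le> \<bar>K\<bar> * norm (t y) * norm y"
      by (intro mult_right_mono) auto
    finally have "norm (t y) * norm (t y) \<le> norm (t y) * (norm y * \<bar>K\<bar>)"
      by (simp add: power2_eq_square mult_ac)
    then show ?thesis
      by (cases "norm (t y) = 0") auto
  qed
  then have bl: "bounded_linear t"
    by (intro bounded_linear_intro[where K = "\<bar>K\<bar>"]) (simp_all add: lin scaleR_scaleC)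
  show ?thesis
  proof (rule bexI)
    show "\<forall>x y. cinner x (blinfun_apply (Blinfun t) y) = B x y"
      by (simp add: bounded_linear_Blinfun_apply[OF bl] t')
    show "Blinfun t \<in> bounded_clinear_ops"
      by (simp add: bounded_clinear_ops_def bounded_linear_Blinfun_apply[OF bl] lin)
  qed
qed

text \<open>The form \<open>(x, y) \<mapsto> \<langle>T x, y\<rangle>\<close> is bounded, hence given by an operator, and this operator is
  unique; so the definite description that defines \<open>adjoint_op\<close> denotes.\<close>

lemma
  assumes T: "T \<in> bounded_clinear_ops"
  shows adjoint_op_closed: "adjoint_op T \<in> bounded_clinear_ops"
    and cinner_adjoint_left: "cinner (adjoint_op T x) y = cinner x (blinfun_apply T y)"
proof -
  let ?P = "\<lambda>T'. T' \<in> bounded_clinear_ops \<and>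
     (\<forall>x y. cinner (blinfun_apply T' x) y = cinner x (blinfun_apply T y))"
  obtain T' where T': "T' \<in> bounded_clinear_ops" "\<And>x y. cinner x (blinfun_apply T' y) = cinner (blinfun_apply T x) y"
  proof -
    have "\<exists>T' \<in> bounded_clinear_ops. \<forall>x y. cinner x (blinfun_apply T' y) = cinner (blinfun_apply T x) y"
    proof (rule operator_of_bounded_form[where K = "norm T"])
      show "cmod (cinner (blinfun_apply T x) y) \<le> norm T * norm x * norm y" for x y
        using cmod_cinner_le[of "T x" y] norm_blinfun[of T x]
        by (meson mult_right_mono norm_ge_zero order_trans)
    qed (simp_all add: blinfun.add_right cinner_add_left cinner_add_right cinner_scaleC_left
        cinner_scaleC_right bounded_clinear_opsD[OF T])
    then show ?thesis using that by blast
  qed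
  have "?P T'"
    using T' by (metis cinner_commute)
  moreover have "T1 = T'" if "?P T1" for T1
  proof (rule blinfun_eqI, rule cinner_ext)
    fix i x
    show "cinner x (blinfun_apply T1 i) = cinner x (blinfun_apply T' i)"
      using that T' by (metis cinner_commute)
  qed
  ultimately have "?P (adjoint_op T)"
    unfolding adjoint_op_def by (rule theI)
  then show "adjoint_op T \<in> bounded_clinear_ops"
    and "cinner (adjoint_op T x) y = cinner x (blinfun_apply T y)" by auto
qed

lemma cinner_adjoint_right:
  assumes "T \<in> bounded_clinear_ops"
  shows "cinner x (adjoint_op T y) = cinner (blinfun_apply T x) y"
  by (metis assms cinner_adjoint_left cinner_commute)

lemma bounded_clinear_ops_closed:
  "0 \<in> bounded_clinear_ops" "id_blinfun \<in> bounded_clinear_ops"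
  "S \<in> bounded_clinear_ops \<Longrightarrow> T \<in> bounded_clinear_ops \<Longrightarrow> S + T \<in> bounded_clinear_ops"
  "S \<in> bounded_clinear_ops \<Longrightarrow> T \<in> bounded_clinear_ops \<Longrightarrow> S - T \<in> bounded_clinear_ops"
  "T \<in> bounded_clinear_ops \<Longrightarrow> - T \<in> bounded_clinear_ops"
  "S \<in> bounded_clinear_ops \<Longrightarrow> T \<in> bounded_clinear_ops \<Longrightarrow> S o\<^sub>L T \<in> bounded_clinear_ops"
  "T \<in> bounded_clinear_ops \<Longrightarrow> scaleC_blinfun c T \<in> bounded_clinear_ops"
  by (simp_all add: bounded_clinear_ops_def blinfun.bilinear_simps scaleC_add_right
      complex_vector.scale_right_diff_distrib scaleC_blinfun.rep_eq scaleC_scaleC mult.commute)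

lemma blinfun_eq_cinnerI:
  fixes S T :: "'h::chilbert_space \<Rightarrow>\<^sub>L 'h"
  assumes "\<And>x y. cinner x (blinfun_apply S y) = cinner x (blinfun_apply T y)"
  shows "S = T"
  by (rule blinfun_eqI, rule cinner_ext) (rule assms)


section \<open>Compact operators\<close>

text \<open>Total boundedness of the unit ball for a seminorm, in the form of a finite colouring whose
  colour classes are small; two colourings are refined by pairing them.\<close>

definition precompact :: "('h::real_normed_vector \<Rightarrow> real) \<Rightarrow> bool" where
  "precompact p \<longleftrightarrow> (\<forall>e>0. \<exists>g::'h \<Rightarrow> nat. finite (g ` cball 0 1) \<and>
     (\<forall>x\<in>cball 0 1. \<forall>y\<in>cball 0 1. g x = g y \<longrightarrow> p (x - y) < e))"

text \<open>Differences of points of the unit ball have norm at most 2, so for each \<open>e\<close> a colouring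
  suited to some precompact \<open>q\<close> that controls \<open>p\<close> up to \<open>e\<close> will do; \<open>q\<close> may change with \<open>e\<close>.\<close>

lemma precompact_approx:
  assumes "\<And>e. e > 0 \<Longrightarrow> \<exists>q d. precompact q \<and> d > 0 \<and> (\<forall>z. norm z \<le> 2 \<longrightarrow> q z < d \<longrightarrow> p z < e)"
  shows "precompact p"
  unfolding precompact_def
proof (intro allI impI)
  fix e :: real assume "e > 0"
  then obtain q d where q: "precompact q" "d > 0" "\<And>z. norm z \<le> 2 \<Longrightarrow> q z < d \<Longrightarrow> p z < e"
    using assms by blast
  obtain g :: "'a \<Rightarrow> nat" where g: "finite (g ` cball 0 1)"
    "\<And>x y. x \<in> cball 0 1 \<Longrightarrow> y \<in> cball 0 1 \<Longrightarrow> g x = g y \<Longrightarrow> q (x - y) < d"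
    using q(1,2) unfolding precompact_def by meson
  have "norm (x - y) \<le> 2" if "x \<in> cball 0 1" "y \<in> cball 0 1" for x y :: 'a
    using that norm_triangle_ineq4[of x y] by simp
  then show "\<exists>g::'a \<Rightarrow> nat. finite (g ` cball 0 1) \<and>
     (\<forall>x\<in>cball 0 1. \<forall>y\<in>cball 0 1. g x = g y \<longrightarrow> p (x - y) < e)"
    using g q(3) by blast
qed

lemma precompact_dominated:
  assumes "precompact q" and "\<And>e. e > 0 \<Longrightarrow> \<exists>d>0. \<forall>z. norm z \<le> 2 \<longrightarrow> q z < d \<longrightarrow> p z < e"
  shows "precompact p"
proof (rule precompact_approx)
  fix e :: real assume "e > 0"
  from assms(2)[OF this] obtain d where d: "d > 0" "\<forall>z. norm z \<le> 2 \<longrightarrow> q z < d \<longrightarrow> p z < e"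
    by (elim exE conjE)
  show "\<exists>q d. precompact q \<and> d > 0 \<and> (\<forall>z. norm z \<le> 2 \<longrightarrow> q z < d \<longrightarrow> p z < e)"
    by (intro exI[where x = q] exI[where x = d] conjI assms(1) d)
qed

lemma precompact_zero: "precompact (\<lambda>z::'h::real_normed_vector. 0)"
  unfolding precompact_def
proof (intro allI impI)
  fix e :: real assume "e > 0"
  then show "\<exists>g::'h \<Rightarrow> nat. finite (g ` cball 0 1) \<and>
     (\<forall>x\<in>cball 0 1. \<forall>y\<in>cball 0 1. g x = g y \<longrightarrow> 0 < e)"
    by (intro exI[where x = "\<lambda>_. 0"]) (auto intro: finite_subset[of _ "{0}"])
qed

lemma precompact_add:
  assumes p: "precompact p" and q: "precompact q"
  shows "precompact (\<lambda>z. p z + q z)"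
  unfolding precompact_def
proof (intro allI impI)
  fix e :: real assume "e > 0"
  then have e: "e / 2 > 0" by simp
  obtain g :: "'a \<Rightarrow> nat" where g: "finite (g ` cball 0 1)"
    "\<And>x y. x \<in> cball 0 1 \<Longrightarrow> y \<in> cball 0 1 \<Longrightarrow> g x = g y \<Longrightarrow> p (x - y) < e / 2"
    using p e unfolding precompact_def by meson
  obtain h :: "'a \<Rightarrow> nat" where h: "finite (h ` cball 0 1)"
    "\<And>x y. x \<in> cball 0 1 \<Longrightarrow> y \<in> cball 0 1 \<Longrightarrow> h x = h y \<Longrightarrow> q (x - y) < e / 2"
    using q e unfolding precompact_def by meson
  let ?f = "\<lambda>x. prod_encode (g x, h x)"
  have "?f ` cball 0 1 \<subseteq> prod_encode ` (g ` cball 0 1 \<times> h ` cball 0 1)" by auto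
  then have "finite (?f ` cball 0 1)"
    by (rule finite_subset) (simp add: g(1) h(1))
  moreover have "p (x - y) + q (x - y) < e"
    if "x \<in> cball 0 1" "y \<in> cball 0 1" "?f x = ?f y" for x y
    using g(2)[of x y] h(2)[of x y] that by simp
  ultimately show "\<exists>f::'a \<Rightarrow> nat. finite (f ` cball 0 1) \<and>
     (\<forall>x\<in>cball 0 1. \<forall>y\<in>cball 0 1. f x = f y \<longrightarrow> p (x - y) + q (x - y) < e)"
    by (intro exI[where x = ?f]) blast
qed

text \<open>A finite cover of the image of the ball by small balls colours a point by the first ball
  that its image meets. Conversely, representatives of the colours are centres of a finite
  cover; closed balls of half the radius make it cover the closure of the image too.\<close>

lemma compact_ops_iff:
  "T \<in> compact_ops \<longleftrightarrow> T \<in> bounded_clinear_ops \<and> precompact (\<lambda>x. norm (blinfun_apply T x))"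
proof -
  let ?I = "blinfun_apply T ` cball 0 1"
  have "precompact (\<lambda>x. norm (blinfun_apply T x))" if cpt: "compact (closure ?I)"
    unfolding precompact_def
  proof (intro allI impI)
    fix e :: real assume "e > 0"
    then have "e / 2 > 0" by simp
    then obtain k where k: "finite k" "closure ?I \<subseteq> (\<Union>x\<in>k. ball x (e / 2))"
      using cpt[unfolded compact_eq_totally_bounded] by meson
    obtain n :: nat and f where f: "k = f ` {i. i < n}"
      using finite_imp_nat_seg_image_inj_on[OF k(1)] by metis
    define g where "g x = (LEAST i. i < n \<and> blinfun_apply T x \<in> ball (f i) (e / 2))" for x
    have g: "g x < n \<and> blinfun_apply T x \<in> ball (f (g x)) (e / 2)" if "x \<in> cball 0 1" for x
    proof -
      have "blinfun_apply T x \<in> closure ?I"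
        using that by (intro subsetD[OF closure_subset]) simp
      then obtain i where "i < n \<and> blinfun_apply T x \<in> ball (f i) (e / 2)"
        using k(2) f by blast
      then show ?thesis
        unfolding g_def by (rule LeastI)
    qed
    have "norm (blinfun_apply T (x - y)) < e" if "x \<in> cball 0 1" "y \<in> cball 0 1" "g x = g y" for x y
    proof -
      have "dist (blinfun_apply T x) (blinfun_apply T y) < e / 2 + e / 2"
        using g[OF that(1)] g[OF that(2)] that(3)
        by (intro dist_triangle_less_add[of _ "f (g x)"]) (auto simp: dist_commute)
      then show ?thesis
        by (simp add: dist_norm blinfun.diff_right)
    qed
    moreover have "g ` cball 0 1 \<subseteq> {..<n}" using g by auto
    ultimately show "\<exists>g::'a \<Rightarrow> nat. finite (g ` cball 0 1) \<and>
       (\<forall>x\<in>cball 0 1. \<forall>y\<in>cball 0 1. g x = g y \<longrightarrow> norm (blinfun_apply T (x - y)) < e)"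
      by (meson finite_lessThan finite_subset)
  qed
  moreover have "compact (closure ?I)" if pre: "precompact (\<lambda>x. norm (blinfun_apply T x))"
    unfolding compact_eq_totally_bounded
  proof (intro conjI allI impI)
    show "complete (closure ?I)" by (simp add: complete_eq_closed)
    fix e :: real assume e: "e > 0"
    then have "e / 2 > 0" by simp
    then obtain g :: "'a \<Rightarrow> nat" where g: "finite (g ` cball 0 1)"
      "\<And>x y. x \<in> cball 0 1 \<Longrightarrow> y \<in> cball 0 1 \<Longrightarrow> g x = g y \<Longrightarrow> norm (blinfun_apply T (x - y)) < e / 2"
      using pre unfolding precompact_def by meson
    define r where "r v = (SOME x. x \<in> cball 0 1 \<and> g x = v)" for v
    have r: "r (g x) \<in> cball 0 1 \<and> g (r (g x)) = g x" if "x \<in> cball 0 1" for x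
      unfolding r_def by (rule someI[of _ x]) (use that in auto)
    let ?k = "(\<lambda>v. blinfun_apply T (r v)) ` (g ` cball 0 1)"
    have "?I \<subseteq> (\<Union>y\<in>?k. cball y (e / 2))"
    proof (rule image_subsetI)
      fix x :: 'a assume x: "x \<in> cball 0 1"
      have "norm (blinfun_apply T (r (g x) - x)) < e / 2"
        using r[OF x] x g(2) by blast
      then have "blinfun_apply T x \<in> cball (blinfun_apply T (r (g x))) (e / 2)"
        by (simp add: dist_norm blinfun.diff_right)
      then show "blinfun_apply T x \<in> (\<Union>y\<in>?k. cball y (e / 2))" using x by blast
    qed
    moreover have "closed (\<Union>y\<in>?k. cball y (e / 2))"
      using g(1) by (intro closed_UN) auto
    ultimately have "closure ?I \<subseteq> (\<Union>y\<in>?k. cball y (e / 2))"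
      by (rule closure_minimal)
    also have "\<dots> \<subseteq> (\<Union>y\<in>?k. ball y e)"
    proof (rule UN_mono[OF order_refl])
      show "cball y (e / 2) \<subseteq> ball y e" for y :: 'a using e by (auto simp: subset_iff)
    qed
    finally show "\<exists>k. finite k \<and> closure ?I \<subseteq> (\<Union>x\<in>k. ball x e)"
      using g(1) by blast
  qed
  ultimately show ?thesis
    unfolding compact_ops_def by blast
qed

lemma compact_ops_subset: "compact_ops \<subseteq> bounded_clinear_ops"
  by (auto simp: compact_ops_def)

lemma compact_ops_zero: "0 \<in> compact_ops"
  unfolding compact_ops_iff by (simp add: bounded_clinear_ops_closed precompact_zero)

lemma compact_ops_add:
  assumes "S \<in> compact_ops" "T \<in> compact_ops"
  shows "S + T \<in> compact_ops"
  unfolding compact_ops_iff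
proof
  show "S + T \<in> bounded_clinear_ops"
    using assms by (auto intro!: bounded_clinear_ops_closed simp: compact_ops_iff)
  have "norm (blinfun_apply (S + T) z) \<le> norm (blinfun_apply S z) + norm (blinfun_apply T z)" for z
    by (simp add: blinfun.add_left norm_triangle_ineq)
  then show "precompact (\<lambda>x. norm (blinfun_apply (S + T) x))"
    using assms precompact_dominated[OF precompact_add, of "\<lambda>x. norm (blinfun_apply S x)" "\<lambda>x. norm (blinfun_apply T x)"]
    unfolding compact_ops_iff by (meson le_less_trans)
qed

lemma compact_ops_compose_left:
  assumes S: "S \<in> bounded_clinear_ops" and T: "T \<in> compact_ops"
  shows "S o\<^sub>L T \<in> compact_ops"
  unfolding compact_ops_iff
proof
  show "S o\<^sub>L T \<in> bounded_clinear_ops"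
    using assms by (auto intro!: bounded_clinear_ops_closed simp: compact_ops_iff)
  have "norm (blinfun_apply (S o\<^sub>L T) z) < e"
    if "norm (blinfun_apply T z) < e / (norm S + 1)" "e > 0" for z e
  proof -
    have pos: "norm S + 1 > 0" using norm_ge_zero[of S] by linarith
    have "norm (blinfun_apply (S o\<^sub>L T) z) \<le> norm S * norm (blinfun_apply T z)"
      by (simp add: norm_blinfun)
    also have "\<dots> \<le> (norm S + 1) * norm (blinfun_apply T z)"
      by (simp add: mult_right_mono)
    also have "\<dots> < e" using that(1) pos by (simp add: field_simps)
    finally show ?thesis .
  qed
  moreover have "e / (norm S + 1) > 0" if "e > 0" for e
    using that norm_ge_zero[of S] by (intro divide_pos_pos) linarith+
  ultimately show "precompact (\<lambda>x. norm (blinfun_apply (S o\<^sub>L T) x))"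
    using T precompact_dominated[of "\<lambda>x. norm (blinfun_apply T x)" "\<lambda>x. norm (blinfun_apply (S o\<^sub>L T) x)"]
    unfolding compact_ops_iff by meson
qed

lemma compact_ops_compose_right:
  assumes S: "S \<in> bounded_clinear_ops" and T: "T \<in> compact_ops"
  shows "T o\<^sub>L S \<in> compact_ops"
  unfolding compact_ops_iff
proof
  show "T o\<^sub>L S \<in> bounded_clinear_ops"
    using assms by (auto intro!: bounded_clinear_ops_closed simp: compact_ops_iff)
  define M where "M = norm S + 1"
  have M: "M > 0" using norm_ge_zero[of S] unfolding M_def by linarith
  show "precompact (\<lambda>x. norm (blinfun_apply (T o\<^sub>L S) x))"
    unfolding precompact_def
  proof (intro allI impI)
    fix e :: real assume "e > 0"
    then have "e / M > 0" using M by simp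
    then obtain g :: "'a \<Rightarrow> nat" where g: "finite (g ` cball 0 1)"
      "\<And>x y. x \<in> cball 0 1 \<Longrightarrow> y \<in> cball 0 1 \<Longrightarrow> g x = g y \<Longrightarrow> norm (blinfun_apply T (x - y)) < e / M"
      using T unfolding compact_ops_iff precompact_def by meson
    define s where "s x = (1 / M) *\<^sub>R blinfun_apply S x" for x
    have s: "s x \<in> cball 0 1" if "x \<in> cball 0 1" for x
    proof -
      have "norm (blinfun_apply S x) \<le> norm S * norm x" by (rule norm_blinfun)
      also have "\<dots> \<le> norm S * 1" using that by (intro mult_left_mono) auto
      also have "\<dots> \<le> M" by (simp add: M_def)
      finally show ?thesis using M by (simp add: s_def)
    qed
    have "norm (blinfun_apply (T o\<^sub>L S) (x - y)) < e"
      if "x \<in> cball 0 1" "y \<in> cball 0 1" "g (s x) = g (s y)" for x y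
    proof -
      have "(T o\<^sub>L S) (x - y) = M *\<^sub>R blinfun_apply T (s x - s y)"
        using M by (simp add: s_def blinfun.bilinear_simps scaleR_diff_right)
      then have "norm (blinfun_apply (T o\<^sub>L S) (x - y)) = M * norm (blinfun_apply T (s x - s y))"
        using M by simp
      then show ?thesis
        using g(2)[OF s s that(3)] that(1,2) M by (simp add: field_simps)
    qed
    moreover have "(\<lambda>x. g (s x)) ` cball 0 1 \<subseteq> g ` cball 0 1" using s by auto
    ultimately show "\<exists>g::'a \<Rightarrow> nat. finite (g ` cball 0 1) \<and>
       (\<forall>x\<in>cball 0 1. \<forall>y\<in>cball 0 1. g x = g y \<longrightarrow> norm (blinfun_apply (T o\<^sub>L S) (x - y)) < e)"
      using g(1) finite_subset by (intro exI[where x = "\<lambda>x. g (s x)"]) blast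
  qed
qed

lemma scaleC_blinfun_eq_compose: "scaleC_blinfun c T = scaleC_blinfun c id_blinfun o\<^sub>L T"
  by (rule blinfun_eqI) (simp add: scaleC_blinfun.rep_eq)

lemma compact_ops_scaleC: "T \<in> compact_ops \<Longrightarrow> scaleC_blinfun c T \<in> compact_ops"
  using compact_ops_compose_left[OF bounded_clinear_ops_closed(7)[OF bounded_clinear_ops_closed(2)], of T c]
    scaleC_blinfun_eq_compose[of c T] by simp

lemma scaleC_blinfun_minus1: "scaleC_blinfun (-1) T = - T"
  by (rule blinfun_eqI) (simp add: scaleC_blinfun.rep_eq scaleC_minus1 blinfun.minus_left)

lemma compact_ops_minus: "T \<in> compact_ops \<Longrightarrow> - T \<in> compact_ops"
  using compact_ops_scaleC[of T "-1"] by (simp add: scaleC_blinfun_minus1)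

lemma compact_ops_diff: "S \<in> compact_ops \<Longrightarrow> T \<in> compact_ops \<Longrightarrow> S - T \<in> compact_ops"
  using compact_ops_add[OF _ compact_ops_minus, of S T] by simp

section \<open>Orthonormal sequences\<close>

text \<open>Gram--Schmidt: finitely many vectors never span, and a vector outside their span minus its
  projection is a nonzero vector orthogonal to them.\<close>

lemma exists_orthonormal_sequence:
  assumes inf: "\<not> (\<exists>B :: 'h::chilbert_space set. finite B \<and> complex_vector.span B = UNIV)"
  shows "\<exists>e :: nat \<Rightarrow> 'h. \<forall>i j. cinner (e i) (e j) = (if i = j then 1 else 0)"
proof -
  define P where "P f n r \<longleftrightarrow> cinner r r = 1 \<and> (\<forall>i<n. cinner (f i) r = 0)"
    for f :: "nat \<Rightarrow> 'h" and n :: nat and r :: 'h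
  have "\<exists>f. \<forall>n. P f n (f n)"
  proof (rule dependent_wellorder_choice)
    show "P f x r = P g x r" if "\<And>y. y < x \<Longrightarrow> f y = g y" for r f g x
      using that unfolding P_def by auto
    fix n :: nat and f :: "nat \<Rightarrow> 'h"
    assume f: "\<And>y. y < n \<Longrightarrow> P f y (f y)"
    have orth: "cinner (f i) (f j) = (if i = j then 1 else 0)" if "i < n" "j < n" for i j
    proof (cases i j rule: linorder_cases)
      case less
      then show ?thesis using f[OF that(2)] by (simp add: P_def)
    next
      case equal
      then show ?thesis using f[OF that(1)] by (simp add: P_def)
    next
      case greater
      then have "cinner (f j) (f i) = 0" using f[OF that(1)] by (simp add: P_def)
      then show ?thesis using greater cinner_commute[of "f i" "f j"] by simp
    qed
    obtain y where y: "y \<notin> complex_vector.span (f ` {..<n})"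
      using inf by (metis UNIV_eq_I finite_imageI finite_lessThan)
    define z where "z = y - (\<Sum>i<n. cinner (f i) y *\<^sub>C f i)"
    have "z \<noteq> 0"
    proof
      assume "z = 0"
      then have "y = (\<Sum>i<n. cinner (f i) y *\<^sub>C f i)" by (simp add: z_def)
      also have "\<dots> \<in> complex_vector.span (f ` {..<n})"
        by (intro complex_vector.span_sum complex_vector.span_scale complex_vector.span_base) auto
      finally show False using y by contradiction
    qed
    have zf: "cinner (f j) z = 0" if "j < n" for j
    proof -
      have "cinner (f j) (\<Sum>i<n. cinner (f i) y *\<^sub>C f i) = (\<Sum>i<n. if i = j then cinner (f i) y else 0)"
        unfolding cinner_sum_right by (rule sum.cong) (use that orth in \<open>auto simp: cinner_scaleC_right\<close>)
      also have "\<dots> = cinner (f j) y" using that by simp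
      finally show ?thesis by (simp add: z_def cinner_diff_right)
    qed
    have "P f n (complex_of_real (1 / norm z) *\<^sub>C z)"
      unfolding P_def using \<open>z \<noteq> 0\<close>
      by (simp add: cinner_scaleC_right cinner_self zf norm_scaleC norm_divide)
    then show "\<exists>r. P f n r" by blast
  qed
  then obtain e where e: "\<And>n. P e n (e n)" by blast
  have "cinner (e i) (e j) = (if i = j then 1 else 0)" for i j
  proof (cases i j rule: linorder_cases)
    case less
    then show ?thesis using e[of j] by (simp add: P_def)
  next
    case equal
    then show ?thesis using e[of i] by (simp add: P_def)
  next
    case greater
    then have "cinner (e j) (e i) = 0" using e[of i] by (simp add: P_def)
    then show ?thesis using greater cinner_commute[of "e i" "e j"] by simp
  qed
  then show ?thesis by blast
qed

text \<open>Orthonormal vectors have mutual distance \<open>\<surd>2\<close>, so colour classes of diameter below 1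
  contain at most one of them each.\<close>

lemma id_not_compact:
  fixes e :: "nat \<Rightarrow> 'h::chilbert_space"
  assumes e: "\<And>i j. cinner (e i) (e j) = (if i = j then 1 else 0)"
  shows "(id_blinfun :: 'h \<Rightarrow>\<^sub>L 'h) \<notin> compact_ops"
proof
  assume "(id_blinfun :: 'h \<Rightarrow>\<^sub>L 'h) \<in> compact_ops"
  then have pre: "precompact (\<lambda>x::'h. norm x)" by (simp add: compact_ops_iff)
  have "(0::real) < 1" by simp
  then obtain g :: "'h \<Rightarrow> nat" where g: "finite (g ` cball 0 1)"
    "\<And>x y. x \<in> cball 0 1 \<Longrightarrow> y \<in> cball 0 1 \<Longrightarrow> g x = g y \<Longrightarrow> norm (x - y) < 1"
    using pre unfolding precompact_def by meson
  have ball: "e i \<in> cball 0 1" for i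
  proof -
    have "complex_of_real ((norm (e i))\<^sup>2) = 1" using e[of i i] by (simp only: cinner_self simp_thms if_True)
    then have "(norm (e i))\<^sup>2 = 1" by (simp only: of_real_eq_1_iff)
    then show ?thesis by (auto simp: power2_eq_1_iff)
  qed
  have "\<not> inj (\<lambda>i. g (e i))"
  proof
    assume "inj (\<lambda>i. g (e i))"
    moreover have "range (\<lambda>i. g (e i)) \<subseteq> g ` cball 0 1" using ball by auto
    ultimately show False
      using g(1) finite_subset range_inj_infinite by metis
  qed
  then obtain i j where ij: "i \<noteq> j" "g (e i) = g (e j)" by (auto simp: inj_def)
  then have "norm (e i - e j) < 1" using g(2) ball by blast
  moreover have "complex_of_real ((norm (e i - e j))\<^sup>2) = 2"
    unfolding cinner_self[symmetric] using ij(1) by (simp add: cinner_diff_left cinner_diff_right e)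
  then have "(norm (e i - e j))\<^sup>2 = 2" by (metis of_real_eq_iff of_real_numeral)
  ultimately show False
    using power_mono[of "norm (e i - e j)" 1 2] by simp
qed


section \<open>Positive semidefinite kernels\<close>

text \<open>A formal linear combination of points is a list of coefficients and points. Points need
  not be elements of a vector space, and lists let combinations be appended without collecting
  terms.\<close>

definition kernel_form ::
    "('x \<Rightarrow> 'x \<Rightarrow> complex) \<Rightarrow> (complex \<times> 'x) list \<Rightarrow> (complex \<times> 'x) list \<Rightarrow> complex" where
  "kernel_form K v w = (\<Sum>(a, x)\<leftarrow>v. \<Sum>(b, y)\<leftarrow>w. cnj a * b * K x y)"

definition psd_kernel :: "'x set \<Rightarrow> ('x \<Rightarrow> 'x \<Rightarrow> complex) \<Rightarrow> bool" where
  "psd_kernel X K \<longleftrightarrow> (\<forall>v. snd ` set v \<subseteq> X \<longrightarrow> kernel_form K v v \<in> \<real>\<^sub>\<ge>\<^sub>0)"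

definition scale_formal :: "complex \<Rightarrow> (complex \<times> 'x) list \<Rightarrow> (complex \<times> 'x) list" where
  "scale_formal c v = map (\<lambda>(a, x). (c * a, x)) v"

lemma kernel_form_simps [simp]:
  "kernel_form K [] w = 0" "kernel_form K v [] = 0"
  "kernel_form K ((a, x) # v) w = (\<Sum>(b, y)\<leftarrow>w. cnj a * b * K x y) + kernel_form K v w"
  by (simp_all add: kernel_form_def) (induction v; auto)

lemma kernel_form_append_left: "kernel_form K (v @ v') w = kernel_form K v w + kernel_form K v' w"
  by (simp add: kernel_form_def)

lemma kernel_form_append_right: "kernel_form K v (w @ w') = kernel_form K v w + kernel_form K v w'"
  by (induction v) (auto simp: algebra_simps)

lemma kernel_form_scale_left: "kernel_form K (scale_formal c v) w = cnj c * kernel_form K v w"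
proof (induction v)
  case (Cons p v)
  have "(\<Sum>(b, y)\<leftarrow>w. cnj (c * a) * b * K x y) = cnj c * (\<Sum>(b, y)\<leftarrow>w. cnj a * b * K x y)" for a x
    by (simp add: sum_list_const_mult[symmetric] split_def mult.assoc)
  then show ?case
    using Cons by (cases p) (simp add: scale_formal_def algebra_simps)
qed (simp add: scale_formal_def)

lemma kernel_form_scale_right: "kernel_form K v (scale_formal c w) = c * kernel_form K v w"
proof (induction v)
  case (Cons p v)
  have "(\<Sum>(b, y)\<leftarrow>scale_formal c w. cnj a * b * K x y) = c * (\<Sum>(b, y)\<leftarrow>w. cnj a * b * K x y)" for a x
    by (induction w) (auto simp: scale_formal_def algebra_simps)
  then show ?case
    using Cons by (cases p) (simp add: algebra_simps)
qed simp

lemma snd_scale_formal [simp]: "snd ` set (scale_formal c v) = snd ` set v"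
  by (force simp: scale_formal_def)

lemmas kernel_form_expand = kernel_form_append_left kernel_form_append_right
  kernel_form_scale_left kernel_form_scale_right

text \<open>The values at \<open>t = 0, 1, -1, \<i>\<close> force the middle coefficients to be conjugate. The
  inequality is then the minimum over \<open>t = u r\<^sup>*\<close> with real \<open>u\<close>; if \<open>q\<close> vanishes, large \<open>u\<close>
  force \<open>r = 0\<close>.\<close>

lemma nonneg_real_form_cauchy_schwarz:
  fixes p q r s :: complex
  assumes form: "\<And>t. p + t * r + cnj t * s + cnj t * t * q \<in> \<real>\<^sub>\<ge>\<^sub>0"
  shows "s = cnj r" "(cmod r)\<^sup>2 \<le> Re p * Re q"
proof -
  have p: "Re p \<ge> 0" "Im p = 0"
    using form[of 0] by (simp_all add: complex_nonneg_Reals_iff)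
  have q: "Im q = 0"
    using form[of 1] form[of "-1"] p by (simp add: complex_nonneg_Reals_iff)
  have "Im r + Im s = 0"
    using form[of 1] p q by (simp add: complex_nonneg_Reals_iff)
  moreover have "Re r - Re s = 0"
    using form[of \<i>] p q by (simp add: complex_nonneg_Reals_iff)
  ultimately show s: "s = cnj r"
    by (simp add: complex_eq_iff)
  have quad: "0 \<le> Re p + 2 * u * (cmod r)\<^sup>2 + u\<^sup>2 * (cmod r)\<^sup>2 * Re q" for u :: real
  proof -
    have eq: "p + (complex_of_real u * cnj r) * r + cnj (complex_of_real u * cnj r) * s
        + cnj (complex_of_real u * cnj r) * (complex_of_real u * cnj r) * q
      = p + 2 * complex_of_real u * (r * cnj r) + (complex_of_real u)\<^sup>2 * (r * cnj r) * q"
      by (simp add: s power2_eq_square algebra_simps)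
    have "0 \<le> Re (p + 2 * complex_of_real u * (r * cnj r) + (complex_of_real u)\<^sup>2 * (r * cnj r) * q)"
      using form[of "complex_of_real u * cnj r"] unfolding eq by (simp add: complex_nonneg_Reals_iff)
    then show ?thesis
      unfolding complex_norm_square[symmetric] by (simp flip: of_real_power)
  qed
  show "(cmod r)\<^sup>2 \<le> Re p * Re q"
  proof (cases "Re q > 0")
    case True
    have "0 \<le> Re p + 2 * (- 1 / Re q) * (cmod r)\<^sup>2 + (- 1 / Re q)\<^sup>2 * (cmod r)\<^sup>2 * Re q"
      by (rule quad)
    then show ?thesis
      using True by (simp add: field_simps power2_eq_square)
  next
    case False
    have "cmod r = 0"
    proof (rule ccontr)
      assume "cmod r \<noteq> 0"
      then have pos: "(cmod r)\<^sup>2 > 0" by simp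
      define u where "u = - (Re p + 1) / (cmod r)\<^sup>2"
      have "u\<^sup>2 * (cmod r)\<^sup>2 * Re q \<le> 0"
        using False by (intro mult_nonneg_nonpos) auto
      moreover have "2 * u * (cmod r)\<^sup>2 = - 2 * (Re p + 1)"
        using pos by (simp add: u_def)
      ultimately show False
        using quad[of u] p(1) by simp
    qed
    moreover have "Re q \<ge> 0"
    proof (rule ccontr)
      assume q_neg: "\<not> Re q \<ge> 0"
      define u where "u = 1 + (Re p) / (- Re q)"
      have u: "u \<ge> 1" using q_neg p(1) by (simp add: u_def divide_nonneg_neg)
      have "0 \<le> Re p + u\<^sup>2 * Re q"
        using form[of "complex_of_real u"] \<open>cmod r = 0\<close> s
        by (simp add: complex_nonneg_Reals_iff power2_eq_square)
      moreover have "u * Re q \<ge> u\<^sup>2 * Re q"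
        using u q_neg by (simp add: power2_eq_square mult_right_mono_neg)
      moreover have "u * Re q = Re q - Re p"
        using q_neg by (simp add: u_def field_simps)
      ultimately show False using q_neg by simp
    qed
    ultimately show ?thesis using p(1) by simp
  qed
qed

lemma psd_kernel_form:
  assumes K: "psd_kernel X K" and v: "snd ` set v \<subseteq> X" and w: "snd ` set w \<subseteq> X"
  shows kernel_form_nonneg: "kernel_form K v v \<in> \<real>\<^sub>\<ge>\<^sub>0"
    and kernel_form_hermitian: "kernel_form K w v = cnj (kernel_form K v w)"
    and kernel_form_cauchy_schwarz:
      "(cmod (kernel_form K v w))\<^sup>2 \<le> Re (kernel_form K v v) * Re (kernel_form K w w)"
proof -
  show "kernel_form K v v \<in> \<real>\<^sub>\<ge>\<^sub>0"
    using K v by (auto simp: psd_kernel_def)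
  have "kernel_form K v v + t * kernel_form K v w + cnj t * kernel_form K w v
      + cnj t * t * kernel_form K w w \<in> \<real>\<^sub>\<ge>\<^sub>0" for t
  proof -
    have "snd ` set (v @ scale_formal t w) \<subseteq> X" using v w by (simp add: image_Un)
    then have "kernel_form K (v @ scale_formal t w) (v @ scale_formal t w) \<in> \<real>\<^sub>\<ge>\<^sub>0"
      using K by (auto simp: psd_kernel_def)
    then show ?thesis by (simp add: kernel_form_expand algebra_simps)
  qed
  note cs = nonneg_real_form_cauchy_schwarz[OF this]
  show "kernel_form K w v = cnj (kernel_form K v w)"
    and "(cmod (kernel_form K v w))\<^sup>2 \<le> Re (kernel_form K v v) * Re (kernel_form K w w)"
    by (fact cs)+
qed

lemma psd_kernel_hermitian:
  assumes "psd_kernel X K" "x \<in> X" "y \<in> X"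
  shows "K y x = cnj (K x y)"
  using kernel_form_hermitian[OF assms(1), of "[(1, x)]" "[(1, y)]"] assms by simp

text \<open>Eliminating one point \<open>p\<close> (a Schur complement) subtracts the square of the component along
  \<open>p\<close>; what remains is the form minimised over multiples of \<open>p\<close>, hence still positive.\<close>

definition schur_complement :: "'x \<Rightarrow> ('x \<Rightarrow> 'x \<Rightarrow> complex) \<Rightarrow> 'x \<Rightarrow> 'x \<Rightarrow> complex" where
  "schur_complement p K x y = (if K p p = 0 then K x y else K x y - K x p * K p y / K p p)"

lemma psd_kernel_schur_complement:
  assumes K: "psd_kernel UNIV K"
  shows "psd_kernel UNIV (schur_complement p K)"
proof (cases "K p p = 0")
  case False
  define d where "d = K p p"
  have d: "d \<noteq> 0" "cnj d = d"
    using False psd_kernel_hermitian[OF K, of p p] by (simp_all add: d_def)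
  have "kernel_form (schur_complement p K) v w
      = kernel_form K v w - kernel_form K v [(1, p)] * kernel_form K [(1, p)] w / d" for v w
  proof (induction v)
    case (Cons q v)
    obtain a x where q: "q = (a, x)" by (cases q)
    have h: "(\<Sum>(b, y)\<leftarrow>w. cnj a * b * schur_complement p K x y)
        = (\<Sum>(b, y)\<leftarrow>w. cnj a * b * K x y) - cnj a * K x p * (\<Sum>(b, y)\<leftarrow>w. b * K p y) / d"
      using False by (induction w) (auto simp: schur_complement_def d_def algebra_simps
          diff_divide_distrib add_divide_distrib)
    then show ?case
      by (simp only: q kernel_form_simps h Cons) (simp add: algebra_simps add_divide_distrib)
  qed simp
  moreover have "kernel_form K v v - kernel_form K v [(1, p)] * kernel_form K [(1, p)] v / d \<in> \<real>\<^sub>\<ge>\<^sub>0" for v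
  proof -
    define f where "f = kernel_form K [(1, p)] v"
    have herm: "kernel_form K v [(1, p)] = cnj f"
      unfolding f_def by (rule kernel_form_hermitian[OF K]) auto
    let ?u = "v @ scale_formal (- f / d) [(1, p)]"
    have "kernel_form K ?u ?u \<in> \<real>\<^sub>\<ge>\<^sub>0"
      by (rule kernel_form_nonneg[OF K]) auto
    moreover have "kernel_form K [(1, p)] [(1, p)] = d" by (simp add: d_def)
    then have "kernel_form K ?u ?u = kernel_form K v v - cnj f * f / d"
      unfolding kernel_form_expand herm f_def[symmetric] using d by (simp add: field_simps)
    ultimately show ?thesis by (simp add: herm f_def)
  qed
  ultimately show ?thesis
    by (simp add: psd_kernel_def)
qed (use K in \<open>simp add: schur_complement_def[abs_def]\<close>)

lemma psd_kernel_null: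
  assumes K: "psd_kernel X K" and "x \<in> X" "y \<in> X" "K x x = 0"
  shows "K x y = 0" "K y x = 0"
proof -
  show "K x y = 0"
    using kernel_form_cauchy_schwarz[OF K, of "[(1, x)]" "[(1, y)]"] assms by simp
  then show "K y x = 0"
    using psd_kernel_hermitian[OF K assms(2,3)] by simp
qed

text \<open>Cholesky factorisation: eliminating \<open>0, 1, 2, \<dots>\<close> in turn writes \<open>K\<close> as \<open>L L\<^sup>*\<close> with \<open>L\<close> lower
  triangular, and the rows of \<open>L\<close> are the coordinates of the realising vectors.\<close>

lemma gram_realization_nat:
  fixes e :: "nat \<Rightarrow> 'h::chilbert_space"
  assumes e: "\<And>i j. cinner (e i) (e j) = (if i = j then 1 else 0)"
    and K: "psd_kernel UNIV K"
  shows "\<exists>w :: nat \<Rightarrow> 'h. \<forall>m n. cinner (w m) (w n) = K m n"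
proof -
  define A where "A n = rec_nat K (\<lambda>n K. schur_complement n K) n" for n
  have A0: "A 0 = K" and AS: "A (Suc n) = schur_complement n (A n)" for n
    by (simp_all add: A_def)
  have psd: "psd_kernel UNIV (A n)" for n
    by (induction n) (simp_all add: A0 AS K psd_kernel_schur_complement)
  have herm: "A n y x = cnj (A n x y)" for n x y
    by (rule psd_kernel_hermitian[OF psd]) auto
  have diag: "A n i i \<in> \<real>\<^sub>\<ge>\<^sub>0" for n i
    using kernel_form_nonneg[OF psd, of "[(1, i)]" "[]"] by simp
  have rows: "i < n \<Longrightarrow> A n i y = 0" for n i y
  proof (induction n arbitrary: y)
    case (Suc n)
    show ?case
    proof (cases "i = n")
      case True
      then show ?thesis
        using psd_kernel_null[OF psd[of n], of n y] by (auto simp: AS schur_complement_def)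
    next
      case False
      then show ?thesis
        using Suc by (simp add: AS schur_complement_def)
    qed
  qed simp
  define L where "L k x = (if A k k k = 0 then 0 else A k x k / complex_of_real (sqrt (Re (A k k k))))" for k x
  have step: "A n x y = A (Suc n) x y + L n x * cnj (L n y)" for n x y
  proof (cases "A n n n = 0")
    case False
    define d where "d = Re (A n n n)"
    have d: "A n n n = complex_of_real d" "d > 0"
      using diag[of n n] False
      by (auto simp: d_def complex_nonneg_Reals_iff complex_eq_iff less_le)
    have "L n x * cnj (L n y) = A n x n * A n n y / (complex_of_real (sqrt d) * complex_of_real (sqrt d))"
      using False herm[of n n y] by (simp add: L_def d_def)
    also have "complex_of_real (sqrt d) * complex_of_real (sqrt d) = A n n n"
      using d by (simp flip: of_real_mult)
    finally show ?thesis
      using False by (simp add: AS schur_complement_def)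
  qed (simp add: AS schur_complement_def L_def)
  have sum: "K x y = A n x y + (\<Sum>k<n. L k x * cnj (L k y))" for n x y
  proof (induction n)
    case (Suc n)
    then show ?case using step[of n x y] by simp
  qed (simp add: A0)
  have L_zero: "L k x = 0" if "x < k" for k x
    using rows[OF that] by (simp add: L_def)
  define w where "w x = (\<Sum>k<Suc x. cnj (L k x) *\<^sub>C e k)" for x
  have w: "w x = (\<Sum>k<n. cnj (L k x) *\<^sub>C e k)" if "x < n" for x n
    unfolding w_def by (rule sum.mono_neutral_left) (use that L_zero in auto)
  have "cinner (w x) (w y) = K x y" for x y
  proof -
    define n where "n = Suc (max x y)"
    have n: "x < n" "y < n" by (simp_all add: n_def)
    have "cinner (w x) (w y) = (\<Sum>k<n. \<Sum>l<n. if l = k then L k x * cnj (L l y) else 0)"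
      unfolding w[OF n(1)] w[OF n(2)] cinner_sum_left cinner_sum_right
      by (intro sum.cong refl) (auto simp: cinner_scaleC_left cinner_scaleC_right e)
    also have "\<dots> = (\<Sum>k<n. L k x * cnj (L k y))" by simp
    also have "\<dots> = K x y" using sum[of x y n] rows[OF n(1)] by simp
    finally show ?thesis .
  qed
  then show ?thesis by blast
qed

section \<open>Factorization of positive operator matrices\<close>

lemma kernel_form_comp:
  "kernel_form (\<lambda>x y. K (d x) (d y)) v w = kernel_form K (map (apsnd d) v) (map (apsnd d) w)"
  by (simp add: kernel_form_def split_def comp_def)

lemma psd_kernel_comp:
  assumes "psd_kernel X K" "range d \<subseteq> X"
  shows "psd_kernel UNIV (\<lambda>x y. K (d x) (d y))"
  unfolding psd_kernel_def kernel_form_comp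
proof (intro allI impI)
  fix v :: "(complex \<times> 'b) list"
  have "snd ` set (map (apsnd d) v) \<subseteq> X" using assms(2) by auto
  then show "kernel_form K (map (apsnd d) v) (map (apsnd d) v) \<in> \<real>\<^sub>\<ge>\<^sub>0"
    using assms(1) unfolding psd_kernel_def by blast
qed

lemma bounded_bilinear_cinner: "bounded_bilinear (cinner :: 'h::chilbert_space \<Rightarrow> 'h \<Rightarrow> complex)"
proof
  show "\<exists>K. \<forall>a b::'h. norm (cinner a b) \<le> norm a * norm b * K"
    by (intro exI[where x = 1]) (simp add: cmod_cinner_le)
qed (simp_all add: cinner_add_left cinner_add_right cinner_scaleC_left cinner_scaleC_right
    scaleR_scaleC scaleR_conv_of_real)

lemmas tendsto_cinner = bounded_bilinear.tendsto[OF bounded_bilinear_cinner]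

text \<open>The points \<open>(i, \<xi>)\<close> with \<open>\<xi>\<close> in a countable dense set can be enumerated, so their kernel
  is realised by vectors \<open>w i\<close> of \<open>H\<close> itself. These depend continuously on \<open>\<xi>\<close>, and the limits
  \<open>V i \<xi>\<close> depend linearly on \<open>\<xi>\<close> because every linear relation has null length under the kernel;
  so they are the values of operators \<open>C\<^sub>i\<close> with \<open>T\<^sub>i\<^sub>j = C\<^sub>i\<^sup>* C\<^sub>j\<close>.\<close>

lemma psd_operator_matrix_factor:
  fixes T :: "nat \<Rightarrow> nat \<Rightarrow> ('h::chilbert_space \<Rightarrow>\<^sub>L 'h)" and e :: "nat \<Rightarrow> 'h"
  assumes e: "\<And>i j. cinner (e i) (e j) = (if i = j then 1 else 0)"
    and sep: "separable_space (euclidean :: 'h topology)"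
    and T: "\<And>i j. T i j \<in> bounded_clinear_ops"
    and psd: "psd_kernel UNIV (\<lambda>(i, \<xi>) (j, \<eta>). cinner \<xi> (blinfun_apply (T i j) \<eta>))"
  shows "\<exists>C. (\<forall>i. C i \<in> bounded_clinear_ops) \<and> (\<forall>i j. T i j = adjoint_op (C i) o\<^sub>L C j)"
proof -
  let ?K = "\<lambda>(i, \<xi>) (j, \<eta>). cinner \<xi> (blinfun_apply (T i j) \<eta>)"
  obtain D :: "'h set" where D: "countable D" "closure D = UNIV"
    using sep by (auto simp: separable_space_def)
  then have "D \<noteq> {}" by auto
  define d where "d = from_nat_into D"
  have d: "range d = D"
    unfolding d_def by (rule range_from_nat_into[OF \<open>D \<noteq> {}\<close> D(1)])
  define pt where "pt m = (fst (prod_decode m), d (snd (prod_decode m)))" for m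
  obtain w0 :: "nat \<Rightarrow> 'h" where w0: "\<And>m n. cinner (w0 m) (w0 n) = ?K (pt m) (pt n)"
    using gram_realization_nat[OF e psd_kernel_comp[OF psd, of pt]] by auto
  define w where "w i p = w0 (prod_encode (i, p))" for i p
  have w: "cinner (w i p) (w j q) = cinner (d p) (blinfun_apply (T i j) (d q))" for i j p q
    by (simp add: w_def w0 pt_def)
  have "\<exists>s :: nat \<Rightarrow> nat. (\<lambda>n. d (s n)) \<longlonglongrightarrow> \<xi>" for \<xi>
  proof -
    have "\<xi> \<in> closure D" using D(2) by simp
    then obtain x where x: "\<And>n. x n \<in> D" "x \<longlonglongrightarrow> \<xi>"
      unfolding closure_sequential by blast
    have "\<forall>n. \<exists>p. x n = d p" using x(1) d by blast
    then obtain s where "\<And>n. x n = d (s n)" by metis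
    then have "x = (\<lambda>n. d (s n))" by blast
    then show ?thesis using x(2) by blast
  qed
  then obtain s where s: "\<And>\<xi>. (\<lambda>n. d (s \<xi> n)) \<longlonglongrightarrow> \<xi>" by metis
  have dist_w: "norm (w i p - w i q) \<le> sqrt (norm (T i i)) * norm (d p - d q)" for i p q
  proof -
    have "complex_of_real ((norm (w i p - w i q))\<^sup>2) = cinner (d p - d q) (blinfun_apply (T i i) (d p - d q))"
      unfolding cinner_self[symmetric]
      by (simp add: cinner_diff_left cinner_diff_right w blinfun.diff_right algebra_simps)
    then have "(norm (w i p - w i q))\<^sup>2 = cmod (cinner (d p - d q) (blinfun_apply (T i i) (d p - d q)))"
      by (metis abs_of_nonneg norm_of_real zero_le_power2)
    also have "\<dots> \<le> norm (d p - d q) * norm (blinfun_apply (T i i) (d p - d q))"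
      by (rule cmod_cinner_le)
    also have "\<dots> \<le> norm (d p - d q) * (norm (T i i) * norm (d p - d q))"
      by (intro mult_left_mono norm_blinfun) auto
    also have "\<dots> = (sqrt (norm (T i i)) * norm (d p - d q))\<^sup>2"
      by (simp add: power_mult_distrib) (simp add: power2_eq_square)
    finally show ?thesis
      by (rule power2_le_imp_le) simp
  qed
  have "convergent (\<lambda>n. w i (s \<xi> n))" for i \<xi>
  proof (rule Cauchy_convergent, rule metric_CauchyI)
    fix \<epsilon> :: real assume \<epsilon>: "\<epsilon> > 0"
    define M where "M = sqrt (norm (T i i)) + 1"
    have M: "M > 0" by (simp add: M_def add_nonneg_pos)
    have "Cauchy (\<lambda>n. d (s \<xi> n))" by (rule LIMSEQ_imp_Cauchy[OF s])
    then obtain N where N: "\<And>m n. m \<ge> N \<Longrightarrow> n \<ge> N \<Longrightarrow> dist (d (s \<xi> m)) (d (s \<xi> n)) < \<epsilon> / M"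
      using metric_CauchyD[of _ "\<epsilon> / M"] \<epsilon> M by (meson divide_pos_pos)
    have "dist (w i (s \<xi> m)) (w i (s \<xi> n)) < \<epsilon>" if "m \<ge> N" "n \<ge> N" for m n
    proof -
      have "dist (w i (s \<xi> m)) (w i (s \<xi> n)) \<le> M * norm (d (s \<xi> m) - d (s \<xi> n))"
        using dist_w[of i "s \<xi> m" "s \<xi> n"] unfolding dist_norm M_def by (simp add: algebra_simps add.commute add_increasing)
      also have "\<dots> < M * (\<epsilon> / M)"
        using N[OF that] M by (intro mult_strict_left_mono) (auto simp: dist_norm)
      finally show ?thesis using M by simp
    qed
    then show "\<exists>N. \<forall>m\<ge>N. \<forall>n\<ge>N. dist (w i (s \<xi> m)) (w i (s \<xi> n)) < \<epsilon>" by blast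
  qed
  then have "\<forall>i \<xi>. \<exists>l. (\<lambda>n. w i (s \<xi> n)) \<longlonglongrightarrow> l" by (simp add: convergent_def)
  then obtain V where V: "\<And>i \<xi>. (\<lambda>n. w i (s \<xi> n)) \<longlonglongrightarrow> V i \<xi>" by metis
  have VV: "cinner (V i \<xi>) (V j \<eta>) = cinner \<xi> (blinfun_apply (T i j) \<eta>)" for i j \<xi> \<eta>
  proof (rule LIMSEQ_unique)
    show "(\<lambda>n. cinner (w i (s \<xi> n)) (w j (s \<eta> n))) \<longlonglongrightarrow> cinner (V i \<xi>) (V j \<eta>)"
      by (intro tendsto_cinner V)
    show "(\<lambda>n. cinner (w i (s \<xi> n)) (w j (s \<eta> n))) \<longlonglongrightarrow> cinner \<xi> (blinfun_apply (T i j) \<eta>)"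
      unfolding w by (intro tendsto_cinner s blinfun.tendsto tendsto_const)
  qed
  have zeroI: "x = 0" if "cinner x x = 0" for x :: 'h
    using that by (simp add: cinner_self)
  have V_add: "V i (\<xi> + \<eta>) = V i \<xi> + V i \<eta>" for i \<xi> \<eta>
  proof -
    have "V i (\<xi> + \<eta>) - V i \<xi> - V i \<eta> = 0"
      by (rule zeroI) (simp add: cinner_diff_left cinner_diff_right cinner_add_left cinner_add_right
          VV blinfun.add_right algebra_simps)
    then show ?thesis by (simp add: algebra_simps)
  qed
  have V_scale: "V i (c *\<^sub>C \<xi>) = c *\<^sub>C V i \<xi>" for i c \<xi>
  proof -
    have "V i (c *\<^sub>C \<xi>) - c *\<^sub>C V i \<xi> = 0"
      by (rule zeroI) (simp add: cinner_diff_left cinner_diff_right cinner_scaleC_left cinner_scaleC_right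
          VV bounded_clinear_opsD[OF T] algebra_simps)
    then show ?thesis by simp
  qed
  have V_norm: "norm (V i \<xi>) \<le> norm \<xi> * sqrt (norm (T i i))" for i \<xi>
  proof -
    have "complex_of_real ((norm (V i \<xi>))\<^sup>2) = cinner \<xi> (blinfun_apply (T i i) \<xi>)"
      unfolding cinner_self[symmetric] by (rule VV)
    then have "(norm (V i \<xi>))\<^sup>2 = cmod (cinner \<xi> (blinfun_apply (T i i) \<xi>))"
      by (metis abs_of_nonneg norm_of_real zero_le_power2)
    also have "\<dots> \<le> norm \<xi> * norm (blinfun_apply (T i i) \<xi>)" by (rule cmod_cinner_le)
    also have "\<dots> \<le> norm \<xi> * (norm (T i i) * norm \<xi>)"
      by (intro mult_left_mono norm_blinfun) auto
    also have "\<dots> = (norm \<xi> * sqrt (norm (T i i)))\<^sup>2"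
      by (simp add: power_mult_distrib) (simp add: power2_eq_square)
    finally show ?thesis by (rule power2_le_imp_le) simp
  qed
  have bl: "bounded_linear (V i)" for i
    using V_norm by (intro bounded_linear_intro[where K = "sqrt (norm (T i i))"])
      (simp_all add: V_add V_scale scaleR_scaleC)
  define C where "C i = Blinfun (V i)" for i
  have C_apply: "blinfun_apply (C i) = V i" for i
    unfolding C_def by (rule bounded_linear_Blinfun_apply[OF bl])
  have C: "C i \<in> bounded_clinear_ops" for i
    by (simp add: bounded_clinear_ops_def C_apply V_scale)
  have "T i j = adjoint_op (C i) o\<^sub>L C j" for i j
    by (rule blinfun_eq_cinnerI) (simp add: cinner_adjoint_right[OF C] C_apply VV)
  then show ?thesis using C by blast
qed


section \<open>Extension of positive functionals\<close>

text \<open>Complex vector spaces with an involution. Singled out from the algebras because the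
  extension theorems are applied to the space of matrices of all sizes as an ordered vector
  space.\<close>

locale star_module = abelian_group E for E :: "'e cstar" (structure) +
  assumes smult_closed [simp, intro]: "x \<in> carrier E \<Longrightarrow> c \<odot> x \<in> carrier E"
    and smult_add_right: "x \<in> carrier E \<Longrightarrow> y \<in> carrier E \<Longrightarrow> c \<odot> (x \<oplus> y) = c \<odot> x \<oplus> c \<odot> y"
    and smult_add_left: "x \<in> carrier E \<Longrightarrow> (c + d) \<odot> x = c \<odot> x \<oplus> d \<odot> x"
    and smult_smult: "x \<in> carrier E \<Longrightarrow> c \<odot> (d \<odot> x) = (c * d) \<odot> x"
    and smult_one: "x \<in> carrier E \<Longrightarrow> 1 \<odot> x = x"
    and star_closed [simp, intro]: "x \<in> carrier E \<Longrightarrow> star E x \<in> carrier E"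
    and star_star: "x \<in> carrier E \<Longrightarrow> star E (star E x) = x"
    and star_add: "x \<in> carrier E \<Longrightarrow> y \<in> carrier E \<Longrightarrow> star E (x \<oplus> y) = star E x \<oplus> star E y"
    and star_smult: "x \<in> carrier E \<Longrightarrow> star E (c \<odot> x) = cnj c \<odot> star E x"
begin

lemma smult_zero_left [simp]: "x \<in> carrier E \<Longrightarrow> 0 \<odot> x = \<zero>"
  using smult_add_left[of x 0 0] add.l_cancel_one'[of "0 \<odot> x" "0 \<odot> x"] by simp

lemma smult_zero_right [simp]: "c \<odot> \<zero> = \<zero>"
  using smult_add_right[of \<zero> \<zero> c] add.l_cancel_one'[of "c \<odot> \<zero>" "c \<odot> \<zero>"] by simp

lemma smult_minus_cancel [simp]: "x \<in> carrier E \<Longrightarrow> x \<oplus> (-1) \<odot> x = \<zero>"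
  using smult_add_left[of x 1 "-1"] by (simp add: smult_one)

lemma star_zero [simp]: "star E \<zero> = \<zero>"
  using star_smult[of \<zero> 0] by simp

text \<open>A maximal positive partial functional, given by its graph, is total: a missing vector \<open>y\<close> could
  be given any value between those forced from below and from above by the cone, and both bounds
  are finite because \<open>F\<close> is cofinal.\<close>

lemma riesz_positive_extension:
  fixes f :: "'e \<Rightarrow> real"
  assumes F: "F \<subseteq> carrier E" "\<And>x y. x \<in> F \<Longrightarrow> y \<in> F \<Longrightarrow> x \<oplus> y \<in> F"
      "\<And>x r. x \<in> F \<Longrightarrow> complex_of_real r \<odot> x \<in> F"
    and C: "C \<subseteq> carrier E" "\<zero> \<in> C" "\<And>x y. x \<in> C \<Longrightarrow> y \<in> C \<Longrightarrow> x \<oplus> y \<in> C"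
      "\<And>x r. x \<in> C \<Longrightarrow> 0 \<le> r \<Longrightarrow> complex_of_real r \<odot> x \<in> C"
    and cofinal: "\<And>x. x \<in> carrier E \<Longrightarrow> \<exists>z\<in>C. x \<oplus> z \<in> F"
    and f: "\<And>x y. x \<in> F \<Longrightarrow> y \<in> F \<Longrightarrow> f (x \<oplus> y) = f x + f y"
      "\<And>x r. x \<in> F \<Longrightarrow> f (complex_of_real r \<odot> x) = r * f x"
      "\<And>x. x \<in> F \<Longrightarrow> x \<in> C \<Longrightarrow> 0 \<le> f x"
  shows "\<exists>g. (\<forall>x\<in>carrier E. \<forall>y\<in>carrier E. g (x \<oplus> y) = g x + g y) \<and>
    (\<forall>x\<in>carrier E. \<forall>r. g (complex_of_real r \<odot> x) = r * g x) \<and>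
    (\<forall>x\<in>C. 0 \<le> g x) \<and> (\<forall>x\<in>F. g x = f x)"
proof -
  define good where "good G \<longleftrightarrow> (\<lambda>x. (x, f x)) ` F \<subseteq> G \<and> fst ` G \<subseteq> carrier E \<and>
     (\<forall>x t y u. (x, t) \<in> G \<longrightarrow> (y, u) \<in> G \<longrightarrow> (x \<oplus> y, t + u) \<in> G) \<and>
     (\<forall>x t r. (x, t) \<in> G \<longrightarrow> (complex_of_real r \<odot> x, r * t) \<in> G) \<and>
     (\<forall>x t. (x, t) \<in> G \<longrightarrow> x \<in> C \<longrightarrow> 0 \<le> t)" for G :: "('e \<times> real) set"
  have goodF: "(x, f x) \<in> G" if "good G" "x \<in> F" for G x
    using that(1)[unfolded good_def, THEN conjunct1] that(2) by (simp add: image_subset_iff)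
  have good_carrier: "fst ` G \<subseteq> carrier E" if "good G" for G
    using that by (simp add: good_def)
  have good_add: "(x \<oplus> y, t + u) \<in> G" if "good G" "(x, t) \<in> G" "(y, u) \<in> G" for G x y t u
    using that by (simp add: good_def)
  have good_scale: "(complex_of_real r \<odot> x, r * t) \<in> G" if "good G" "(x, t) \<in> G" for G x t r
    using that by (simp add: good_def)
  have good_pos: "0 \<le> t" if "good G" "(x, t) \<in> G" "x \<in> C" for G x t
    using that(1)[unfolded good_def] that(2,3) by metis
  have "\<exists>M\<in>Collect good. \<forall>X\<in>Collect good. M \<subseteq> X \<longrightarrow> X = M"
  proof (rule subset_Zorn_nonempty)
    have "good ((\<lambda>x. (x, f x)) ` F)"
      unfolding good_def using F f by (auto simp: image_iff)
    then show "Collect good \<noteq> {}" by blast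
    fix \<C> assume ne: "\<C> \<noteq> {}" and chain: "subset.chain (Collect good) \<C>"
    then have goods: "\<And>G. G \<in> \<C> \<Longrightarrow> good G" by (auto simp: subset.chain_def)
    have dir: "\<exists>G\<in>\<C>. p \<in> G \<and> q \<in> G" if pq: "p \<in> \<Union>\<C>" "q \<in> \<Union>\<C>" for p q
    proof -
      obtain G H where GH: "G \<in> \<C>" "H \<in> \<C>" "p \<in> G" "q \<in> H" using pq by blast
      then have "G \<subseteq> H \<or> H \<subseteq> G" using chain by (auto simp: subset.chain_def)
      then show ?thesis using GH by blast
    qed
    have "good (\<Union>\<C>)"
      unfolding good_def
    proof (intro conjI allI impI)
      show "(\<lambda>x. (x, f x)) ` F \<subseteq> \<Union>\<C>" using ne goodF[OF goods] by blast
      show "fst ` \<Union>\<C> \<subseteq> carrier E" using good_carrier[OF goods] by blast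
      show "(x \<oplus> y, t + u) \<in> \<Union>\<C>" if "(x, t) \<in> \<Union>\<C>" "(y, u) \<in> \<Union>\<C>" for x t y u
        using dir[OF that] good_add[OF goods] by blast
      show "(complex_of_real r \<odot> x, r * t) \<in> \<Union>\<C>" if "(x, t) \<in> \<Union>\<C>" for x t r
        using that good_scale[OF goods] by blast
      show "0 \<le> t" if "(x, t) \<in> \<Union>\<C>" "x \<in> C" for x t
        using that good_pos[OF goods] by blast
    qed
    then show "\<Union>\<C> \<in> Collect good" by blast
  qed
  then obtain M where M: "good M" and maximal: "\<And>X. good X \<Longrightarrow> M \<subseteq> X \<Longrightarrow> X = M"
    by blast
  note MF = goodF[OF M] and Madd = good_add[OF M] and Mscale = good_scale[OF M] and Mpos = good_pos[OF M]
  have Mcar: "x \<in> carrier E" if "(x, t) \<in> M" for x t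
    using good_carrier[OF M] that by (force simp: image_subset_iff)
  have Mzero: "(\<zero>, 0) \<in> M"
  proof -
    obtain z where "\<zero> \<oplus> z \<in> F" using cofinal[of \<zero>] by auto
    then have "\<zero> \<oplus> z \<in> carrier E" using F(1) by blast
    then show ?thesis
      using Mscale[OF MF[OF \<open>\<zero> \<oplus> z \<in> F\<close>], of 0] by simp
  qed
  have total: "\<exists>t. (y, t) \<in> M" if y: "y \<in> carrier E" for y
  proof -
    \<comment> \<open>\<open>L\<close> and \<open>U\<close> collect the values that positivity forces from below and from above on \<open>y\<close>.\<close>
    define L where "L = {t. \<exists>x z. (x, t) \<in> M \<and> z \<in> C \<and> x \<oplus> z = y}"
    define U where "U = {t. \<exists>x z. (x, t) \<in> M \<and> z \<in> C \<and> y \<oplus> z = x}"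
    have LU: "t \<le> t'" if t: "t \<in> L" and t': "t' \<in> U" for t t'
    proof -
      obtain x z where x: "(x, t) \<in> M" "z \<in> C" "x \<oplus> z = y" using t by (auto simp: L_def)
      obtain x' z' where x': "(x', t') \<in> M" "z' \<in> C" "y \<oplus> z' = x'" using t' by (auto simp: U_def)
      have car: "x \<in> carrier E" "z \<in> carrier E" "z' \<in> carrier E" "z \<oplus> z' \<in> C"
        using x x' Mcar C by blast+
      have "(x' \<oplus> (-1) \<odot> x, t' + (-1) * t) \<in> M"
        using Madd[OF x'(1) Mscale[OF x(1), of "-1"]] by simp
      moreover have "x' \<oplus> (-1) \<odot> x = z \<oplus> z' \<oplus> (x \<oplus> (-1) \<odot> x)"
        unfolding x'(3)[symmetric] x(3)[symmetric] using car(1-3) smult_closed[OF car(1), of "-1"]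
        by (simp only: a_ac a_closed)
      moreover have "\<dots> = z \<oplus> z'" using car by simp
      ultimately have "(z \<oplus> z', t' - t) \<in> M" by simp
      from Mpos[OF this car(4)] show ?thesis by simp
    qed
    obtain u where u: "u \<in> U"
    proof -
      obtain z where "z \<in> C" "y \<oplus> z \<in> F" using cofinal[OF y] by blast
      then have "f (y \<oplus> z) \<in> U" using MF unfolding U_def by blast
      then show ?thesis using that by blast
    qed
    obtain l where l: "l \<in> L"
    proof -
      obtain z where z: "z \<in> C" "(-1) \<odot> y \<oplus> z \<in> F" using cofinal[of "(-1) \<odot> y"] y by auto
      have zc: "z \<in> carrier E" using z(1) C(1) by blast
      have my: "(-1) \<odot> y \<in> carrier E" using y by simp
      let ?x = "(-1) \<odot> ((-1) \<odot> y \<oplus> z)"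
      have "?x = y \<oplus> (-1) \<odot> z"
        using y zc by (simp add: smult_add_right smult_smult smult_one)
      moreover have "y \<oplus> (-1) \<odot> z \<oplus> z = y \<oplus> (z \<oplus> (-1) \<odot> z)"
        using y zc smult_closed[OF zc, of "-1"] by (simp only: a_ac a_closed)
      ultimately have "?x \<oplus> z = y" using y zc by simp
      moreover have "(?x, - f ((-1) \<odot> y \<oplus> z)) \<in> M"
        using Mscale[OF MF[OF z(2)], of "-1"] by simp
      ultimately show ?thesis using that z(1) unfolding L_def by blast
    qed
    define \<alpha> where "\<alpha> = Sup L"
    have L\<alpha>: "t \<le> \<alpha>" if "t \<in> L" for t
      unfolding \<alpha>_def by (rule cSup_upper[OF that]) (use LU u in \<open>auto simp: bdd_above_def\<close>)
    have \<alpha>U: "\<alpha> \<le> t" if "t \<in> U" for t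
      unfolding \<alpha>_def by (rule cSup_least) (use LU l that in auto)
    define M' where "M' = {(x \<oplus> complex_of_real c \<odot> y, t + c * \<alpha>) | x t c. (x, t) \<in> M}"
    have M'I: "(x \<oplus> complex_of_real c \<odot> y, t + c * \<alpha>) \<in> M'" if "(x, t) \<in> M" for x t c
      using that unfolding M'_def by blast
    have M'E: "\<exists>x s c. p = x \<oplus> complex_of_real c \<odot> y \<and> t = s + c * \<alpha> \<and> (x, s) \<in> M"
      if "(p, t) \<in> M'" for p t
      using that by (auto simp: M'_def)
    have sub: "M \<subseteq> M'"
    proof
      fix p assume "p \<in> M"
      then show "p \<in> M'"
        using M'I[of "fst p" "snd p" 0] Mcar[of "fst p" "snd p"] y by simp
    qed
    have "good M'"
      unfolding good_def
    proof (intro conjI allI impI)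
      show "(\<lambda>x. (x, f x)) ` F \<subseteq> M'" using MF sub by blast
      show "fst ` M' \<subseteq> carrier E" using Mcar y by (auto simp: M'_def)
      show "(p \<oplus> q, t + u) \<in> M'" if pq: "(p, t) \<in> M'" "(q, u) \<in> M'" for p t q u
      proof -
        obtain x t' c where p: "p = x \<oplus> complex_of_real c \<odot> y" "t = t' + c * \<alpha>" "(x, t') \<in> M"
          using M'E[OF pq(1)] by metis
        obtain x' u' c' where q: "q = x' \<oplus> complex_of_real c' \<odot> y" "u = u' + c' * \<alpha>" "(x', u') \<in> M"
          using M'E[OF pq(2)] by metis
        have "p \<oplus> q = (x \<oplus> x') \<oplus> complex_of_real (c + c') \<odot> y"
          using Mcar[OF p(3)] Mcar[OF q(3)] y by (simp add: p q smult_add_left a_ac)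
        then show ?thesis
          using M'I[OF Madd[OF p(3) q(3)], of "c + c'"] by (simp add: p q algebra_simps)
      qed
      show "(complex_of_real r \<odot> p, r * t) \<in> M'" if pt: "(p, t) \<in> M'" for p t r
      proof -
        obtain x t' c where p: "p = x \<oplus> complex_of_real c \<odot> y" "t = t' + c * \<alpha>" "(x, t') \<in> M"
          using M'E[OF pt] by metis
        have "complex_of_real r \<odot> p = complex_of_real r \<odot> x \<oplus> complex_of_real (r * c) \<odot> y"
          using Mcar[OF p(3)] y by (simp add: p smult_add_right smult_smult)
        then show ?thesis
          using M'I[OF Mscale[OF p(3), of r], of "r * c"] by (simp add: p algebra_simps)
      qed
      show "0 \<le> t" if w: "(w, t) \<in> M'" "w \<in> C" for w t
      proof -
        obtain x t' c where p: "w = x \<oplus> complex_of_real c \<odot> y" "t = t' + c * \<alpha>" "(x, t') \<in> M"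
          using M'E[OF w(1)] by metis
        have x: "x \<in> carrier E" by (rule Mcar[OF p(3)])
        have key: "complex_of_real (1 / d) \<odot> w \<in> C" if "d > 0" for d
          using C(4)[OF w(2), of "1 / d"] that by simp
        consider "c = 0" | "c > 0" | "c < 0" by linarith
        then show ?thesis
        proof cases
          case 1
          then show ?thesis using Mpos[OF p(3)] w(2) x y p by simp
        next
          case 2
          have cy: "complex_of_real (1 / c) \<odot> (complex_of_real c \<odot> y) = y"
            using 2 y by (simp add: smult_smult smult_one)
          have "complex_of_real (- 1 / c) \<odot> x \<oplus> complex_of_real (1 / c) \<odot> w
              = complex_of_real (- 1 / c) \<odot> x \<oplus> complex_of_real (1 / c) \<odot> x \<oplus> y"
            using x y cy by (simp only: p smult_add_right smult_closed a_ac a_closed)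
          also have "complex_of_real (- 1 / c) \<odot> x \<oplus> complex_of_real (1 / c) \<odot> x = \<zero>"
            using x by (simp flip: smult_add_left)
          finally have "complex_of_real (- 1 / c) \<odot> x \<oplus> complex_of_real (1 / c) \<odot> w = y"
            using y by simp
          then have "(- 1 / c) * t' \<in> L"
            unfolding L_def using Mscale[OF p(3), of "- 1 / c"] key[OF 2] by (intro CollectI exI conjI)
          then have "- t' \<le> c * \<alpha>" using L\<alpha>[of "- 1 / c * t'"] 2 by (simp add: field_simps)
          then show ?thesis by (simp add: p)
        next
          case 3
          have cy: "complex_of_real (1 / (- c)) \<odot> (complex_of_real c \<odot> y) = (-1) \<odot> y"
            using 3 y by (simp add: smult_smult)
          have "y \<oplus> complex_of_real (1 / (- c)) \<odot> w
              = complex_of_real (1 / (- c)) \<odot> x \<oplus> (y \<oplus> (-1) \<odot> y)"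
            using x y smult_closed[OF y, of "-1"] smult_closed[OF x, of "complex_of_real (1 / (- c))"]
            by (simp only: p smult_add_right smult_closed cy a_ac a_closed)
          then have "y \<oplus> complex_of_real (1 / (- c)) \<odot> w = complex_of_real (1 / (- c)) \<odot> x"
            using x y by simp
          then have "(1 / (- c)) * t' \<in> U"
            unfolding U_def using Mscale[OF p(3), of "1 / (- c)"] key[of "- c", unfolded neg_0_less_iff_less, OF 3]
            by (intro CollectI exI conjI)
          then have "\<alpha> \<le> t' / (- c)" using \<alpha>U by fastforce
          then have "\<alpha> * (- c) \<le> t'" using 3 by (simp only: pos_le_divide_eq neg_0_less_iff_less)
          then show ?thesis by (simp add: p mult.commute)
        qed
      qed
    qed
    then have "M' = M" using maximal sub by blast
    moreover have "(y, \<alpha>) \<in> M'"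
      using M'I[OF Mzero, of 1] y by (simp add: smult_one)
    ultimately show ?thesis by blast
  qed
  have unique: "t = u" if "(x, t) \<in> M" "(x, u) \<in> M" for x t u
  proof -
    have x: "x \<in> carrier E" by (rule Mcar[OF that(1)])
    have "(\<zero>, t - u) \<in> M" "(\<zero>, u - t) \<in> M"
      using Madd[OF that(1) Mscale[OF that(2), of "-1"]] Madd[OF that(2) Mscale[OF that(1), of "-1"]] x
      by simp_all
    from Mpos[OF this(1) C(2)] Mpos[OF this(2) C(2)] show ?thesis by simp
  qed
  define g where "g x = (THE t. (x, t) \<in> M)" for x
  have g: "g x = t" if "(x, t) \<in> M" for x t
    unfolding g_def using that unique by (intro the_equality) metis+
  have gM: "(x, g x) \<in> M" if "x \<in> carrier E" for x
    using total[OF that] g by fastforce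
  show ?thesis
  proof (intro exI[of _ g] conjI ballI allI)
    show "g (x \<oplus> y) = g x + g y" if "x \<in> carrier E" "y \<in> carrier E" for x y
      by (rule g[OF Madd[OF gM[OF that(1)] gM[OF that(2)]]])
    show "g (complex_of_real r \<odot> x) = r * g x" if "x \<in> carrier E" for x r
      by (rule g[OF Mscale[OF gM[OF that]]])
    show "0 \<le> g x" if "x \<in> C" for x
      using Mpos[OF gM that] that C(1) by blast
    show "g x = f x" if "x \<in> F" for x
      by (rule g[OF MF[OF that]])
  qed
qed

text \<open>The complex version follows by extending the real part, positive on the larger cone \<open>C'\<close>
  of all \<open>x\<close> with \<open>x + x\<^sup>* \<in> C\<close>. That cone contains \<open>\<i> x\<close> and \<open>-\<i> x\<close> for hermitian \<open>x\<close>, which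
  makes the complexified functional \<open>g x - \<i> g (\<i> x)\<close> real on \<open>C\<close>.\<close>

theorem krein_positive_extension:
  fixes s\<^sub>0 :: "'e \<Rightarrow> complex"
  assumes F: "F \<subseteq> carrier E" "\<And>x y. x \<in> F \<Longrightarrow> y \<in> F \<Longrightarrow> x \<oplus> y \<in> F"
      "\<And>x c. x \<in> F \<Longrightarrow> c \<odot> x \<in> F" "\<And>x. x \<in> F \<Longrightarrow> star E x \<in> F"
    and C: "C \<subseteq> carrier E" "\<zero> \<in> C" "\<And>x y. x \<in> C \<Longrightarrow> y \<in> C \<Longrightarrow> x \<oplus> y \<in> C"
      "\<And>x r. x \<in> C \<Longrightarrow> 0 \<le> r \<Longrightarrow> complex_of_real r \<odot> x \<in> C"
      "\<And>x. x \<in> C \<Longrightarrow> star E x = x"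
    and cofinal: "\<And>x. x \<in> carrier E \<Longrightarrow> \<exists>z\<in>C. x \<oplus> star E x \<oplus> z \<in> F \<inter> C"
    and s\<^sub>0: "\<And>x y. x \<in> F \<Longrightarrow> y \<in> F \<Longrightarrow> s\<^sub>0 (x \<oplus> y) = s\<^sub>0 x + s\<^sub>0 y"
      "\<And>x c. x \<in> F \<Longrightarrow> s\<^sub>0 (c \<odot> x) = c * s\<^sub>0 x"
      "\<And>x. x \<in> F \<Longrightarrow> x \<in> C \<Longrightarrow> s\<^sub>0 x \<in> \<real>\<^sub>\<ge>\<^sub>0"
  shows "\<exists>s. (\<forall>x\<in>carrier E. \<forall>y\<in>carrier E. s (x \<oplus> y) = s x + s y) \<and>
    (\<forall>x\<in>carrier E. \<forall>c. s (c \<odot> x) = c * s x) \<and>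
    (\<forall>x\<in>C. s x \<in> \<real>\<^sub>\<ge>\<^sub>0) \<and> (\<forall>x\<in>F. s x = s\<^sub>0 x)"
proof -
  have Fc: "x \<in> carrier E" if "x \<in> F" for x using that F(1) by blast
  have Cc: "x \<in> carrier E" if "x \<in> C" for x using that C(1) by blast
  \<comment> \<open>By cofinality every hermitian element of \<open>F\<close> is a difference of elements of \<open>F \<inter> C\<close>, so \<open>s\<^sub>0\<close> is real there.\<close>
  have im: "Im (s\<^sub>0 x) + Im (s\<^sub>0 (star E x)) = 0" if x: "x \<in> F" for x
  proof -
    obtain z where z: "z \<in> C" "x \<oplus> star E x \<oplus> z \<in> F \<inter> C"
      using cofinal[OF Fc[OF x]] by blast
    let ?h = "x \<oplus> star E x"
    have h: "?h \<in> F" using F x by blast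
    have "z = (?h \<oplus> z) \<oplus> (-1) \<odot> ?h"
    proof -
      have "(?h \<oplus> z) \<oplus> (-1) \<odot> ?h = z \<oplus> (?h \<oplus> (-1) \<odot> ?h)"
        using Fc[OF h] Cc[OF z(1)] smult_closed[OF Fc[OF h], of "-1"]
        by (metis a_assoc a_comm)
      then show ?thesis using Fc[OF h] Cc[OF z(1)] by simp
    qed
    also have "\<dots> \<in> F" using z(2) h F by blast
    finally have zF: "z \<in> F" .
    have "s\<^sub>0 (?h \<oplus> z) = s\<^sub>0 x + s\<^sub>0 (star E x) + s\<^sub>0 z"
      using s\<^sub>0(1) x h zF F by simp
    moreover have "Im (s\<^sub>0 (?h \<oplus> z)) = 0" "Im (s\<^sub>0 z) = 0"
      using s\<^sub>0(3)[of "?h \<oplus> z"] s\<^sub>0(3)[OF zF z(1)] z(2) by (simp_all add: complex_nonneg_Reals_iff)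
    ultimately show ?thesis by simp
  qed
  have herm: "s\<^sub>0 (star E x) = cnj (s\<^sub>0 x)" if x: "x \<in> F" for x
    using im[OF x] im[OF F(3)[OF x], of \<i>] s\<^sub>0(2)[OF x, of \<i>] s\<^sub>0(2)[OF F(4)[OF x], of "cnj \<i>"]
      star_smult[OF Fc[OF x], of \<i>]
    by (simp add: complex_eq_iff)
  define C' where "C' = {x \<in> carrier E. x \<oplus> star E x \<in> C}"
  have "\<exists>g. (\<forall>x\<in>carrier E. \<forall>y\<in>carrier E. g (x \<oplus> y) = g x + g y) \<and>
    (\<forall>x\<in>carrier E. \<forall>r. g (complex_of_real r \<odot> x) = r * g x) \<and>
    (\<forall>x\<in>C'. 0 \<le> g x) \<and> (\<forall>x\<in>F. g x = Re (s\<^sub>0 x))"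
  proof (rule riesz_positive_extension[where C = C'])
    show "C' \<subseteq> carrier E" "\<zero> \<in> C'" using C(2) by (auto simp: C'_def)
    show "x \<oplus> y \<in> C'" if "x \<in> C'" "y \<in> C'" for x y
    proof -
      have "x \<oplus> y \<oplus> star E (x \<oplus> y) = (x \<oplus> star E x) \<oplus> (y \<oplus> star E y)"
        using that by (simp add: C'_def star_add a_ac)
      then show ?thesis using that C(3) by (simp add: C'_def)
    qed
    show "complex_of_real r \<odot> x \<in> C'" if "x \<in> C'" "0 \<le> r" for x r
      using that C(4)[of "x \<oplus> star E x" r] by (simp add: C'_def star_smult smult_add_right)
    show "\<exists>z\<in>C'. x \<oplus> z \<in> F" if x: "x \<in> carrier E" for x
    proof -
      obtain z where z: "z \<in> C" "x \<oplus> star E x \<oplus> z \<in> F \<inter> C" using cofinal[OF x] by blast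
      let ?y = "x \<oplus> star E x \<oplus> z"
      let ?h = "complex_of_real (1/2) \<odot> ?y"
      let ?z = "?h \<oplus> (-1) \<odot> x"
      have zc: "z \<in> carrier E" and yc: "?y \<in> carrier E" using z Cc x by auto
      have hh: "?h \<oplus> ?h = ?y"
        using smult_add_left[OF yc, of "1/2" "1/2"] smult_one[OF yc] by simp
      have star_h: "star E ?h = ?h"
        using C(5)[of ?y] z(2) star_smult[OF yc, of "complex_of_real (1/2)"] by simp
      have mx: "(-1) \<odot> x \<in> carrier E" "(-1) \<odot> star E x \<in> carrier E" using x by auto
      have hc: "?h \<in> carrier E" using yc by blast
      have "?z \<oplus> star E ?z = (?h \<oplus> ?h) \<oplus> ((-1) \<odot> x \<oplus> (-1) \<odot> star E x)"
        using hc mx x star_h by (simp only: star_add star_smult star_h complex_cnj_minus complex_cnj_one)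
          (simp only: a_ac a_closed)
      also have "\<dots> = (x \<oplus> (-1) \<odot> x) \<oplus> (star E x \<oplus> (-1) \<odot> star E x) \<oplus> z"
        unfolding hh using mx x zc star_closed[OF x] by (simp only: a_ac a_closed)
      also have "\<dots> = z" using x zc by simp
      finally have "?z \<in> C'" using z(1) hc mx by (simp add: C'_def)
      moreover have "x \<oplus> ?z = ?h \<oplus> (x \<oplus> (-1) \<odot> x)"
        using x hc mx by (simp only: a_ac a_closed)
      then have "x \<oplus> ?z = ?h" using x hc by simp
      then have "x \<oplus> ?z \<in> F" using F(3) z(2) by auto
      ultimately show ?thesis by blast
    qed
    show "0 \<le> Re (s\<^sub>0 x)" if "x \<in> F" "x \<in> C'" for x
      using s\<^sub>0(3)[of "x \<oplus> star E x"] that F herm[of x] s\<^sub>0(1)[of x "star E x"]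
      by (simp add: C'_def complex_nonneg_Reals_iff)
  qed (use F s\<^sub>0 in auto)
  then obtain g where g: "\<And>x y. x \<in> carrier E \<Longrightarrow> y \<in> carrier E \<Longrightarrow> g (x \<oplus> y) = g x + g y"
    "\<And>x r. x \<in> carrier E \<Longrightarrow> g (complex_of_real r \<odot> x) = r * g x"
    "\<And>x. x \<in> C' \<Longrightarrow> 0 \<le> g x" "\<And>x. x \<in> F \<Longrightarrow> g x = Re (s\<^sub>0 x)" by blast
  define s where "s x = Complex (g x) (- g (\<i> \<odot> x))" for x
  show ?thesis
  proof (intro exI[of _ s] conjI ballI allI)
    show "s (x \<oplus> y) = s x + s y" if "x \<in> carrier E" "y \<in> carrier E" for x y
      using that by (simp add: s_def g(1) smult_add_right complex_eq_iff)
    show "s (c \<odot> x) = c * s x" if x: "x \<in> carrier E" for x c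
    proof -
      have g': "g (c \<odot> x) = Re c * g x + Im c * g (\<i> \<odot> x)" for c
      proof -
        have "c \<odot> x = complex_of_real (Re c) \<odot> x \<oplus> complex_of_real (Im c) \<odot> (\<i> \<odot> x)"
          using x complex_eq[of c] by (metis smult_add_left smult_smult mult.commute)
        then show ?thesis using x by (simp add: g)
      qed
      show ?thesis
        using x g'[of c] g'[of "\<i> * c"] by (simp add: s_def smult_smult complex_eq_iff)
    qed
    show "s x \<in> \<real>\<^sub>\<ge>\<^sub>0" if x: "x \<in> C" for x
    proof -
      have "x \<in> C'" using x C by (auto simp: C'_def)
      have "c \<odot> x \<in> C'" if "cnj c = - c" for c
      proof -
        have "c \<odot> x \<oplus> star E (c \<odot> x) = (c + cnj c) \<odot> x"
          using Cc[OF x] C(5)[OF x] by (simp add: star_smult smult_add_left)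
        also have "\<dots> = \<zero>" using that Cc[OF x] by simp
        finally show ?thesis using C(2) Cc[OF x] by (simp add: C'_def)
      qed
      from this[of \<i>] this[of "- \<i>"] have "0 \<le> g (\<i> \<odot> x)" "0 \<le> g ((- \<i>) \<odot> x)"
        using g(3) by auto
      moreover have "(- \<i>) \<odot> x = complex_of_real (-1) \<odot> (\<i> \<odot> x)"
        using Cc[OF x] by (simp add: smult_smult)
      then have "g ((- \<i>) \<odot> x) = - g (\<i> \<odot> x)"
        using g(2)[of "\<i> \<odot> x" "-1"] Cc[OF x] by simp
      ultimately show ?thesis
        using g(3)[OF \<open>x \<in> C'\<close>] by (simp add: s_def complex_nonneg_Reals_iff)
    qed
    show "s x = s\<^sub>0 x" if x: "x \<in> F" for x
      using g(4)[OF x] g(4)[OF F(3)[OF x, of \<i>]] s\<^sub>0(2)[OF x, of \<i>] by (simp add: s_def complex_eq_iff)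
  qed
qed

end


section \<open>Star algebras and the Arveson extension theorem\<close>

locale unital_star_algebra = ring A + star_module A for A :: "'a cstar" (structure) +
  assumes smult_mult_left:
      "x \<in> carrier A \<Longrightarrow> y \<in> carrier A \<Longrightarrow> (c \<odot> x) \<otimes> y = c \<odot> (x \<otimes> y)"
    and smult_mult_right:
      "x \<in> carrier A \<Longrightarrow> y \<in> carrier A \<Longrightarrow> x \<otimes> (c \<odot> y) = c \<odot> (x \<otimes> y)"
    and star_mult:
      "x \<in> carrier A \<Longrightarrow> y \<in> carrier A \<Longrightarrow> star A (x \<otimes> y) = star A y \<otimes> star A x"
begin

lemma star_one [simp]: "star A \<one> = \<one>"
proof -
  have "star A (star A \<one> \<otimes> \<one>) = star A \<one> \<otimes> star A (star A \<one>)"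
    by (rule star_mult) auto
  then show ?thesis by (simp add: star_star)
qed

text \<open>Sums of squares serve as the positive cone. They are closed under addition by
  construction, whereas for single squares in a C*-algebra this is a theorem of spectral
  theory.\<close>

inductive_set sos :: "'a set" where
  zero: "\<zero> \<in> sos"
| add: "d \<in> sos \<Longrightarrow> a \<in> carrier A \<Longrightarrow> d \<oplus> star A a \<otimes> a \<in> sos"

lemma sos_carrier: "d \<in> sos \<Longrightarrow> d \<in> carrier A"
  by (induction rule: sos.induct) auto

lemma sos_plus: "e \<in> sos \<Longrightarrow> d \<in> sos \<Longrightarrow> d \<oplus> e \<in> sos"
proof (induction rule: sos.induct)
  case zero
  then show ?case using sos_carrier by simp
next
  case (add e a)
  then have "d \<oplus> (e \<oplus> star A a \<otimes> a) = (d \<oplus> e) \<oplus> star A a \<otimes> a"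
    using sos_carrier by (simp add: a_assoc)
  then show ?case using add sos.add by simp
qed

lemma square_sos: "a \<in> carrier A \<Longrightarrow> star A a \<otimes> a \<in> sos"
  using sos.add[OF sos.zero, of a] by simp

end

lemma unital_cstar_star_algebra:
  assumes "unital_cstar_algebra A"
  shows "unital_star_algebra A"
proof -
  interpret unital_cstar_algebra A by fact
  show ?thesis
  proof (intro unital_star_algebra.intro star_module.intro)
    show "ring A" "abelian_group A" by unfold_locales
    show "star_module_axioms A"
      using M.smult_closed M.smult_r_distr M.smult_l_distr M.smult_assoc1 M.smult_one
        star_closed star_star star_add star_smult
      by (intro star_module_axioms.intro) auto
    show "unital_star_algebra_axioms A"
      using smult_mult_left smult_mult_right star_mult by (intro unital_star_algebra_axioms.intro) auto
  qed
qed

text \<open>The unit dominates every square, for the cone of sums of squares. The extension theorem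
  and the estimates for positive kernels depend on the norm of a C*-algebra only through this
  property, which passes to matrix algebras.\<close>

locale archimedean_star_algebra = unital_star_algebra +
  assumes order_unit: "a \<in> carrier A \<Longrightarrow>
    \<exists>r d. 0 \<le> r \<and> d \<in> sos \<and> complex_of_real r \<odot> \<one> = star A a \<otimes> a \<oplus> d"

lemma operator_subsystemD:
  assumes "operator_subsystem A S"
  shows "S \<subseteq> carrier A" "\<zero>\<^bsub>A\<^esub> \<in> S" "\<one>\<^bsub>A\<^esub> \<in> S"
    "\<And>x y. x \<in> S \<Longrightarrow> y \<in> S \<Longrightarrow> x \<oplus>\<^bsub>A\<^esub> y \<in> S"
    "\<And>x c. x \<in> S \<Longrightarrow> c \<odot>\<^bsub>A\<^esub> x \<in> S" "\<And>x. x \<in> S \<Longrightarrow> star A x \<in> S"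
proof -
  have sub: "submodule (class_ring :: complex ring) S A"
    using assms by (simp add: operator_subsystem_def)
  then show "S \<subseteq> carrier A" "\<zero>\<^bsub>A\<^esub> \<in> S" "\<And>x y. x \<in> S \<Longrightarrow> y \<in> S \<Longrightarrow> x \<oplus>\<^bsub>A\<^esub> y \<in> S"
    "\<And>x c. x \<in> S \<Longrightarrow> c \<odot>\<^bsub>A\<^esub> x \<in> S"
    by (auto simp: submodule_def)
  show "\<one>\<^bsub>A\<^esub> \<in> S" "\<And>x. x \<in> S \<Longrightarrow> star A x \<in> S"
    using assms by (simp_all add: operator_subsystem_def)
qed

text \<open>The space of finitely supported matrices over \<open>A\<close>, indexed by an arbitrary type. Working
  with all sizes at once turns a completely positive map into operators into one positive
  functional. Only the vector space structure and the involution of the record are meaningful.\<close>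

definition fin_mat :: "'a cstar \<Rightarrow> ('t \<times> 't \<Rightarrow> 'a) cstar" where
  "fin_mat A = \<lparr>carrier = {X. range X \<subseteq> carrier A \<and> finite {p. X p \<noteq> \<zero>\<^bsub>A\<^esub>}},
     mult = undefined, one = undefined, zero = (\<lambda>_. \<zero>\<^bsub>A\<^esub>), add = (\<lambda>X Y p. X p \<oplus>\<^bsub>A\<^esub> Y p),
     smult = (\<lambda>c X p. c \<odot>\<^bsub>A\<^esub> X p), star = (\<lambda>X (t, u). star A (X (u, t))), nrm = undefined\<rparr>"

definition fin_col :: "'a cstar \<Rightarrow> ('t \<Rightarrow> 'a) set" where
  "fin_col A = {u. range u \<subseteq> carrier A \<and> finite {t. u t \<noteq> \<zero>\<^bsub>A\<^esub>}}"

definition outer :: "'a cstar \<Rightarrow> ('t \<Rightarrow> 'a) \<Rightarrow> ('t \<Rightarrow> 'a) \<Rightarrow> 't \<times> 't \<Rightarrow> 'a" where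
  "outer A u v = (\<lambda>(t, t'). star A (u t) \<otimes>\<^bsub>A\<^esub> v t')"

definition single_col :: "'a cstar \<Rightarrow> 't \<Rightarrow> 'a \<Rightarrow> 't \<Rightarrow> 'a" where
  "single_col A t x = (\<lambda>t'. if t' = t then x else \<zero>\<^bsub>A\<^esub>)"

definition single_mat :: "'a cstar \<Rightarrow> 't \<Rightarrow> 't \<Rightarrow> 'a \<Rightarrow> 't \<times> 't \<Rightarrow> 'a" where
  "single_mat A t u x = (\<lambda>p. if p = (t, u) then x else \<zero>\<^bsub>A\<^esub>)"

text \<open>The positive matrices of all finite sizes: finite sums of squares \<open>u\<^sup>* u\<close> of finitely
  supported rows.\<close>

inductive_set gram_cone :: "'a cstar \<Rightarrow> ('t \<times> 't \<Rightarrow> 'a) set" for A where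
  zero: "(\<lambda>_. \<zero>\<^bsub>A\<^esub>) \<in> gram_cone A"
| add: "X \<in> gram_cone A \<Longrightarrow> u \<in> fin_col A \<Longrightarrow> (\<lambda>p. X p \<oplus>\<^bsub>A\<^esub> outer A u u p) \<in> gram_cone A"

lemma fin_mat_simps:
  "\<zero>\<^bsub>fin_mat A\<^esub> = (\<lambda>_. \<zero>\<^bsub>A\<^esub>)" "X \<oplus>\<^bsub>fin_mat A\<^esub> Y = (\<lambda>p. X p \<oplus>\<^bsub>A\<^esub> Y p)"
  "c \<odot>\<^bsub>fin_mat A\<^esub> X = (\<lambda>p. c \<odot>\<^bsub>A\<^esub> X p)" "star (fin_mat A) X = (\<lambda>(t, u). star A (X (u, t)))"
  by (simp_all add: fin_mat_def)

lemma fin_mat_carrier: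
  "X \<in> carrier (fin_mat A) \<longleftrightarrow> (\<forall>p. X p \<in> carrier A) \<and> finite {p. X p \<noteq> \<zero>\<^bsub>A\<^esub>}"
  by (auto simp: fin_mat_def)

lemma fin_col_iff:
  "u \<in> fin_col A \<longleftrightarrow> (\<forall>t. u t \<in> carrier A) \<and> finite {t. u t \<noteq> \<zero>\<^bsub>A\<^esub>}"
  by (auto simp: fin_col_def)

text \<open>Matrix positions are pairs; quantifiers over positions are kept unsplit so that facts
  about entries \<open>X p\<close> remain applicable.\<close>

declare split_paired_All [simp del]

context unital_star_algebra
begin

lemma fin_mat_add_closed:
  assumes "X \<in> carrier (fin_mat A)" "Y \<in> carrier (fin_mat A)"
  shows "(\<lambda>p. X p \<oplus> Y p) \<in> carrier (fin_mat A)"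
proof -
  have "{p. X p \<oplus> Y p \<noteq> \<zero>} \<subseteq> {p. X p \<noteq> \<zero>} \<union> {p. Y p \<noteq> \<zero>}"
    by auto
  then show ?thesis
    using assms by (auto simp: fin_mat_carrier intro: finite_subset)
qed

lemma fin_mat_smult_closed:
  assumes "X \<in> carrier (fin_mat A)"
  shows "(\<lambda>p. c \<odot> X p) \<in> carrier (fin_mat A)"
proof -
  have "{p. c \<odot> X p \<noteq> \<zero>} \<subseteq> {p. X p \<noteq> \<zero>}" by auto
  then show ?thesis
    using assms by (auto simp: fin_mat_carrier intro: finite_subset)
qed

lemma fin_mat_star_closed:
  assumes "X \<in> carrier (fin_mat A)"
  shows "(\<lambda>(t, u). star A (X (u, t))) \<in> carrier (fin_mat A)"
proof -
  have "{p. (\<lambda>(t, u). star A (X (u, t))) p \<noteq> \<zero>} \<subseteq> prod.swap ` {p. X p \<noteq> \<zero>}"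
    by (auto simp: image_iff)
  then show ?thesis
    using assms by (auto simp: fin_mat_carrier intro: finite_subset)
qed

lemma star_module_fin_mat: "star_module (fin_mat A :: ('t \<times> 't \<Rightarrow> 'a) cstar)"
proof (rule star_module.intro)
  show "abelian_group (fin_mat A :: ('t \<times> 't \<Rightarrow> 'a) cstar)"
  proof (rule abelian_groupI; unfold fin_mat_simps)
    fix X :: "'t \<times> 't \<Rightarrow> 'a" assume X: "X \<in> carrier (fin_mat A)"
    show "\<exists>Y\<in>carrier (fin_mat A). (\<lambda>p. Y p \<oplus> X p) = (\<lambda>_. \<zero>)"
      using fin_mat_smult_closed[OF X, of "-1"] X a_comm
      by (intro bexI[of _ "\<lambda>p. (-1) \<odot> X p"]) (auto simp: fin_mat_carrier fun_eq_iff)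
    show "(\<lambda>p. \<zero> \<oplus> X p) = X" using X by (simp add: fin_mat_carrier)
  next
    fix X Y :: "'t \<times> 't \<Rightarrow> 'a" assume "X \<in> carrier (fin_mat A)" "Y \<in> carrier (fin_mat A)"
    then show "(\<lambda>p. X p \<oplus> Y p) = (\<lambda>p. Y p \<oplus> X p)" "(\<lambda>p. X p \<oplus> Y p) \<in> carrier (fin_mat A)"
      by (simp_all add: fin_mat_carrier a_comm fin_mat_add_closed[unfolded fin_mat_carrier])
  qed (auto simp: fin_mat_carrier a_assoc)
  show "star_module_axioms (fin_mat A :: ('t \<times> 't \<Rightarrow> 'a) cstar)"
  proof (rule star_module_axioms.intro; unfold fin_mat_simps)
  qed (auto simp: fin_mat_smult_closed fin_mat_star_closed fin_mat_carrier[THEN iffD1, THEN conjunct1, rule_format]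
      smult_add_right smult_add_left smult_smult smult_one star_star star_add star_smult fun_eq_iff)
qed

lemma outer_closed:
  assumes "u \<in> fin_col A" "v \<in> fin_col A"
  shows "outer A u v \<in> carrier (fin_mat A)"
proof -
  have "{p. outer A u v p \<noteq> \<zero>} \<subseteq> {t. u t \<noteq> \<zero>} \<times> {t. v t \<noteq> \<zero>}"
    using assms by (auto simp: outer_def fin_col_iff)
  then show ?thesis
    using assms by (auto simp: fin_mat_carrier fin_col_iff outer_def intro: finite_subset)
qed

lemma single_col_closed: "x \<in> carrier A \<Longrightarrow> single_col A t x \<in> fin_col A"
  by (auto simp: single_col_def fin_col_iff intro: finite_subset[of _ "{t}"])

lemma single_mat_closed: "x \<in> carrier A \<Longrightarrow> single_mat A t u x \<in> carrier (fin_mat A)"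
  by (auto simp: single_mat_def fin_mat_carrier intro: finite_subset[of _ "{(t, u)}"])

lemma col_add_closed:
  assumes "u \<in> fin_col A" "v \<in> fin_col A"
  shows "(\<lambda>t. u t \<oplus> v t) \<in> fin_col A"
proof -
  have "{t. u t \<oplus> v t \<noteq> \<zero>} \<subseteq> {t. u t \<noteq> \<zero>} \<union> {t. v t \<noteq> \<zero>}" by auto
  then show ?thesis using assms by (auto simp: fin_col_iff intro: finite_subset)
qed

lemma col_smult_closed:
  assumes "u \<in> fin_col A"
  shows "(\<lambda>t. c \<odot> u t) \<in> fin_col A"
proof -
  have "{t. c \<odot> u t \<noteq> \<zero>} \<subseteq> {t. u t \<noteq> \<zero>}" by auto
  then show ?thesis using assms by (auto simp: fin_col_iff intro: finite_subset)
qed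

lemma gram_cone_carrier: "X \<in> gram_cone A \<Longrightarrow> X \<in> carrier (fin_mat A)"
proof (induction rule: gram_cone.induct)
  case (add X u)
  then show ?case by (intro fin_mat_add_closed outer_closed)
qed (simp add: fin_mat_carrier)

lemma gram_cone_entry: "X \<in> gram_cone A \<Longrightarrow> X p \<in> carrier A"
  using gram_cone_carrier fin_mat_carrier by metis

lemma gram_cone_plus:
  "Y \<in> gram_cone A \<Longrightarrow> X \<in> gram_cone A \<Longrightarrow> (\<lambda>p. X p \<oplus> Y p) \<in> gram_cone A"
proof (induction rule: gram_cone.induct)
  case zero
  then show ?case using gram_cone_entry[of X] by simp
next
  case (add Y u)
  have "(\<lambda>p. X p \<oplus> (Y p \<oplus> outer A u u p)) = (\<lambda>p. (X p \<oplus> Y p) \<oplus> outer A u u p)"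
    using gram_cone_entry[OF add.prems] gram_cone_entry[OF add.hyps(1)]
      outer_closed[OF add.hyps(2) add.hyps(2)] by (simp add: a_assoc fin_mat_carrier)
  then show ?case using gram_cone.add[OF add.IH[OF add.prems] add.hyps(2)] by simp
qed

lemma outer_gram_cone: "u \<in> fin_col A \<Longrightarrow> outer A u u \<in> gram_cone A"
  using gram_cone.add[OF gram_cone.zero, of u A] outer_closed[of u u] by (simp add: fin_mat_carrier)

lemma gram_cone_scale: "X \<in> gram_cone A \<Longrightarrow> 0 \<le> r \<Longrightarrow> (\<lambda>p. complex_of_real r \<odot> X p) \<in> gram_cone A"
proof (induction rule: gram_cone.induct)
  case (add X u)
  let ?u = "\<lambda>t. complex_of_real (sqrt r) \<odot> u t"
  have "(\<lambda>p. complex_of_real r \<odot> (X p \<oplus> outer A u u p)) = (\<lambda>p. complex_of_real r \<odot> X p \<oplus> outer A ?u ?u p)"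
    using add.hyps add.prems gram_cone_entry[OF add.hyps(1)]
    by (auto simp: outer_def fin_col_iff smult_add_right star_smult smult_mult_left smult_mult_right
        smult_smult simp flip: of_real_mult)
  then show ?case
    using gram_cone.add[OF add.IH[OF add.prems] col_smult_closed[OF add.hyps(2), of "complex_of_real (sqrt r)"]]
    by simp
qed (simp add: gram_cone.zero)

lemma gram_cone_hermitian: "X \<in> gram_cone A \<Longrightarrow> star A (X (u, t)) = X (t, u)"
proof (induction arbitrary: t u rule: gram_cone.induct)
  case (add X v)
  then show ?case
    using gram_cone_entry[OF add.hyps(1)]
    by (simp add: outer_def star_add star_mult star_star fin_col_iff)
qed simp

text \<open>If \<open>d\<close> is the sum of the \<open>a\<^sup>* a\<close>, then \<open>z\<^sup>* d z\<close> is the sum of the \<open>(a z)\<^sup>* (a z)\<close>.\<close>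

lemma sandwich_gram_cone:
  assumes z: "z \<in> fin_col A"
  shows "d \<in> sos \<Longrightarrow> (\<lambda>(t, t'). star A (z t) \<otimes> d \<otimes> z t') \<in> gram_cone A"
proof (induction rule: sos.induct)
  case zero
  have "(\<lambda>(t, t'). star A (z t) \<otimes> \<zero> \<otimes> z t') = (\<lambda>_. \<zero>)"
    using z by (auto simp: fin_col_iff)
  then show ?case by (simp add: gram_cone.zero)
next
  case (add d a)
  have zc: "z t \<in> carrier A" for t using z by (simp add: fin_col_iff)
  let ?u = "\<lambda>t. a \<otimes> z t"
  have "{t. ?u t \<noteq> \<zero>} \<subseteq> {t. z t \<noteq> \<zero>}" using add by auto
  then have u: "?u \<in> fin_col A"
    using z add by (auto simp: fin_col_iff intro: finite_subset)
  have "(\<lambda>(t, t'). star A (z t) \<otimes> (d \<oplus> star A a \<otimes> a) \<otimes> z t')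
      = (\<lambda>p. (\<lambda>(t, t'). star A (z t) \<otimes> d \<otimes> z t') p \<oplus> outer A ?u ?u p)"
    using add zc sos_carrier by (auto simp: outer_def star_mult l_distr r_distr m_assoc)
  then show ?case using gram_cone.add[OF add.IH u] by simp
qed

end

context archimedean_star_algebra
begin

text \<open>For the row \<open>w = e\<^sub>t - x e\<^sub>u\<close> the square \<open>w\<^sup>* w\<close> has the entries \<open>-x\<close> and \<open>-x\<^sup>*\<close> that
  cancel the given ones; what remains on the diagonal is \<open>1\<close> and \<open>x\<^sup>* x\<close>, and the latter is
  completed to a multiple of the unit.\<close>

lemma single_mat_dominated:
  assumes x: "x \<in> carrier A"
  shows "\<exists>Z\<in>gram_cone A. \<exists>Y\<in>gram_cone A. (\<forall>p. \<exists>c. Y p = c \<odot> \<one>) \<and>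
    (\<forall>t' u'. single_mat A t u x (t', u') \<oplus> star A (single_mat A t u x (u', t')) \<oplus> Z (t', u') = Y (t', u'))"
proof -
  obtain r d where r: "0 \<le> r" and d: "d \<in> sos"
    and rd: "complex_of_real r \<odot> \<one> = star A x \<otimes> x \<oplus> d"
    using order_unit[OF x] by blast
  have dc: "d \<in> carrier A" by (rule sos_carrier[OF d])
  define w where "w = (\<lambda>t'. single_col A t \<one> t' \<oplus> single_col A u ((-1) \<odot> x) t')"
  define e where "e = single_col A u \<one>"
  have w: "w \<in> fin_col A" unfolding w_def by (intro col_add_closed single_col_closed) (auto simp: x)
  have e: "e \<in> fin_col A" unfolding e_def by (intro single_col_closed) auto
  define Z where "Z = (\<lambda>p. outer A w w p \<oplus> (\<lambda>(t, t'). star A (e t) \<otimes> d \<otimes> e t') p)"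
  have Z: "Z \<in> gram_cone A"
    unfolding Z_def by (intro gram_cone_plus sandwich_gram_cone e d outer_gram_cone w)
  define Y where "Y = (\<lambda>p. outer A (single_col A t \<one>) (single_col A t \<one>) p
      \<oplus> complex_of_real r \<odot> outer A e e p)"
  have Y: "Y \<in> gram_cone A"
    unfolding Y_def by (intro gram_cone_plus gram_cone_scale r outer_gram_cone e single_col_closed) auto
  have o: "outer A (single_col A v \<one>) (single_col A v \<one>) p = (if p = (v, v) then 1 else 0) \<odot> \<one>" for v p
    by (cases p) (auto simp: outer_def single_col_def smult_one)
  have "\<exists>c. Y p = c \<odot> \<one>" for p
    unfolding Y_def e_def o using smult_add_left[OF one_closed] smult_smult[OF one_closed] by metis
  moreover have "single_mat A t u x (t', u') \<oplus> star A (single_mat A t u x (u', t')) \<oplus> Z (t', u') = Y (t', u')"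
    for t' u'
  proof -
    define m where "m = (-1) \<odot> x"
    have m: "m \<in> carrier A" "star A m \<in> carrier A" "star A m = (-1) \<odot> star A x" "x \<oplus> m = \<zero>"
      "star A x \<oplus> star A m = \<zero>" "star A m \<otimes> m = star A x \<otimes> x"
      using x by (simp_all add: m_def star_smult smult_mult_left smult_mult_right smult_smult smult_one)
    have sq: "star A x \<otimes> x \<in> carrier A" using x by simp
    have diag: "x \<oplus> star A x \<oplus> (star A (\<one> \<oplus> m) \<otimes> (\<one> \<oplus> m) \<oplus> d) = \<one> \<oplus> complex_of_real r \<odot> \<one>"
    proof -
      have "star A (\<one> \<oplus> m) \<otimes> (\<one> \<oplus> m) = \<one> \<oplus> m \<oplus> star A m \<oplus> star A x \<otimes> x"
        using m x by (simp add: star_add l_distr r_distr a_ac)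
      then have "x \<oplus> star A x \<oplus> (star A (\<one> \<oplus> m) \<otimes> (\<one> \<oplus> m) \<oplus> d)
          = (x \<oplus> m) \<oplus> (star A x \<oplus> star A m) \<oplus> (\<one> \<oplus> (star A x \<otimes> x \<oplus> d))"
        using m(1,2) x sq dc star_closed[OF x] by (simp only: a_ac a_closed one_closed)
      then show ?thesis using m x dc rd by simp
    qed
    have w': "w v = (if v = t then if t = u then \<one> \<oplus> m else \<one> else if v = u then m else \<zero>)" for v
      using m(1) by (simp add: w_def single_col_def flip: m_def)
    have Z': "Z (a, b) = star A (w a) \<otimes> w b \<oplus> (if a = u \<and> b = u then d else \<zero>)" for a b
      using dc by (simp add: Z_def outer_def e_def single_col_def)
    have Y': "Y (a, b) = (if a = t \<and> b = t then \<one> else \<zero>)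
        \<oplus> (if a = u \<and> b = u then complex_of_real r \<odot> \<one> else \<zero>)" for a b
      by (simp add: Y_def e_def o smult_one)
    note simps = Z' Y' w' single_mat_def
    show ?thesis
    proof (cases "t = u")
      case True
      show ?thesis
        using x m(1,2) diag dc True by (cases "t' = u"; cases "u' = u") (simp_all add: simps)
    next
      case False
      consider "t' = t" "u' = t" | "t' = t" "u' = u" | "t' = u" "u' = t" | "t' = u" "u' = u"
        | "t' \<noteq> t" "t' \<noteq> u" | "u' \<noteq> t" "u' \<noteq> u" by blast
      then show ?thesis
      proof cases
        case 2
        then show ?thesis using False x m(1,4) by (simp add: simps)
      next
        case 3
        then show ?thesis using False x m(2,5) by (simp add: simps)
      next
        case 4
        then show ?thesis using False m(1,6) rd dc x by (simp add: simps)
      qed (use False x m(1,2) in \<open>auto simp: simps\<close>)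
    qed
  qed
  ultimately show ?thesis using Z Y by blast
qed

text \<open>By induction over the entries. The entries of the bound \<open>Y\<close> are multiples of the unit, so
  \<open>Y\<close> has entries in every operator subsystem: this is the cofinality required by
  \<open>krein_positive_extension\<close>.\<close>

lemma fin_mat_dominated:
  assumes X: "X \<in> carrier (fin_mat A)"
  shows "\<exists>Z\<in>gram_cone A. \<exists>Y\<in>gram_cone A. (\<forall>p. \<exists>c. Y p = c \<odot> \<one>) \<and>
    (\<forall>t u. X (t, u) \<oplus> star A (X (u, t)) \<oplus> Z (t, u) = Y (t, u))"
proof -
  have "finite W \<Longrightarrow> {p. X p \<noteq> \<zero>} \<subseteq> W \<Longrightarrow> \<forall>p. X p \<in> carrier A \<Longrightarrow>
    \<exists>Z\<in>gram_cone A. \<exists>Y\<in>gram_cone A. (\<forall>p. \<exists>c. Y p = c \<odot> \<one>) \<and>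
      (\<forall>t u. X (t, u) \<oplus> star A (X (u, t)) \<oplus> Z (t, u) = Y (t, u))" for W and X :: "'b \<times> 'b \<Rightarrow> 'a"
  proof (induction W arbitrary: X rule: finite_induct)
    case empty
    then have "X = (\<lambda>_. \<zero>)" by auto
    moreover have "\<exists>c. \<zero> = c \<odot> \<one>" using smult_zero_left[OF one_closed] by metis
    ultimately show ?case
      by (intro bexI[of _ "\<lambda>_. \<zero>"]) (auto simp: gram_cone.zero)
  next
    case (insert p W)
    obtain t u where p: "p = (t, u)" by (cases p)
    define xp where "xp = X p"
    have xp: "xp \<in> carrier A" using insert.prems by (simp add: xp_def)
    define X' where "X' = X(p := \<zero>)"
    have X': "\<And>p. X' p \<in> carrier A" "{p. X' p \<noteq> \<zero>} \<subseteq> W" using insert.prems by (auto simp: X'_def)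
    obtain Z' Y' where Z': "Z' \<in> gram_cone A" "Y' \<in> gram_cone A" "\<And>p. \<exists>c. Y' p = c \<odot> \<one>"
      "\<And>t u. X' (t, u) \<oplus> star A (X' (u, t)) \<oplus> Z' (t, u) = Y' (t, u)"
      using insert.IH[OF X'(2)] X'(1) by blast
    let ?S = "single_mat A t u xp"
    have Sc: "?S q \<in> carrier A" for q using xp by (simp add: single_mat_def)
    obtain Z1 Y1 where Z1: "Z1 \<in> gram_cone A" "Y1 \<in> gram_cone A" "\<And>p. \<exists>c. Y1 p = c \<odot> \<one>"
      "\<And>t' u'. ?S (t', u') \<oplus> star A (?S (u', t')) \<oplus> Z1 (t', u') = Y1 (t', u')"
      using single_mat_dominated[OF xp, of t u] by blast
    have Xsum: "X q = X' q \<oplus> ?S q" for q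
      using insert.prems by (auto simp: X'_def single_mat_def xp_def p)
    let ?Z = "\<lambda>p. Z' p \<oplus> Z1 p" and ?Y = "\<lambda>p. Y' p \<oplus> Y1 p"
    have "\<exists>c. ?Y q = c \<odot> \<one>" for q
      using Z'(3)[of q] Z1(3)[of q] smult_add_left[OF one_closed] by metis
    moreover have "X (t, u) \<oplus> star A (X (u, t)) \<oplus> ?Z (t, u) = ?Y (t, u)" for t u
      unfolding Xsum Z'(4)[symmetric] Z1(4)[symmetric]
      using X'(1) Sc gram_cone_entry[OF Z'(1)] gram_cone_entry[OF Z1(1)]
      by (simp add: star_add a_ac)
    ultimately show ?case
      using gram_cone_plus[OF Z1(1) Z'(1)] gram_cone_plus[OF Z1(2) Z'(2)]
      by (intro bexI[of _ ?Z] bexI[of _ ?Y] conjI allI)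
  qed
  then show ?thesis using X by (auto simp: fin_mat_carrier)
qed

text \<open>Arveson's extension theorem, where the completely positive map \<open>\<phi>\<close> is encoded by the
  numbers \<open>\<sigma> x t u = \<langle>t, \<phi> x u\<rangle>\<close>. The functional \<open>X \<mapsto> \<Sum> \<sigma> (X\<^sub>t\<^sub>u) t u\<close> on the matrices with
  entries in \<open>S\<close> is extended to all finitely supported matrices, and \<open>\<tau> x t u\<close> is its value at
  the matrix with single entry \<open>x\<close>. Positivity on the square of a row is nonnegativity of the
  kernel form on the corresponding formal combination.\<close>

theorem arveson_extension:
  fixes \<sigma> :: "'a \<Rightarrow> 't \<Rightarrow> 't \<Rightarrow> complex"
  assumes S: "operator_subsystem A S"
    and add: "\<And>x y t u. x \<in> S \<Longrightarrow> y \<in> S \<Longrightarrow> \<sigma> (x \<oplus> y) t u = \<sigma> x t u + \<sigma> y t u"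
    and scale: "\<And>c x t u. x \<in> S \<Longrightarrow> \<sigma> (c \<odot> x) t u = c * \<sigma> x t u"
    and pos: "\<And>X Z. X \<in> gram_cone A \<Longrightarrow> range X \<subseteq> S \<Longrightarrow> finite Z \<Longrightarrow> {p. X p \<noteq> \<zero>} \<subseteq> Z \<times> Z \<Longrightarrow>
      (\<Sum>t\<in>Z. \<Sum>u\<in>Z. \<sigma> (X (t, u)) t u) \<in> \<real>\<^sub>\<ge>\<^sub>0"
  shows "\<exists>\<tau>. (\<forall>x\<in>carrier A. \<forall>y\<in>carrier A. \<forall>t u. \<tau> (x \<oplus> y) t u = \<tau> x t u + \<tau> y t u) \<and>
    (\<forall>x\<in>carrier A. \<forall>c t u. \<tau> (c \<odot> x) t u = c * \<tau> x t u) \<and>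
    psd_kernel (carrier A \<times> UNIV) (\<lambda>(a, t) (b, u). \<tau> (star A a \<otimes> b) t u) \<and>
    (\<forall>x\<in>S. \<forall>t u. \<tau> x t u = \<sigma> x t u)"
proof -
  note SD = operator_subsystemD[OF S]
  interpret E: star_module "fin_mat A :: ('t \<times> 't \<Rightarrow> 'a) cstar" by (rule star_module_fin_mat)
  define F where "F = {X \<in> carrier (fin_mat A :: ('t \<times> 't \<Rightarrow> 'a) cstar). range X \<subseteq> S}"
  define s\<^sub>0 where "s\<^sub>0 X = (\<Sum>p\<in>{p. X p \<noteq> \<zero>}. \<sigma> (X p) (fst p) (snd p))" for X
  have \<sigma>_zero: "\<sigma> \<zero> t u = 0" for t u
    using scale[OF SD(2), of 0 t u] by simp
  have s\<^sub>0: "s\<^sub>0 X = (\<Sum>p\<in>W. \<sigma> (X p) (fst p) (snd p))" if "finite W" "{p. X p \<noteq> \<zero>} \<subseteq> W" for X W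
    unfolding s\<^sub>0_def by (rule sum.mono_neutral_left[OF that]) (auto simp: \<sigma>_zero)
  have FS: "X p \<in> S" if "X \<in> F" for X p using that by (auto simp: F_def)
  have Ffin: "finite {p. X p \<noteq> \<zero>}" if "X \<in> F" for X using that by (auto simp: F_def fin_mat_carrier)
  have "\<exists>s. (\<forall>x\<in>carrier (fin_mat A). \<forall>y\<in>carrier (fin_mat A). s (x \<oplus>\<^bsub>fin_mat A\<^esub> y) = s x + s y) \<and>
    (\<forall>x\<in>carrier (fin_mat A). \<forall>c. s (c \<odot>\<^bsub>fin_mat A\<^esub> x) = c * s x) \<and>
    (\<forall>x\<in>gram_cone A. s x \<in> \<real>\<^sub>\<ge>\<^sub>0) \<and> (\<forall>x\<in>F. s x = s\<^sub>0 x)"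
  proof (rule E.krein_positive_extension)
    show "F \<subseteq> carrier (fin_mat A)" by (auto simp: F_def)
    show F_add: "X \<oplus>\<^bsub>fin_mat A\<^esub> Y \<in> F" if "X \<in> F" "Y \<in> F" for X Y
      using that E.a_closed[of X Y] SD(4) by (auto simp: F_def fin_mat_simps image_subset_iff)
    show F_scale: "c \<odot>\<^bsub>fin_mat A\<^esub> X \<in> F" if "X \<in> F" for X c
      using that E.smult_closed[of X c] SD(5) by (auto simp: F_def fin_mat_simps image_subset_iff)
    show "star (fin_mat A) X \<in> F" if "X \<in> F" for X
      using that E.star_closed[of X] SD(6) by (auto simp: F_def fin_mat_simps image_subset_iff)
    show "gram_cone A \<subseteq> carrier (fin_mat A)" using gram_cone_carrier by blast
    show "\<zero>\<^bsub>fin_mat A\<^esub> \<in> gram_cone A" by (simp add: fin_mat_simps gram_cone.zero)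
    show "X \<oplus>\<^bsub>fin_mat A\<^esub> Y \<in> gram_cone A" if "X \<in> gram_cone A" "Y \<in> gram_cone A" for X Y
      using gram_cone_plus that by (simp add: fin_mat_simps)
    show "complex_of_real r \<odot>\<^bsub>fin_mat A\<^esub> X \<in> gram_cone A" if "X \<in> gram_cone A" "0 \<le> r" for X r
      using gram_cone_scale that by (simp add: fin_mat_simps)
    show "star (fin_mat A) X = X" if "X \<in> gram_cone A" for X
      using gram_cone_hermitian[OF that] by (auto simp: fin_mat_simps fun_eq_iff)
    show "\<exists>Z\<in>gram_cone A. X \<oplus>\<^bsub>fin_mat A\<^esub> star (fin_mat A) X \<oplus>\<^bsub>fin_mat A\<^esub> Z \<in> F \<inter> gram_cone A"
      if X: "X \<in> carrier (fin_mat A)" for X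
    proof -
      obtain Z Y where Z: "Z \<in> gram_cone A" "Y \<in> gram_cone A" "\<And>p. \<exists>c. Y p = c \<odot> \<one>"
        "\<And>t u. X (t, u) \<oplus> star A (X (u, t)) \<oplus> Z (t, u) = Y (t, u)"
        using fin_mat_dominated[OF X] by blast
      have "X \<oplus>\<^bsub>fin_mat A\<^esub> star (fin_mat A) X \<oplus>\<^bsub>fin_mat A\<^esub> Z = Y"
        using Z(4) by (auto simp: fin_mat_simps fun_eq_iff)
      moreover have "Y p \<in> S" for p using Z(3)[of p] SD(3,5) by auto
      then have "Y \<in> F" using gram_cone_carrier[OF Z(2)] by (auto simp: F_def)
      ultimately show ?thesis using Z(1,2) by auto
    qed
    show "s\<^sub>0 (X \<oplus>\<^bsub>fin_mat A\<^esub> Y) = s\<^sub>0 X + s\<^sub>0 Y" if X: "X \<in> F" and Y: "Y \<in> F" for X Y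
    proof -
      let ?W = "{p. X p \<noteq> \<zero>} \<union> {p. Y p \<noteq> \<zero>}"
      have W: "finite ?W" using Ffin X Y by blast
      have "{p. X p \<oplus> Y p \<noteq> \<zero>} \<subseteq> ?W" by auto
      then show ?thesis
        using s\<^sub>0[OF W, of X] s\<^sub>0[OF W, of Y] s\<^sub>0[OF W, of "X \<oplus>\<^bsub>fin_mat A\<^esub> Y"] FS[OF X] FS[OF Y]
        by (simp add: fin_mat_simps add sum.distrib)
    qed
    show "s\<^sub>0 (c \<odot>\<^bsub>fin_mat A\<^esub> X) = c * s\<^sub>0 X" if X: "X \<in> F" for X c
    proof -
      have "{p. c \<odot> X p \<noteq> \<zero>} \<subseteq> {p. X p \<noteq> \<zero>}" by auto
      then show ?thesis
        using s\<^sub>0[OF Ffin[OF X], of X] s\<^sub>0[OF Ffin[OF X], of "c \<odot>\<^bsub>fin_mat A\<^esub> X"] FS[OF X]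
        by (simp add: fin_mat_simps scale sum_distrib_left)
    qed
    show "s\<^sub>0 X \<in> \<real>\<^sub>\<ge>\<^sub>0" if X: "X \<in> F" "X \<in> gram_cone A" for X
    proof -
      let ?D = "{p. X p \<noteq> \<zero>}"
      let ?Z = "fst ` ?D \<union> snd ` ?D"
      have Z: "finite ?Z" using Ffin[OF X(1)] by auto
      have D: "?D \<subseteq> ?Z \<times> ?Z" by force
      have "s\<^sub>0 X = (\<Sum>p\<in>?Z \<times> ?Z. \<sigma> (X p) (fst p) (snd p))"
        by (rule s\<^sub>0) (use Z D in auto)
      also have "\<dots> = (\<Sum>t\<in>?Z. \<Sum>u\<in>?Z. \<sigma> (X (t, u)) t u)"
        by (simp add: sum.cartesian_product split_def)
      also have "\<dots> \<in> \<real>\<^sub>\<ge>\<^sub>0"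
        by (rule pos[OF X(2) _ Z D]) (use FS[OF X(1)] in auto)
      finally show ?thesis .
    qed
  qed
  then obtain s where s_add: "\<And>X Y. X \<in> carrier (fin_mat A) \<Longrightarrow> Y \<in> carrier (fin_mat A) \<Longrightarrow>
      s (\<lambda>p. X p \<oplus> Y p) = s X + s Y"
    and s_scale: "\<And>X c. X \<in> carrier (fin_mat A) \<Longrightarrow> s (\<lambda>p. c \<odot> X p) = c * s X"
    and s_pos: "\<And>X. X \<in> gram_cone A \<Longrightarrow> s X \<in> \<real>\<^sub>\<ge>\<^sub>0"
    and s_F: "\<And>X. X \<in> F \<Longrightarrow> s X = s\<^sub>0 X"
    unfolding fin_mat_simps by blast
  define \<tau> where "\<tau> x t u = s (single_mat A t u x)" for x t u
  have \<tau>_add: "\<tau> (x \<oplus> y) t u = \<tau> x t u + \<tau> y t u" if "x \<in> carrier A" "y \<in> carrier A" for x y t u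
  proof -
    have "single_mat A t u (x \<oplus> y) = (\<lambda>p. single_mat A t u x p \<oplus> single_mat A t u y p)"
      by (auto simp: single_mat_def)
    then show ?thesis using that by (simp add: \<tau>_def s_add single_mat_closed)
  qed
  have \<tau>_scale: "\<tau> (c \<odot> x) t u = c * \<tau> x t u" if "x \<in> carrier A" for x c t u
  proof -
    have "single_mat A t u (c \<odot> x) = (\<lambda>p. c \<odot> single_mat A t u x p)"
      by (auto simp: single_mat_def)
    then show ?thesis using that by (simp add: \<tau>_def s_scale single_mat_closed)
  qed
  have s_zero: "s (\<lambda>_. \<zero>) = 0"
    using s_scale[of "\<lambda>_. \<zero>" 0] by (simp add: fin_mat_carrier)
  \<comment> \<open>\<open>col v\<close> is the row of the formal combination \<open>v\<close>, with \<open>c a\<close> added at position \<open>t\<close> for each term \<open>(c, a, t)\<close>.\<close>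
  define col where "col v = foldr (\<lambda>(c, a, t) w t'. single_col A t (c \<odot> a) t' \<oplus> w t') v (\<lambda>_. \<zero>)"
    for v :: "(complex \<times> 'a \<times> 't) list"
  have col_simps: "col [] = (\<lambda>_. \<zero>)"
    "col ((c, a, t) # v) = (\<lambda>t'. single_col A t (c \<odot> a) t' \<oplus> col v t')" for c a t v
    by (simp_all add: col_def)
  have col_closed: "col v \<in> fin_col A" if "snd ` set v \<subseteq> carrier A \<times> UNIV" for v
    using that
  proof (induction v)
    case (Cons p v)
    then show ?case by (cases p) (auto simp: col_simps intro!: col_add_closed single_col_closed)
  qed (simp add: col_simps fin_col_iff)
  let ?K = "\<lambda>(a, t) (b, u). \<tau> (star A a \<otimes> b) t u"
  have row: "(\<Sum>(b, y)\<leftarrow>w. cnj c * b * ?K (a, t) y) = s (outer A (single_col A t (c \<odot> a)) (col w))"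
    if a: "a \<in> carrier A" and w: "snd ` set w \<subseteq> carrier A \<times> UNIV" for c a t w
    using w
  proof (induction w)
    case Nil
    have "outer A (single_col A t (c \<odot> a)) (\<lambda>_. \<zero>) = (\<lambda>_. \<zero>)"
      using a by (auto simp: outer_def single_col_def)
    then show ?case by (simp add: col_simps s_zero)
  next
    case (Cons p w)
    obtain c' b u where p: "p = (c', b, u)" by (cases p)
    have b: "b \<in> carrier A" and w: "snd ` set w \<subseteq> carrier A \<times> UNIV" using Cons.prems by (auto simp: p)
    have "col w t' \<in> carrier A" for t' using col_closed[OF w] by (simp add: fin_col_iff)
    then have "outer A (single_col A t (c \<odot> a)) (col (p # w)) q
        = (cnj c * c') \<odot> single_mat A t u (star A a \<otimes> b) q
            \<oplus> outer A (single_col A t (c \<odot> a)) (col w) q" for q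
      using a b by (cases q) (auto simp: p col_simps outer_def single_col_def single_mat_def r_distr
          star_smult smult_mult_left smult_mult_right smult_smult mult.commute[of c'])
    then have "outer A (single_col A t (c \<odot> a)) (col (p # w))
        = (\<lambda>q. (cnj c * c') \<odot> single_mat A t u (star A a \<otimes> b) q
            \<oplus> outer A (single_col A t (c \<odot> a)) (col w) q)" by (rule ext)
    moreover have "single_mat A t u (star A a \<otimes> b) \<in> carrier (fin_mat A)"
      using a b by (intro single_mat_closed) auto
    moreover have "outer A (single_col A t (c \<odot> a)) (col w) \<in> carrier (fin_mat A)"
      using a by (intro outer_closed col_closed w single_col_closed) auto
    ultimately show ?case
      using Cons.IH[OF w] by (simp add: p s_add s_scale fin_mat_smult_closed \<tau>_def)
  qed
  have form: "kernel_form ?K v w = s (outer A (col v) (col w))"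
    if v: "snd ` set v \<subseteq> carrier A \<times> UNIV" and w: "snd ` set w \<subseteq> carrier A \<times> UNIV" for v w
    using v
  proof (induction v)
    case Nil
    have "outer A (\<lambda>_. \<zero>) (col w) = (\<lambda>_. \<zero>)"
      using col_closed[OF w] by (auto simp: outer_def fin_col_iff)
    then show ?case by (simp add: col_simps s_zero)
  next
    case (Cons p v)
    obtain c a t where p: "p = (c, a, t)" by (cases p)
    have a: "a \<in> carrier A" and v: "snd ` set v \<subseteq> carrier A \<times> UNIV" using Cons.prems by (auto simp: p)
    have sc: "single_col A t (c \<odot> a) \<in> fin_col A" using a by (intro single_col_closed) auto
    have "outer A (col (p # v)) (col w)
        = (\<lambda>q. outer A (single_col A t (c \<odot> a)) (col w) q \<oplus> outer A (col v) (col w) q)"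
      using sc col_closed[OF v] col_closed[OF w]
      by (auto simp: p col_simps outer_def fin_col_iff star_add l_distr)
    then show ?case
      using Cons.IH[OF v] row[OF a w] outer_closed[OF sc col_closed[OF w]]
        outer_closed[OF col_closed[OF v] col_closed[OF w]]
      by (simp add: p s_add)
  qed
  have "psd_kernel (carrier A \<times> UNIV) ?K"
    unfolding psd_kernel_def by (simp add: form s_pos outer_gram_cone col_closed)
  moreover have "\<tau> x t u = \<sigma> x t u" if x: "x \<in> S" for x t u
  proof -
    have "single_mat A t u x \<in> F"
      using x SD(1,2) single_mat_closed[of x t u] by (auto simp: F_def single_mat_def)
    then have "\<tau> x t u = s\<^sub>0 (single_mat A t u x)" by (simp add: \<tau>_def s_F)
    also have "\<dots> = (\<Sum>p\<in>{(t, u)}. \<sigma> (single_mat A t u x p) (fst p) (snd p))"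
      by (rule s\<^sub>0) (auto simp: single_mat_def)
    finally show ?thesis by (simp add: single_mat_def)
  qed
  ultimately show ?thesis using \<tau>_add \<tau>_scale by blast
qed

end


section \<open>Square roots and order units in C*-algebras\<close>

context unital_cstar_algebra
begin

lemma nrm_star:
  assumes x: "x \<in> carrier A"
  shows "nrm A (star A x) = nrm A x"
proof -
  have le: "nrm A y \<le> nrm A (star A y)" if y: "y \<in> carrier A" for y
  proof (cases "nrm A y = 0")
    case True
    then show ?thesis using nrm_nonneg[OF star_closed[OF y]] by simp
  next
    case False
    then have pos: "nrm A y > 0" using nrm_nonneg[OF y] by simp
    have "nrm A y * nrm A y \<le> nrm A (star A y) * nrm A y"
      using cstar_identity[OF y] nrm_mult[OF star_closed[OF y] y] by (simp add: power2_eq_square)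
    then show ?thesis using pos by simp
  qed
  show ?thesis
    using le[OF x] le[OF star_closed[OF x]] star_star[OF x] by simp
qed

lemma a_minus_smult: "x \<in> carrier A \<Longrightarrow> y \<in> carrier A \<Longrightarrow> x \<ominus> y = x \<oplus> (-1) \<odot> y"
  using M.smult_l_minus[of 1 y] M.smult_one[of y] M.R.add.inv_closed
  by (simp add: a_minus_def class_ring_simps)

lemma nrm_minus_commute:
  assumes "x \<in> carrier A" "y \<in> carrier A"
  shows "nrm A (x \<ominus> y) = nrm A (y \<ominus> x)"
proof -
  interpret S: unital_star_algebra A by (rule unital_cstar_star_algebra) (rule unital_cstar_algebra_axioms)
  have "x \<ominus> y = (-1) \<odot> (y \<ominus> x)"
    using assms by (simp add: a_minus_smult S.smult_add_right S.smult_smult S.smult_one a_comm)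
  then show ?thesis using assms nrm_smult[of "y \<ominus> x" "-1"] by simp
qed

lemma cstar_metric: "Metric_space (carrier A) (cstar_dist A)"
proof
  fix x y z
  show "0 \<le> cstar_dist A x y" by (auto simp: cstar_dist_def nrm_nonneg)
  show "cstar_dist A x y = cstar_dist A y x" by (auto simp: cstar_dist_def nrm_minus_commute)
  show "(cstar_dist A x y = 0) = (x = y)" if "x \<in> carrier A" "y \<in> carrier A"
    using that by (simp add: cstar_dist_def nrm_eq_zero)
  show "cstar_dist A x z \<le> cstar_dist A x y + cstar_dist A y z"
    if "x \<in> carrier A" "y \<in> carrier A" "z \<in> carrier A"
  proof -
    have "x \<ominus> z = (x \<ominus> y) \<oplus> (y \<ominus> z)"
      using that by (simp add: a_minus_def a_assoc r_neg1)
    then show ?thesis using that nrm_add[of "x \<ominus> y" "y \<ominus> z"] by (simp add: cstar_dist_def)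
  qed
qed

text \<open>\<open>1 - y\<close> is a square root of \<open>1 - t\<close> iff \<open>y = (t + y\<^sup>2) / 2\<close>; for \<open>\<parallel>t\<parallel> < 1\<close> the right hand side
  is a contraction of a ball, and its fixed point is selfadjoint because it is unique.\<close>

lemma exists_sqrt_one_minus:
  assumes t: "t \<in> carrier A" "star A t = t" "nrm A t < 1"
  shows "\<exists>c \<in> carrier A. star A c \<otimes> c \<oplus> t = \<one>"
proof -
  interpret S: unital_star_algebra A by (rule unital_cstar_star_algebra) (rule unital_cstar_algebra_axioms)
  interpret Met: Metric_space "carrier A" "cstar_dist A" by (rule cstar_metric)
  define k where "k = nrm A t"
  have k: "0 \<le> k" "k < 1" using t nrm_nonneg by (auto simp: k_def)
  define B where "B = Met.mcball \<zero> k"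
  have B: "y \<in> B \<longleftrightarrow> y \<in> carrier A \<and> nrm A y \<le> k" for y
  proof -
    have "nrm A (\<zero> \<ominus> y) = nrm A y" if "y \<in> carrier A"
      using nrm_minus_commute[OF zero_closed that] that by (simp add: a_minus_def)
    then show ?thesis by (auto simp: B_def cstar_dist_def)
  qed
  define f where "f y = (1/2) \<odot> (t \<oplus> y \<otimes> y)" for y
  have fB: "f y \<in> B" if y: "y \<in> B" for y
  proof -
    have "nrm A (t \<oplus> y \<otimes> y) \<le> nrm A t + nrm A y * nrm A y"
      using y t by (meson B add_mono nrm_add nrm_mult m_closed order_refl order_trans)
    also have "\<dots> \<le> k + k * k"
      using y k nrm_nonneg by (intro add_mono mult_mono) (auto simp: B k_def)
    also have "\<dots> \<le> k + k * 1" using k by (intro add_left_mono mult_left_mono) auto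
    finally show ?thesis
      using y t nrm_smult[of "t \<oplus> y \<otimes> y" "1/2"] by (auto simp: B f_def)
  qed
  have con: "nrm A (f y \<ominus> f z) \<le> k * nrm A (y \<ominus> z)" if y: "y \<in> B" and z: "z \<in> B" for y z
  proof -
    have yc: "y \<in> carrier A" and zc: "z \<in> carrier A" using y z B by auto
    have mc: "(-1) \<odot> t \<in> carrier A" "(-1) \<odot> (z \<otimes> z) \<in> carrier A" using t(1) zc by auto
    have "f y \<ominus> f z = (1/2) \<odot> ((t \<oplus> y \<otimes> y) \<oplus> (-1) \<odot> (t \<oplus> z \<otimes> z))"
      using yc zc t(1) by (simp add: f_def a_minus_smult S.smult_add_right S.smult_smult)
    also have "(t \<oplus> y \<otimes> y) \<oplus> (-1) \<odot> (t \<oplus> z \<otimes> z) = y \<otimes> y \<oplus> (-1) \<odot> (z \<otimes> z) \<oplus> (t \<oplus> (-1) \<odot> t)"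
      using yc zc t(1) mc by (simp only: S.smult_add_right m_closed a_ac a_closed)
    also have "t \<oplus> (-1) \<odot> t = \<zero>" using t(1) by simp
    also have "y \<otimes> y \<oplus> (-1) \<odot> (z \<otimes> z) \<oplus> \<zero> = y \<otimes> (y \<ominus> z) \<oplus> (y \<ominus> z) \<otimes> z"
    proof -
      have yz: "y \<otimes> z \<in> carrier A" "(-1) \<odot> (y \<otimes> z) \<in> carrier A" using yc zc by auto
      have "y \<otimes> (y \<ominus> z) = y \<otimes> y \<oplus> (-1) \<odot> (y \<otimes> z)"
        using yc zc by (simp add: a_minus_smult r_distr S.smult_mult_right)
      moreover have "(y \<ominus> z) \<otimes> z = y \<otimes> z \<oplus> (-1) \<odot> (z \<otimes> z)"
        using yc zc by (simp add: a_minus_smult l_distr S.smult_mult_left)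
      ultimately have "y \<otimes> (y \<ominus> z) \<oplus> (y \<ominus> z) \<otimes> z = y \<otimes> y \<oplus> (-1) \<odot> (z \<otimes> z) \<oplus> (y \<otimes> z \<oplus> (-1) \<odot> (y \<otimes> z))"
        using yc zc yz mc(2) by (simp only: m_closed a_ac a_closed)
      then show ?thesis using yz yc zc by simp
    qed
    finally have "nrm A (f y \<ominus> f z) = (1/2) * nrm A (y \<otimes> (y \<ominus> z) \<oplus> (y \<ominus> z) \<otimes> z)"
      using yc zc nrm_smult[of "y \<otimes> (y \<ominus> z) \<oplus> (y \<ominus> z) \<otimes> z" "1/2"] by simp
    also have "\<dots> \<le> (1/2) * (nrm A y * nrm A (y \<ominus> z) + nrm A (y \<ominus> z) * nrm A z)"
      using yc zc by (intro mult_left_mono order_trans[OF nrm_add] add_mono nrm_mult) auto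
    also have "\<dots> \<le> (1/2) * (k * nrm A (y \<ominus> z) + nrm A (y \<ominus> z) * k)"
      using y z yc zc nrm_nonneg[of "y \<ominus> z"] by (intro mult_left_mono add_mono mult_right_mono) (auto simp: B)
    finally show ?thesis by simp
  qed
  interpret Sub: Submetric "carrier A" "cstar_dist A" B
    by unfold_locales (auto simp: B)
  have "Sub.sub.mcomplete"
    using Sub.closedin_mcomplete_imp_mcomplete[OF _ complete] Met.closedin_mcball by (simp add: B_def)
  moreover have "\<zero> \<in> B" using k by (simp add: B nrm_eq_zero[THEN iffD2])
  ultimately obtain y where y: "y \<in> B" "f y = y"
    using Sub.sub.Banach_fixedpoint_thm[of f k] fB con k(2) B
    by (auto simp: cstar_dist_def)
  have yc: "y \<in> carrier A" using y B by auto
  have sy: "star A y \<in> B" using y B nrm_star star_closed by auto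
  have "f (star A y) = star A (f y)"
    using yc t by (simp add: f_def S.star_smult star_add star_mult)
  then have fsy: "f (star A y) = star A y" using y by simp
  have "nrm A (y \<ominus> star A y) \<le> k * nrm A (y \<ominus> star A y)"
    using con[OF y(1) sy] y(2) fsy by simp
  then have "nrm A (y \<ominus> star A y) = 0"
    using k(2) nrm_nonneg[of "y \<ominus> star A y"] yc star_closed[OF yc]
    by (metis minus_closed mult_le_cancel_right1 order_antisym not_less)
  then have self: "star A y = y"
    using yc star_closed[OF yc] nrm_eq_zero[of "y \<ominus> star A y"] by simp
  define m where "m = (-1) \<odot> y"
  have m: "m \<in> carrier A" "star A m = m" "m \<otimes> m = y \<otimes> y" "y \<oplus> m = \<zero>"
    using yc self by (simp_all add: m_def S.star_smult S.smult_mult_left S.smult_mult_right S.smult_smult S.smult_one)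
  have "y \<oplus> y = t \<oplus> y \<otimes> y"
  proof -
    have "y \<oplus> y = 2 \<odot> y" using S.smult_add_left[OF yc, of 1 1] by (simp add: S.smult_one yc)
    also have "\<dots> = 2 \<odot> f y" using y by simp
    also have "\<dots> = t \<oplus> y \<otimes> y" using yc t by (simp add: f_def S.smult_smult S.smult_one)
    finally show ?thesis .
  qed
  then have "(\<one> \<oplus> m) \<otimes> (\<one> \<oplus> m) \<oplus> t = \<one> \<oplus> m \<oplus> m \<oplus> (y \<oplus> y)"
    using m yc t by (simp add: l_distr r_distr a_ac)
  also have "\<dots> = \<one> \<oplus> ((y \<oplus> m) \<oplus> (y \<oplus> m))"
    using m(1) yc by (simp only: a_ac a_closed one_closed)
  also have "\<dots> = \<one>" using m by simp
  finally show ?thesis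
    using m by (intro bexI[of _ "\<one> \<oplus> m"]) (simp_all add: star_add)
qed

text \<open>The complement \<open>1 - a\<^sup>* a / r\<close> has a square root because \<open>a\<^sup>* a / r\<close> has norm below one by
  the C*-identity.\<close>

lemma cstar_order_unit:
  assumes a: "a \<in> carrier A" and r: "(nrm A a)\<^sup>2 < r"
  shows "\<exists>c \<in> carrier A. complex_of_real r \<odot> \<one> = star A a \<otimes> a \<oplus> star A c \<otimes> c"
proof -
  interpret S: unital_star_algebra A by (rule unital_cstar_star_algebra) (rule unital_cstar_algebra_axioms)
  have r0: "r > 0" using r by (meson le_less_trans zero_le_power2)
  let ?t = "complex_of_real (1 / r) \<odot> (star A a \<otimes> a)"
  have aa: "star A a \<otimes> a \<in> carrier A" using a by (simp add: star_closed)
  have "nrm A ?t = (1 / r) * (nrm A a)\<^sup>2"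
    using nrm_smult[OF aa, of "complex_of_real (1 / r)"] cstar_identity[OF a] r0 by (simp add: norm_divide)
  moreover have "(1 / r) * (nrm A a)\<^sup>2 < 1" using r r0 by (simp add: divide_less_eq)
  ultimately have "nrm A ?t < 1" by linarith
  moreover have "star A ?t = ?t"
    using a aa by (simp add: S.star_smult star_mult star_star star_closed)
  ultimately obtain c where c: "c \<in> carrier A" "star A c \<otimes> c \<oplus> ?t = \<one>"
    using exists_sqrt_one_minus[of ?t] aa by auto
  let ?c = "complex_of_real (sqrt r) \<odot> c"
  have sc: "star A c \<in> carrier A" using c by (simp add: star_closed)
  have "complex_of_real r \<odot> \<one> = complex_of_real r \<odot> (star A c \<otimes> c \<oplus> ?t)" using c by simp
  also have "\<dots> = complex_of_real r \<odot> (star A c \<otimes> c) \<oplus> star A a \<otimes> a"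
    using c(1) sc aa r0 by (simp add: S.smult_add_right S.smult_smult S.smult_one)
  also have "complex_of_real r \<odot> (star A c \<otimes> c) = star A ?c \<otimes> ?c"
    using c(1) sc r0
    by (simp add: S.star_smult S.smult_mult_left S.smult_mult_right S.smult_smult flip: of_real_mult)
  finally show ?thesis
    using c(1) sc aa by (intro bexI[of _ ?c]) (simp_all add: a_comm S.star_smult)
qed

end

lemma unital_cstar_archimedean:
  assumes "unital_cstar_algebra A"
  shows "archimedean_star_algebra A"
proof -
  interpret unital_cstar_algebra A by fact
  interpret S: unital_star_algebra A by (rule unital_cstar_star_algebra) fact
  show ?thesis
  proof
    fix a assume a: "a \<in> carrier A"
    then obtain c where "c \<in> carrier A"
      "complex_of_real ((nrm A a)\<^sup>2 + 1) \<odot>\<^bsub>A\<^esub> \<one>\<^bsub>A\<^esub> = star A a \<otimes>\<^bsub>A\<^esub> a \<oplus>\<^bsub>A\<^esub> star A c \<otimes>\<^bsub>A\<^esub> c"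
      using cstar_order_unit[of a "(nrm A a)\<^sup>2 + 1"] by auto
    then show "\<exists>r d. 0 \<le> r \<and> d \<in> S.sos \<and> complex_of_real r \<odot>\<^bsub>A\<^esub> \<one>\<^bsub>A\<^esub> = star A a \<otimes>\<^bsub>A\<^esub> a \<oplus>\<^bsub>A\<^esub> d"
      using S.square_sos[of c] by (intro exI[of _ "(nrm A a)\<^sup>2 + 1"] exI[of _ "star A c \<otimes>\<^bsub>A\<^esub> c"]) auto
  qed
qed

section \<open>Matrix algebras\<close>

lemma mat_cstar_carrier:
  "X \<in> carrier (mat_cstar N A) \<longleftrightarrow>
    (\<forall>i<N. \<forall>j<N. X (i, j) \<in> carrier A) \<and> X \<in> extensional ({..<N} \<times> {..<N})"
  by (auto simp: mat_cstar_def mat_carrier_def PiE_iff)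

lemma mat_cstar_entry:
  "X \<in> carrier (mat_cstar N A) \<Longrightarrow> i < N \<Longrightarrow> j < N \<Longrightarrow> X (i, j) \<in> carrier A"
  by (simp add: mat_cstar_carrier)

lemma mat_cstar_eqI:
  assumes "X \<in> carrier (mat_cstar N A)" "Y \<in> carrier (mat_cstar N A)"
    and "\<And>i j. i < N \<Longrightarrow> j < N \<Longrightarrow> X (i, j) = Y (i, j)"
  shows "X = Y"
  using assms by (intro extensionalityI[of X "{..<N} \<times> {..<N}" Y]) (auto simp: mat_cstar_carrier)

lemma mat_cstar_apply:
  assumes "i < N" "j < N"
  shows "(X \<otimes>\<^bsub>mat_cstar N A\<^esub> Y) (i, j) = (\<Oplus>\<^bsub>A\<^esub>k\<in>{..<N}. X (i, k) \<otimes>\<^bsub>A\<^esub> Y (k, j))"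
    "\<one>\<^bsub>mat_cstar N A\<^esub> (i, j) = (if i = j then \<one>\<^bsub>A\<^esub> else \<zero>\<^bsub>A\<^esub>)"
    "\<zero>\<^bsub>mat_cstar N A\<^esub> (i, j) = \<zero>\<^bsub>A\<^esub>"
    "(X \<oplus>\<^bsub>mat_cstar N A\<^esub> Y) (i, j) = X (i, j) \<oplus>\<^bsub>A\<^esub> Y (i, j)"
    "(c \<odot>\<^bsub>mat_cstar N A\<^esub> X) (i, j) = c \<odot>\<^bsub>A\<^esub> X (i, j)"
    "star (mat_cstar N A) X (i, j) = star A (X (j, i))"
  using assms by (simp_all add: mat_cstar_def)

lemma mat_cstar_extensional:
  "X \<otimes>\<^bsub>mat_cstar N A\<^esub> Y \<in> extensional ({..<N} \<times> {..<N})"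
  "\<one>\<^bsub>mat_cstar N A\<^esub> \<in> extensional ({..<N} \<times> {..<N})"
  "\<zero>\<^bsub>mat_cstar N A\<^esub> \<in> extensional ({..<N} \<times> {..<N})"
  "X \<oplus>\<^bsub>mat_cstar N A\<^esub> Y \<in> extensional ({..<N} \<times> {..<N})"
  "c \<odot>\<^bsub>mat_cstar N A\<^esub> X \<in> extensional ({..<N} \<times> {..<N})"
  "star (mat_cstar N A) X \<in> extensional ({..<N} \<times> {..<N})"
  by (simp_all add: mat_cstar_def)

definition elem_mat :: "nat \<Rightarrow> 'a cstar \<Rightarrow> nat \<Rightarrow> nat \<Rightarrow> 'a \<Rightarrow> nat \<times> nat \<Rightarrow> 'a" where
  "elem_mat N A i j a = (\<lambda>(p, q)\<in>{..<N} \<times> {..<N}. if p = i \<and> q = j then a else \<zero>\<^bsub>A\<^esub>)"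

definition diag_mat :: "nat \<Rightarrow> 'a cstar \<Rightarrow> 'a \<Rightarrow> nat \<times> nat \<Rightarrow> 'a" where
  "diag_mat N A a = (\<lambda>(p, q)\<in>{..<N} \<times> {..<N}. if p = q then a else \<zero>\<^bsub>A\<^esub>)"

lemma elem_mat_apply: "p < N \<Longrightarrow> q < N \<Longrightarrow> elem_mat N A i j a (p, q) = (if p = i \<and> q = j then a else \<zero>\<^bsub>A\<^esub>)"
  by (simp add: elem_mat_def)

lemma diag_mat_apply: "p < N \<Longrightarrow> q < N \<Longrightarrow> diag_mat N A a (p, q) = (if p = q then a else \<zero>\<^bsub>A\<^esub>)"
  by (simp add: diag_mat_def)

lemma (in abelian_monoid) finsum_swap:
  assumes "finite I" "finite J" "\<And>i j. i \<in> I \<Longrightarrow> j \<in> J \<Longrightarrow> f i j \<in> carrier G"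
  shows "(\<Oplus>i\<in>I. \<Oplus>j\<in>J. f i j) = (\<Oplus>j\<in>J. \<Oplus>i\<in>I. f i j)"
  using assms(1,3)
proof (induction I rule: finite_induct)
  case empty
  then show ?case by (simp add: finsum_zero)
next
  case (insert x I)
  have "(\<Oplus>i\<in>insert x I. \<Oplus>j\<in>J. f i j) = (\<Oplus>j\<in>J. f x j) \<oplus> (\<Oplus>i\<in>I. \<Oplus>j\<in>J. f i j)"
    using insert by (intro finsum_insert) (auto intro!: finsum_closed)
  also have "\<dots> = (\<Oplus>j\<in>J. f x j) \<oplus> (\<Oplus>j\<in>J. \<Oplus>i\<in>I. f i j)"
    using insert by simp
  also have "\<dots> = (\<Oplus>j\<in>J. f x j \<oplus> (\<Oplus>i\<in>I. f i j))"
    using insert by (intro finsum_addf[symmetric]) (auto intro!: finsum_closed)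
  also have "\<dots> = (\<Oplus>j\<in>J. \<Oplus>i\<in>insert x I. f i j)"
    using insert by (intro finsum_cong' refl finsum_insert[symmetric]) (auto intro!: finsum_closed)
  finally show ?case .
qed

lemma (in abelian_monoid) finsum_single_index:
  assumes "finite I" "k \<in> I" "f k \<in> carrier G" "\<And>i. i \<in> I \<Longrightarrow> i \<noteq> k \<Longrightarrow> f i = \<zero>"
  shows "(\<Oplus>i\<in>I. f i) = f k"
proof -
  have f: "f i \<in> carrier G" if "i \<in> I" for i
    using assms(3,4) that by (cases "i = k") auto
  have "(\<Oplus>i\<in>I. f i) = (\<Oplus>i\<in>I. if k = i then f i else \<zero>)"
    using assms f by (intro finsum_cong') auto
  also have "\<dots> = f k" using assms f by (intro finsum_singleton) auto
  finally show ?thesis .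
qed

context unital_star_algebra
begin

lemma star_finsum:
  assumes "finite I" "\<And>i. i \<in> I \<Longrightarrow> f i \<in> carrier A"
  shows "star A (\<Oplus>i\<in>I. f i) = (\<Oplus>i\<in>I. star A (f i))"
  using assms
proof (induction I rule: finite_induct)
  case (insert x I)
  have "star A (\<Oplus>i\<in>insert x I. f i) = star A (f x \<oplus> (\<Oplus>i\<in>I. f i))"
    using insert by (subst finsum_insert) auto
  also have "\<dots> = star A (f x) \<oplus> (\<Oplus>i\<in>I. star A (f i))"
    using insert by (subst star_add) (auto intro!: finsum_closed)
  also have "\<dots> = (\<Oplus>i\<in>insert x I. star A (f i))"
    using insert by (intro finsum_insert[symmetric]) auto
  finally show ?case .
qed simp

lemma smult_finsum:
  assumes "finite I" "\<And>i. i \<in> I \<Longrightarrow> f i \<in> carrier A"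
  shows "c \<odot> (\<Oplus>i\<in>I. f i) = (\<Oplus>i\<in>I. c \<odot> f i)"
  using assms
proof (induction I rule: finite_induct)
  case (insert x I)
  have "c \<odot> (\<Oplus>i\<in>insert x I. f i) = c \<odot> (f x \<oplus> (\<Oplus>i\<in>I. f i))"
    using insert by (subst finsum_insert) auto
  also have "\<dots> = c \<odot> f x \<oplus> (\<Oplus>i\<in>I. c \<odot> f i)"
    using insert by (subst smult_add_right) (auto intro!: finsum_closed)
  also have "\<dots> = (\<Oplus>i\<in>insert x I. c \<odot> f i)"
    using insert by (intro finsum_insert[symmetric]) auto
  finally show ?case .
qed simp

lemma mat_mult_closed:
  assumes "X \<in> carrier (mat_cstar N A)" "Y \<in> carrier (mat_cstar N A)"
  shows "X \<otimes>\<^bsub>mat_cstar N A\<^esub> Y \<in> carrier (mat_cstar N A)"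
  using assms by (auto simp: mat_cstar_carrier mat_cstar_apply mat_cstar_extensional intro!: finsum_closed)

lemma mat_add_closed:
  assumes "X \<in> carrier (mat_cstar N A)" "Y \<in> carrier (mat_cstar N A)"
  shows "X \<oplus>\<^bsub>mat_cstar N A\<^esub> Y \<in> carrier (mat_cstar N A)"
  using assms by (auto simp: mat_cstar_carrier mat_cstar_apply mat_cstar_extensional)

lemma mat_smult_closed:
  assumes "X \<in> carrier (mat_cstar N A)"
  shows "c \<odot>\<^bsub>mat_cstar N A\<^esub> X \<in> carrier (mat_cstar N A)"
  using assms by (auto simp: mat_cstar_carrier mat_cstar_apply mat_cstar_extensional)

lemma mat_star_closed:
  assumes "X \<in> carrier (mat_cstar N A)"
  shows "star (mat_cstar N A) X \<in> carrier (mat_cstar N A)"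
  using assms by (auto simp: mat_cstar_carrier mat_cstar_apply mat_cstar_extensional)

lemma mat_zero_closed: "\<zero>\<^bsub>mat_cstar N A\<^esub> \<in> carrier (mat_cstar N A)"
  by (auto simp: mat_cstar_carrier mat_cstar_apply mat_cstar_extensional)

lemma mat_one_closed: "\<one>\<^bsub>mat_cstar N A\<^esub> \<in> carrier (mat_cstar N A)"
  by (auto simp: mat_cstar_carrier mat_cstar_apply mat_cstar_extensional)

lemmas mat_closed = mat_mult_closed mat_add_closed mat_smult_closed mat_star_closed
  mat_zero_closed mat_one_closed

lemma mat_ring: "ring (mat_cstar N A)"
proof (rule ringI)
  show "abelian_group (mat_cstar N A)"
  proof (rule abelian_groupI)
    fix X assume X: "X \<in> carrier (mat_cstar N A)"
    show "\<exists>Y\<in>carrier (mat_cstar N A). Y \<oplus>\<^bsub>mat_cstar N A\<^esub> X = \<zero>\<^bsub>mat_cstar N A\<^esub>"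
    proof (intro bexI[of _ "(-1) \<odot>\<^bsub>mat_cstar N A\<^esub> X"])
      have "(-1) \<odot> x \<oplus> x = \<zero>" if "x \<in> carrier A" for x
        using smult_minus_cancel[OF that] that by (simp add: a_comm)
      then show "(-1) \<odot>\<^bsub>mat_cstar N A\<^esub> X \<oplus>\<^bsub>mat_cstar N A\<^esub> X = \<zero>\<^bsub>mat_cstar N A\<^esub>"
        using X by (intro mat_cstar_eqI[of _ N A]) (auto simp: mat_closed mat_cstar_apply mat_cstar_entry)
    qed (simp add: mat_closed X)
  next
    fix X Y assume "X \<in> carrier (mat_cstar N A)" "Y \<in> carrier (mat_cstar N A)"
    then show "X \<oplus>\<^bsub>mat_cstar N A\<^esub> Y = Y \<oplus>\<^bsub>mat_cstar N A\<^esub> X"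
      by (intro mat_cstar_eqI[of _ N A]) (auto simp: mat_closed mat_cstar_apply mat_cstar_entry a_comm)
  next
    fix X Y Z assume "X \<in> carrier (mat_cstar N A)" "Y \<in> carrier (mat_cstar N A)" "Z \<in> carrier (mat_cstar N A)"
    then show "X \<oplus>\<^bsub>mat_cstar N A\<^esub> Y \<oplus>\<^bsub>mat_cstar N A\<^esub> Z = X \<oplus>\<^bsub>mat_cstar N A\<^esub> (Y \<oplus>\<^bsub>mat_cstar N A\<^esub> Z)"
      by (intro mat_cstar_eqI[of _ N A]) (auto simp: mat_closed mat_cstar_apply mat_cstar_entry a_assoc)
  next
    fix X assume "X \<in> carrier (mat_cstar N A)"
    then show "\<zero>\<^bsub>mat_cstar N A\<^esub> \<oplus>\<^bsub>mat_cstar N A\<^esub> X = X"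
      by (intro mat_cstar_eqI[of _ N A]) (auto simp: mat_closed mat_cstar_apply mat_cstar_entry)
  qed (simp_all add: mat_closed)
  show "Group.monoid (mat_cstar N A)"
  proof (rule Group.monoidI)
    fix X Y Z
    assume X: "X \<in> carrier (mat_cstar N A)" and Y: "Y \<in> carrier (mat_cstar N A)" and Z: "Z \<in> carrier (mat_cstar N A)"
    note e = mat_cstar_entry[OF X] mat_cstar_entry[OF Y] mat_cstar_entry[OF Z]
    show "X \<otimes>\<^bsub>mat_cstar N A\<^esub> Y \<otimes>\<^bsub>mat_cstar N A\<^esub> Z = X \<otimes>\<^bsub>mat_cstar N A\<^esub> (Y \<otimes>\<^bsub>mat_cstar N A\<^esub> Z)"
    proof (rule mat_cstar_eqI[of _ N A])
      fix i j assume ij: "i < N" "j < N"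
      have "(X \<otimes>\<^bsub>mat_cstar N A\<^esub> Y \<otimes>\<^bsub>mat_cstar N A\<^esub> Z) (i, j)
          = (\<Oplus>k\<in>{..<N}. (\<Oplus>l\<in>{..<N}. X (i, l) \<otimes> Y (l, k)) \<otimes> Z (k, j))"
        using ij e by (simp add: mat_cstar_apply) (intro finsum_cong', auto simp: mat_cstar_apply intro!: finsum_closed)
      also have "\<dots> = (\<Oplus>k\<in>{..<N}. \<Oplus>l\<in>{..<N}. X (i, l) \<otimes> Y (l, k) \<otimes> Z (k, j))"
        using ij e by (intro finsum_cong' refl finsum_ldistr) (auto intro!: finsum_closed)
      also have "\<dots> = (\<Oplus>l\<in>{..<N}. \<Oplus>k\<in>{..<N}. X (i, l) \<otimes> Y (l, k) \<otimes> Z (k, j))"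
        using ij e by (intro finsum_swap) auto
      also have "\<dots> = (\<Oplus>l\<in>{..<N}. \<Oplus>k\<in>{..<N}. X (i, l) \<otimes> (Y (l, k) \<otimes> Z (k, j)))"
        using ij e by (intro finsum_cong' refl) (auto simp: m_assoc intro!: finsum_closed)
      also have "\<dots> = (\<Oplus>l\<in>{..<N}. X (i, l) \<otimes> (\<Oplus>k\<in>{..<N}. Y (l, k) \<otimes> Z (k, j)))"
        using ij e by (intro finsum_cong' refl finsum_rdistr[symmetric]) (auto intro!: finsum_closed)
      also have "\<dots> = (X \<otimes>\<^bsub>mat_cstar N A\<^esub> (Y \<otimes>\<^bsub>mat_cstar N A\<^esub> Z)) (i, j)"
        using ij e by (simp add: mat_cstar_apply) (intro finsum_cong', auto simp: mat_cstar_apply intro!: finsum_closed)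
      finally show "(X \<otimes>\<^bsub>mat_cstar N A\<^esub> Y \<otimes>\<^bsub>mat_cstar N A\<^esub> Z) (i, j) = (X \<otimes>\<^bsub>mat_cstar N A\<^esub> (Y \<otimes>\<^bsub>mat_cstar N A\<^esub> Z)) (i, j)" .
    qed (simp_all add: mat_closed X Y Z)
  next
    fix X assume X: "X \<in> carrier (mat_cstar N A)"
    note e = mat_cstar_entry[OF X]
    show "\<one>\<^bsub>mat_cstar N A\<^esub> \<otimes>\<^bsub>mat_cstar N A\<^esub> X = X"
    proof (rule mat_cstar_eqI[of _ N A])
      fix i j assume ij: "i < N" "j < N"
      have "(\<Oplus>k\<in>{..<N}. \<one>\<^bsub>mat_cstar N A\<^esub> (i, k) \<otimes> X (k, j)) = \<one>\<^bsub>mat_cstar N A\<^esub> (i, i) \<otimes> X (i, j)"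
        using ij e by (intro finsum_single_index) (auto simp: mat_cstar_apply)
      then show "(\<one>\<^bsub>mat_cstar N A\<^esub> \<otimes>\<^bsub>mat_cstar N A\<^esub> X) (i, j) = X (i, j)"
        using ij e by (simp add: mat_cstar_apply)
    qed (simp_all add: mat_closed X)
    show "X \<otimes>\<^bsub>mat_cstar N A\<^esub> \<one>\<^bsub>mat_cstar N A\<^esub> = X"
    proof (rule mat_cstar_eqI[of _ N A])
      fix i j assume ij: "i < N" "j < N"
      have "(\<Oplus>k\<in>{..<N}. X (i, k) \<otimes> \<one>\<^bsub>mat_cstar N A\<^esub> (k, j)) = X (i, j) \<otimes> \<one>\<^bsub>mat_cstar N A\<^esub> (j, j)"
        using ij e by (intro finsum_single_index) (auto simp: mat_cstar_apply)
      then show "(X \<otimes>\<^bsub>mat_cstar N A\<^esub> \<one>\<^bsub>mat_cstar N A\<^esub>) (i, j) = X (i, j)"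
        using ij e by (simp add: mat_cstar_apply)
    qed (simp_all add: mat_closed X)
  qed (simp_all add: mat_closed)
next
  fix X Y Z
  assume X: "X \<in> carrier (mat_cstar N A)" and Y: "Y \<in> carrier (mat_cstar N A)" and Z: "Z \<in> carrier (mat_cstar N A)"
  note e = mat_cstar_entry[OF X] mat_cstar_entry[OF Y] mat_cstar_entry[OF Z]
  show "(X \<oplus>\<^bsub>mat_cstar N A\<^esub> Y) \<otimes>\<^bsub>mat_cstar N A\<^esub> Z = X \<otimes>\<^bsub>mat_cstar N A\<^esub> Z \<oplus>\<^bsub>mat_cstar N A\<^esub> Y \<otimes>\<^bsub>mat_cstar N A\<^esub> Z"
  proof (rule mat_cstar_eqI[of _ N A])
    fix i j assume ij: "i < N" "j < N"
    have "(\<Oplus>k\<in>{..<N}. (X \<oplus>\<^bsub>mat_cstar N A\<^esub> Y) (i, k) \<otimes> Z (k, j))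
        = (\<Oplus>k\<in>{..<N}. X (i, k) \<otimes> Z (k, j) \<oplus> Y (i, k) \<otimes> Z (k, j))"
      using ij e by (intro finsum_cong') (auto simp: mat_cstar_apply l_distr)
    also have "\<dots> = (\<Oplus>k\<in>{..<N}. X (i, k) \<otimes> Z (k, j)) \<oplus> (\<Oplus>k\<in>{..<N}. Y (i, k) \<otimes> Z (k, j))"
      using ij e by (intro finsum_addf) auto
    finally show "((X \<oplus>\<^bsub>mat_cstar N A\<^esub> Y) \<otimes>\<^bsub>mat_cstar N A\<^esub> Z) (i, j)
        = (X \<otimes>\<^bsub>mat_cstar N A\<^esub> Z \<oplus>\<^bsub>mat_cstar N A\<^esub> Y \<otimes>\<^bsub>mat_cstar N A\<^esub> Z) (i, j)"
      using ij by (simp add: mat_cstar_apply)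
  qed (simp_all add: mat_closed X Y Z)
  show "Z \<otimes>\<^bsub>mat_cstar N A\<^esub> (X \<oplus>\<^bsub>mat_cstar N A\<^esub> Y) = Z \<otimes>\<^bsub>mat_cstar N A\<^esub> X \<oplus>\<^bsub>mat_cstar N A\<^esub> Z \<otimes>\<^bsub>mat_cstar N A\<^esub> Y"
  proof (rule mat_cstar_eqI[of _ N A])
    fix i j assume ij: "i < N" "j < N"
    have "(\<Oplus>k\<in>{..<N}. Z (i, k) \<otimes> (X \<oplus>\<^bsub>mat_cstar N A\<^esub> Y) (k, j))
        = (\<Oplus>k\<in>{..<N}. Z (i, k) \<otimes> X (k, j) \<oplus> Z (i, k) \<otimes> Y (k, j))"
      using ij e by (intro finsum_cong') (auto simp: mat_cstar_apply r_distr)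
    also have "\<dots> = (\<Oplus>k\<in>{..<N}. Z (i, k) \<otimes> X (k, j)) \<oplus> (\<Oplus>k\<in>{..<N}. Z (i, k) \<otimes> Y (k, j))"
      using ij e by (intro finsum_addf) auto
    finally show "(Z \<otimes>\<^bsub>mat_cstar N A\<^esub> (X \<oplus>\<^bsub>mat_cstar N A\<^esub> Y)) (i, j)
        = (Z \<otimes>\<^bsub>mat_cstar N A\<^esub> X \<oplus>\<^bsub>mat_cstar N A\<^esub> Z \<otimes>\<^bsub>mat_cstar N A\<^esub> Y) (i, j)"
      using ij by (simp add: mat_cstar_apply)
  qed (simp_all add: mat_closed X Y Z)
qed

lemma mat_star_algebra: "unital_star_algebra (mat_cstar N A)"
proof (intro unital_star_algebra.intro star_module.intro mat_ring)
  interpret M: ring "mat_cstar N A" by (rule mat_ring)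
  show "abelian_group (mat_cstar N A)" by unfold_locales
  show "star_module_axioms (mat_cstar N A)"
    by (rule star_module_axioms.intro; (intro mat_cstar_eqI[of _ N A])?)
      (auto simp: mat_closed mat_cstar_apply mat_cstar_entry smult_add_right smult_add_left
        smult_smult smult_one star_star star_add star_smult)
  show "unital_star_algebra_axioms (mat_cstar N A)"
  proof
    fix X Y c assume X: "X \<in> carrier (mat_cstar N A)" and Y: "Y \<in> carrier (mat_cstar N A)"
    note e = mat_cstar_entry[OF X] mat_cstar_entry[OF Y]
    show "(c \<odot>\<^bsub>mat_cstar N A\<^esub> X) \<otimes>\<^bsub>mat_cstar N A\<^esub> Y = c \<odot>\<^bsub>mat_cstar N A\<^esub> (X \<otimes>\<^bsub>mat_cstar N A\<^esub> Y)"
    proof (rule mat_cstar_eqI[of _ N A])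
      fix i j assume ij: "i < N" "j < N"
      have "(\<Oplus>k\<in>{..<N}. (c \<odot>\<^bsub>mat_cstar N A\<^esub> X) (i, k) \<otimes> Y (k, j)) = (\<Oplus>k\<in>{..<N}. c \<odot> (X (i, k) \<otimes> Y (k, j)))"
        using ij e by (intro finsum_cong') (auto simp: mat_cstar_apply smult_mult_left)
      then show "((c \<odot>\<^bsub>mat_cstar N A\<^esub> X) \<otimes>\<^bsub>mat_cstar N A\<^esub> Y) (i, j) = (c \<odot>\<^bsub>mat_cstar N A\<^esub> (X \<otimes>\<^bsub>mat_cstar N A\<^esub> Y)) (i, j)"
        using ij e smult_finsum[of "{..<N}" "\<lambda>k. X (i, k) \<otimes> Y (k, j)" c] by (simp add: mat_cstar_apply)
    qed (simp_all add: mat_closed X Y)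
    show "X \<otimes>\<^bsub>mat_cstar N A\<^esub> (c \<odot>\<^bsub>mat_cstar N A\<^esub> Y) = c \<odot>\<^bsub>mat_cstar N A\<^esub> (X \<otimes>\<^bsub>mat_cstar N A\<^esub> Y)"
    proof (rule mat_cstar_eqI[of _ N A])
      fix i j assume ij: "i < N" "j < N"
      have "(\<Oplus>k\<in>{..<N}. X (i, k) \<otimes> (c \<odot>\<^bsub>mat_cstar N A\<^esub> Y) (k, j)) = (\<Oplus>k\<in>{..<N}. c \<odot> (X (i, k) \<otimes> Y (k, j)))"
        using ij e by (intro finsum_cong') (auto simp: mat_cstar_apply smult_mult_right)
      then show "(X \<otimes>\<^bsub>mat_cstar N A\<^esub> (c \<odot>\<^bsub>mat_cstar N A\<^esub> Y)) (i, j) = (c \<odot>\<^bsub>mat_cstar N A\<^esub> (X \<otimes>\<^bsub>mat_cstar N A\<^esub> Y)) (i, j)"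
        using ij e smult_finsum[of "{..<N}" "\<lambda>k. X (i, k) \<otimes> Y (k, j)" c] by (simp add: mat_cstar_apply)
    qed (simp_all add: mat_closed X Y)
    show "star (mat_cstar N A) (X \<otimes>\<^bsub>mat_cstar N A\<^esub> Y) = star (mat_cstar N A) Y \<otimes>\<^bsub>mat_cstar N A\<^esub> star (mat_cstar N A) X"
    proof (rule mat_cstar_eqI[of _ N A])
      fix i j assume ij: "i < N" "j < N"
      have "star A (\<Oplus>k\<in>{..<N}. X (j, k) \<otimes> Y (k, i)) = (\<Oplus>k\<in>{..<N}. star A (X (j, k) \<otimes> Y (k, i)))"
        using ij e by (intro star_finsum) auto
      also have "\<dots> = (\<Oplus>k\<in>{..<N}. star (mat_cstar N A) Y (i, k) \<otimes> star (mat_cstar N A) X (k, j))"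
        using ij e by (intro finsum_cong') (auto simp: mat_cstar_apply star_mult)
      finally show "star (mat_cstar N A) (X \<otimes>\<^bsub>mat_cstar N A\<^esub> Y) (i, j)
          = (star (mat_cstar N A) Y \<otimes>\<^bsub>mat_cstar N A\<^esub> star (mat_cstar N A) X) (i, j)"
        using ij by (simp add: mat_cstar_apply)
    qed (simp_all add: mat_closed X Y)
  qed
qed

lemma elem_mat_closed: "a \<in> carrier A \<Longrightarrow> elem_mat N A i j a \<in> carrier (mat_cstar N A)"
  by (auto simp: mat_cstar_carrier elem_mat_def)

lemma diag_mat_closed: "a \<in> carrier A \<Longrightarrow> diag_mat N A a \<in> carrier (mat_cstar N A)"
  by (auto simp: mat_cstar_carrier diag_mat_def)

lemma elem_mat_mult_apply:
  assumes a: "a \<in> carrier A" and X: "X \<in> carrier (mat_cstar N A)" and j: "j < N" and pq: "p < N" "q < N"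
  shows "(elem_mat N A i j a \<otimes>\<^bsub>mat_cstar N A\<^esub> X) (p, q) = (if p = i then a \<otimes> X (j, q) else \<zero>)"
proof -
  have "(\<Oplus>k\<in>{..<N}. elem_mat N A i j a (p, k) \<otimes> X (k, q)) = elem_mat N A i j a (p, j) \<otimes> X (j, q)"
    using assms mat_cstar_entry[OF X] by (intro finsum_single_index) (auto simp: elem_mat_apply)
  then show ?thesis
    using assms mat_cstar_entry[OF X] by (simp add: mat_cstar_apply elem_mat_apply)
qed

lemma mult_elem_mat_apply:
  assumes a: "a \<in> carrier A" and X: "X \<in> carrier (mat_cstar N A)" and i: "i < N" and pq: "p < N" "q < N"
  shows "(X \<otimes>\<^bsub>mat_cstar N A\<^esub> elem_mat N A i j a) (p, q) = (if q = j then X (p, i) \<otimes> a else \<zero>)"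
proof -
  have "(\<Oplus>k\<in>{..<N}. X (p, k) \<otimes> elem_mat N A i j a (k, q)) = X (p, i) \<otimes> elem_mat N A i j a (i, q)"
    using assms mat_cstar_entry[OF X] by (intro finsum_single_index) (auto simp: elem_mat_apply)
  then show ?thesis
    using assms mat_cstar_entry[OF X] by (simp add: mat_cstar_apply elem_mat_apply)
qed

lemma elem_mat_mult:
  assumes "a \<in> carrier A" "b \<in> carrier A" "j < N"
  shows "elem_mat N A i j a \<otimes>\<^bsub>mat_cstar N A\<^esub> elem_mat N A j k b = elem_mat N A i k (a \<otimes> b)"
  using assms
  by (intro mat_cstar_eqI[of _ N A])
    (auto simp: mat_closed elem_mat_closed elem_mat_mult_apply elem_mat_apply)

lemma elem_mat_star:
  assumes "a \<in> carrier A"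
  shows "star (mat_cstar N A) (elem_mat N A i j a) = elem_mat N A j i (star A a)"
  using assms
  by (intro mat_cstar_eqI[of _ N A])
    (auto simp: mat_closed elem_mat_closed mat_cstar_apply elem_mat_apply)

lemma diag_mat_mult_apply:
  assumes a: "a \<in> carrier A" and X: "X \<in> carrier (mat_cstar N A)" and pq: "p < N" "q < N"
  shows "(diag_mat N A a \<otimes>\<^bsub>mat_cstar N A\<^esub> X) (p, q) = a \<otimes> X (p, q)"
proof -
  have "(\<Oplus>k\<in>{..<N}. diag_mat N A a (p, k) \<otimes> X (k, q)) = diag_mat N A a (p, p) \<otimes> X (p, q)"
    using assms mat_cstar_entry[OF X] by (intro finsum_single_index) (auto simp: diag_mat_apply)
  then show ?thesis
    using assms by (simp add: mat_cstar_apply diag_mat_apply)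
qed

lemma diag_mat_hom:
  assumes "a \<in> carrier A" "b \<in> carrier A"
  shows "diag_mat N A (a \<otimes> b) = diag_mat N A a \<otimes>\<^bsub>mat_cstar N A\<^esub> diag_mat N A b"
    "diag_mat N A (a \<oplus> b) = diag_mat N A a \<oplus>\<^bsub>mat_cstar N A\<^esub> diag_mat N A b"
  using assms
  by (auto intro!: mat_cstar_eqI[of _ N A]
      simp: mat_closed diag_mat_closed diag_mat_mult_apply mat_cstar_apply(2-6) diag_mat_apply)

lemma
  assumes "a \<in> carrier A"
  shows diag_mat_smult: "diag_mat N A (c \<odot> a) = c \<odot>\<^bsub>mat_cstar N A\<^esub> diag_mat N A a"
    and diag_mat_star: "diag_mat N A (star A a) = star (mat_cstar N A) (diag_mat N A a)"
  using assms
  by (auto intro!: mat_cstar_eqI[of _ N A]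
      simp: mat_closed diag_mat_closed mat_cstar_apply diag_mat_apply)

lemma diag_mat_one: "diag_mat N A \<one> = \<one>\<^bsub>mat_cstar N A\<^esub>"
  by (auto intro!: mat_cstar_eqI[of _ N A] simp: mat_closed diag_mat_closed mat_cstar_apply diag_mat_apply)

end

text \<open>By the parallelogram law \<open>(X + Y)\<^sup>* (X + Y) + (X - Y)\<^sup>* (X - Y) = 2 X\<^sup>* X + 2 Y\<^sup>* Y\<close>, the
  matrices whose square is dominated by a multiple of the unit are closed under addition, so it
  suffices to treat matrices with a single nonzero entry.\<close>

lemma (in archimedean_star_algebra) mat_archimedean: "archimedean_star_algebra (mat_cstar N A)"
proof -
  let ?M = "mat_cstar N A"
  interpret M: unital_star_algebra "?M" by (rule mat_star_algebra)
  let ?one = "\<one>\<^bsub>?M\<^esub>"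
  define bnd where "bnd X \<longleftrightarrow> (\<exists>r d. 0 \<le> r \<and> d \<in> M.sos \<and>
    complex_of_real r \<odot>\<^bsub>?M\<^esub> ?one = star (?M) X \<otimes>\<^bsub>?M\<^esub> X \<oplus>\<^bsub>?M\<^esub> d)" for X
  have bnd_add: "bnd (X \<oplus>\<^bsub>?M\<^esub> Y)"
    if X: "X \<in> carrier (?M)" "bnd X" and Y: "Y \<in> carrier (?M)" "bnd Y" for X Y
  proof -
    obtain r d where d: "0 \<le> r" "d \<in> M.sos" "complex_of_real r \<odot>\<^bsub>?M\<^esub> ?one
        = star (?M) X \<otimes>\<^bsub>?M\<^esub> X \<oplus>\<^bsub>?M\<^esub> d"
      using X(2) unfolding bnd_def by blast
    obtain s e where e: "0 \<le> s" "e \<in> M.sos" "complex_of_real s \<odot>\<^bsub>?M\<^esub> ?one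
        = star (?M) Y \<otimes>\<^bsub>?M\<^esub> Y \<oplus>\<^bsub>?M\<^esub> e"
      using Y(2) unfolding bnd_def by blast
    note dc = M.sos_carrier[OF d(2)] M.sos_carrier[OF e(2)]
    let ?m = "(-1) \<odot>\<^bsub>?M\<^esub> Y"
    let ?D = "X \<oplus>\<^bsub>?M\<^esub> ?m"
    let ?g = "star (?M) ?D \<otimes>\<^bsub>?M\<^esub> ?D \<oplus>\<^bsub>?M\<^esub> (d \<oplus>\<^bsub>?M\<^esub> d) \<oplus>\<^bsub>?M\<^esub> (e \<oplus>\<^bsub>?M\<^esub> e)"
    have g: "?g \<in> M.sos"
      using X Y d e by (intro M.sos_plus M.square_sos) auto
    let ?xx = "star (?M) X \<otimes>\<^bsub>?M\<^esub> X" and ?yy = "star (?M) Y \<otimes>\<^bsub>?M\<^esub> Y"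
    let ?xy = "star (?M) X \<otimes>\<^bsub>?M\<^esub> Y" and ?yx = "star (?M) Y \<otimes>\<^bsub>?M\<^esub> X"
    have c: "?xx \<in> carrier (?M)" "?yy \<in> carrier (?M)"
      "?xy \<in> carrier (?M)" "?yx \<in> carrier (?M)"
      "(-1) \<odot>\<^bsub>?M\<^esub> ?xy \<in> carrier (?M)" "(-1) \<odot>\<^bsub>?M\<^esub> ?yx \<in> carrier (?M)"
      using X Y by auto
    have p: "star (?M) (X \<oplus>\<^bsub>?M\<^esub> Y) \<otimes>\<^bsub>?M\<^esub> (X \<oplus>\<^bsub>?M\<^esub> Y)
        = ?xx \<oplus>\<^bsub>?M\<^esub> ?yx \<oplus>\<^bsub>?M\<^esub> (?xy \<oplus>\<^bsub>?M\<^esub> ?yy)"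
      using X Y by (simp add: M.star_add M.l_distr M.r_distr)
    have m: "star (?M) ?D \<otimes>\<^bsub>?M\<^esub> ?D
        = ?xx \<oplus>\<^bsub>?M\<^esub> (-1) \<odot>\<^bsub>?M\<^esub> ?yx \<oplus>\<^bsub>?M\<^esub> ((-1) \<odot>\<^bsub>?M\<^esub> ?xy \<oplus>\<^bsub>?M\<^esub> ?yy)"
      using X Y by (simp add: M.star_add M.l_distr M.r_distr M.star_smult M.smult_mult_left
          M.smult_add_right M.smult_mult_right M.smult_smult M.smult_one)
    have "star (?M) (X \<oplus>\<^bsub>?M\<^esub> Y) \<otimes>\<^bsub>?M\<^esub> (X \<oplus>\<^bsub>?M\<^esub> Y) \<oplus>\<^bsub>?M\<^esub> ?g
        = (?xy \<oplus>\<^bsub>?M\<^esub> (-1) \<odot>\<^bsub>?M\<^esub> ?xy) \<oplus>\<^bsub>?M\<^esub> (?yx \<oplus>\<^bsub>?M\<^esub> (-1) \<odot>\<^bsub>?M\<^esub> ?yx)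
        \<oplus>\<^bsub>?M\<^esub> ((?xx \<oplus>\<^bsub>?M\<^esub> d) \<oplus>\<^bsub>?M\<^esub> (?xx \<oplus>\<^bsub>?M\<^esub> d)
          \<oplus>\<^bsub>?M\<^esub> ((?yy \<oplus>\<^bsub>?M\<^esub> e) \<oplus>\<^bsub>?M\<^esub> (?yy \<oplus>\<^bsub>?M\<^esub> e)))"
      unfolding p m using c dc by (simp only: M.a_ac M.a_closed)
    also have "\<dots> = complex_of_real (r + r + (s + s)) \<odot>\<^bsub>?M\<^esub> ?one"
      unfolding d(3)[symmetric] e(3)[symmetric]
      by (simp only: of_real_add M.smult_add_left M.one_closed M.smult_minus_cancel c M.l_zero M.a_closed
          M.smult_closed M.zero_closed)
    finally show ?thesis
      using g d(1) e(1) unfolding bnd_def by (intro exI[of _ "r + r + (s + s)"] exI[of _ ?g]) auto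
  qed
  have bnd_elem: "bnd (elem_mat N A i j a)" if a: "a \<in> carrier A" and ij: "i < N" "j < N" for i j a
  proof -
    obtain r d where d: "0 \<le> r" "d \<in> sos" "complex_of_real r \<odot> \<one> = star A a \<otimes> a \<oplus> d"
      using order_unit[OF a] by blast
    define P where "P = (\<lambda>(p, q)\<in>{..<N} \<times> {..<N}. if p = q \<and> p \<noteq> j then complex_of_real (sqrt r) \<odot> \<one> else \<zero>)"
    have P: "P \<in> carrier (?M)" by (auto simp: mat_cstar_carrier P_def)
    have P_apply: "P (p, q) = (if p = q \<and> p \<noteq> j then complex_of_real (sqrt r) \<odot> \<one> else \<zero>)" if "p < N" "q < N" for p q
      using that by (simp add: P_def)
    have PP: "(star (?M) P \<otimes>\<^bsub>?M\<^esub> P) (p, q) = (if p = q \<and> p \<noteq> j then complex_of_real r \<odot> \<one> else \<zero>)"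
      if pq: "p < N" "q < N" for p q
    proof -
      have "(\<Oplus>k\<in>{..<N}. star (?M) P (p, k) \<otimes> P (k, q)) = star (?M) P (p, p) \<otimes> P (p, q)"
        using pq by (intro finsum_single_index) (auto simp: mat_cstar_apply P_apply)
      then show ?thesis
        using pq d(1) by (simp add: mat_cstar_apply P_apply star_smult smult_mult_left smult_smult
            flip: of_real_mult)
    qed
    have "e \<in> sos \<Longrightarrow> elem_mat N A j j e \<in> M.sos" for e
    proof (induction rule: sos.induct)
      case zero
      have "elem_mat N A j j \<zero> = \<zero>\<^bsub>?M\<^esub>"
        by (intro mat_cstar_eqI[of _ N A]) (auto simp: mat_closed elem_mat_closed mat_cstar_apply elem_mat_apply)
      then show ?case by (simp add: M.sos.zero)
    next
      case (add e b)
      have "elem_mat N A j j (e \<oplus> star A b \<otimes> b) = elem_mat N A j j e \<oplus>\<^bsub>?M\<^esub>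
          star (?M) (elem_mat N A j j b) \<otimes>\<^bsub>?M\<^esub> elem_mat N A j j b"
        using add sos_carrier ij unfolding elem_mat_star[OF add.hyps(2)]
        by (subst elem_mat_mult, simp_all, intro mat_cstar_eqI[of _ N A])
          (auto simp: mat_closed elem_mat_closed mat_cstar_apply elem_mat_apply)
      then show ?case using M.sos.add[OF add.IH elem_mat_closed[OF add.hyps(2)]] by simp
    qed
    then have D: "star (?M) P \<otimes>\<^bsub>?M\<^esub> P \<oplus>\<^bsub>?M\<^esub> elem_mat N A j j d \<in> M.sos" (is "?D \<in> _")
      using d(2) P by (intro M.sos_plus M.square_sos) auto
    have "complex_of_real r \<odot>\<^bsub>?M\<^esub> ?one = star (?M) (elem_mat N A i j a)
        \<otimes>\<^bsub>?M\<^esub> elem_mat N A i j a \<oplus>\<^bsub>?M\<^esub> ?D"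
    proof -
      have "star (?M) (elem_mat N A i j a) \<otimes>\<^bsub>?M\<^esub> elem_mat N A i j a
          = elem_mat N A j j (star A a \<otimes> a)"
        using a ij by (simp add: elem_mat_star elem_mat_mult)
      moreover have "complex_of_real r \<odot>\<^bsub>?M\<^esub> ?one
          = elem_mat N A j j (star A a \<otimes> a) \<oplus>\<^bsub>?M\<^esub> ?D"
      proof (rule mat_cstar_eqI[of _ N A])
        fix p q assume pq: "p < N" "q < N"
        show "(complex_of_real r \<odot>\<^bsub>?M\<^esub> ?one) (p, q)
            = (elem_mat N A j j (star A a \<otimes> a) \<oplus>\<^bsub>?M\<^esub> ?D) (p, q)"
          using pq a d(3) sos_carrier[OF d(2)] PP[OF pq]
          by (auto simp: mat_cstar_apply(2,4,5) elem_mat_apply)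
      qed (use a P sos_carrier[OF d(2)] in \<open>auto simp: mat_closed elem_mat_closed\<close>)
      ultimately show ?thesis by simp
    qed
    then show ?thesis using d(1) D unfolding bnd_def by blast
  qed
  have bnd_supp: "bnd X" if "finite W" "{(i, j). i < N \<and> j < N \<and> X (i, j) \<noteq> \<zero>} \<subseteq> W" "X \<in> carrier (?M)" for W X
    using that
  proof (induction W arbitrary: X rule: finite_induct)
    case empty
    then have "X = \<zero>\<^bsub>?M\<^esub>"
      by (intro mat_cstar_eqI[of _ N A]) (auto simp: mat_closed mat_cstar_apply)
    then show ?case
      unfolding bnd_def by (intro exI[of _ 0] exI[of _ "\<zero>\<^bsub>?M\<^esub>"]) (simp add: M.sos.zero)
  next
    case (insert p W)
    obtain i j where p: "p = (i, j)" by (cases p)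
    show ?case
    proof (cases "i < N \<and> j < N")
      case False
      then show ?thesis using insert p by (intro insert.IH) auto
    next
      case True
      define X' where "X' = (\<lambda>q\<in>{..<N} \<times> {..<N}. if q = p then \<zero> else X q)"
      have X': "X' \<in> carrier (?M)" "{(i, j). i < N \<and> j < N \<and> X' (i, j) \<noteq> \<zero>} \<subseteq> W"
        using insert.prems by (auto simp: X'_def mat_cstar_carrier)
      have Xp: "X p \<in> carrier A" using insert.prems(2) True by (simp add: p mat_cstar_entry)
      have "X = X' \<oplus>\<^bsub>?M\<^esub> elem_mat N A i j (X p)"
        using insert.prems(2) X'(1) Xp
        by (intro mat_cstar_eqI[of _ N A])
          (auto simp: mat_closed elem_mat_closed mat_cstar_apply elem_mat_apply mat_cstar_entry X'_def p)
      then show ?thesis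
        using bnd_add[OF X'(1) insert.IH[OF X'(2,1)] elem_mat_closed[OF Xp] bnd_elem[OF Xp]] True by metis
    qed
  qed
  have all: "bnd X" if "X \<in> carrier (?M)" for X
    by (rule bnd_supp[of "{..<N} \<times> {..<N}"]) (use that in auto)
  show ?thesis
    by unfold_locales (use all in \<open>auto simp: bnd_def\<close>)
qed

section \<open>The algebra of bounded operators\<close>

lemma bounded_ops_simps [simp]:
  "carrier bounded_ops = bounded_clinear_ops" "S \<otimes>\<^bsub>bounded_ops\<^esub> T = S o\<^sub>L T" "\<one>\<^bsub>bounded_ops\<^esub> = id_blinfun"
  "\<zero>\<^bsub>bounded_ops\<^esub> = 0" "S \<oplus>\<^bsub>bounded_ops\<^esub> T = S + T" "c \<odot>\<^bsub>bounded_ops\<^esub> T = scaleC_blinfun c T"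
  "star bounded_ops = adjoint_op" "nrm bounded_ops = norm"
  by (simp_all add: bounded_ops_def)

lemma bounded_ops_star_algebra: "unital_star_algebra (bounded_ops :: ('h::chilbert_space \<Rightarrow>\<^sub>L 'h) cstar)"
proof -
  have ag: "abelian_group (bounded_ops :: ('h \<Rightarrow>\<^sub>L 'h) cstar)"
  proof (rule abelian_groupI)
    fix T :: "'h \<Rightarrow>\<^sub>L 'h" assume "T \<in> carrier bounded_ops"
    then show "\<exists>S\<in>carrier bounded_ops. S \<oplus>\<^bsub>bounded_ops\<^esub> T = \<zero>\<^bsub>bounded_ops\<^esub>"
      by (intro bexI[of _ "- T"]) (simp_all add: bounded_clinear_ops_closed)
  qed (simp_all add: bounded_clinear_ops_closed)
  have adj: "adjoint_op S = T" if "S \<in> bounded_clinear_ops" "\<And>x y. cinner x (blinfun_apply T y) = cinner (blinfun_apply S x) y"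
    for S T :: "'h \<Rightarrow>\<^sub>L 'h"
    by (rule blinfun_eq_cinnerI) (simp add: cinner_adjoint_right that)
  have adj_adj: "adjoint_op (adjoint_op S) = S" if "S \<in> bounded_clinear_ops" for S :: "'h \<Rightarrow>\<^sub>L 'h"
    by (rule adj) (simp_all add: that adjoint_op_closed cinner_adjoint_left)
  have adj_add: "adjoint_op (S + T) = adjoint_op S + adjoint_op T"
    if "S \<in> bounded_clinear_ops" "T \<in> bounded_clinear_ops" for S T :: "'h \<Rightarrow>\<^sub>L 'h"
    by (rule adj) (simp_all add: that bounded_clinear_ops_closed cinner_adjoint_right blinfun.add_left
        cinner_add_left cinner_add_right)
  have adj_scale: "adjoint_op (scaleC_blinfun c S) = scaleC_blinfun (cnj c) (adjoint_op S)"
    if "S \<in> bounded_clinear_ops" for c and S :: "'h \<Rightarrow>\<^sub>L 'h"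
    by (rule adj) (simp_all add: that bounded_clinear_ops_closed cinner_adjoint_right scaleC_blinfun.rep_eq
        cinner_scaleC_left cinner_scaleC_right)
  have adj_comp: "adjoint_op (S o\<^sub>L T) = adjoint_op T o\<^sub>L adjoint_op S"
    if "S \<in> bounded_clinear_ops" "T \<in> bounded_clinear_ops" for S T :: "'h \<Rightarrow>\<^sub>L 'h"
    by (rule adj) (simp_all add: that bounded_clinear_ops_closed cinner_adjoint_right)
  show ?thesis
  proof (intro unital_star_algebra.intro star_module.intro ag)
    show "ring (bounded_ops :: ('h \<Rightarrow>\<^sub>L 'h) cstar)"
      by (intro ringI ag Group.monoidI)
        (auto simp: bounded_clinear_ops_closed blinfun.bilinear_simps intro!: blinfun_eqI)
    show "star_module_axioms (bounded_ops :: ('h \<Rightarrow>\<^sub>L 'h) cstar)"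
      by (rule star_module_axioms.intro)
        (auto simp: bounded_clinear_ops_closed adjoint_op_closed scaleC_blinfun.rep_eq blinfun.bilinear_simps
          scaleC_add_right scaleC_add_left scaleC_scaleC scaleC_one adj_adj adj_add adj_scale intro!: blinfun_eqI)
    show "unital_star_algebra_axioms (bounded_ops :: ('h \<Rightarrow>\<^sub>L 'h) cstar)"
      by (rule unital_star_algebra_axioms.intro)
        (auto simp: bounded_clinear_ops_closed adjoint_op_closed scaleC_blinfun.rep_eq
          bounded_clinear_opsD adj_comp intro!: blinfun_eqI)
  qed
qed

lemma bounded_ops_finsum:
  assumes "finite I" "\<And>i. i \<in> I \<Longrightarrow> f i \<in> bounded_clinear_ops"
  shows "(\<Oplus>\<^bsub>bounded_ops\<^esub>i\<in>I. f i) = (\<Sum>i\<in>I. f i :: 'h::chilbert_space \<Rightarrow>\<^sub>L 'h)"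
  using assms
proof (induction I rule: finite_induct)
  interpret unital_star_algebra "bounded_ops :: ('h \<Rightarrow>\<^sub>L 'h) cstar" by (rule bounded_ops_star_algebra)
  case empty
  then show ?case using finsum_empty[of f] by simp
next
  interpret unital_star_algebra "bounded_ops :: ('h \<Rightarrow>\<^sub>L 'h) cstar" by (rule bounded_ops_star_algebra)
  case (insert i I)
  then show ?case by (subst finsum_insert) auto
qed

section \<open>Compressions of a positive kernel\<close>

lemma kernel_form_cong:
  assumes "\<And>x y. x \<in> snd ` set v \<Longrightarrow> y \<in> snd ` set w \<Longrightarrow> K x y = K' x y"
  shows "kernel_form K v w = kernel_form K' v w"
  unfolding kernel_form_def using assms
  by (intro arg_cong[of _ _ sum_list] map_cong refl) (force intro!: arg_cong[of _ _ sum_list] map_cong)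

lemma kernel_form_add_kernel:
  "kernel_form (\<lambda>x y. K x y + K' x y) v w = kernel_form K v w + kernel_form K' v w"
proof -
  have "(\<Sum>(b, y)\<leftarrow>w. cnj a * b * (K x y + K' x y))
      = (\<Sum>(b, y)\<leftarrow>w. cnj a * b * K x y) + (\<Sum>(b, y)\<leftarrow>w. cnj a * b * K' x y)" for a x
    by (induction w) (auto simp: algebra_simps)
  then show ?thesis by (induction v) auto
qed

lemma kernel_form_scale_kernel:
  "kernel_form (\<lambda>x y. c * K x y) v w = c * kernel_form K v w"
proof -
  have "(\<Sum>(b, y)\<leftarrow>w. cnj a * b * (c * K x y)) = c * (\<Sum>(b, y)\<leftarrow>w. cnj a * b * K x y)" for a x
    by (induction w) (auto simp: algebra_simps)
  then show ?thesis by (induction v) (auto simp: algebra_simps)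
qed

lemma kernel_form_map_left:
  "kernel_form K (map f [0..<n]) w = (\<Sum>k<n. kernel_form K [f k] w)"
  by (induction n) (simp_all add: kernel_form_append_left)

lemma kernel_form_map_right:
  "kernel_form K v (map f [0..<n]) = (\<Sum>k<n. kernel_form K v [f k])"
  by (induction n) (simp_all add: kernel_form_append_right)

lemma norm_blinfun_le_formI:
  fixes T :: "'h::chilbert_space \<Rightarrow>\<^sub>L 'h"
  assumes "\<And>\<xi> \<eta>. cmod (cinner \<xi> (blinfun_apply T \<eta>)) \<le> K * norm \<xi> * norm \<eta>" "0 \<le> K"
  shows "norm T \<le> K"
proof (rule norm_blinfun_bound[OF assms(2)])
  fix \<eta>
  have "(norm (blinfun_apply T \<eta>))\<^sup>2 = cmod (cinner (blinfun_apply T \<eta>) (blinfun_apply T \<eta>))"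
    by (simp add: cinner_self norm_power)
  also have "\<dots> \<le> K * norm (blinfun_apply T \<eta>) * norm \<eta>" by (rule assms(1))
  finally have "norm (blinfun_apply T \<eta>) * norm (blinfun_apply T \<eta>) \<le> norm (blinfun_apply T \<eta>) * (K * norm \<eta>)"
    by (simp add: power2_eq_square mult_ac)
  then show "norm (blinfun_apply T \<eta>) \<le> K * norm \<eta>"
    using assms(2) by (cases "norm (blinfun_apply T \<eta>) = 0") auto
qed

text \<open>The kernel \<open>\<tau>\<close> describes a unital completely positive map \<open>\<Psi>\<close> from \<open>A\<close> to \<open>N \<times> N\<close> operator
  matrices by \<open>\<tau> b (i, \<xi>) (j, \<eta>) = \<langle>\<xi>, \<Psi>(b)\<^sub>i\<^sub>j \<eta>\<rangle>\<close>. Linearity in the vectors follows from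
  positivity.\<close>

locale positive_kernel = archimedean_star_algebra A for A :: "'a cstar" (structure) +
  fixes \<tau> :: "'a \<Rightarrow> nat \<times> 'h::chilbert_space \<Rightarrow> nat \<times> 'h \<Rightarrow> complex" and N :: nat
  assumes tau_add: "x \<in> carrier A \<Longrightarrow> y \<in> carrier A \<Longrightarrow> \<tau> (x \<oplus> y) t u = \<tau> x t u + \<tau> y t u"
    and tau_smult: "x \<in> carrier A \<Longrightarrow> \<tau> (c \<odot> x) t u = c * \<tau> x t u"
    and tau_psd: "psd_kernel (carrier A \<times> UNIV) (\<lambda>(a, t) (b, u). \<tau> (star A a \<otimes> b) t u)"
    and tau_one: "i < N \<Longrightarrow> j < N \<Longrightarrow> \<tau> \<one> (i, \<xi>) (j, \<eta>) = (if i = j then cinner \<xi> \<eta> else 0)"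
begin

abbreviation "tau_kernel \<equiv> (\<lambda>(a, t) (b, u). \<tau> (star A a \<otimes> b) t u)"

text \<open>Left multiplication by \<open>b\<close> on the formal combinations of the tensors \<open>a \<otimes> t\<close> that make up
  the Stinespring space of \<open>\<tau>\<close>.\<close>

definition act :: "'a \<Rightarrow> (complex \<times> 'a \<times> nat \<times> 'h) list \<Rightarrow> (complex \<times> 'a \<times> nat \<times> 'h) list" where
  "act b v = map (apsnd (\<lambda>(a, t). (b \<otimes> a, t))) v"

lemma act_closed:
  assumes "b \<in> carrier A" "snd ` set v \<subseteq> carrier A \<times> UNIV"
  shows "snd ` set (act b v) \<subseteq> carrier A \<times> UNIV"
  using assms by (force simp: act_def)

lemma sos_kernel_nonneg:
  assumes v: "snd ` set v \<subseteq> carrier A \<times> UNIV"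
  shows "d \<in> sos \<Longrightarrow> kernel_form (\<lambda>(a, t) (b, u). \<tau> (star A a \<otimes> d \<otimes> b) t u) v v \<in> \<real>\<^sub>\<ge>\<^sub>0"
proof (induction rule: sos.induct)
  have vc: "(c, a, t) \<in> set v \<Longrightarrow> a \<in> carrier A" for c a t
    using v by force
  case zero
  have "\<tau> \<zero> t u = 0" for t u using tau_smult[of \<zero> 0 t u] by simp
  then have "kernel_form (\<lambda>(a, t) (b, u). \<tau> (star A a \<otimes> \<zero> \<otimes> b) t u) v v = kernel_form (\<lambda>_ _. 0) v v"
    by (intro kernel_form_cong) (auto dest!: vc)
  also have "\<dots> = 0" using kernel_form_scale_kernel[of 0 "\<lambda>_ _. 0" v v] by simp
  finally show ?case by simp
next
  have vc: "(c, a, t) \<in> set v \<Longrightarrow> a \<in> carrier A" for c a t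
    using v by force
  case (add d c)
  have dc: "d \<in> carrier A" using add sos_carrier by blast
  have "kernel_form (\<lambda>(a, t) (b, u). \<tau> (star A a \<otimes> (d \<oplus> star A c \<otimes> c) \<otimes> b) t u) v v
      = kernel_form (\<lambda>x y. (\<lambda>(a, t) (b, u). \<tau> (star A a \<otimes> d \<otimes> b) t u) x y
          + tau_kernel ((\<lambda>(a, t). (c \<otimes> a, t)) x) ((\<lambda>(a, t). (c \<otimes> a, t)) y)) v v"
    using add.hyps dc
    by (intro kernel_form_cong) (auto dest!: vc simp: star_mult r_distr l_distr m_assoc tau_add)
  also have "\<dots> = kernel_form (\<lambda>(a, t) (b, u). \<tau> (star A a \<otimes> d \<otimes> b) t u) v v
      + kernel_form tau_kernel (act c v) (act c v)"
    unfolding kernel_form_add_kernel act_def by (simp only: kernel_form_comp)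
  finally show ?case
    using add.IH kernel_form_nonneg[OF tau_psd act_closed[OF add.hyps(2) v], of "[]"]
    by (simp add: nonneg_Reals_add_I)
qed

text \<open>Left multiplication by \<open>b\<close> is bounded on the Stinespring space, since \<open>r 1 - b\<^sup>* b\<close> is a
  sum of squares.\<close>

lemma act_bounded:
  assumes v: "snd ` set v \<subseteq> carrier A \<times> UNIV" and b: "b \<in> carrier A" and d: "d \<in> sos"
    and rd: "complex_of_real r \<odot> \<one> = star A b \<otimes> b \<oplus> d"
  shows "Re (kernel_form tau_kernel (act b v) (act b v)) \<le> r * Re (kernel_form tau_kernel v v)"
proof -
  have dc: "d \<in> carrier A" using d sos_carrier by blast
  have "complex_of_real r * tau_kernel x y = tau_kernel ((\<lambda>(a, t). (b \<otimes> a, t)) x) ((\<lambda>(a, t). (b \<otimes> a, t)) y)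
      + (\<lambda>(a, t) (b, u). \<tau> (star A a \<otimes> d \<otimes> b) t u) x y"
    if xy: "x \<in> carrier A \<times> UNIV" "y \<in> carrier A \<times> UNIV" for x y
  proof -
    obtain a t a' t' where [simp]: "x = (a, t)" "y = (a', t')" by (cases x, cases y)
    have a: "a \<in> carrier A" "a' \<in> carrier A" using xy by auto
    have "complex_of_real r \<odot> (star A a \<otimes> a') = star A a \<otimes> (complex_of_real r \<odot> \<one>) \<otimes> a'"
      using a by (simp add: smult_mult_left smult_mult_right)
    also have "\<dots> = star A (b \<otimes> a) \<otimes> (b \<otimes> a') \<oplus> star A a \<otimes> d \<otimes> a'"
      unfolding rd using a b dc by (simp add: star_mult r_distr l_distr m_assoc)
    finally show ?thesis
      using a b dc by (simp flip: tau_smult tau_add)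
  qed
  then have "kernel_form (\<lambda>x y. complex_of_real r * tau_kernel x y) v v
      = kernel_form (\<lambda>x y. tau_kernel ((\<lambda>(a, t). (b \<otimes> a, t)) x) ((\<lambda>(a, t). (b \<otimes> a, t)) y)
        + (\<lambda>(a, t) (b, u). \<tau> (star A a \<otimes> d \<otimes> b) t u) x y) v v"
    using v by (intro kernel_form_cong) blast
  then have "complex_of_real r * kernel_form tau_kernel v v = kernel_form tau_kernel (act b v) (act b v)
      + kernel_form (\<lambda>(a, t) (b, u). \<tau> (star A a \<otimes> d \<otimes> b) t u) v v"
    unfolding kernel_form_add_kernel act_def kernel_form_scale_kernel by (simp only: kernel_form_comp)
  from arg_cong[OF this, of Re] show ?thesis
    using sos_kernel_nonneg[OF v d] by (simp add: complex_nonneg_Reals_iff)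
qed

lemma tau_hermitian: "b \<in> carrier A \<Longrightarrow> \<tau> (star A b) u t = cnj (\<tau> b t u)"
  using psd_kernel_hermitian[OF tau_psd, of "(\<one>, t)" "(b, u)"] by simp

lemma tau_cauchy_schwarz:
  assumes v: "snd ` set v \<subseteq> carrier A \<times> UNIV" and c: "c \<in> carrier A"
  shows "(cmod (kernel_form tau_kernel [(1, c, t)] v))\<^sup>2
    \<le> Re (\<tau> (star A c \<otimes> c) t t) * Re (kernel_form tau_kernel v v)"
  using kernel_form_cauchy_schwarz[OF tau_psd _ v, of "[(1, c, t)]"] c by simp

lemma act_single: "b \<in> carrier A \<Longrightarrow> act b [(c, \<one>, t)] = [(c, b, t)]"
  by (simp add: act_def)

text \<open>A combination of length zero keeps length zero under \<open>b\<close>, hence is then orthogonal to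
  everything. Applied to \<open>1 \<otimes> (j, \<eta> + \<eta>') - 1 \<otimes> (j, \<eta>) - 1 \<otimes> (j, \<eta>')\<close> this gives linearity of
  \<open>\<tau>\<close> in the vectors.\<close>

lemma null_combination:
  assumes null: "kernel_form tau_kernel v v = 0" and v: "snd ` set v \<subseteq> {\<one>} \<times> UNIV" and b: "b \<in> carrier A"
  shows "kernel_form tau_kernel [(1, \<one>, t)] (act b v) = 0"
proof -
  have v': "snd ` set v \<subseteq> carrier A \<times> UNIV" using v by (auto simp: subset_iff)
  obtain r d where r: "d \<in> sos" "complex_of_real r \<odot> \<one> = star A b \<otimes> b \<oplus> d"
    using order_unit[OF b] by blast
  have "Re (kernel_form tau_kernel (act b v) (act b v)) \<le> 0"
    using act_bounded[OF v' b r] null by simp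
  moreover have "kernel_form tau_kernel (act b v) (act b v) \<in> \<real>\<^sub>\<ge>\<^sub>0"
    by (rule kernel_form_nonneg[OF tau_psd act_closed[OF b v'], of "[]"]) simp
  ultimately have "Re (kernel_form tau_kernel (act b v) (act b v)) = 0"
    by (simp add: complex_nonneg_Reals_iff)
  then show ?thesis
    using tau_cauchy_schwarz[OF act_closed[OF b v'] one_closed, of t] by simp
qed

lemma tau_add_right:
  assumes "b \<in> carrier A" "j < N"
  shows "\<tau> b t (j, \<eta> + \<eta>') = \<tau> b t (j, \<eta>) + \<tau> b t (j, \<eta>')"
proof -
  let ?v = "[(1, \<one>, j, \<eta> + \<eta>'), (-1, \<one>, j, \<eta>), (-1, \<one>, j, \<eta>')]"
  have "kernel_form tau_kernel ?v ?v = 0"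
    using assms by (simp add: tau_one cinner_add_left cinner_add_right)
  from null_combination[OF this _ assms(1), of t] show ?thesis
    using assms by (simp add: act_def algebra_simps)
qed

lemma tau_scale_right:
  assumes "b \<in> carrier A" "j < N"
  shows "\<tau> b t (j, c *\<^sub>C \<eta>) = c * \<tau> b t (j, \<eta>)"
proof -
  let ?v = "[(1, \<one>, j, c *\<^sub>C \<eta>), (- c, \<one>, j, \<eta>)]"
  have "kernel_form tau_kernel ?v ?v = 0"
    using assms by (simp add: tau_one cinner_scaleC_left cinner_scaleC_right algebra_simps)
  from null_combination[OF this _ assms(1), of t] show ?thesis
    using assms by (simp add: act_def algebra_simps)
qed

lemma tau_add_left:
  assumes "b \<in> carrier A" "i < N"
  shows "\<tau> b (i, \<xi> + \<xi>') t = \<tau> b (i, \<xi>) t + \<tau> b (i, \<xi>') t"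
  using tau_hermitian[of "star A b"] tau_add_right[of "star A b" i t \<xi> \<xi>'] assms by (simp add: star_star)

lemma tau_scale_left:
  assumes "b \<in> carrier A" "i < N"
  shows "\<tau> b (i, c *\<^sub>C \<xi>) t = cnj c * \<tau> b (i, \<xi>) t"
  using tau_hermitian[of "star A b"] tau_scale_right[of "star A b" i t c \<xi>] assms by (simp add: star_star)

lemma tau_square_bound:
  assumes b: "b \<in> carrier A" "d \<in> sos" "complex_of_real r \<odot> \<one> = star A b \<otimes> b \<oplus> d" and j: "j < N"
  shows "Re (\<tau> (star A b \<otimes> b) (j, \<eta>) (j, \<eta>)) \<le> r * (norm \<eta>)\<^sup>2"
  using act_bounded[of "[(1, \<one>, j, \<eta>)]" b d r] b j
  by (simp add: act_single tau_one cinner_self del: of_real_power)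

lemma tau_bound:
  assumes b: "b \<in> carrier A" "d \<in> sos" "complex_of_real r \<odot> \<one> = star A b \<otimes> b \<oplus> d"
    and ij: "i < N" "j < N"
  shows "cmod (\<tau> b (i, \<xi>) (j, \<eta>)) \<le> sqrt r * norm \<xi> * norm \<eta>"
proof -
  have "(cmod (\<tau> b (i, \<xi>) (j, \<eta>)))\<^sup>2 \<le> Re (\<tau> \<one> (i, \<xi>) (i, \<xi>)) * Re (\<tau> (star A b \<otimes> b) (j, \<eta>) (j, \<eta>))"
    using tau_cauchy_schwarz[of "[(1, b, j, \<eta>)]" \<one> "(i, \<xi>)"] b(1) by simp
  also have "\<dots> = (norm \<xi>)\<^sup>2 * Re (\<tau> (star A b \<otimes> b) (j, \<eta>) (j, \<eta>))"
    using ij by (simp add: tau_one cinner_self del: of_real_power)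
  also have "\<dots> \<le> (norm \<xi>)\<^sup>2 * (r * (norm \<eta>)\<^sup>2)"
    using tau_square_bound[OF b ij(2)] by (intro mult_left_mono) auto
  finally have le: "(cmod (\<tau> b (i, \<xi>) (j, \<eta>)))\<^sup>2 \<le> (norm \<xi>)\<^sup>2 * (r * (norm \<eta>)\<^sup>2)" .
  have "cmod (\<tau> b (i, \<xi>) (j, \<eta>)) \<le> sqrt ((norm \<xi>)\<^sup>2 * (r * (norm \<eta>)\<^sup>2))"
    using real_sqrt_le_mono[OF le] by simp
  then show ?thesis by (simp add: real_sqrt_mult mult_ac)
qed

text \<open>The entry \<open>\<Psi>(b)\<^sub>i\<^sub>j\<close> of the operator matrix \<open>\<Psi>(b)\<close>.\<close>

definition compr :: "'a \<Rightarrow> nat \<Rightarrow> nat \<Rightarrow> 'h \<Rightarrow>\<^sub>L 'h" where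
  "compr b i j = (SOME T. T \<in> bounded_clinear_ops \<and> (\<forall>\<xi> \<eta>. cinner \<xi> (blinfun_apply T \<eta>) = \<tau> b (i, \<xi>) (j, \<eta>)))"

lemma
  assumes b: "b \<in> carrier A" and ij: "i < N" "j < N"
  shows compr_closed: "compr b i j \<in> bounded_clinear_ops"
    and cinner_compr: "cinner \<xi> (blinfun_apply (compr b i j) \<eta>) = \<tau> b (i, \<xi>) (j, \<eta>)"
proof -
  obtain r d where r: "d \<in> sos" "complex_of_real r \<odot> \<one> = star A b \<otimes> b \<oplus> d"
    using order_unit[OF b] by blast
  have "\<exists>T\<in>bounded_clinear_ops. \<forall>\<xi> \<eta>. cinner \<xi> (blinfun_apply T \<eta>) = \<tau> b (i, \<xi>) (j, \<eta>)"
    by (rule operator_of_bounded_form[OF _ _ _ _ tau_bound[OF b r ij]])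
      (simp_all add: b ij tau_add_left tau_add_right tau_scale_left tau_scale_right)
  then have "compr b i j \<in> bounded_clinear_ops \<and>
      (\<forall>\<xi> \<eta>. cinner \<xi> (blinfun_apply (compr b i j) \<eta>) = \<tau> b (i, \<xi>) (j, \<eta>))"
    unfolding compr_def by (intro someI_ex[of "\<lambda>T. T \<in> bounded_clinear_ops \<and> _ T"]) blast
  then show "compr b i j \<in> bounded_clinear_ops"
    "cinner \<xi> (blinfun_apply (compr b i j) \<eta>) = \<tau> b (i, \<xi>) (j, \<eta>)" by blast+
qed

lemma compr_eqI:
  assumes "b \<in> carrier A" "i < N" "j < N" "\<And>\<xi> \<eta>. cinner \<xi> (blinfun_apply T \<eta>) = \<tau> b (i, \<xi>) (j, \<eta>)"
  shows "compr b i j = T"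
  by (rule blinfun_eq_cinnerI) (simp add: cinner_compr assms)

lemma compr_one: "i < N \<Longrightarrow> j < N \<Longrightarrow> compr \<one> i j = (if i = j then id_blinfun else 0)"
  by (rule compr_eqI) (simp_all add: tau_one)

lemma compr_add:
  "b \<in> carrier A \<Longrightarrow> c \<in> carrier A \<Longrightarrow> i < N \<Longrightarrow> j < N \<Longrightarrow> compr (b \<oplus> c) i j = compr b i j + compr c i j"
  by (rule compr_eqI) (simp_all add: blinfun.add_left cinner_add_right cinner_compr tau_add)

lemma compr_smult:
  "b \<in> carrier A \<Longrightarrow> i < N \<Longrightarrow> j < N \<Longrightarrow> compr (c \<odot> b) i j = scaleC_blinfun c (compr b i j)"
  by (rule compr_eqI) (simp_all add: scaleC_blinfun.rep_eq cinner_scaleC_right cinner_compr tau_smult)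

lemma norm_compr_le:
  assumes "b \<in> carrier A" "d \<in> sos" "complex_of_real r \<odot> \<one> = star A b \<otimes> b \<oplus> d" "0 \<le> r" "i < N" "j < N"
  shows "norm (compr b i j) \<le> sqrt r"
  using assms tau_bound[OF assms(1-3,5,6)] by (intro norm_blinfun_le_formI) (simp_all add: cinner_compr)

text \<open>The failure of multiplicativity is controlled by the distance of \<open>x \<otimes> (j, \<eta>)\<close> from the range of
  the isometry \<open>(k, \<zeta>) \<mapsto> 1 \<otimes> (k, \<zeta>)\<close> of a Stinespring dilation; \<open>schwarz_gap\<close> is its square.\<close>

definition schwarz_gap :: "'a \<Rightarrow> nat \<Rightarrow> 'h \<Rightarrow> real" where
  "schwarz_gap x j \<eta> = Re (\<tau> (star A x \<otimes> x) (j, \<eta>) (j, \<eta>)) - (\<Sum>k<N. (norm (blinfun_apply (compr x k j) \<eta>))\<^sup>2)"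

definition mult_defect :: "'a \<Rightarrow> 'a \<Rightarrow> nat \<Rightarrow> nat \<Rightarrow> 'h \<Rightarrow>\<^sub>L 'h" where
  "mult_defect c x i j = compr (c \<otimes> x) i j - (\<Sum>k<N. compr c i k o\<^sub>L compr x k j)"

text \<open>The combination \<open>v\<close> is \<open>x \<otimes> (j, \<eta>)\<close> minus its projection to the range of the isometry,
  whose coordinates are \<open>\<Psi>(x)\<^sub>k\<^sub>j \<eta>\<close>; its squared length is the gap. The defect at \<open>\<eta>\<close> pairs
  with \<open>\<xi>\<close> as \<open>v\<close> pairs with \<open>c\<^sup>* \<otimes> (i, \<xi>)\<close>, so the estimate is the Cauchy--Schwarz inequality.\<close>

lemma
  assumes c: "c \<in> carrier A" and x: "x \<in> carrier A" and ij: "i < N" "j < N"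
    and d: "0 \<le> r" "d \<in> sos" "complex_of_real r \<odot> \<one> = c \<otimes> star A c \<oplus> d"
  shows mult_defect_le_gap: "(norm (blinfun_apply (mult_defect c x i j) \<eta>))\<^sup>2 \<le> r * schwarz_gap x j \<eta>"
    and schwarz_gap_nonneg: "0 \<le> schwarz_gap x j \<eta>"
proof -
  define y where "y k = blinfun_apply (compr x k j) \<eta>" for k
  define v :: "(complex \<times> 'a \<times> nat \<times> 'h) list" where "v = (1, x, j, \<eta>) # map (\<lambda>k. (- 1, \<one>, k, y k)) [0..<N]"
  have v: "snd ` set v \<subseteq> carrier A \<times> UNIV" using x by (auto simp: v_def)
  have row: "kernel_form tau_kernel [(1, a, t)] v = \<tau> (star A a \<otimes> x) t (j, \<eta>) - (\<Sum>k<N. \<tau> (star A a) t (k, y k))"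
    if "a \<in> carrier A" for a t
  proof -
    have "kernel_form tau_kernel [(1, a, t)] v
        = kernel_form tau_kernel [(1, a, t)] [(1, x, j, \<eta>)]
          + kernel_form tau_kernel [(1, a, t)] (map (\<lambda>k. (- 1, \<one>, k, y k)) [0..<N])"
      unfolding v_def kernel_form_append_right[symmetric] by simp
    then show ?thesis using that unfolding kernel_form_map_right by (simp add: sum_negf)
  qed
  have unit_row: "kernel_form tau_kernel [(- 1, \<one>, k, y k)] v = 0" if k: "k < N" for k
  proof -
    have "kernel_form tau_kernel [(- 1, \<one>, k, y k)] v = - kernel_form tau_kernel [(1, \<one>, k, y k)] v"
      using kernel_form_scale_left[of tau_kernel "-1" "[(1, \<one>, k, y k)]" v] by (simp add: scale_formal_def)
    also have "kernel_form tau_kernel [(1, \<one>, k, y k)] v = \<tau> x (k, y k) (j, \<eta>) - (\<Sum>l<N. \<tau> \<one> (k, y k) (l, y l))"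
      using row[OF one_closed, of "(k, y k)"] x by (simp del: kernel_form_simps)
    also have "(\<Sum>l<N. \<tau> \<one> (k, y k) (l, y l)) = (\<Sum>l<N. if k = l then cinner (y k) (y l) else 0)"
      by (rule sum.cong) (use k in \<open>simp_all add: tau_one\<close>)
    also have "\<dots> = cinner (y k) (y k)" using k by simp
    also have "\<dots> = \<tau> x (k, y k) (j, \<eta>)"
      unfolding y_def using x k ij by (simp add: cinner_compr)
    finally show ?thesis by simp
  qed
  have "kernel_form tau_kernel v v = kernel_form tau_kernel [(1, x, j, \<eta>)] v
      + kernel_form tau_kernel (map (\<lambda>k. (- 1, \<one>, k, y k)) [0..<N]) v"
    unfolding kernel_form_append_left[symmetric] by (subst (1) v_def) simp
  also have "\<dots> = kernel_form tau_kernel [(1, x, j, \<eta>)] v"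
    unfolding kernel_form_map_left by (simp add: unit_row del: kernel_form_simps)
  also have "\<dots> = \<tau> (star A x \<otimes> x) (j, \<eta>) (j, \<eta>) - (\<Sum>k<N. \<tau> (star A x) (j, \<eta>) (k, y k))"
    by (rule row[OF x])
  also have "(\<Sum>k<N. \<tau> (star A x) (j, \<eta>) (k, y k)) = (\<Sum>k<N. complex_of_real ((norm (y k))\<^sup>2))"
  proof (rule sum.cong[OF refl])
    fix k assume "k \<in> {..<N}"
    then have "cinner (y k) (y k) = \<tau> x (k, y k) (j, \<eta>)"
      unfolding y_def using x ij by (simp add: cinner_compr)
    then show "\<tau> (star A x) (j, \<eta>) (k, y k) = complex_of_real ((norm (y k))\<^sup>2)"
      using x by (simp only: tau_hermitian cinner_self[symmetric]) (metis cinner_commute)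
  qed
  finally have vv: "Re (kernel_form tau_kernel v v) = schwarz_gap x j \<eta>"
    by (simp add: schwarz_gap_def y_def del: of_real_power)
  show gap: "0 \<le> schwarz_gap x j \<eta>"
    using kernel_form_nonneg[OF tau_psd v, of "[]"] vv by (simp add: complex_nonneg_Reals_iff)
  let ?D = "mult_defect c x i j"
  have D: "cinner \<xi> (blinfun_apply ?D \<eta>) = kernel_form tau_kernel [(1, star A c, i, \<xi>)] v" for \<xi>
    using c x ij
    by (simp add: row star_star mult_defect_def blinfun.diff_left blinfun.sum_left cinner_diff_right
        cinner_sum_right cinner_compr y_def del: kernel_form_simps)
  define z where "z = blinfun_apply ?D \<eta>"
  have "(cmod (cinner z z))\<^sup>2 \<le> Re (\<tau> (star A (star A c) \<otimes> star A c) (i, z) (i, z)) * schwarz_gap x j \<eta>"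
    using tau_cauchy_schwarz[OF v star_closed[OF c], of "(i, z)"] D[of z] vv by (simp add: z_def)
  also have "\<dots> \<le> (r * (norm z)\<^sup>2) * schwarz_gap x j \<eta>"
    using c d ij gap by (intro mult_right_mono tau_square_bound) (simp_all add: star_star)
  finally have "(norm z)\<^sup>2 * (norm z)\<^sup>2 \<le> (norm z)\<^sup>2 * (r * schwarz_gap x j \<eta>)"
    by (simp add: cinner_self norm_mult power2_eq_square mult_ac)
  show "(norm (blinfun_apply ?D \<eta>))\<^sup>2 \<le> r * schwarz_gap x j \<eta>"
  proof (cases "z = 0")
    case True
    then show ?thesis using gap d(1) by (simp flip: z_def)
  next
    case False
    then have "0 < (norm z)\<^sup>2" by simp
    with \<open>(norm z)\<^sup>2 * (norm z)\<^sup>2 \<le> (norm z)\<^sup>2 * (r * schwarz_gap x j \<eta>)\<close>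
    have "(norm z)\<^sup>2 \<le> r * schwarz_gap x j \<eta>" by (rule mult_left_le_imp_le)
    then show ?thesis by (simp flip: z_def)
  qed
qed

end


section \<open>Lifts modulo the compact operators\<close>

text \<open>Where \<open>K z\<close> is small on the ball, so is \<open>T z\<close> up to the arbitrarily small first term;
  total boundedness therefore passes from \<open>K\<close> to \<open>T\<close>. In applications \<open>K\<close> enters through
  \<open>\<langle>z, K z\<rangle>\<close>, whence the mixed second term.\<close>

lemma compact_opsI_approx:
  assumes T: "T \<in> bounded_clinear_ops"
    and approx: "\<And>\<epsilon>. \<epsilon> > 0 \<Longrightarrow> \<exists>K\<in>compact_ops. \<exists>M\<ge>0. \<forall>z.
      (norm (blinfun_apply T z))\<^sup>2 \<le> \<epsilon> * (norm z)\<^sup>2 + M * norm z * norm (blinfun_apply K z)"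
  shows "T \<in> compact_ops"
  unfolding compact_ops_iff
proof (intro conjI T precompact_approx)
  fix e :: real assume e: "e > 0"
  then have "e\<^sup>2 / 8 > 0" by simp
  from approx[OF this] obtain K M where K: "K \<in> compact_ops" and M: "M \<ge> 0"
    and le: "\<And>z. (norm (blinfun_apply T z))\<^sup>2 \<le> e\<^sup>2 / 8 * (norm z)\<^sup>2 + M * norm z * norm (blinfun_apply K z)"
    by blast
  define d where "d = e\<^sup>2 / (4 * M + 4)"
  have d: "d > 0" using e M by (simp add: d_def)
  have "norm (blinfun_apply T z) < e" if z: "norm z \<le> 2" "norm (blinfun_apply K z) < d" for z
  proof -
    have "(norm z)\<^sup>2 \<le> 2\<^sup>2" using z by (intro power_mono) auto
    then have "e\<^sup>2 / 8 * (norm z)\<^sup>2 \<le> e\<^sup>2 / 8 * 4" by (intro mult_left_mono) auto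
    moreover have "M * norm z * norm (blinfun_apply K z) \<le> M * 2 * d"
      using z M by (intro mult_mono) auto
    moreover have "M * 2 * d < e\<^sup>2 / 2"
    proof -
      have "M * 2 * d = e\<^sup>2 / 2 * (M / (M + 1))" using M by (simp add: d_def field_simps)
      also have "\<dots> < e\<^sup>2 / 2 * 1" using M e by (intro mult_strict_left_mono) auto
      finally show ?thesis by simp
    qed
    ultimately have "(norm (blinfun_apply T z))\<^sup>2 < e\<^sup>2" using le[of z] by linarith
    then show ?thesis using e by (simp add: power2_less_imp_less)
  qed
  then show "\<exists>q d. precompact q \<and> 0 < d \<and> (\<forall>z. norm z \<le> 2 \<longrightarrow> q z < d \<longrightarrow> norm (blinfun_apply T z) < e)"
    using K d unfolding compact_ops_iff
    by (intro exI[of _ "\<lambda>z. norm (blinfun_apply K z)"] exI[of _ d]) blast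
qed

lemma compact_ops_sum:
  assumes "\<And>i. i \<in> I \<Longrightarrow> f i \<in> compact_ops"
  shows "(\<Sum>i\<in>I. f i) \<in> compact_ops"
  using assms by (induction I rule: infinite_finite_induct) (simp_all add: compact_ops_zero compact_ops_add)

lemma bounded_clinear_ops_sum:
  assumes "\<And>i. i \<in> I \<Longrightarrow> f i \<in> bounded_clinear_ops"
  shows "(\<Sum>i\<in>I. f i) \<in> bounded_clinear_ops"
  using assms by (induction I rule: infinite_finite_induct) (simp_all add: bounded_clinear_ops_closed)

lemmas blinfun_compose_sum_left = bounded_bilinear.sum_left[OF bounded_bilinear_blinfun_compose]
lemmas blinfun_compose_sum_right = bounded_bilinear.sum_right[OF bounded_bilinear_blinfun_compose]
lemmas blinfun_compose_diff_left = bounded_bilinear.diff_left[OF bounded_bilinear_blinfun_compose]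
lemmas blinfun_compose_add_right = bounded_bilinear.add_right[OF bounded_bilinear_blinfun_compose]

lemma blinfun_compose_assoc: "(S o\<^sub>L T) o\<^sub>L U = S o\<^sub>L (T o\<^sub>L U)"
  by (rule blinfun_eqI) simp

lemma power2_norm_add_le: "(norm (x + y))\<^sup>2 \<le> 2 * (norm x)\<^sup>2 + 2 * (norm (y::'b::real_normed_vector))\<^sup>2"
proof -
  have "(norm (x + y))\<^sup>2 \<le> (norm x + norm y)\<^sup>2"
    by (intro power_mono norm_triangle_ineq) auto
  also have "\<dots> \<le> 2 * (norm x)\<^sup>2 + 2 * (norm y)\<^sup>2"
    using sum_squares_bound[of "norm x" "norm y"] by (simp add: power2_sum)
  finally show ?thesis .
qed

text \<open>A unital *-homomorphism into the Calkin algebra, seen as assigning to each \<open>a\<close> the coset \<open>R a\<close> of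
  operators.\<close>

locale calkin_hom = unital_cstar_algebra A for A :: "'a cstar" (structure) +
  fixes R :: "'a \<Rightarrow> ('h::chilbert_space \<Rightarrow>\<^sub>L 'h) set"
  assumes lift_ex: "a \<in> carrier A \<Longrightarrow> \<exists>T. T \<in> R a"
    and lift_bounded: "a \<in> carrier A \<Longrightarrow> T \<in> R a \<Longrightarrow> T \<in> bounded_clinear_ops"
    and lift_iff: "a \<in> carrier A \<Longrightarrow> T \<in> R a \<Longrightarrow> S \<in> R a \<longleftrightarrow> S - T \<in> compact_ops"
    and lift_add: "a \<in> carrier A \<Longrightarrow> b \<in> carrier A \<Longrightarrow> T \<in> R a \<Longrightarrow> S \<in> R b \<Longrightarrow> T + S \<in> R (a \<oplus> b)"
    and lift_mult: "a \<in> carrier A \<Longrightarrow> b \<in> carrier A \<Longrightarrow> T \<in> R a \<Longrightarrow> S \<in> R b \<Longrightarrow> T o\<^sub>L S \<in> R (a \<otimes> b)"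
    and lift_smult: "a \<in> carrier A \<Longrightarrow> T \<in> R a \<Longrightarrow> scaleC_blinfun c T \<in> R (c \<odot> a)"
    and lift_star: "a \<in> carrier A \<Longrightarrow> T \<in> R a \<Longrightarrow> adjoint_op T \<in> R (star A a)"
    and lift_one: "id_blinfun \<in> R \<one>"
begin

sublocale S: archimedean_star_algebra A
  by (rule unital_cstar_archimedean) (rule unital_cstar_algebra_axioms)

lemma lift_zero: "R \<zero> = compact_ops"
proof -
  obtain T where T: "T \<in> R \<zero>" using lift_ex by blast
  have "scaleC_blinfun 0 T = 0" by (rule blinfun_eqI) (simp add: scaleC_blinfun.rep_eq)
  then have "0 \<in> R \<zero>" using lift_smult[OF zero_closed T, of 0] by simp
  then show ?thesis using lift_iff[OF zero_closed, of 0] by auto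
qed

lemma lift_compact_perturb: "a \<in> carrier A \<Longrightarrow> T \<in> R a \<Longrightarrow> K \<in> compact_ops \<Longrightarrow> T + K \<in> R a"
  using lift_iff[of a T "T + K"] by simp

lemma lift_diff:
  assumes "a \<in> carrier A" "b \<in> carrier A" "T \<in> R a" "S \<in> R b"
  shows "T - S \<in> R (a \<ominus> b)"
  using lift_add[OF assms(1) _ assms(3) lift_smult[OF assms(2,4), of "-1"]] assms(1,2)
  by (simp add: a_minus_smult scaleC_blinfun_minus1)

lemma lift_finsum:
  assumes "\<And>k::nat. k < n \<Longrightarrow> a k \<in> carrier A" "\<And>k. k < n \<Longrightarrow> T k \<in> R (a k)"
  shows "(\<Sum>k<(n::nat). T k) \<in> R (\<Oplus>k\<in>{..<n}. a k)"
  using assms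
proof (induction n)
  case 0
  then show ?case by (simp add: lift_zero compact_ops_zero)
next
  case (Suc n)
  have "(\<Oplus>k\<in>{..<Suc n}. a k) = a n \<oplus> (\<Oplus>k\<in>{..<n}. a k)"
    using Suc.prems unfolding lessThan_Suc by (intro finsum_insert) auto
  then show ?case
    using Suc by (auto intro!: lift_add finsum_closed simp: add.commute[of _ "T n"])
qed

text \<open>Every lift of a small element is small up to a compact perturbation: the homomorphism
  turns the domination of \<open>a\<^sup>* a\<close> by \<open>\<epsilon>\<^sup>2\<close> into one of operators modulo compact ones.\<close>

lemma essential_norm_bound:
  assumes a: "a \<in> carrier A" "nrm A a < \<epsilon>" and T: "T \<in> R a"
  shows "\<exists>K\<in>compact_ops. \<forall>\<eta>. (norm (blinfun_apply T \<eta>))\<^sup>2 \<le> \<epsilon>\<^sup>2 * (norm \<eta>)\<^sup>2 + norm \<eta> * norm (blinfun_apply K \<eta>)"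
proof -
  have "(nrm A a)\<^sup>2 < \<epsilon>\<^sup>2"
    using a nrm_nonneg[OF a(1)] by (intro power_strict_mono) auto
  then obtain c where c: "c \<in> carrier A" "complex_of_real (\<epsilon>\<^sup>2) \<odot> \<one> = star A a \<otimes> a \<oplus> star A c \<otimes> c"
    using cstar_order_unit[OF a(1)] by blast
  obtain C where C: "C \<in> R c" using lift_ex[OF c(1)] by blast
  note bd = lift_bounded[OF a(1) T] lift_bounded[OF c(1) C]
  let ?e = "scaleC_blinfun (complex_of_real (\<epsilon>\<^sup>2)) id_blinfun"
  let ?S = "(adjoint_op T o\<^sub>L T) + (adjoint_op C o\<^sub>L C)"
  have "?S \<in> R (complex_of_real (\<epsilon>\<^sup>2) \<odot> \<one>)"
    unfolding c(2) using a c T C by (intro lift_add lift_mult lift_star) (auto intro: star_closed)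
  then have K: "?S - ?e \<in> compact_ops"
    using lift_iff[OF _ lift_smult[OF one_closed lift_one]] by simp
  have "(norm (blinfun_apply T \<eta>))\<^sup>2 \<le> \<epsilon>\<^sup>2 * (norm \<eta>)\<^sup>2 + norm \<eta> * norm (blinfun_apply (?S - ?e) \<eta>)" for \<eta>
  proof -
    have "cinner \<eta> (blinfun_apply (?S - ?e) \<eta>) = complex_of_real ((norm (blinfun_apply T \<eta>))\<^sup>2)
        + complex_of_real ((norm (blinfun_apply C \<eta>))\<^sup>2) - complex_of_real (\<epsilon>\<^sup>2 * (norm \<eta>)\<^sup>2)"
      unfolding of_real_mult cinner_self[symmetric]
      by (simp add: blinfun.diff_left blinfun.add_left cinner_diff_right cinner_add_right
          cinner_adjoint_right bd scaleC_blinfun.rep_eq cinner_scaleC_right)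
    then have "(norm (blinfun_apply T \<eta>))\<^sup>2 + (norm (blinfun_apply C \<eta>))\<^sup>2 - \<epsilon>\<^sup>2 * (norm \<eta>)\<^sup>2
        = Re (cinner \<eta> (blinfun_apply (?S - ?e) \<eta>))" by (simp del: of_real_power of_real_mult)
    also have "\<dots> \<le> norm \<eta> * norm (blinfun_apply (?S - ?e) \<eta>)"
      using complex_Re_le_cmod cmod_cinner_le order_trans by blast
    finally show ?thesis using zero_le_power2[of "norm (blinfun_apply C \<eta>)"] by linarith
  qed
  then show ?thesis using K by blast
qed

end

section \<open>The multiplicative domain modulo compact operators\<close>

text \<open>A unital completely positive map \<open>\<Psi>\<close> on \<open>M\<^sub>N(A)\<close>, given by its kernel, next to the
  homomorphism \<open>R\<close>. How far \<open>\<Psi>\<close> lifts \<open>R \<otimes> id\<close> is recorded by \<open>mult_domain\<close> below.\<close>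

locale lifted_kernel = calkin_hom A R + K: positive_kernel "mat_cstar N A" \<tau> N
  for A :: "'a cstar" (structure) and R :: "'a \<Rightarrow> ('h::chilbert_space \<Rightarrow>\<^sub>L 'h) set"
    and N :: nat and \<tau> :: "(nat \<times> nat \<Rightarrow> 'a) \<Rightarrow> nat \<times> 'h \<Rightarrow> nat \<times> 'h \<Rightarrow> complex"
begin

abbreviation "M \<equiv> mat_cstar N A"

lemma compact_defectI:
  assumes x: "x \<in> carrier M" and c: "c \<in> carrier M" and ij: "i < N" "j < N"
    and L: "L \<in> compact_ops" "\<And>\<eta>. K.schwarz_gap x j \<eta> \<le> norm \<eta> * norm (blinfun_apply L \<eta>)"
  shows "K.mult_defect c x i j \<in> compact_ops"
proof (rule compact_opsI_approx)
  show "K.mult_defect c x i j \<in> bounded_clinear_ops"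
    unfolding K.mult_defect_def using x c ij
    by (intro bounded_clinear_ops_closed bounded_clinear_ops_sum) (auto intro: K.compr_closed)
  obtain r d where r: "0 \<le> r" "d \<in> K.sos"
    "complex_of_real r \<odot>\<^bsub>M\<^esub> \<one>\<^bsub>M\<^esub> = star M (star M c) \<otimes>\<^bsub>M\<^esub> star M c \<oplus>\<^bsub>M\<^esub> d"
    using K.order_unit[OF K.star_closed[OF c]] by blast
  then have r': "complex_of_real r \<odot>\<^bsub>M\<^esub> \<one>\<^bsub>M\<^esub> = c \<otimes>\<^bsub>M\<^esub> star M c \<oplus>\<^bsub>M\<^esub> d"
    using c by (simp add: K.star_star)
  fix \<epsilon> :: real assume "\<epsilon> > 0"
  have "(norm (blinfun_apply (K.mult_defect c x i j) z))\<^sup>2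
      \<le> \<epsilon> * (norm z)\<^sup>2 + r * norm z * norm (blinfun_apply L z)" for z
  proof -
    have "(norm (blinfun_apply (K.mult_defect c x i j) z))\<^sup>2 \<le> r * K.schwarz_gap x j z"
      by (rule K.mult_defect_le_gap[OF c x ij r(1,2) r'])
    also have "\<dots> \<le> r * (norm z * norm (blinfun_apply L z))"
      by (intro mult_left_mono L r(1))
    finally show ?thesis using \<open>\<epsilon> > 0\<close> by (simp add: add_increasing mult.assoc)
  qed
  then show "\<exists>K\<in>compact_ops. \<exists>Ma\<ge>0. \<forall>z. (norm (blinfun_apply (K.mult_defect c x i j) z))\<^sup>2
      \<le> \<epsilon> * (norm z)\<^sup>2 + Ma * norm z * norm (blinfun_apply K z)"
    using L(1) r(1) by blast
qed

text \<open>The elements at which \<open>\<Psi>\<close> lifts \<open>R \<otimes> id\<close> and which are multiplicative on the right modulo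
  compact operators. That \<open>c\<close> ranges over all of \<open>M\<close> makes the set closed under products.\<close>

definition mult_domain :: "(nat \<times> nat \<Rightarrow> 'a) set" where
  "mult_domain = {b \<in> carrier M. (\<forall>i<N. \<forall>j<N. K.compr b i j \<in> R (b (i, j))) \<and>
     (\<forall>c\<in>carrier M. \<forall>i<N. \<forall>j<N. K.mult_defect c b i j \<in> compact_ops)}"

lemma mult_domainD:
  assumes "b \<in> mult_domain"
  shows "b \<in> carrier M" "i < N \<Longrightarrow> j < N \<Longrightarrow> K.compr b i j \<in> R (b (i, j))"
    "c \<in> carrier M \<Longrightarrow> i < N \<Longrightarrow> j < N \<Longrightarrow> K.mult_defect c b i j \<in> compact_ops"
  using assms by (auto simp: mult_domain_def)

lemma mult_domain_one: "\<one>\<^bsub>M\<^esub> \<in> mult_domain"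
proof -
  have "K.mult_defect c \<one>\<^bsub>M\<^esub> i j = 0" if "c \<in> carrier M" "i < N" "j < N" for c i j
  proof -
    have "(\<Sum>k<N. K.compr c i k o\<^sub>L K.compr \<one>\<^bsub>M\<^esub> k j) = (\<Sum>k<N. if k = j then K.compr c i k else 0)"
      by (rule sum.cong) (use that in \<open>auto simp: K.compr_one intro!: blinfun_eqI\<close>)
    then show ?thesis using that by (simp add: K.mult_defect_def)
  qed
  then show ?thesis
    by (auto simp: mult_domain_def K.compr_one mat_cstar_apply lift_one lift_zero compact_ops_zero)
qed

lemma mult_defect_add:
  assumes "b \<in> carrier M" "b' \<in> carrier M" "c \<in> carrier M" "i < N" "j < N"
  shows "K.mult_defect c (b \<oplus>\<^bsub>M\<^esub> b') i j = K.mult_defect c b i j + K.mult_defect c b' i j"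
  using assms
  by (simp add: K.mult_defect_def K.r_distr K.compr_add blinfun_compose_add_right sum.distrib)

lemma mult_defect_smult:
  assumes "b \<in> carrier M" "c \<in> carrier M" "i < N" "j < N"
  shows "K.mult_defect c (s \<odot>\<^bsub>M\<^esub> b) i j = scaleC_blinfun s (K.mult_defect c b i j)"
proof -
  have "(\<Sum>k<N. K.compr c i k o\<^sub>L scaleC_blinfun s (K.compr b k j))
      = scaleC_blinfun s (\<Sum>k<N. K.compr c i k o\<^sub>L K.compr b k j)"
    using assms
    by (intro blinfun_eqI)
      (simp add: scaleC_blinfun.rep_eq blinfun.sum_left complex_vector.scale_sum_right bounded_clinear_opsD[OF K.compr_closed])
  then show ?thesis
    using assms
    by (intro blinfun_eqI) (simp add: K.mult_defect_def K.smult_mult_right K.compr_smult scaleC_blinfun.rep_eq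
        blinfun.diff_left complex_vector.scale_right_diff_distrib)
qed

lemma mult_domain_add:
  assumes b: "b \<in> mult_domain" and b': "b' \<in> mult_domain"
  shows "b \<oplus>\<^bsub>M\<^esub> b' \<in> mult_domain"
  using mult_domainD[OF b] mult_domainD[OF b']
  by (auto simp: mult_domain_def K.compr_add mat_cstar_apply mult_defect_add mat_cstar_entry
      intro!: lift_add compact_ops_add)

lemma mult_domain_smult:
  assumes b: "b \<in> mult_domain"
  shows "s \<odot>\<^bsub>M\<^esub> b \<in> mult_domain"
  using mult_domainD[OF b]
  by (auto simp: mult_domain_def K.compr_smult mat_cstar_apply mult_defect_smult mat_cstar_entry
      intro!: lift_smult compact_ops_scaleC)

text \<open>By associativity the defect of \<open>c\<close> and \<open>b b'\<close> is the defect of \<open>c b\<close> and \<open>b'\<close>, plus that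
  of \<open>c\<close> and \<open>b\<close> multiplied by \<open>\<Psi>(b')\<close>, minus \<open>\<Psi>(c)\<close> times that of \<open>b\<close> and \<open>b'\<close>.\<close>

lemma mult_domain_mult:
  assumes b: "b \<in> mult_domain" and b': "b' \<in> mult_domain"
  shows "b \<otimes>\<^bsub>M\<^esub> b' \<in> mult_domain"
proof -
  note B = mult_domainD[OF b] and B' = mult_domainD[OF b']
  have compr_mult: "K.compr (c \<otimes>\<^bsub>M\<^esub> b') i j = (\<Sum>k<N. K.compr c i k o\<^sub>L K.compr b' k j) + K.mult_defect c b' i j" for c i j
    by (simp add: K.mult_defect_def)
  have "K.compr (b \<otimes>\<^bsub>M\<^esub> b') i j \<in> R ((b \<otimes>\<^bsub>M\<^esub> b') (i, j))" if ij: "i < N" "j < N" for i j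
  proof -
    have e: "b (i, k) \<in> carrier A" "b' (k, j) \<in> carrier A" if "k < N" for k
      using B(1) B'(1) ij that by (auto intro: mat_cstar_entry)
    have "(\<Sum>k<N. K.compr b i k o\<^sub>L K.compr b' k j) \<in> R (\<Oplus>k\<in>{..<N}. b (i, k) \<otimes> b' (k, j))"
      using B(2) B'(2) e ij by (intro lift_finsum lift_mult) auto
    then show ?thesis
      using B'(3)[OF B(1) ij] e ij unfolding compr_mult
      by (intro lift_compact_perturb) (auto simp: mat_cstar_apply intro!: finsum_closed)
  qed
  moreover have "K.mult_defect c (b \<otimes>\<^bsub>M\<^esub> b') i j \<in> compact_ops" if c: "c \<in> carrier M" and ij: "i < N" "j < N" for c i j
  proof -
    have cb: "c \<otimes>\<^bsub>M\<^esub> b \<in> carrier M" using c B(1) by simp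
    have "K.mult_defect c (b \<otimes>\<^bsub>M\<^esub> b') i j = K.compr (c \<otimes>\<^bsub>M\<^esub> b \<otimes>\<^bsub>M\<^esub> b') i j
        - (\<Sum>k<N. K.compr c i k o\<^sub>L K.compr (b \<otimes>\<^bsub>M\<^esub> b') k j)"
      using c B(1) B'(1) by (simp add: K.mult_defect_def K.m_assoc)
    also have "\<dots> = K.mult_defect (c \<otimes>\<^bsub>M\<^esub> b) b' i j
        + ((\<Sum>k<N. K.compr (c \<otimes>\<^bsub>M\<^esub> b) i k o\<^sub>L K.compr b' k j)
          - (\<Sum>l<N. K.compr c i l o\<^sub>L (\<Sum>k<N. K.compr b l k o\<^sub>L K.compr b' k j)))
        - (\<Sum>l<N. K.compr c i l o\<^sub>L K.mult_defect b b' l j)"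
      unfolding compr_mult by (simp add: blinfun_compose_add_right sum.distrib)
    also have "(\<Sum>l<N. K.compr c i l o\<^sub>L (\<Sum>k<N. K.compr b l k o\<^sub>L K.compr b' k j))
        = (\<Sum>k<N. (\<Sum>l<N. K.compr c i l o\<^sub>L K.compr b l k) o\<^sub>L K.compr b' k j)"
      unfolding blinfun_compose_sum_left blinfun_compose_sum_right
      by (subst sum.swap) (simp add: blinfun_compose_assoc)
    also have "(\<Sum>k<N. K.compr (c \<otimes>\<^bsub>M\<^esub> b) i k o\<^sub>L K.compr b' k j)
          - (\<Sum>k<N. (\<Sum>l<N. K.compr c i l o\<^sub>L K.compr b l k) o\<^sub>L K.compr b' k j)
        = (\<Sum>k<N. K.mult_defect c b i k o\<^sub>L K.compr b' k j)"
      by (simp add: K.mult_defect_def blinfun_compose_diff_left sum_subtractf)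
    finally have "K.mult_defect c (b \<otimes>\<^bsub>M\<^esub> b') i j = K.mult_defect (c \<otimes>\<^bsub>M\<^esub> b) b' i j
        + (\<Sum>k<N. K.mult_defect c b i k o\<^sub>L K.compr b' k j)
        - (\<Sum>l<N. K.compr c i l o\<^sub>L K.mult_defect b b' l j)" .
    moreover have "\<dots> \<in> compact_ops"
      using B B' c cb ij
      by (intro compact_ops_diff compact_ops_add compact_ops_sum compact_ops_compose_left
          compact_ops_compose_right) (auto intro: K.compr_closed)
    ultimately show ?thesis by simp
  qed
  ultimately show ?thesis using B(1) B'(1) by (auto simp: mult_domain_def)
qed

text \<open>The norm of \<open>A\<close> controls the order of \<open>M\<close> on diagonal matrices, and thereby the size of
  \<open>\<Psi>\<close> there.\<close>

lemma diag_order_unit: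
  assumes a: "a \<in> carrier A" "nrm A a < \<epsilon>"
  shows "\<exists>d\<in>K.sos. complex_of_real (\<epsilon>\<^sup>2) \<odot>\<^bsub>M\<^esub> \<one>\<^bsub>M\<^esub>
    = star M (diag_mat N A a) \<otimes>\<^bsub>M\<^esub> diag_mat N A a \<oplus>\<^bsub>M\<^esub> d"
proof -
  have "(nrm A a)\<^sup>2 < \<epsilon>\<^sup>2"
    using a nrm_nonneg[OF a(1)] by (intro power_strict_mono) auto
  then obtain c where c: "c \<in> carrier A" "complex_of_real (\<epsilon>\<^sup>2) \<odot> \<one> = star A a \<otimes> a \<oplus> star A c \<otimes> c"
    using cstar_order_unit[OF a(1)] by blast
  have "complex_of_real (\<epsilon>\<^sup>2) \<odot>\<^bsub>M\<^esub> \<one>\<^bsub>M\<^esub> = diag_mat N A (complex_of_real (\<epsilon>\<^sup>2) \<odot> \<one>)"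
    by (simp add: S.diag_mat_smult S.diag_mat_one del: of_real_power)
  also have "\<dots> = star M (diag_mat N A a) \<otimes>\<^bsub>M\<^esub> diag_mat N A a
      \<oplus>\<^bsub>M\<^esub> star M (diag_mat N A c) \<otimes>\<^bsub>M\<^esub> diag_mat N A c"
    unfolding c(2) using a c by (simp add: S.diag_mat_hom S.diag_mat_star star_closed)
  finally show ?thesis
    using K.square_sos[OF S.diag_mat_closed[OF c(1)]] by blast
qed

lemma diag_mat_minus:
  assumes "a \<in> carrier A" "b \<in> carrier A"
  shows "diag_mat N A (a \<ominus> b) = diag_mat N A a \<oplus>\<^bsub>M\<^esub> (-1) \<odot>\<^bsub>M\<^esub> diag_mat N A b"
  using assms by (simp add: a_minus_smult S.diag_mat_hom S.diag_mat_smult)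

text \<open>Approximate \<open>a\<close> by \<open>b\<close>. On the diagonal matrix of \<open>a - b\<close> the map \<open>\<Psi>\<close> and its defects are
  small in norm (\<open>diag_order_unit\<close>), and lifts of \<open>a - b\<close> are small modulo compact operators
  (\<open>essential_norm_bound\<close>); an operator within any \<open>\<epsilon>\<close> of the compact ones is compact.\<close>

lemma mult_domain_diag_closed:
  assumes a: "a \<in> carrier A"
    and approx: "\<And>\<epsilon>. \<epsilon> > 0 \<Longrightarrow> \<exists>b\<in>carrier A. diag_mat N A b \<in> mult_domain \<and> nrm A (a \<ominus> b) < \<epsilon>"
  shows "diag_mat N A a \<in> mult_domain"
proof -
  let ?D = "diag_mat N A"
  have Da: "?D a \<in> carrier M" by (rule S.diag_mat_closed[OF a])
  have "K.compr (?D a) i j \<in> R (?D a (i, j))" if ij: "i < N" "j < N" for i j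
  proof -
    have ac: "?D a (i, j) \<in> carrier A" using a ij by (simp add: diag_mat_apply)
    obtain S where S: "S \<in> R (?D a (i, j))" using lift_ex[OF ac] by blast
    let ?T = "K.compr (?D a) i j"
    note bd = K.compr_closed[OF Da ij] lift_bounded[OF ac S]
    have "?T - S \<in> compact_ops"
    proof (rule compact_opsI_approx)
      show "?T - S \<in> bounded_clinear_ops" by (intro bounded_clinear_ops_closed bd)
      fix \<epsilon> :: real assume "\<epsilon> > 0"
      define \<delta> where "\<delta> = sqrt (\<epsilon> / 4)"
      have \<delta>: "\<delta> > 0" "\<delta>\<^sup>2 = \<epsilon> / 4" using \<open>\<epsilon> > 0\<close> by (simp_all add: \<delta>_def)
      obtain b where b: "b \<in> carrier A" "?D b \<in> mult_domain" "nrm A (a \<ominus> b) < \<delta>"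
        using approx[OF \<delta>(1)] by blast
      note Db = mult_domainD[OF b(2)]
      let ?Tb = "K.compr (?D b) i j"
      have ab: "a \<ominus> b \<in> carrier A" using a b by simp
      obtain d where d: "d \<in> K.sos" "complex_of_real (\<delta>\<^sup>2) \<odot>\<^bsub>M\<^esub> \<one>\<^bsub>M\<^esub>
          = star M (?D (a \<ominus> b)) \<otimes>\<^bsub>M\<^esub> ?D (a \<ominus> b) \<oplus>\<^bsub>M\<^esub> d"
        using diag_order_unit[OF ab b(3)] by blast
      have "K.compr (?D (a \<ominus> b)) i j = ?T - ?Tb"
        using Da Db(1) ij a b by (simp add: diag_mat_minus K.compr_add K.compr_smult scaleC_blinfun_minus1)
      moreover have "norm (K.compr (?D (a \<ominus> b)) i j) \<le> sqrt (\<delta>\<^sup>2)"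
        by (rule K.norm_compr_le[OF S.diag_mat_closed[OF ab] d _ ij]) simp
      ultimately have T: "norm (?T - ?Tb) \<le> \<delta>" using \<delta>(1) by simp
      have bc: "?D b (i, j) \<in> carrier A" using b ij by (simp add: diag_mat_apply)
      have "?Tb - S \<in> R (?D b (i, j) \<ominus> ?D a (i, j))"
        by (rule lift_diff[OF bc ac Db(2)[OF ij] S])
      moreover have "nrm A (?D b (i, j) \<ominus> ?D a (i, j)) < \<delta>"
        using a b ij \<delta>(1) nrm_minus_commute[OF a b(1)] nrm_eq_zero[of \<zero>]
        by (simp add: diag_mat_apply a_minus_def)
      ultimately obtain K where K: "K \<in> compact_ops" "\<And>\<eta>. (norm (blinfun_apply (?Tb - S) \<eta>))\<^sup>2
          \<le> \<delta>\<^sup>2 * (norm \<eta>)\<^sup>2 + norm \<eta> * norm (blinfun_apply K \<eta>)"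
        using essential_norm_bound[of "?D b (i, j) \<ominus> ?D a (i, j)" \<delta> "?Tb - S"] ac bc by auto
      have "(norm (blinfun_apply (?T - S) z))\<^sup>2 \<le> \<epsilon> * (norm z)\<^sup>2 + 2 * norm z * norm (blinfun_apply K z)" for z
      proof -
        have "(norm (blinfun_apply (?T - S) z))\<^sup>2 = (norm (blinfun_apply (?T - ?Tb) z + blinfun_apply (?Tb - S) z))\<^sup>2"
          by (simp add: blinfun.diff_left)
        also have "\<dots> \<le> 2 * (norm (blinfun_apply (?T - ?Tb) z))\<^sup>2 + 2 * (norm (blinfun_apply (?Tb - S) z))\<^sup>2"
          by (rule power2_norm_add_le)
        also have "(norm (blinfun_apply (?T - ?Tb) z))\<^sup>2 \<le> (\<delta> * norm z)\<^sup>2"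
          using T norm_blinfun[of "?T - ?Tb" z]
          by (intro power_mono order_trans[OF norm_blinfun] mult_right_mono) auto
        finally show ?thesis using K(2)[of z] \<delta>(2) by (simp add: power_mult_distrib)
      qed
      then show "\<exists>K\<in>compact_ops. \<exists>Ma\<ge>0. \<forall>z. (norm (blinfun_apply (?T - S) z))\<^sup>2
          \<le> \<epsilon> * (norm z)\<^sup>2 + Ma * norm z * norm (blinfun_apply K z)"
        using K(1) by (intro bexI[of _ K] exI[of _ 2]) auto
    qed
    then show ?thesis using lift_iff[OF ac S] by simp
  qed
  moreover have "K.mult_defect c (?D a) i j \<in> compact_ops" if c: "c \<in> carrier M" and ij: "i < N" "j < N" for c i j
  proof (rule compact_opsI_approx)
    show "K.mult_defect c (?D a) i j \<in> bounded_clinear_ops"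
      unfolding K.mult_defect_def using Da c ij
      by (intro bounded_clinear_ops_closed bounded_clinear_ops_sum) (auto intro: K.compr_closed)
    obtain r d where r: "0 \<le> r" "d \<in> K.sos"
      "complex_of_real r \<odot>\<^bsub>M\<^esub> \<one>\<^bsub>M\<^esub> = star M (star M c) \<otimes>\<^bsub>M\<^esub> star M c \<oplus>\<^bsub>M\<^esub> d"
      using K.order_unit[OF K.star_closed[OF c]] by blast
    then have r': "complex_of_real r \<odot>\<^bsub>M\<^esub> \<one>\<^bsub>M\<^esub> = c \<otimes>\<^bsub>M\<^esub> star M c \<oplus>\<^bsub>M\<^esub> d"
      using c by (simp add: K.star_star)
    fix \<epsilon> :: real assume "\<epsilon> > 0"
    define \<delta> where "\<delta> = sqrt (\<epsilon> / (2 * (r + 1)))"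
    have \<delta>: "\<delta> > 0" "\<delta>\<^sup>2 = \<epsilon> / (2 * (r + 1))" using \<open>\<epsilon> > 0\<close> r(1) by (simp_all add: \<delta>_def)
    have r\<delta>: "2 * (r * \<delta>\<^sup>2) \<le> \<epsilon>"
    proof -
      have "2 * (r * \<delta>\<^sup>2) = \<epsilon> * (r / (r + 1))" using r(1) by (simp add: \<delta>(2) field_simps)
      also have "\<dots> \<le> \<epsilon> * 1" using r(1) \<open>\<epsilon> > 0\<close> by (intro mult_left_mono) auto
      finally show ?thesis by simp
    qed
    obtain b where b: "b \<in> carrier A" "?D b \<in> mult_domain" "nrm A (a \<ominus> b) < \<delta>"
      using approx[OF \<delta>(1)] by blast
    have ab: "a \<ominus> b \<in> carrier A" using a b by simp
    have Dab: "?D (a \<ominus> b) \<in> carrier M" by (rule S.diag_mat_closed[OF ab])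
    obtain e where e: "e \<in> K.sos" "complex_of_real (\<delta>\<^sup>2) \<odot>\<^bsub>M\<^esub> \<one>\<^bsub>M\<^esub>
        = star M (?D (a \<ominus> b)) \<otimes>\<^bsub>M\<^esub> ?D (a \<ominus> b) \<oplus>\<^bsub>M\<^esub> e"
      using diag_order_unit[OF ab b(3)] by blast
    note Db = mult_domainD[OF b(2)]
    let ?E = "K.mult_defect c (?D a) i j" and ?Eb = "K.mult_defect c (?D b) i j"
    have Eb: "?Eb \<in> compact_ops" by (rule Db(3)[OF c ij])
    have "K.mult_defect c (?D (a \<ominus> b)) i j = ?E - ?Eb"
      using Da Db(1) c ij a b
      by (simp add: diag_mat_minus mult_defect_add mult_defect_smult scaleC_blinfun_minus1)
    moreover have "(norm (blinfun_apply (K.mult_defect c (?D (a \<ominus> b)) i j) z))\<^sup>2 \<le> r * (\<delta>\<^sup>2 * (norm z)\<^sup>2)" for z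
    proof -
      have "K.schwarz_gap (?D (a \<ominus> b)) j z \<le> \<delta>\<^sup>2 * (norm z)\<^sup>2"
        using K.tau_square_bound[OF Dab e ij(2), of z]
          sum_nonneg[of "{..<N}" "\<lambda>k. (norm (blinfun_apply (K.compr (?D (a \<ominus> b)) k j) z))\<^sup>2"]
        unfolding K.schwarz_gap_def by (smt (verit) zero_le_power2)
      then show ?thesis
        using K.mult_defect_le_gap[OF c Dab ij r(1,2) r', of z] r(1)
        by (meson mult_left_mono order_trans)
    qed
    ultimately have E: "(norm (blinfun_apply (?E - ?Eb) z))\<^sup>2 \<le> r * (\<delta>\<^sup>2 * (norm z)\<^sup>2)" for z
      by simp
    have "(norm (blinfun_apply ?E z))\<^sup>2 \<le> \<epsilon> * (norm z)\<^sup>2 + (2 * norm ?Eb) * norm z * norm (blinfun_apply ?Eb z)" for z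
    proof -
      have "(norm (blinfun_apply ?E z))\<^sup>2 = (norm (blinfun_apply (?E - ?Eb) z + blinfun_apply ?Eb z))\<^sup>2"
        by (simp add: blinfun.diff_left)
      also have "\<dots> \<le> 2 * (norm (blinfun_apply (?E - ?Eb) z))\<^sup>2 + 2 * (norm (blinfun_apply ?Eb z))\<^sup>2"
        by (rule power2_norm_add_le)
      also have "(norm (blinfun_apply ?Eb z))\<^sup>2 \<le> (norm ?Eb * norm z) * norm (blinfun_apply ?Eb z)"
        unfolding power2_eq_square by (intro mult_right_mono norm_blinfun) auto
      also have "2 * (norm (blinfun_apply (?E - ?Eb) z))\<^sup>2 \<le> 2 * (r * \<delta>\<^sup>2) * (norm z)\<^sup>2"
        using E[of z] by simp
      also have "\<dots> \<le> \<epsilon> * (norm z)\<^sup>2" by (intro mult_right_mono r\<delta>) simp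
      finally show ?thesis by (simp add: mult_ac)
    qed
    then show "\<exists>K\<in>compact_ops. \<exists>Ma\<ge>0. \<forall>z. (norm (blinfun_apply ?E z))\<^sup>2
        \<le> \<epsilon> * (norm z)\<^sup>2 + Ma * norm z * norm (blinfun_apply K z)"
      using Eb by (intro bexI[of _ ?Eb] exI[of _ "2 * norm ?Eb"]) auto
  qed
  ultimately show ?thesis using Da by (auto simp: mult_domain_def)
qed

text \<open>The elements of \<open>A\<close> whose diagonal matrix lies in the domain along with its adjoint form a
  C*-subalgebra.\<close>

lemma mult_domain_all:
  assumes gen: "cstar_generated A G = carrier A" "G \<subseteq> carrier A"
    and G: "\<And>g. g \<in> G \<Longrightarrow> diag_mat N A g \<in> mult_domain \<and> star M (diag_mat N A g) \<in> mult_domain"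
    and a: "a \<in> carrier A"
  shows "diag_mat N A a \<in> mult_domain"
proof -
  define B where "B = {a \<in> carrier A. diag_mat N A a \<in> mult_domain \<and> diag_mat N A (star A a) \<in> mult_domain}"
  interpret Met: Metric_space "carrier A" "cstar_dist A" by (rule cstar_metric)
  have "\<zero>\<^bsub>M\<^esub> \<in> mult_domain" using mult_domain_smult[OF mult_domain_one, of 0] by simp
  moreover have "diag_mat N A \<zero> = \<zero>\<^bsub>M\<^esub>"
    using S.diag_mat_smult[of \<one> N 0] S.diag_mat_closed[of \<one> N] by simp
  ultimately have zero: "\<zero> \<in> B" by (simp add: B_def)
  have "cstar_subalgebra A B"
    unfolding cstar_subalgebra_def
  proof (intro conjI ballI)
    show "LinearCombinations.submodule (class_ring :: complex ring) B A"
      unfolding LinearCombinations.submodule_def using zero M.module_axioms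
      by (auto simp: B_def S.diag_mat_hom S.diag_mat_smult star_add star_smult star_closed mult_domain_add mult_domain_smult)
    show "x \<otimes> y \<in> B" if "x \<in> B" "y \<in> B" for x y
      using that by (auto simp: B_def S.diag_mat_hom(1) star_mult star_closed mult_domain_mult)
    show "star A x \<in> B" if "x \<in> B" for x
      using that by (auto simp: B_def star_star star_closed)
    show "cstar_closed A B"
      unfolding Met.metric_closedin_iff_sequentially_closed
    proof (intro conjI allI impI)
      show "B \<subseteq> carrier A" by (auto simp: B_def)
      fix \<sigma> l assume "range \<sigma> \<subseteq> B \<and> limitin Met.mtopology \<sigma> l sequentially"
      then have \<sigma>: "\<And>n. \<sigma> n \<in> B" and lim: "limitin Met.mtopology \<sigma> l sequentially" by auto
      have l: "l \<in> carrier A" using lim by (simp add: Met.limitin_metric)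
      have near: "\<exists>b\<in>B. nrm A (l \<ominus> b) < \<epsilon>" if "\<epsilon> > 0" for \<epsilon>
      proof -
        have "\<forall>\<^sub>F n in sequentially. \<sigma> n \<in> carrier A \<and> cstar_dist A (\<sigma> n) l < \<epsilon>"
          using lim that by (simp add: Met.limitin_metric)
        then obtain n where "\<sigma> n \<in> carrier A" "cstar_dist A (\<sigma> n) l < \<epsilon>"
          using eventually_happens[of _ sequentially] by auto
        then show ?thesis
          using \<sigma>[of n] l nrm_minus_commute[of l "\<sigma> n"]
          by (intro bexI[of _ "\<sigma> n"]) (auto simp: cstar_dist_def)
      qed
      have "diag_mat N A l \<in> mult_domain"
        using near by (intro mult_domain_diag_closed[OF l]) (auto simp: B_def)
      moreover have "diag_mat N A (star A l) \<in> mult_domain"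
      proof (rule mult_domain_diag_closed[OF star_closed[OF l]])
        fix \<epsilon> :: real assume "\<epsilon> > 0"
        then obtain b where b: "b \<in> B" "nrm A (l \<ominus> b) < \<epsilon>" using near by blast
        then have bc: "b \<in> carrier A" by (simp add: B_def)
        have "star A l \<ominus> star A b = star A (l \<ominus> b)"
          using l bc by (simp add: a_minus_smult star_closed star_add star_smult)
        then have "nrm A (star A l \<ominus> star A b) < \<epsilon>"
          using nrm_star[of "l \<ominus> b"] l bc b(2) by simp
        then show "\<exists>b\<in>carrier A. diag_mat N A b \<in> mult_domain \<and> nrm A (star A l \<ominus> b) < \<epsilon>"
          using b(1) bc by (intro bexI[of _ "star A b"]) (auto simp: B_def star_closed)
      qed
      ultimately show "l \<in> B" using l by (simp add: B_def)
    qed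
  qed
  moreover have "G \<subseteq> B"
    using gen(2) G by (auto simp: B_def S.diag_mat_star subset_iff)
  ultimately have "cstar_generated A G \<subseteq> B"
    unfolding cstar_generated_def by blast
  then show ?thesis using gen(1) a by (auto simp: B_def)
qed

end


section \<open>Four-dimensional operator systems\<close>

context star_module
begin

lemma module_class_ring: "Module.module (class_ring :: complex ring) E"
  by (rule moduleI)
    (auto simp: smult_add_left smult_add_right smult_smult smult_one abelian_group_axioms
      domain.axioms(1)[OF field.axioms(1)[OF class_field]])

lemma submodule_finsum:
  assumes S: "submodule (class_ring :: complex ring) S E" and "finite I" "\<And>i. i \<in> I \<Longrightarrow> f i \<in> S"
  shows "(\<Oplus>i\<in>I. f i) \<in> S"
  using assms(2,3)
proof (induction I rule: finite_induct)
  case empty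
  then show ?case using submodule.zero_closed[OF S] by simp
next
  case (insert i I)
  have "f j \<in> carrier E" if "j \<in> insert i I" for j
    using insert.prems[OF that] submodule.subset[OF S] by blast
  then have "(\<Oplus>j\<in>insert i I. f j) = f i \<oplus> (\<Oplus>j\<in>I. f j)"
    using insert.hyps by (intro finsum_insert) auto
  then show ?case
    using insert submodule.m_closed[OF S] by simp
qed

lemma has_dimension_span:
  assumes W: "finite W" "W \<subseteq> carrier E"
    and indep: "\<And>c :: 'e \<Rightarrow> complex. (\<Oplus>v\<in>W. c v \<odot> v) = \<zero> \<Longrightarrow> \<forall>v\<in>W. c v = 0"
  shows "has_dimension E (LinearCombinations.module.span (class_ring :: complex ring) E W) (card W)"
proof -
  interpret Mod: Module.module "class_ring :: complex ring" E by (rule module_class_ring)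
  have sub: "submodule (class_ring :: complex ring) (Mod.span W) E"
    using W(2) by (rule Mod.span_is_submodule)
  have WS: "W \<subseteq> Mod.span W" using W(2) by (rule Mod.in_own_span)
  have li: "\<not> Mod.lin_dep W"
    using indep by (intro Mod.finite_lin_indpt2 W) (auto simp: Mod.lincomb_def)
  interpret V: vectorspace "class_ring :: complex ring" "E\<lparr>carrier := Mod.span W\<rparr>"
  proof (rule vectorspace.intro)
    show "Module.module (class_ring :: complex ring) (E\<lparr>carrier := Mod.span W\<rparr>)"
      by (rule Mod.submodule_is_module[OF sub])
    show "field (class_ring :: complex ring)" by (rule class_field)
  qed
  have gen: "V.span W = carrier (E\<lparr>carrier := Mod.span W\<rparr>)"
    using Mod.span_li_not_depend(1)[OF WS sub] by simp
  have "V.basis W"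
    unfolding V.basis_def using gen li Mod.span_li_not_depend(2)[OF WS sub] WS by simp
  then have "V.dim = card W" using W(1) by (rule V.dim_basis[rotated])
  moreover have "V.fin_dim"
    unfolding V.fin_dim_def using W(1) WS gen by auto
  ultimately show ?thesis by (simp add: has_dimension_def)
qed

end

text \<open>On the span of \<open>1, x, x\<^sup>*, x\<^sup>* x + x x\<^sup>*\<close> a lift modulo an ideal turns the sum of the two
  Schwarz inequalities for \<open>x\<close> and \<open>x\<^sup>*\<close> into an equality modulo that ideal, hence each of them.
  Linear independence, given in the form checked below for a concrete \<open>x\<close>, makes the dimension
  equal to four.\<close>

lemma (in unital_star_algebra) four_dimensional_system:
  assumes x: "x \<in> carrier A" and y: "y = star A x \<otimes> x \<oplus> x \<otimes> star A x"
    and indep: "\<And>\<alpha> \<beta> \<gamma> \<delta>. \<alpha> \<odot> \<one> \<oplus> (\<beta> \<odot> x \<oplus> (\<gamma> \<odot> star A x \<oplus> \<delta> \<odot> y)) = \<zero> \<Longrightarrow>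
      \<alpha> = 0 \<and> \<beta> = 0 \<and> \<gamma> = 0 \<and> \<delta> = 0"
  shows "\<exists>S. operator_subsystem A S \<and> has_dimension A S 4 \<and> x \<in> S \<and> star A x \<in> S \<and> y \<in> S"
proof -
  interpret Mod: Module.module "class_ring :: complex ring" A by (rule module_class_ring)
  have yc: "y \<in> carrier A" and sx: "star A x \<in> carrier A" using x by (auto simp: y)
  have sy: "star A y = y" using x by (simp add: y star_add star_mult star_star)
  let ?W = "{\<one>, x, star A x, y}"
  have ne: "\<one> \<noteq> x" "\<one> \<noteq> star A x" "\<one> \<noteq> y" "x \<noteq> star A x" "x \<noteq> y" "star A x \<noteq> y"
    using indep[of 1 "-1" 0 0] indep[of 1 0 "-1" 0] indep[of 1 0 0 "-1"] indep[of 0 1 "-1" 0]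
      indep[of 0 1 0 "-1"] indep[of 0 0 1 "-1"] x yc sx smult_minus_cancel[OF one_closed]
      smult_minus_cancel[OF x] smult_minus_cancel[OF sx]
    by (simp_all only: smult_zero_left one_closed smult_one l_zero r_zero zero_closed smult_closed a_closed)
       (metis zero_neq_one)+
  have W: "finite ?W" "?W \<subseteq> carrier A" using x yc sx by auto
  let ?S = "Mod.span ?W"
  have sub: "submodule (class_ring :: complex ring) ?S A"
    using W(2) by (rule Mod.span_is_submodule)
  have WS: "?W \<subseteq> ?S" using W(2) by (rule Mod.in_own_span)
  have "has_dimension A ?S (card ?W)"
  proof (rule has_dimension_span[OF W])
    fix c :: "'a \<Rightarrow> complex"
    assume "(\<Oplus>v\<in>?W. c v \<odot> v) = \<zero>"
    moreover have "(\<Oplus>v\<in>?W. c v \<odot> v) = c \<one> \<odot> \<one> \<oplus> (c x \<odot> x \<oplus> (c (star A x) \<odot> star A x \<oplus> c y \<odot> y))"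
      using ne x yc sx by (simp add: finsum_insert)
    ultimately have "c \<one> = 0 \<and> c x = 0 \<and> c (star A x) = 0 \<and> c y = 0"
      using indep[of "c \<one>" "c x" "c (star A x)" "c y"] by simp
    then show "\<forall>v\<in>?W. c v = 0" by auto
  qed
  moreover have "card ?W = 4" using ne by simp
  ultimately have dim: "has_dimension A ?S 4" by metis
  have "star A s \<in> ?S" if s: "s \<in> ?S" for s
  proof -
    obtain c where c: "Mod.lincomb c ?W = s"
      using Mod.finite_in_span[OF W s] by blast
    have "star A s = (\<Oplus>v\<in>?W. cnj (c v) \<odot> star A v)"
    proof -
      have "star A s = star A (\<Oplus>v\<in>?W. c v \<odot> v)"
        using c by (simp add: Mod.lincomb_def)
      also have "\<dots> = (\<Oplus>v\<in>?W. star A (c v \<odot> v))"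
        using W by (intro star_finsum) auto
      also have "\<dots> = (\<Oplus>v\<in>?W. cnj (c v) \<odot> star A v)"
        using W(2) by (intro finsum_cong' refl) (auto simp: star_smult subset_iff)
      finally show ?thesis .
    qed
    also have "\<dots> \<in> ?S"
    proof (rule submodule_finsum[OF sub W(1)])
      fix v assume "v \<in> ?W"
      then have "star A v \<in> ?W" using x sy by (auto simp: star_star)
      then show "cnj (c v) \<odot> star A v \<in> ?S"
        using WS submodule.smult_closed[OF sub] by auto
    qed
    finally show ?thesis .
  qed
  then have "operator_subsystem A ?S"
    using sub WS by (simp add: operator_subsystem_def)
  then show ?thesis using dim WS by auto
qed

section \<open>A single generator of a matrix algebra\<close>

text \<open>A strictly upper triangular matrix with unit superdiagonal; the generators \<open>g\<close> sit in the first
  row. Two further rows and columns carry only the superdiagonal, which makes the linear independence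
  visible in the last diagonal entries.\<close>

definition gen_mat :: "nat \<Rightarrow> 'a cstar \<Rightarrow> (nat \<Rightarrow> 'a) \<Rightarrow> nat \<times> nat \<Rightarrow> 'a" where
  "gen_mat m A g = (\<lambda>(i, j)\<in>{..<m + 4} \<times> {..<m + 4}.
     if j = Suc i then \<one>\<^bsub>A\<^esub> else if i = 0 \<and> 2 \<le> j \<and> j < m + 2 then g (j - 2) else \<zero>\<^bsub>A\<^esub>)"

lemma gen_mat_apply:
  "i < m + 4 \<Longrightarrow> j < m + 4 \<Longrightarrow> gen_mat m A g (i, j) =
     (if j = Suc i then \<one>\<^bsub>A\<^esub> else if i = 0 \<and> 2 \<le> j \<and> j < m + 2 then g (j - 2) else \<zero>\<^bsub>A\<^esub>)"
  by (simp add: gen_mat_def)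

locale single_generator = unital_star_algebra A for A :: "'a cstar" (structure) +
  fixes m :: nat and g :: "nat \<Rightarrow> 'a"
  assumes g: "k < m \<Longrightarrow> g k \<in> carrier A"
begin

abbreviation "N \<equiv> m + 4"
abbreviation "M \<equiv> mat_cstar N A"
abbreviation "x \<equiv> gen_mat m A g"

lemma gen_mat_closed: "x \<in> carrier M"
  unfolding mat_cstar_carrier
proof (intro conjI allI impI)
  show "x (i, j) \<in> carrier A" if "i < N" "j < N" for i j
    using that by (auto simp: gen_mat_apply intro!: g)
qed (simp add: gen_mat_def)

text \<open>Since \<open>x\<^sup>* x + x x\<^sup>*\<close> has the last two diagonal entries \<open>2\<close> and \<open>1\<close>, these entries of the
  relation read \<open>\<alpha> + 2 \<delta> = 0\<close> and \<open>\<alpha> + \<delta> = 0\<close>. Then the neighbouring off-diagonal entries give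
  \<open>\<beta> = 0\<close> and \<open>\<gamma> = 0\<close>.\<close>

lemma gen_mat_independent:
  assumes nontrivial: "\<one> \<noteq> \<zero>"
    and zero: "\<alpha> \<odot>\<^bsub>M\<^esub> \<one>\<^bsub>M\<^esub> \<oplus>\<^bsub>M\<^esub> (\<beta> \<odot>\<^bsub>M\<^esub> x \<oplus>\<^bsub>M\<^esub> (\<gamma> \<odot>\<^bsub>M\<^esub> star M x \<oplus>\<^bsub>M\<^esub>
      \<delta> \<odot>\<^bsub>M\<^esub> (star M x \<otimes>\<^bsub>M\<^esub> x \<oplus>\<^bsub>M\<^esub> x \<otimes>\<^bsub>M\<^esub> star M x))) = \<zero>\<^bsub>M\<^esub>"
  shows "\<alpha> = 0 \<and> \<beta> = 0 \<and> \<gamma> = 0 \<and> \<delta> = 0"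
proof -
  have smult_zero: "c = 0" if "c \<odot> \<one> = \<zero>" for c
  proof (rule ccontr)
    assume "c \<noteq> 0"
    then have "\<one> = (1 / c) \<odot> (c \<odot> \<one>)" by (simp add: smult_smult smult_one)
    then show False using that nontrivial by simp
  qed
  have eq: "\<alpha> \<odot> \<one>\<^bsub>M\<^esub> (i, j) \<oplus> (\<beta> \<odot> x (i, j) \<oplus> (\<gamma> \<odot> star A (x (j, i)) \<oplus>
      \<delta> \<odot> ((star M x \<otimes>\<^bsub>M\<^esub> x) (i, j) \<oplus> (x \<otimes>\<^bsub>M\<^esub> star M x) (i, j)))) = \<zero>" if "i < N" "j < N" for i j
    using arg_cong[OF zero, of "\<lambda>X. X (i, j)"] that by (simp only: mat_cstar_apply(3-6))
  have col: "(star M x \<otimes>\<^bsub>M\<^esub> x) (Suc k, Suc k) = \<one>" if k: "m < k" "Suc k < N" for k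
  proof -
    have "(\<Oplus>l\<in>{..<N}. star M x (Suc k, l) \<otimes> x (l, Suc k)) = star M x (Suc k, k) \<otimes> x (k, Suc k)"
      using k by (intro finsum_single_index) (auto simp: mat_cstar_apply gen_mat_apply)
    then show ?thesis using k by (simp add: mat_cstar_apply gen_mat_apply)
  qed
  have row: "(x \<otimes>\<^bsub>M\<^esub> star M x) (k, k) = (if Suc k < N then \<one> else \<zero>)" if k: "0 < k" "k < N" for k
  proof (cases "Suc k < N")
    case True
    have "(\<Oplus>l\<in>{..<N}. x (k, l) \<otimes> star M x (l, k)) = x (k, Suc k) \<otimes> star M x (Suc k, k)"
      using k True by (intro finsum_single_index) (auto simp: mat_cstar_apply gen_mat_apply)
    then show ?thesis using k True by (simp add: mat_cstar_apply gen_mat_apply)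
  next
    case False
    have "(\<Oplus>l\<in>{..<N}. x (k, l) \<otimes> star M x (l, k)) = (\<Oplus>l\<in>{..<N}. \<zero>)"
      using k False by (intro finsum_cong') (auto simp: mat_cstar_apply gen_mat_apply)
    then show ?thesis using k False by (simp add: mat_cstar_apply)
  qed
  have "(\<alpha> + \<delta>) \<odot> \<one> = \<zero>"
    using eq[of "m + 3" "m + 3"] col[of "m + 2"] row[of "m + 3"]
    by (simp add: mat_cstar_apply(2) gen_mat_apply smult_add_left numeral_3_eq_3)
  then have 1: "\<alpha> + \<delta> = 0" by (rule smult_zero)
  have "\<alpha> \<odot> \<one> \<oplus> (\<delta> \<odot> \<one> \<oplus> \<delta> \<odot> \<one>) = \<zero>"
    using eq[of "m + 2" "m + 2"] col[of "m + 1"] row[of "m + 2"]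
    by (simp add: mat_cstar_apply(2) gen_mat_apply smult_add_right numeral_2_eq_2)
  then have "(\<alpha> + (\<delta> + \<delta>)) \<odot> \<one> = \<zero>"
    by (simp only: smult_add_left one_closed)
  then have 2: "\<alpha> + (\<delta> + \<delta>) = 0" by (rule smult_zero)
  have "\<delta> = (\<alpha> + (\<delta> + \<delta>)) - (\<alpha> + \<delta>)" by simp
  also have "\<dots> = 0" unfolding 1 2 by simp
  finally have ad: "\<delta> = 0" "\<alpha> = 0" using 1 by simp_all
  have mc: "(star M x \<otimes>\<^bsub>M\<^esub> x) (i, j) \<in> carrier A" "(x \<otimes>\<^bsub>M\<^esub> star M x) (i, j) \<in> carrier A" if "i < N" "j < N" for i j
    using mat_closed(1)[OF mat_closed(4)[OF gen_mat_closed] gen_mat_closed]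
      mat_closed(1)[OF gen_mat_closed mat_closed(4)[OF gen_mat_closed]] that
    by (auto intro: mat_cstar_entry)
  have "\<beta> \<odot> \<one> = \<zero>"
    using eq[of "m + 2" "m + 3"] mc[of "m + 2" "m + 3"] ad by (simp add: mat_cstar_apply(2) gen_mat_apply)
  moreover have "\<gamma> \<odot> \<one> = \<zero>"
    using eq[of "m + 3" "m + 2"] mc[of "m + 3" "m + 2"] ad by (simp add: mat_cstar_apply(2) gen_mat_apply)
  ultimately show ?thesis using ad smult_zero by blast
qed

text \<open>The top power of \<open>x\<close> is a matrix unit, giving \<open>e\<^sub>0\<^sub>0\<close> and the last \<open>e\<^sub>k\<^sub>k\<close>. Cutting the columns of \<open>x\<close> by known
  diagonal units, and removing the first row, yields all others one after the other.\<close>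

lemma gen_mat_generates:
  assumes D: "D \<subseteq> carrier M" "\<one>\<^bsub>M\<^esub> \<in> D" "x \<in> D"
    "\<And>b c. b \<in> D \<Longrightarrow> c \<in> D \<Longrightarrow> b \<oplus>\<^bsub>M\<^esub> c \<in> D" "\<And>b c. b \<in> D \<Longrightarrow> c \<in> D \<Longrightarrow> b \<otimes>\<^bsub>M\<^esub> c \<in> D"
    "\<And>b s. b \<in> D \<Longrightarrow> s \<odot>\<^bsub>M\<^esub> b \<in> D" "\<And>b. b \<in> D \<Longrightarrow> star M b \<in> D"
    and l: "l < m"
  shows "diag_mat N A (g l) \<in> D"
proof -
  interpret MM: unital_star_algebra M by (rule mat_star_algebra)
  define e where "e i j = elem_mat N A i j \<one>" for i j
  have e_closed: "e i j \<in> carrier M" for i j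
    unfolding e_def by (intro elem_mat_closed) simp
  have e_mult: "e i j \<otimes>\<^bsub>M\<^esub> e j k = e i k" if "j < N" for i j k
    unfolding e_def using that by (simp add: elem_mat_mult)
  have e_star: "star M (e i j) = e j i" for i j
    unfolding e_def by (simp add: elem_mat_star)
  \<comment> \<open>\<open>P p\<close> is the power \<open>x\<^sup>p\<close>, supported on and above the \<open>p\<close>-th superdiagonal, with units on it.\<close>
  define P where "P p = rec_nat \<one>\<^bsub>M\<^esub> (\<lambda>_ y. y \<otimes>\<^bsub>M\<^esub> x) p" for p
  have P0: "P 0 = \<one>\<^bsub>M\<^esub>" and PS: "P (Suc p) = P p \<otimes>\<^bsub>M\<^esub> x" for p by (simp_all add: P_def)
  have PD: "P p \<in> D" for p by (induction p) (simp_all add: P0 PS D)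
  have Pc: "P p \<in> carrier M" for p using PD D(1) by blast
  have P_entries: "i < N \<Longrightarrow> j < N \<Longrightarrow> (j < i + p \<longrightarrow> P p (i, j) = \<zero>) \<and> (j = i + p \<longrightarrow> P p (i, j) = \<one>)" for p i j
  proof (induction p arbitrary: i j)
    case 0
    then show ?case by (simp add: P0 mat_cstar_apply)
  next
    case (Suc p)
    have ent: "P (Suc p) (i, j) = (\<Oplus>k\<in>{..<N}. P p (i, k) \<otimes> x (k, j))"
      using Suc.prems by (simp add: PS mat_cstar_apply)
    have xz: "x (k, j) = \<zero>" if "j \<le> k" "k < N" for k
      using that Suc.prems by (auto simp: gen_mat_apply)
    have xc: "x (k, j) \<in> carrier A" "P p (i, k) \<in> carrier A" if "k < N" for k
      using that Suc.prems mat_cstar_entry[OF gen_mat_closed] mat_cstar_entry[OF Pc] by auto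
    have term_zero: "P p (i, k) \<otimes> x (k, j) = \<zero>" if "k < N" "k < i + p \<or> j \<le> k" for k
      using Suc.IH[of i k] Suc.prems that xz xc by auto
    have "P (Suc p) (i, j) = \<zero>" if "j < i + Suc p"
    proof -
      have "(\<Oplus>k\<in>{..<N}. P p (i, k) \<otimes> x (k, j)) = (\<Oplus>k\<in>{..<N}. \<zero>)"
        using that by (intro finsum_cong' refl term_zero) auto
      then show ?thesis by (simp add: ent)
    qed
    moreover have "P (Suc p) (i, j) = \<one>" if j: "j = i + Suc p"
    proof -
      have "(\<Oplus>k\<in>{..<N}. P p (i, k) \<otimes> x (k, j)) = P p (i, i + p) \<otimes> x (i + p, j)"
        using j Suc.prems xc by (intro finsum_single_index term_zero) auto
      also have "\<dots> = \<one>"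
        using Suc.IH[of i "i + p"] Suc.prems j by (simp add: gen_mat_apply)
      finally show ?thesis by (simp only: ent)
    qed
    ultimately show ?case by blast
  qed
  define n where "n = m + 3"
  have N: "N = Suc n" by (simp add: n_def)
  have "P n = e 0 n"
  proof (rule mat_cstar_eqI[OF Pc e_closed])
    fix i j assume "i < N" "j < N"
    then show "P n (i, j) = e 0 n (i, j)"
      using P_entries[of i j n] unfolding e_def by (cases "i = 0 \<and> j = n") (auto simp: elem_mat_apply N)
  qed
  then have e0n: "e 0 n \<in> D" using PD[of n] by simp
  then have en0: "e n 0 \<in> D" using D(7) e_star by metis
  have e00: "e 0 0 \<in> D" using D(5)[OF e0n en0] e_mult[of n 0 0] by (simp add: N)
  have enn: "e n n \<in> D" using D(5)[OF en0 e0n] e_mult[of 0 n n] by simp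
  have xe: "(x \<otimes>\<^bsub>M\<^esub> e k k) (p, q) = (if q = k then x (p, k) else \<zero>)" if "k < N" "p < N" "q < N" for k p q
    unfolding e_def using that mult_elem_mat_apply[OF one_closed gen_mat_closed] mat_cstar_entry[OF gen_mat_closed, of p k]
    by simp
  have xec: "x \<otimes>\<^bsub>M\<^esub> e k k \<in> carrier M" for k using gen_mat_closed e_closed by simp
  have step: "e k (Suc k) \<in> D" if k: "e (Suc k) (Suc k) \<in> D" "0 < k" "Suc k < N" for k
  proof -
    let ?y = "x \<otimes>\<^bsub>M\<^esub> e (Suc k) (Suc k)"
    have "?y \<oplus>\<^bsub>M\<^esub> (-1) \<odot>\<^bsub>M\<^esub> (e 0 0 \<otimes>\<^bsub>M\<^esub> ?y) = e k (Suc k)"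
    proof (rule mat_cstar_eqI[of _ N A])
      fix p q assume pq: "p < N" "q < N"
      have "(e 0 0 \<otimes>\<^bsub>M\<^esub> ?y) (p, q) = (if p = 0 then ?y (0, q) else \<zero>)"
        unfolding e_def[of 0] using pq elem_mat_mult_apply[OF one_closed xec, of 0 p q] mat_cstar_entry[OF xec, of 0 q]
        by simp
      then show "(?y \<oplus>\<^bsub>M\<^esub> (-1) \<odot>\<^bsub>M\<^esub> (e 0 0 \<otimes>\<^bsub>M\<^esub> ?y)) (p, q) = e k (Suc k) (p, q)"
        using pq k mat_cstar_entry[OF gen_mat_closed, of p "Suc k"] unfolding e_def[of k]
        by (auto simp: mat_cstar_apply(4,5) xe elem_mat_apply gen_mat_apply)
    qed (use xec e_closed in \<open>auto simp: mat_closed\<close>)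
    moreover have "?y \<oplus>\<^bsub>M\<^esub> (-1) \<odot>\<^bsub>M\<^esub> (e 0 0 \<otimes>\<^bsub>M\<^esub> ?y) \<in> D"
      by (intro D(3-6) k(1) e00)
    ultimately show ?thesis by simp
  qed
  have diag: "0 < k \<Longrightarrow> k \<le> n \<Longrightarrow> e k k \<in> D" for k
  proof (induction "n - k" arbitrary: k)
    case 0
    then show ?case using enn by simp
  next
    case (Suc d)
    then have "e (Suc k) (Suc k) \<in> D" by simp
    then have up: "e k (Suc k) \<in> D" using Suc by (intro step) (auto simp: N)
    then have "e k (Suc k) \<otimes>\<^bsub>M\<^esub> star M (e k (Suc k)) \<in> D" by (intro D(5,7))
    moreover have "e k (Suc k) \<otimes>\<^bsub>M\<^esub> star M (e k (Suc k)) = e k k"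
      unfolding e_star using Suc by (intro e_mult) (simp add: N)
    ultimately show ?case by simp
  qed
  have first: "e 0 (Suc k) \<in> D" if "Suc k \<le> n" for k
    using that
  proof (induction k)
    case 0
    have "x \<otimes>\<^bsub>M\<^esub> e 1 1 = e 0 1"
    proof (rule mat_cstar_eqI[OF xec e_closed])
      fix p q assume pq: "p < N" "q < N"
      then show "(x \<otimes>\<^bsub>M\<^esub> e 1 1) (p, q) = e 0 1 (p, q)"
        unfolding e_def[of 0] by (auto simp: xe elem_mat_apply gen_mat_apply)
    qed
    moreover have "x \<otimes>\<^bsub>M\<^esub> e 1 1 \<in> D" by (intro D(3,5) diag[of 1]) (use 0 in auto)
    ultimately show ?case by simp
  next
    case (Suc k)
    have "e (Suc k) (Suc (Suc k)) \<in> D" using Suc.prems by (intro step diag) (auto simp: N)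
    then have "e 0 (Suc k) \<otimes>\<^bsub>M\<^esub> e (Suc k) (Suc (Suc k)) \<in> D" using Suc by (intro D(5)) auto
    then show ?case using Suc.prems e_mult[of "Suc k" 0 "Suc (Suc k)"] by (simp add: N)
  qed
  have e0: "e 0 k \<in> D" if "k < N" for k
    using e00 first[of "k - 1"] that by (cases k) (auto simp: N)
  have eD: "e i j \<in> D" if "i < N" "j < N" for i j
  proof -
    have "star M (e 0 i) \<otimes>\<^bsub>M\<^esub> e 0 j \<in> D" by (intro D(5,7) e0 that)
    then show ?thesis using e_mult[of 0 i j] by (simp add: e_star)
  qed
  have gl: "g l \<in> carrier A" by (rule g[OF l])
  have "e 0 0 \<otimes>\<^bsub>M\<^esub> (x \<otimes>\<^bsub>M\<^esub> e (l + 2) (l + 2)) = elem_mat N A 0 (l + 2) (g l)"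
  proof (rule mat_cstar_eqI[of _ N A])
    fix p q assume pq: "p < N" "q < N"
    have "(e 0 0 \<otimes>\<^bsub>M\<^esub> (x \<otimes>\<^bsub>M\<^esub> e (l + 2) (l + 2))) (p, q) = (if p = 0 then (x \<otimes>\<^bsub>M\<^esub> e (l + 2) (l + 2)) (0, q) else \<zero>)"
      unfolding e_def[of 0] using pq elem_mat_mult_apply[OF one_closed xec, of 0 p q] mat_cstar_entry[OF xec, of 0 q]
      by simp
    then show "(e 0 0 \<otimes>\<^bsub>M\<^esub> (x \<otimes>\<^bsub>M\<^esub> e (l + 2) (l + 2))) (p, q) = elem_mat N A 0 (l + 2) (g l) (p, q)"
      using pq l by (auto simp: xe elem_mat_apply gen_mat_apply)
  qed (use xec e_closed gl in \<open>auto simp: mat_closed elem_mat_closed\<close>)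
  moreover have "e 0 0 \<otimes>\<^bsub>M\<^esub> (x \<otimes>\<^bsub>M\<^esub> e (l + 2) (l + 2)) \<in> D"
    using eD[of 0 0] eD[of "l + 2" "l + 2"] D(3,5) l by simp
  ultimately have g0: "elem_mat N A 0 (l + 2) (g l) \<in> D" by simp
  have gi: "elem_mat N A i i (g l) \<in> D" if i: "i < N" for i
  proof -
    have "e i 0 \<otimes>\<^bsub>M\<^esub> elem_mat N A 0 (l + 2) (g l) \<otimes>\<^bsub>M\<^esub> e (l + 2) i \<in> D"
      by (intro D(5) eD g0) (use i l in auto)
    then show ?thesis using i l gl by (simp add: e_def elem_mat_mult)
  qed
  \<comment> \<open>The diagonal matrix of \<open>g l\<close> truncated to the first \<open>s\<close> places, as a sum of entries already obtained.\<close>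
  define Q where "Q s = (\<lambda>(p, q)\<in>{..<N} \<times> {..<N}. if p = q \<and> p < s then g l else \<zero>)" for s
  have Qc: "Q s \<in> carrier M" for s using gl by (auto simp: Q_def mat_cstar_carrier)
  have "s \<le> N \<Longrightarrow> Q s \<in> D" for s
  proof (induction s)
    case 0
    have "Q 0 = 0 \<odot>\<^bsub>M\<^esub> \<one>\<^bsub>M\<^esub>"
      by (rule mat_cstar_eqI[OF Qc]) (auto simp: mat_closed mat_cstar_apply Q_def)
    then show ?case using D(6)[OF D(2), of 0] by simp
  next
    case (Suc s)
    have "Q (Suc s) = Q s \<oplus>\<^bsub>M\<^esub> elem_mat N A s s (g l)"
      by (rule mat_cstar_eqI[OF Qc]) (use gl Qc in \<open>auto simp: mat_closed elem_mat_closed mat_cstar_apply Q_def elem_mat_apply\<close>)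
    then show ?case using Suc gi[of s] D(4) by simp
  qed
  moreover have "Q N = diag_mat N A (g l)"
    by (rule mat_cstar_eqI[OF Qc]) (use gl in \<open>auto simp: diag_mat_closed Q_def diag_mat_apply\<close>)
  ultimately show ?thesis by (metis order_refl)
qed

end


section \<open>From a lift on the operator system to a lift on the algebra\<close>

context unital_star_algebra
begin

lemma gram_cone_sum:
  "X \<in> gram_cone A \<Longrightarrow> \<exists>(L::nat) U. (\<forall>l<L. U l \<in> fin_col A) \<and>
    (\<forall>t t'. X (t, t') = (\<Oplus>l\<in>{..<L}. star A (U l t) \<otimes> U l t'))"
proof (induction rule: gram_cone.induct)
  case zero
  show ?case by (intro exI[of _ 0]) simp
next
  case (add X u)
  from add.IH obtain L U where U': "\<forall>l<(L::nat). U l \<in> fin_col A"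
    "\<forall>t t'. X (t, t') = (\<Oplus>l\<in>{..<L}. star A (U l t) \<otimes> U l t')" by (elim exE conjE)
  note U = U'[rule_format]
  define V where "V = U(L := u)"
  have Vc: "V l t \<in> carrier A" if "l < Suc L" for l t
    using U(1)[of l] add.hyps(2) that by (cases "l = L") (auto simp: V_def fin_col_iff)
  have "X (t, t') \<oplus> outer A u u (t, t') = (\<Oplus>l\<in>{..<Suc L}. star A (V l t) \<otimes> V l t')" for t t'
  proof -
    have "(\<Oplus>l\<in>{..<Suc L}. star A (V l t) \<otimes> V l t')
        = star A (V L t) \<otimes> V L t' \<oplus> (\<Oplus>l\<in>{..<L}. star A (V l t) \<otimes> V l t')"
      unfolding lessThan_Suc using Vc by (intro finsum_insert) auto
    also have "(\<Oplus>l\<in>{..<L}. star A (V l t) \<otimes> V l t') = X (t, t')"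
      unfolding U(2) using U(1) by (intro finsum_cong') (auto simp: V_def fin_col_iff)
    finally show ?thesis
      using gram_cone_entry[OF add.hyps(1)] Vc[of L] by (simp add: outer_def V_def a_comm)
  qed
  moreover have "V l \<in> fin_col A" if "l < Suc L" for l
    using U(1)[of l] add.hyps(2) that by (cases "l = L") (auto simp: V_def)
  ultimately show ?case by (intro exI[of _ "Suc L"] exI[of _ V]) auto
qed

lemma mat_finsum_apply:
  assumes "finite I" "\<And>l. l \<in> I \<Longrightarrow> F l \<in> carrier (mat_cstar N A)" "i < N" "j < N"
  shows "(\<Oplus>\<^bsub>mat_cstar N A\<^esub>l\<in>I. F l) (i, j) = (\<Oplus>l\<in>I. F l (i, j))"
  using assms(1,2)
proof (induction I rule: finite_induct)
  interpret M: ring "mat_cstar N A" by (rule mat_ring)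
  case empty
  then show ?case using assms(3,4) by (simp add: mat_cstar_apply)
next
  interpret M: ring "mat_cstar N A" by (rule mat_ring)
  case (insert l I)
  have "(\<Oplus>\<^bsub>mat_cstar N A\<^esub>l\<in>insert l I. F l) = F l \<oplus>\<^bsub>mat_cstar N A\<^esub> (\<Oplus>\<^bsub>mat_cstar N A\<^esub>l\<in>I. F l)"
    using insert by (intro M.finsum_insert) auto
  moreover have "(\<Oplus>l\<in>insert l I. F l (i, j)) = F l (i, j) \<oplus> (\<Oplus>l\<in>I. F l (i, j))"
    using insert.hyps insert.prems assms(3,4) by (intro finsum_insert) (auto intro: mat_cstar_entry)
  ultimately show ?case
    using insert assms(3,4) by (simp add: mat_cstar_apply)
qed

text \<open>A sum of squares of rows indexed by vectors, restricted to a finite set \<open>Z\<close> of them, is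
  the upper left block of the square of one square matrix, whose size is the number of vectors
  plus the number of summands. Complete positivity of \<open>\<psi>\<close> at this size gives a square again, and
  its quadratic form is nonnegative. Indices are reduced modulo \<open>N\<close> so that every natural number
  names a row.\<close>

lemma ucp_gram_cone_nonneg:
  fixes \<psi> :: "'a \<Rightarrow> nat \<times> nat \<Rightarrow> 'h::chilbert_space \<Rightarrow>\<^sub>L 'h" and Z :: "(nat \<times> 'h) set"
  assumes S: "operator_subsystem A S" and \<psi>: "ucp_map A S (mat_cstar N bounded_ops) \<psi>" and N: "0 < N"
    and X: "X \<in> gram_cone A" "range X \<subseteq> S" and Z: "finite Z"
  shows "(\<Sum>t\<in>Z. \<Sum>u\<in>Z. cinner (snd t) (blinfun_apply (\<psi> (X (t, u)) (fst t mod N, fst u mod N)) (snd u))) \<in> \<real>\<^sub>\<ge>\<^sub>0"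
proof -
  note SD = operator_subsystemD[OF S]
  let ?B = "bounded_ops :: ('h \<Rightarrow>\<^sub>L 'h) cstar"
  interpret B: unital_star_algebra ?B by (rule bounded_ops_star_algebra)
  interpret BM: unital_star_algebra "mat_cstar N ?B" by (rule B.mat_star_algebra)
  from gram_cone_sum[OF X(1)] obtain L U where U': "\<forall>l<(L::nat). U l \<in> fin_col A"
    "\<forall>t t'. X (t, t') = (\<Oplus>l\<in>{..<L}. star A (U l t) \<otimes> U l t')" by (elim exE conjE)
  note U = U'[rule_format]
  have Uc: "U l t \<in> carrier A" if "l < L" for l t using U(1)[OF that] by (simp add: fin_col_iff)
  define z where "z = card Z"
  obtain h where h: "bij_betw h {..<z} Z"
    using ex_bij_betw_nat_finite[OF Z] unfolding z_def atLeast0LessThan by blast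
  define k where "k = z + L"
  define V where "V = (\<lambda>(l, q)\<in>{..<k} \<times> {..<k}. if l < L \<and> q < z then U l (h q) else \<zero>)"
  define Y where "Y = (\<lambda>(p, q)\<in>{..<k} \<times> {..<k}. if p < z \<and> q < z then X (h p, h q) else \<zero>)"
  have V: "V \<in> carrier (mat_cstar k A)" using Uc by (auto simp: V_def mat_cstar_carrier)
  have V_apply: "V (l, q) = (if l < L \<and> q < z then U l (h q) else \<zero>)" if "l < k" "q < k" for l q
    using that by (simp add: V_def)
  have Xc: "X p \<in> carrier A" for p by (rule gram_cone_entry[OF X(1)])
  have YS: "Y \<in> mat_carrier k S" using X(2) SD(2) by (auto simp: Y_def mat_carrier_def image_subset_iff)
  have "Y = star (mat_cstar k A) V \<otimes>\<^bsub>mat_cstar k A\<^esub> V"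
  proof (rule mat_cstar_eqI[of _ k A])
    show "Y \<in> carrier (mat_cstar k A)" using Xc by (auto simp: Y_def mat_cstar_carrier)
    show "star (mat_cstar k A) V \<otimes>\<^bsub>mat_cstar k A\<^esub> V \<in> carrier (mat_cstar k A)"
      by (intro mat_closed V)
    fix p q assume pq: "p < k" "q < k"
    show "Y (p, q) = (star (mat_cstar k A) V \<otimes>\<^bsub>mat_cstar k A\<^esub> V) (p, q)"
    proof (cases "p < z \<and> q < z")
      case True
      have "X (h p, h q) = (\<Oplus>l\<in>{..<L}. star A (U l (h p)) \<otimes> U l (h q))" by (rule U(2))
      also have "\<dots> = (\<Oplus>l\<in>{..<k}. star (mat_cstar k A) V (p, l) \<otimes> V (l, q))"
        using True pq Uc by (intro add.finprod_mono_neutral_cong_left) (auto simp: k_def V_apply mat_cstar_apply)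
      finally show ?thesis using True pq by (simp add: Y_def mat_cstar_apply)
    next
      case False
      have "(\<Oplus>l\<in>{..<k}. star (mat_cstar k A) V (p, l) \<otimes> V (l, q)) = (\<Oplus>l\<in>{..<k}. \<zero>)"
        using False pq Uc by (intro finsum_cong') (auto simp: V_apply mat_cstar_apply)
      then show ?thesis using False pq by (auto simp: Y_def mat_cstar_apply)
    qed
  qed
  then have "Y \<in> mat_carrier k S \<inter> positive_cone (mat_cstar k A)"
    using YS V by (auto simp: positive_cone_def)
  then have "mat_map k \<psi> Y \<in> positive_cone (mat_cstar k (mat_cstar N ?B))"
    using \<psi> by (auto simp: ucp_map_def)
  then obtain D where D: "D \<in> carrier (mat_cstar k (mat_cstar N ?B))"
    "mat_map k \<psi> Y = star (mat_cstar k (mat_cstar N ?B)) D \<otimes>\<^bsub>mat_cstar k (mat_cstar N ?B)\<^esub> D"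
    by (auto simp: positive_cone_def)
  have Dc: "D (l, q) \<in> carrier (mat_cstar N ?B)" if "l < k" "q < k" for l q
    using mat_cstar_entry[OF D(1)] that by blast
  have Db: "D (l, q) (r, i) \<in> bounded_clinear_ops" if "l < k" "q < k" "r < N" "i < N" for l q r i
    using mat_cstar_entry[OF Dc] that by simp
  define ix where "ix p = fst (h p) mod N" for p
  define v where "v p = snd (h p)" for p
  have ix: "ix p < N" for p using N by (simp add: ix_def)
  have entry: "\<psi> (X (h p, h q)) (ix p, ix q)
      = (\<Sum>l<k. \<Sum>r<N. adjoint_op (D (l, p) (r, ix p)) o\<^sub>L D (l, q) (r, ix q))" if pq: "p < z" "q < z" for p q
  proof -
    have pk: "p < k" "q < k" using pq by (simp_all add: k_def)
    have "\<psi> (X (h p, h q)) = mat_map k \<psi> Y (p, q)"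
      using pq pk by (simp add: mat_map_def Y_def)
    also have "\<dots> = (\<Oplus>\<^bsub>mat_cstar N ?B\<^esub>l\<in>{..<k}. star (mat_cstar N ?B) (D (l, p)) \<otimes>\<^bsub>mat_cstar N ?B\<^esub> D (l, q))"
      unfolding D(2) using pk Dc
      by (simp add: mat_cstar_apply(1)) (intro BM.finsum_cong', auto simp: mat_cstar_apply(6))
    finally have "\<psi> (X (h p, h q)) (ix p, ix q)
        = (\<Oplus>\<^bsub>mat_cstar N ?B\<^esub>l\<in>{..<k}. star (mat_cstar N ?B) (D (l, p)) \<otimes>\<^bsub>mat_cstar N ?B\<^esub> D (l, q)) (ix p, ix q)"
      by simp
    also have "\<dots> = (\<Oplus>\<^bsub>?B\<^esub>l\<in>{..<k}. (star (mat_cstar N ?B) (D (l, p)) \<otimes>\<^bsub>mat_cstar N ?B\<^esub> D (l, q)) (ix p, ix q))"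
      using Dc pk ix by (intro B.mat_finsum_apply) auto
    also have "\<dots> = (\<Sum>l<k. (star (mat_cstar N ?B) (D (l, p)) \<otimes>\<^bsub>mat_cstar N ?B\<^esub> D (l, q)) (ix p, ix q))"
    proof (rule bounded_ops_finsum)
      fix l assume "l \<in> {..<k}"
      then have "star (mat_cstar N ?B) (D (l, p)) \<otimes>\<^bsub>mat_cstar N ?B\<^esub> D (l, q) \<in> carrier (mat_cstar N ?B)"
        using Dc pk by auto
      then show "(star (mat_cstar N ?B) (D (l, p)) \<otimes>\<^bsub>mat_cstar N ?B\<^esub> D (l, q)) (ix p, ix q) \<in> bounded_clinear_ops"
        using mat_cstar_entry[of _ N ?B "ix p" "ix q"] ix by simp
    qed simp
    also have "\<dots> = (\<Sum>l<k. \<Sum>r<N. adjoint_op (D (l, p) (r, ix p)) o\<^sub>L D (l, q) (r, ix q))"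
    proof (rule sum.cong[OF refl])
      fix l assume l: "l \<in> {..<k}"
      have "(\<Oplus>\<^bsub>?B\<^esub>r\<in>{..<N}. star (mat_cstar N ?B) (D (l, p)) (ix p, r) \<otimes>\<^bsub>?B\<^esub> D (l, q) (r, ix q))
          = (\<Oplus>\<^bsub>?B\<^esub>r\<in>{..<N}. adjoint_op (D (l, p) (r, ix p)) o\<^sub>L D (l, q) (r, ix q))"
        using l pk ix Db by (intro B.finsum_cong')
          (auto simp: mat_cstar_apply(6) intro!: bounded_clinear_ops_closed adjoint_op_closed)
      also have "\<dots> = (\<Sum>r<N. adjoint_op (D (l, p) (r, ix p)) o\<^sub>L D (l, q) (r, ix q))"
        using l pk ix Db by (intro bounded_ops_finsum) (auto intro!: bounded_clinear_ops_closed adjoint_op_closed)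
      finally show "(star (mat_cstar N ?B) (D (l, p)) \<otimes>\<^bsub>mat_cstar N ?B\<^esub> D (l, q)) (ix p, ix q)
          = (\<Sum>r<N. adjoint_op (D (l, p) (r, ix p)) o\<^sub>L D (l, q) (r, ix q))"
        using ix by (simp add: mat_cstar_apply(1))
    qed
    finally show ?thesis .
  qed
  define w where "w l r = (\<Sum>p<z. blinfun_apply (D (l, p) (r, ix p)) (v p))" for l r
  have "(\<Sum>t\<in>Z. \<Sum>u\<in>Z. cinner (snd t) (blinfun_apply (\<psi> (X (t, u)) (fst t mod N, fst u mod N)) (snd u)))
      = (\<Sum>p<z. \<Sum>q<z. cinner (v p) (blinfun_apply (\<psi> (X (h p, h q)) (ix p, ix q)) (v q)))"
    unfolding v_def ix_def by (simp add: sum.reindex_bij_betw[OF h, symmetric])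
  also have "\<dots> = (\<Sum>p<z. \<Sum>q<z. \<Sum>l<k. \<Sum>r<N.
      cinner (blinfun_apply (D (l, p) (r, ix p)) (v p)) (blinfun_apply (D (l, q) (r, ix q)) (v q)))"
    using ix Db by (intro sum.cong refl) (auto simp: entry blinfun.sum_left cinner_sum_right cinner_adjoint_right k_def)
  also have "\<dots> = (\<Sum>l<k. \<Sum>r<N. \<Sum>p<z. \<Sum>q<z.
      cinner (blinfun_apply (D (l, p) (r, ix p)) (v p)) (blinfun_apply (D (l, q) (r, ix q)) (v q)))"
  proof -
    have swap: "(\<Sum>p<z. \<Sum>q<z. \<Sum>l<k. \<Sum>r<N. f p q l r) = (\<Sum>l<k. \<Sum>r<N. \<Sum>p<z. \<Sum>q<z. f p q l r)"
      for f :: "nat \<Rightarrow> nat \<Rightarrow> nat \<Rightarrow> nat \<Rightarrow> complex"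
    proof -
      have cycle: "(\<Sum>q<z. \<Sum>l<k. \<Sum>r<N. g q l r) = (\<Sum>l<k. \<Sum>r<N. \<Sum>q<z. g q l r)"
        for g :: "nat \<Rightarrow> nat \<Rightarrow> nat \<Rightarrow> complex"
        by (subst sum.swap) (intro sum.cong refl sum.swap)
      have "(\<Sum>p<z. \<Sum>q<z. \<Sum>l<k. \<Sum>r<N. f p q l r) = (\<Sum>p<z. \<Sum>l<k. \<Sum>r<N. \<Sum>q<z. f p q l r)"
        by (intro sum.cong refl cycle)
      then show ?thesis using cycle[of "\<lambda>p l r. \<Sum>q<z. f p q l r"] by simp
    qed
    show ?thesis by (rule swap)
  qed
  also have "\<dots> = (\<Sum>l<k. \<Sum>r<N. cinner (w l r) (w l r))"
    by (intro sum.cong refl) (simp add: w_def cinner_sum_left cinner_sum_right, rule sum.swap)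
  also have "\<dots> \<in> \<real>\<^sub>\<ge>\<^sub>0"
    unfolding cinner_self of_real_sum[symmetric] nonneg_Reals_of_real_iff by (intro sum_nonneg) auto
  finally show ?thesis .
qed

end

lemma sum_in_nonneg_Reals:
  assumes "\<And>i. i \<in> I \<Longrightarrow> f i \<in> \<real>\<^sub>\<ge>\<^sub>0"
  shows "(\<Sum>i\<in>I. f i :: complex) \<in> \<real>\<^sub>\<ge>\<^sub>0"
  using assms by (induction I rule: infinite_finite_induct) (auto intro: nonneg_Reals_add_I)

lemma kernel_form_sum_kernel:
  "kernel_form (\<lambda>x y. \<Sum>l\<in>I. K l x y) v w = (\<Sum>l\<in>I. kernel_form (K l) v w)"
proof (induction I rule: infinite_finite_induct)
  case (infinite I)
  then show ?case using kernel_form_scale_kernel[of 0 "\<lambda>_ _. 0" v w] by simp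
next
  case empty
  then show ?case using kernel_form_scale_kernel[of 0 "\<lambda>_ _. 0" v w] by simp
next
  case (insert l I)
  then show ?case by (simp add: kernel_form_add_kernel)
qed

context lifted_kernel
begin

text \<open>The Schwarz gaps of \<open>x\<close> and of \<open>x\<^sup>*\<close> are nonnegative, and their sum is the quadratic form
  of the operator \<open>?L\<close> below, the difference of two lifts of the same element and hence compact.
  So the gap of \<open>x\<close> alone is bounded by a compact operator.\<close>

lemma mult_domainI_system:
  assumes x: "x \<in> carrier M"
    and lifts: "\<And>s i j. s \<in> {x, star M x, star M x \<otimes>\<^bsub>M\<^esub> x \<oplus>\<^bsub>M\<^esub> x \<otimes>\<^bsub>M\<^esub> star M x} \<Longrightarrow> i < N \<Longrightarrow> j < N \<Longrightarrow>
      K.compr s i j \<in> R (s (i, j))"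
  shows "x \<in> mult_domain"
proof -
  let ?y = "star M x \<otimes>\<^bsub>M\<^esub> x \<oplus>\<^bsub>M\<^esub> x \<otimes>\<^bsub>M\<^esub> star M x"
  have sx: "star M x \<in> carrier M" and y: "?y \<in> carrier M" using x by auto
  have "K.mult_defect c x i j \<in> compact_ops" if c: "c \<in> carrier M" and ij: "i < N" "j < N" for c i j
  proof -
    define T where "T s = (\<Sum>k<N. adjoint_op (K.compr s k j) o\<^sub>L K.compr s k j)" for s
    have T: "T s \<in> R ((star M s \<otimes>\<^bsub>M\<^esub> s) (j, j))" if s: "s \<in> carrier M" "s \<in> {x, star M x}" for s
    proof -
      have e: "s (k, j) \<in> carrier A" if "k < N" for k using mat_cstar_entry[OF s(1) that ij(2)] .
      have "(\<Sum>k<N. adjoint_op (K.compr s k j) o\<^sub>L K.compr s k j) \<in> R (\<Oplus>k\<in>{..<N}. star A (s (k, j)) \<otimes> s (k, j))"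
        using e lifts s(2) ij by (intro lift_finsum lift_mult lift_star) (auto intro: star_closed)
      also have "(\<Oplus>k\<in>{..<N}. star A (s (k, j)) \<otimes> s (k, j)) = (star M s \<otimes>\<^bsub>M\<^esub> s) (j, j)"
        using ij e by (simp add: mat_cstar_apply) (intro finsum_cong', auto simp: mat_cstar_apply star_closed)
      finally show ?thesis by (simp add: T_def)
    qed
    have sq: "(star M x \<otimes>\<^bsub>M\<^esub> x) (j, j) \<in> carrier A" "(x \<otimes>\<^bsub>M\<^esub> star M x) (j, j) \<in> carrier A"
      by (rule mat_cstar_entry[OF K.m_closed[OF sx x] ij(2) ij(2)])
        (rule mat_cstar_entry[OF K.m_closed[OF x sx] ij(2) ij(2)])
    have "T x + T (star M x) \<in> R (?y (j, j))"
      using T[OF x] T[OF sx] sq x ij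
      unfolding mat_cstar_apply(4)[OF ij(2) ij(2)] by (intro lift_add) (auto simp: K.star_star)
    then have L: "K.compr ?y j j - (T x + T (star M x)) \<in> compact_ops" (is "?L \<in> _")
      using lift_iff[OF mat_cstar_entry[OF y ij(2) ij(2)], of "T x + T (star M x)" "K.compr ?y j j"]
        lifts[of ?y j j] ij(2) by simp
    have quad: "cinner \<eta> (blinfun_apply (T s) \<eta>) = complex_of_real (\<Sum>k<N. (norm (blinfun_apply (K.compr s k j) \<eta>))\<^sup>2)"
      if "s \<in> carrier M" for s \<eta>
      unfolding T_def of_real_sum cinner_self[symmetric] blinfun.sum_left cinner_sum_right
      by (intro sum.cong refl) (use that ij in \<open>simp add: cinner_adjoint_right[OF K.compr_closed]\<close>)
    have "K.schwarz_gap x j \<eta> \<le> norm \<eta> * norm (blinfun_apply ?L \<eta>)" for \<eta>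
    proof -
      have "\<tau> ?y (j, \<eta>) (j, \<eta>) = \<tau> (star M x \<otimes>\<^bsub>M\<^esub> x) (j, \<eta>) (j, \<eta>) + \<tau> (x \<otimes>\<^bsub>M\<^esub> star M x) (j, \<eta>) (j, \<eta>)"
        using x sx by (intro K.tau_add) auto
      then have "cinner \<eta> (blinfun_apply ?L \<eta>) = \<tau> (star M x \<otimes>\<^bsub>M\<^esub> x) (j, \<eta>) (j, \<eta>) + \<tau> (x \<otimes>\<^bsub>M\<^esub> star M x) (j, \<eta>) (j, \<eta>)
          - (cinner \<eta> (blinfun_apply (T x) \<eta>) + cinner \<eta> (blinfun_apply (T (star M x)) \<eta>))"
        using y ij by (simp add: blinfun.diff_left blinfun.add_left cinner_diff_right cinner_add_right K.cinner_compr)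
      then have "Re (cinner \<eta> (blinfun_apply ?L \<eta>)) = K.schwarz_gap x j \<eta> + K.schwarz_gap (star M x) j \<eta>"
        using x sx by (simp add: K.schwarz_gap_def quad K.star_star)
      moreover have "0 \<le> K.schwarz_gap (star M x) j \<eta>"
        using K.schwarz_gap_nonneg[OF K.one_closed sx ij(2,2), of 1 "\<zero>\<^bsub>M\<^esub>"] K.sos.zero by (simp add: K.smult_one)
      ultimately have "K.schwarz_gap x j \<eta> \<le> Re (cinner \<eta> (blinfun_apply ?L \<eta>))" by simp
      also have "\<dots> \<le> norm \<eta> * norm (blinfun_apply ?L \<eta>)"
        using complex_Re_le_cmod cmod_cinner_le order_trans by blast
      finally show ?thesis .
    qed
    then show ?thesis by (rule compact_defectI[OF x c ij L])
  qed
  then show ?thesis using x lifts by (auto simp: mult_domain_def)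
qed

text \<open>The corner \<open>a \<mapsto> \<Psi>(diag a)\<^sub>0\<^sub>0\<close> of the extended map is the lift. The kernel makes it map a
  positive matrix to an operator matrix with nonnegative quadratic form, which
  \<open>psd_operator_matrix_factor\<close> factors as a square.\<close>

lemma ucp_corner:
  fixes e :: "nat \<Rightarrow> 'h"
  assumes N: "0 < N"
    and e: "\<And>i j. cinner (e i) (e j) = (if i = j then 1 else 0)"
    and sep: "separable_space (euclidean :: 'h topology)"
  shows "ucp_map A (carrier A) bounded_ops (\<lambda>a. K.compr (diag_mat N A a) 0 0)"
proof -
  let ?\<phi> = "\<lambda>a. K.compr (diag_mat N A a) 0 0"
  let ?B = "bounded_ops :: ('h \<Rightarrow>\<^sub>L 'h) cstar"
  interpret B: unital_star_algebra ?B by (rule bounded_ops_star_algebra)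
  have \<phi>c: "?\<phi> a \<in> bounded_clinear_ops" if "a \<in> carrier A" for a
    using N S.diag_mat_closed[OF that] by (intro K.compr_closed)
  have diag_sum: "\<tau> (diag_mat N A (\<Oplus>l\<in>I. f l)) t u = (\<Sum>l\<in>I. \<tau> (diag_mat N A (f l)) t u)"
    if "finite I" "\<And>l. l \<in> I \<Longrightarrow> f l \<in> carrier A" for I :: "nat set" and f t u
    using that
  proof (induction I rule: finite_induct)
    case empty
    have "diag_mat N A \<zero> = \<zero>\<^bsub>M\<^esub>"
      using S.diag_mat_smult[OF one_closed, of N 0] S.diag_mat_closed[OF one_closed, of N] by simp
    then show ?case using K.tau_smult[OF K.zero_closed, of 0 t u] by simp
  next
    case (insert i I)
    have "(\<Oplus>l\<in>insert i I. f l) = f i \<oplus> (\<Oplus>l\<in>I. f l)" using insert by (intro finsum_insert) auto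
    then show ?case
      using insert by (simp add: S.diag_mat_hom K.tau_add S.diag_mat_closed)
  qed
  have cp: "mat_map k ?\<phi> X \<in> positive_cone (mat_cstar k ?B)"
    if X: "X \<in> mat_carrier k (carrier A) \<inter> positive_cone (mat_cstar k A)" for k X
  proof -
    obtain b where b: "b \<in> carrier (mat_cstar k A)" "X = star (mat_cstar k A) b \<otimes>\<^bsub>mat_cstar k A\<^esub> b"
      using X by (auto simp: positive_cone_def)
    define b' where "b' l i = (if i < k then b (l, i) else \<zero>)" for l i
    have b'c: "b' l i \<in> carrier A" if "l < k" for l i
      using mat_cstar_entry[OF b(1)] that by (simp add: b'_def)
    define T where "T i j = ?\<phi> (\<Oplus>l\<in>{..<k}. star A (b' l i) \<otimes> b' l j)" for i j
    have sc: "(\<Oplus>l\<in>{..<k}. star A (b' l i) \<otimes> b' l j) \<in> carrier A" for i j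
      using b'c by (auto intro!: finsum_closed simp: star_closed)
    have Tc: "T i j \<in> bounded_clinear_ops" for i j unfolding T_def by (intro \<phi>c sc)
    have "psd_kernel UNIV (\<lambda>(i, \<xi>) (j, \<eta>). cinner \<xi> (blinfun_apply (T i j) \<eta>))"
      unfolding psd_kernel_def
    proof (intro allI impI)
      fix v :: "(complex \<times> nat \<times> 'h) list"
      let ?d = "\<lambda>l (i, \<xi>). (diag_mat N A (b' l i), (0::nat, \<xi>))"
      have "cinner \<xi> (blinfun_apply (T i j) \<eta>)
          = (\<Sum>l<k. K.tau_kernel (?d l (i, \<xi>)) (?d l (j, \<eta>)))" for i j \<xi> \<eta>
      proof -
        have "cinner \<xi> (blinfun_apply (T i j) \<eta>)
            = (\<Sum>l<k. \<tau> (diag_mat N A (star A (b' l i) \<otimes> b' l j)) (0, \<xi>) (0, \<eta>))"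
          unfolding T_def using N S.diag_mat_closed[OF sc] b'c
          by (subst diag_sum[symmetric]) (auto simp: K.cinner_compr star_closed)
        also have "\<dots> = (\<Sum>l<k. K.tau_kernel (?d l (i, \<xi>)) (?d l (j, \<eta>)))"
          using b'c by (intro sum.cong refl) (simp add: S.diag_mat_hom S.diag_mat_star star_closed)
        finally show ?thesis .
      qed
      then have "kernel_form (\<lambda>(i, \<xi>) (j, \<eta>). cinner \<xi> (blinfun_apply (T i j) \<eta>)) v v
          = kernel_form (\<lambda>x y. \<Sum>l<k. K.tau_kernel (?d l x) (?d l y)) v v"
        by (intro kernel_form_cong) (auto simp: split_def)
      also have "\<dots> = (\<Sum>l<k. kernel_form K.tau_kernel (map (apsnd (?d l)) v) (map (apsnd (?d l)) v))"
        by (simp only: kernel_form_sum_kernel kernel_form_comp)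
      also have "\<dots> \<in> \<real>\<^sub>\<ge>\<^sub>0"
      proof (rule sum_in_nonneg_Reals)
        fix l assume "l \<in> {..<k}"
        then have "snd ` set (map (apsnd (?d l)) v) \<subseteq> carrier M \<times> UNIV"
          using b'c by (auto intro!: S.diag_mat_closed)
        then show "kernel_form K.tau_kernel (map (apsnd (?d l)) v) (map (apsnd (?d l)) v) \<in> \<real>\<^sub>\<ge>\<^sub>0"
          using K.tau_psd unfolding psd_kernel_def by blast
      qed
      finally show "kernel_form (\<lambda>(i, \<xi>) (j, \<eta>). cinner \<xi> (blinfun_apply (T i j) \<eta>)) v v \<in> \<real>\<^sub>\<ge>\<^sub>0" .
    qed
    then obtain C where C: "\<And>i. C i \<in> bounded_clinear_ops" "\<And>i j. T i j = adjoint_op (C i) o\<^sub>L C j"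
      using psd_operator_matrix_factor[OF e sep, of T] Tc by blast
    define c where "c = (\<lambda>(p, q)\<in>{..<k} \<times> {..<k}. if p = 0 then C q else 0)"
    have c: "c \<in> carrier (mat_cstar k ?B)"
      using C(1) by (auto simp: c_def mat_cstar_carrier bounded_clinear_ops_closed)
    have "mat_map k ?\<phi> X = star (mat_cstar k ?B) c \<otimes>\<^bsub>mat_cstar k ?B\<^esub> c"
    proof (rule mat_cstar_eqI[of _ k ?B])
      have Xc: "X (i, j) \<in> carrier A" if "i < k" "j < k" for i j
        using X that by (auto simp: mat_carrier_def)
      show "mat_map k ?\<phi> X \<in> carrier (mat_cstar k ?B)"
        using \<phi>c Xc by (auto simp: mat_map_def mat_cstar_carrier)
      show "star (mat_cstar k ?B) c \<otimes>\<^bsub>mat_cstar k ?B\<^esub> c \<in> carrier (mat_cstar k ?B)"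
        by (intro B.mat_closed c)
      fix i j assume ij: "i < k" "j < k"
      have bb: "(\<Oplus>l\<in>{..<k}. star (mat_cstar k A) b (i, l) \<otimes> b (l, j)) = (\<Oplus>l\<in>{..<k}. star A (b' l i) \<otimes> b' l j)"
        using ij mat_cstar_entry[OF b(1)] by (intro finsum_cong') (auto simp: mat_cstar_apply b'_def star_closed)
      have "(\<Oplus>\<^bsub>?B\<^esub>l\<in>{..<k}. star (mat_cstar k ?B) c (i, l) \<otimes>\<^bsub>?B\<^esub> c (l, j))
          = star (mat_cstar k ?B) c (i, 0) \<otimes>\<^bsub>?B\<^esub> c (0, j)"
        using ij C(1) by (intro B.finsum_single_index)
          (auto simp: mat_cstar_apply c_def intro!: bounded_clinear_ops_closed adjoint_op_closed blinfun_eqI)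
      also have "\<dots> = T i j"
        using ij by (simp add: C(2) mat_cstar_apply c_def)
      finally show "mat_map k ?\<phi> X (i, j) = (star (mat_cstar k ?B) c \<otimes>\<^bsub>mat_cstar k ?B\<^esub> c) (i, j)"
        using ij bb by (simp add: mat_map_def b(2) mat_cstar_apply(1) T_def)
    qed
    then show ?thesis using c by (auto simp: positive_cone_def)
  qed
  show ?thesis
    unfolding ucp_map_def module_hom_def
    using N \<phi>c cp
    by (auto simp: S.diag_mat_hom S.diag_mat_smult S.diag_mat_one K.compr_add K.compr_smult K.compr_one
        S.diag_mat_closed)
qed

end

text \<open>The values of a *-homomorphism into the Calkin algebra are cosets of compact operators,
  and their representatives are the lifts.\<close>

lemma calkin_map_iff: "S \<in> calkin_map T \<longleftrightarrow> S - T \<in> compact_ops"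
  by (auto simp: calkin_map_def a_r_coset_def' algebra_simps intro!: bexI[of _ "S - T"])

lemma calkin_hom_of_star_hom:
  fixes \<rho> :: "'a \<Rightarrow> ('h::chilbert_space \<Rightarrow>\<^sub>L 'h) set"
  assumes A: "unital_cstar_algebra A" and hom: "unital_star_hom A calkin \<rho>"
  shows "calkin_hom A \<rho>"
proof -
  interpret unital_cstar_algebra A by (rule A)
  have rh: "\<rho> \<in> Ring.ring_hom A calkin" and mh: "\<rho> \<in> module_hom (class_ring :: complex ring) A calkin"
    and st: "\<And>x. x \<in> carrier A \<Longrightarrow> \<rho> (star A x) = star calkin (\<rho> x)"
    using hom by (auto simp: unital_star_hom_def)
  have rep: "\<exists>T\<in>bounded_clinear_ops. \<rho> a = calkin_map T" if "a \<in> carrier A" for a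
    using ring_hom_closed[OF rh that]
    by (auto simp: calkin_def cstar_quotient_def A_RCOSETS_def' calkin_map_def)
  show ?thesis
  proof (intro calkin_hom.intro A calkin_hom_axioms.intro)
    show "\<exists>T. T \<in> \<rho> a" if "a \<in> carrier A" for a
      using rep[OF that] calkin_map_iff compact_ops_zero by (metis diff_self)
    show "T \<in> bounded_clinear_ops" if a: "a \<in> carrier A" and T: "T \<in> \<rho> a" for a T
    proof -
      obtain T0 where T0: "T0 \<in> bounded_clinear_ops" "\<rho> a = calkin_map T0" using rep[OF a] by blast
      then have "T - T0 \<in> bounded_clinear_ops"
        using T compact_ops_subset by (auto simp: calkin_map_iff)
      then show ?thesis using bounded_clinear_ops_closed(3)[OF _ T0(1), of "T - T0"] by simp
    qed
    show "(S \<in> \<rho> a) = (S - T \<in> compact_ops)" if a: "a \<in> carrier A" and aT: "T \<in> \<rho> a" for a T S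
    proof -
      obtain T0 where T0: "\<rho> a = calkin_map T0" using rep[OF a] by blast
      have T: "T - T0 \<in> compact_ops" using aT by (simp add: T0 calkin_map_iff)
      have "S - T0 \<in> compact_ops \<longleftrightarrow> S - T \<in> compact_ops"
        using compact_ops_add[OF _ T, of "S - T"] compact_ops_diff[OF _ T, of "S - T0"]
        by (auto simp: algebra_simps)
      then show ?thesis by (simp add: T0 calkin_map_iff)
    qed
    show "T + S \<in> \<rho> (a \<oplus>\<^bsub>A\<^esub> b)" if "a \<in> carrier A" "b \<in> carrier A" "T \<in> \<rho> a" "S \<in> \<rho> b" for a b T S
      using that ring_hom_add[OF rh that(1,2)] by (auto simp: calkin_def cstar_quotient_def set_add_def')
    show "T o\<^sub>L S \<in> \<rho> (a \<otimes>\<^bsub>A\<^esub> b)" if "a \<in> carrier A" "b \<in> carrier A" "T \<in> \<rho> a" "S \<in> \<rho> b" for a b T S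
    proof -
      have "T o\<^sub>L S \<in> calkin_map (T o\<^sub>L S)" by (simp add: calkin_map_iff compact_ops_zero)
      then show ?thesis
        using that ring_hom_mult[OF rh that(1,2)]
        by (auto simp: calkin_def cstar_quotient_def rcoset_mult_def calkin_map_def)
    qed
    show "scaleC_blinfun c T \<in> \<rho> (c \<odot>\<^bsub>A\<^esub> a)" if "a \<in> carrier A" "T \<in> \<rho> a" for a T c
    proof -
      have "scaleC_blinfun c T \<in> calkin_map (scaleC_blinfun c T)" by (simp add: calkin_map_iff compact_ops_zero)
      then show ?thesis
        using that module_hom_smult[OF mh _ that(1), of c]
        by (auto simp: calkin_def cstar_quotient_def calkin_map_def)
    qed
    show "adjoint_op T \<in> \<rho> (star A a)" if "a \<in> carrier A" "T \<in> \<rho> a" for a T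
      using that st by (auto simp: calkin_def cstar_quotient_def)
    show "id_blinfun \<in> \<rho> \<one>\<^bsub>A\<^esub>"
    proof -
      have "id_blinfun \<in> calkin_map (id_blinfun :: 'h \<Rightarrow>\<^sub>L 'h)" by (simp add: calkin_map_iff compact_ops_zero)
      then show ?thesis using ring_hom_one[OF rh] by (simp add: calkin_def cstar_quotient_def calkin_map_def)
    qed
  qed
qed

text \<open>The lift \<open>\<psi>\<close> is extended to a kernel \<open>\<tau>\<close> on all of \<open>M\<close>. Both \<open>x\<close> and \<open>x\<^sup>*\<close> lie in the
  multiplicative domain, whose selfadjoint part \<open>D\<close> is a unital *-algebra and so contains the
  diagonal matrices of all generators, hence of all of \<open>A\<close>.\<close>

theorem lift_of_system_lift:
  fixes A :: "'a cstar" and \<rho> :: "'a \<Rightarrow> ('h::chilbert_space \<Rightarrow>\<^sub>L 'h) set" and g :: "nat \<Rightarrow> 'a" and m :: nat and e :: "nat \<Rightarrow> 'h"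
  defines "M \<equiv> mat_cstar (m + 4) A" and "x \<equiv> gen_mat m A g"
  assumes hom: "calkin_hom A \<rho>"
    and gen: "cstar_generated A (g ` {..<m}) = carrier A" "\<And>k. k < m \<Longrightarrow> g k \<in> carrier A"
    and e: "\<And>i j. cinner (e i) (e j) = (if i = j then 1 else 0)"
    and sep: "separable_space (euclidean :: 'h topology)"
    and S: "operator_subsystem M S" "x \<in> S" "star M x \<in> S" "star M x \<otimes>\<^bsub>M\<^esub> x \<oplus>\<^bsub>M\<^esub> x \<otimes>\<^bsub>M\<^esub> star M x \<in> S"
    and lift: "has_ucp_lift M S (mat_cstar (m + 4) bounded_ops) (mat_map (m + 4) calkin_map) (mat_map (m + 4) \<rho>)"
  shows "has_ucp_lift A (carrier A) bounded_ops calkin_map \<rho>"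
proof -
  let ?N = "m + 4"
  let ?B = "bounded_ops :: ('h \<Rightarrow>\<^sub>L 'h) cstar"
  interpret calkin_hom A \<rho> by (rule hom)
  interpret G: single_generator A m g
    by (intro single_generator.intro single_generator_axioms.intro gen(2)) unfold_locales
  interpret MA: archimedean_star_algebra M unfolding M_def by (rule S.mat_archimedean)
  interpret B: unital_star_algebra ?B by (rule bounded_ops_star_algebra)
  note SD = operator_subsystemD[OF S(1)]
  obtain \<psi> where \<psi>: "ucp_map M S (mat_cstar ?N ?B) \<psi>"
    and \<psi>_lift: "\<And>s. s \<in> S \<Longrightarrow> mat_map ?N calkin_map (\<psi> s) = mat_map ?N \<rho> s"
    using lift by (auto simp: has_ucp_lift_def)
  have mh: "\<psi> \<in> module_hom (class_ring :: complex ring) (M\<lparr>carrier := S\<rparr>) (mat_cstar ?N ?B)"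
    using \<psi> by (simp add: ucp_map_def)
  have \<psi>R: "\<psi> s (i, j) \<in> \<rho> (s (i, j))" if "s \<in> S" "i < ?N" "j < ?N" for s i j
  proof -
    have "calkin_map (\<psi> s (i, j)) = \<rho> (s (i, j))"
      using fun_cong[OF \<psi>_lift[OF that(1)], of "(i, j)"] that by (simp add: mat_map_def)
    then show ?thesis using calkin_map_iff[of "\<psi> s (i, j)" "\<psi> s (i, j)"] compact_ops_zero by simp
  qed
  define \<sigma> where "\<sigma> s t u = cinner (snd t) (blinfun_apply (\<psi> s (fst t mod ?N, fst u mod ?N)) (snd u))"
    for s and t u :: "nat \<times> 'h"
  have "\<exists>\<tau>. (\<forall>x\<in>carrier M. \<forall>y\<in>carrier M. \<forall>t u. \<tau> (x \<oplus>\<^bsub>M\<^esub> y) t u = \<tau> x t u + \<tau> y t u) \<and>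
    (\<forall>x\<in>carrier M. \<forall>c t u. \<tau> (c \<odot>\<^bsub>M\<^esub> x) t u = c * \<tau> x t u) \<and>
    psd_kernel (carrier M \<times> UNIV) (\<lambda>(a, t) (b, u). \<tau> (star M a \<otimes>\<^bsub>M\<^esub> b) t u) \<and>
    (\<forall>x\<in>S. \<forall>t u. \<tau> x t u = \<sigma> x t u)"
  proof (rule MA.arveson_extension[OF S(1)])
    show "\<sigma> (s \<oplus>\<^bsub>M\<^esub> s') t u = \<sigma> s t u + \<sigma> s' t u" if "s \<in> S" "s' \<in> S" for s s' t u
      using module_hom_add[OF mh, of s s'] that
      by (simp add: \<sigma>_def mat_cstar_apply blinfun.add_left cinner_add_right)
    show "\<sigma> (c \<odot>\<^bsub>M\<^esub> s) t u = c * \<sigma> s t u" if "s \<in> S" for c s t u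
      using module_hom_smult[OF mh, of c s] that
      by (simp add: \<sigma>_def mat_cstar_apply scaleC_blinfun.rep_eq cinner_scaleC_right)
    show "(\<Sum>t\<in>Z. \<Sum>u\<in>Z. \<sigma> (X (t, u)) t u) \<in> \<real>\<^sub>\<ge>\<^sub>0"
      if "X \<in> gram_cone M" "range X \<subseteq> S" "finite Z" for X Z
      unfolding \<sigma>_def by (rule MA.ucp_gram_cone_nonneg[OF S(1) \<psi> _ that]) simp
  qed
  then obtain \<tau> where \<tau>': "\<forall>x\<in>carrier M. \<forall>y\<in>carrier M. \<forall>t u. \<tau> (x \<oplus>\<^bsub>M\<^esub> y) t u = \<tau> x t u + \<tau> y t u"
    "\<forall>x\<in>carrier M. \<forall>c t u. \<tau> (c \<odot>\<^bsub>M\<^esub> x) t u = c * \<tau> x t u"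
    "psd_kernel (carrier M \<times> UNIV) (\<lambda>(a, t) (b, u). \<tau> (star M a \<otimes>\<^bsub>M\<^esub> b) t u)"
    "\<forall>x\<in>S. \<forall>t u. \<tau> x t u = \<sigma> x t u" by (elim exE conjE)
  note \<tau> = \<tau>'[rule_format]
  have \<tau>_one: "\<tau> \<one>\<^bsub>M\<^esub> (i, \<xi>) (j, \<eta>) = (if i = j then cinner \<xi> \<eta> else 0)" if "i < ?N" "j < ?N" for i j \<xi> \<eta>
    using \<psi> that SD(3) by (simp add: \<tau>(4) \<sigma>_def ucp_map_def mat_cstar_apply)
  interpret L: lifted_kernel A \<rho> ?N \<tau>
  proof (intro lifted_kernel.intro hom positive_kernel.intro)
    show "archimedean_star_algebra (mat_cstar ?N A)" by (rule S.mat_archimedean)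
    show "positive_kernel_axioms (mat_cstar ?N A) \<tau> ?N"
      using \<tau> \<tau>_one unfolding M_def by (intro positive_kernel_axioms.intro) auto
  qed
  have xc: "x \<in> carrier M" using S(2) SD(1) by blast
  have compr: "L.K.compr s i j \<in> \<rho> (s (i, j))" if s: "s \<in> S" "i < ?N" "j < ?N" for s i j
  proof -
    have "s \<in> carrier (mat_cstar ?N A)" using s(1) SD(1) by (auto simp: M_def)
    then have "L.K.compr s i j = \<psi> s (i, j)"
      using s by (intro L.K.compr_eqI) (simp_all add: \<tau>(4) \<sigma>_def)
    then show ?thesis using \<psi>R[OF s] by simp
  qed
  have star_star: "star M (star M x) = x" by (rule MA.star_star[OF xc])
  have xD: "x \<in> L.mult_domain"
    by (rule L.mult_domainI_system) (use xc S compr in \<open>auto simp flip: M_def\<close>)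
  have comm: "x \<otimes>\<^bsub>M\<^esub> star M x \<oplus>\<^bsub>M\<^esub> star M x \<otimes>\<^bsub>M\<^esub> x = star M x \<otimes>\<^bsub>M\<^esub> x \<oplus>\<^bsub>M\<^esub> x \<otimes>\<^bsub>M\<^esub> star M x"
    using xc by (simp add: MA.a_comm)
  have sxD: "star M x \<in> L.mult_domain"
    by (rule L.mult_domainI_system) (use xc S compr in \<open>auto simp: star_star comm simp flip: M_def\<close>)
  define D where "D = {b \<in> L.mult_domain. star M b \<in> L.mult_domain}"
  have Dc: "b \<in> carrier M" if "b \<in> L.mult_domain" for b
    using L.mult_domainD(1)[OF that] by (simp add: M_def)
  have diagD: "diag_mat ?N A (g l) \<in> D" if "l < m" for l
  proof (rule G.gen_mat_generates[folded M_def, OF _ _ _ _ _ _ _ that])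
    show "D \<subseteq> carrier M" using Dc by (auto simp: D_def)
    show "\<one>\<^bsub>M\<^esub> \<in> D" using L.mult_domain_one by (simp add: D_def flip: M_def)
    show "gen_mat m A g \<in> D" using xD sxD by (simp add: D_def x_def)
    show "b \<oplus>\<^bsub>M\<^esub> c \<in> D" if "b \<in> D" "c \<in> D" for b c
      using that Dc L.mult_domain_add[folded M_def] by (simp add: D_def MA.star_add)
    show "b \<otimes>\<^bsub>M\<^esub> c \<in> D" if "b \<in> D" "c \<in> D" for b c
      using that Dc L.mult_domain_mult[folded M_def] by (simp add: D_def MA.star_mult)
    show "s \<odot>\<^bsub>M\<^esub> b \<in> D" if "b \<in> D" for b s
      using that Dc L.mult_domain_smult[folded M_def] by (simp add: D_def MA.star_smult)
    show "star M b \<in> D" if "b \<in> D" for b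
      using that Dc by (simp add: D_def MA.star_star)
  qed
  have all: "diag_mat ?N A a \<in> L.mult_domain" if "a \<in> carrier A" for a
  proof (rule L.mult_domain_all[OF gen(1) _ _ that])
    show "g ` {..<m} \<subseteq> carrier A" using gen(2) by auto
    show "diag_mat ?N A h \<in> L.mult_domain \<and> star (mat_cstar ?N A) (diag_mat ?N A h) \<in> L.mult_domain"
      if "h \<in> g ` {..<m}" for h
      using that diagD by (auto simp: D_def M_def)
  qed
  let ?\<phi> = "\<lambda>a. L.K.compr (diag_mat ?N A a) 0 0"
  have "ucp_map A (carrier A) ?B ?\<phi>"
    by (rule L.ucp_corner[OF _ e sep]) simp
  moreover have "calkin_map (?\<phi> a) = \<rho> a" if a: "a \<in> carrier A" for a
  proof -
    have "?\<phi> a \<in> \<rho> (diag_mat ?N A a (0, 0))"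
      by (rule L.mult_domainD(2)[OF all[OF a]]) simp_all
    then have "?\<phi> a \<in> \<rho> a" by (simp add: diag_mat_apply)
    then show ?thesis using lift_iff[OF a] calkin_map_iff by blast
  qed
  ultimately show ?thesis unfolding has_ucp_lift_def by blast
qed


section \<open>Operator matrices as a C*-algebra\<close>

text \<open>Makes the space of bounded operators complete.\<close>

subclass (in chilbert_space) banach ..

text \<open>Operator matrices act on \<open>H\<^sup>N\<close>, and the operator norm for this action turns them into a
  C*-algebra. The algebraic structure, and with it positivity, is that of \<open>mat_cstar\<close>.\<close>

definition mat_act :: "nat \<Rightarrow> (nat \<times> nat \<Rightarrow> 'h::chilbert_space \<Rightarrow>\<^sub>L 'h) \<Rightarrow> (nat \<Rightarrow> 'h) \<Rightarrow> nat \<Rightarrow> 'h" where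
  "mat_act N X \<zeta> i = (\<Sum>j<N. blinfun_apply (X (i, j)) (\<zeta> j))"

definition vec_norm :: "nat \<Rightarrow> (nat \<Rightarrow> 'h::chilbert_space) \<Rightarrow> real" where
  "vec_norm N \<zeta> = L2_set (\<lambda>i. norm (\<zeta> i)) {..<N}"

definition mat_norm :: "nat \<Rightarrow> (nat \<times> nat \<Rightarrow> 'h::chilbert_space \<Rightarrow>\<^sub>L 'h) \<Rightarrow> real" where
  "mat_norm N X = Inf {c. 0 \<le> c \<and> (\<forall>\<zeta>. vec_norm N (mat_act N X \<zeta>) \<le> c * vec_norm N \<zeta>)}"

definition op_mat :: "nat \<Rightarrow> (nat \<times> nat \<Rightarrow> 'h::chilbert_space \<Rightarrow>\<^sub>L 'h) cstar" where
  "op_mat N = (mat_cstar N bounded_ops)\<lparr>nrm := mat_norm N\<rparr>"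

lemma vec_norm_nonneg [simp]: "0 \<le> vec_norm N \<zeta>"
  by (simp add: vec_norm_def)

lemma norm_le_vec_norm: "i < N \<Longrightarrow> norm (\<zeta> i) \<le> vec_norm N \<zeta>"
  unfolding vec_norm_def by (rule member_le_L2_set) auto

lemma vec_norm_le_sum: "vec_norm N \<zeta> \<le> (\<Sum>i<N. norm (\<zeta> i))"
  unfolding vec_norm_def by (rule L2_set_le_sum) simp

lemma vec_norm_square: "complex_of_real ((vec_norm N \<zeta>)\<^sup>2) = (\<Sum>i<N. cinner (\<zeta> i) (\<zeta> i))"
  by (simp add: vec_norm_def L2_set_def cinner_self sum_nonneg)

lemma vec_norm_add: "vec_norm N (\<lambda>i. \<zeta> i + \<zeta>' i) \<le> vec_norm N \<zeta> + vec_norm N \<zeta>'"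
  unfolding vec_norm_def
  by (rule order_trans[OF L2_set_mono L2_set_triangle_ineq]) (auto intro: norm_triangle_ineq)

lemma vec_cauchy_schwarz: "cmod (\<Sum>i<N. cinner (\<zeta> i) (\<zeta>' i)) \<le> vec_norm N \<zeta> * vec_norm N \<zeta>'"
proof -
  have "cmod (\<Sum>i<N. cinner (\<zeta> i) (\<zeta>' i)) \<le> (\<Sum>i<N. norm (\<zeta> i) * norm (\<zeta>' i))"
    by (intro order_trans[OF norm_sum] sum_mono cmod_cinner_le)
  also have "\<dots> \<le> vec_norm N \<zeta> * vec_norm N \<zeta>'"
    unfolding vec_norm_def by (rule order_trans[OF _ L2_set_mult_ineq]) simp
  finally show ?thesis .
qed

lemma mat_act_bound_sum: "vec_norm N (mat_act N X \<zeta>) \<le> (\<Sum>i<N. \<Sum>j<N. norm (X (i, j))) * vec_norm N \<zeta>"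
proof -
  have "vec_norm N (mat_act N X \<zeta>) \<le> (\<Sum>i<N. norm (mat_act N X \<zeta> i))" by (rule vec_norm_le_sum)
  also have "\<dots> \<le> (\<Sum>i<N. \<Sum>j<N. norm (X (i, j)) * vec_norm N \<zeta>)"
    unfolding mat_act_def
    by (intro sum_mono order_trans[OF norm_sum] order_trans[OF norm_blinfun] mult_left_mono norm_le_vec_norm) auto
  finally show ?thesis by (simp add: sum_distrib_right)
qed

lemma mat_act_bound: "vec_norm N (mat_act N X \<zeta>) \<le> mat_norm N X * vec_norm N \<zeta>"
proof (cases "vec_norm N \<zeta> = 0")
  case True
  then show ?thesis using mat_act_bound_sum[of N X \<zeta>] by simp
next
  case False
  then have pos: "vec_norm N \<zeta> > 0" using vec_norm_nonneg[of N \<zeta>] by linarith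
  have "vec_norm N (mat_act N X \<zeta>) / vec_norm N \<zeta> \<le> mat_norm N X"
    unfolding mat_norm_def
  proof (rule cInf_greatest)
    have "(\<Sum>i<N. \<Sum>j<N. norm (X (i, j))) \<in> {c. 0 \<le> c \<and> (\<forall>\<zeta>. vec_norm N (mat_act N X \<zeta>) \<le> c * vec_norm N \<zeta>)}"
      using mat_act_bound_sum[of N X] by (auto intro!: sum_nonneg)
    then show "{c. 0 \<le> c \<and> (\<forall>\<zeta>. vec_norm N (mat_act N X \<zeta>) \<le> c * vec_norm N \<zeta>)} \<noteq> {}" by blast
  qed (use pos in \<open>auto simp: divide_le_eq\<close>)
  then show ?thesis using pos by (simp add: divide_le_eq)
qed

lemma mat_norm_le:
  assumes "0 \<le> c" "\<And>\<zeta>. vec_norm N (mat_act N X \<zeta>) \<le> c * vec_norm N \<zeta>"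
  shows "mat_norm N X \<le> c"
  unfolding mat_norm_def by (rule cInf_lower) (use assms in \<open>auto simp: bdd_below_def\<close>)

lemma mat_norm_nonneg: "0 \<le> mat_norm N X"
  unfolding mat_norm_def
proof (rule cInf_greatest)
  have "(\<Sum>i<N. \<Sum>j<N. norm (X (i, j))) \<in> {c. 0 \<le> c \<and> (\<forall>\<zeta>. vec_norm N (mat_act N X \<zeta>) \<le> c * vec_norm N \<zeta>)}"
    using mat_act_bound_sum[of N X] by (auto intro!: sum_nonneg)
  then show "{c. 0 \<le> c \<and> (\<forall>\<zeta>. vec_norm N (mat_act N X \<zeta>) \<le> c * vec_norm N \<zeta>)} \<noteq> {}" by blast
qed simp

lemma mat_norm_le_sum: "mat_norm N X \<le> (\<Sum>i<N. \<Sum>j<N. norm (X (i, j)))"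
  by (intro mat_norm_le mat_act_bound_sum sum_nonneg) auto

lemma entry_le_mat_norm:
  assumes ij: "i < N" "j < N"
  shows "norm (X (i, j)) \<le> mat_norm N X"
proof (rule norm_blinfun_bound[OF mat_norm_nonneg])
  fix \<xi> :: 'a
  define \<zeta> where "\<zeta> k = (if k = j then \<xi> else 0)" for k
  have "mat_act N X \<zeta> i = (\<Sum>k<N. if k = j then blinfun_apply (X (i, k)) \<xi> else 0)"
    unfolding mat_act_def \<zeta>_def by (intro sum.cong) (auto simp: blinfun.zero_right)
  then have "mat_act N X \<zeta> i = blinfun_apply (X (i, j)) \<xi>" using ij by simp
  then have "norm (blinfun_apply (X (i, j)) \<xi>) \<le> vec_norm N (mat_act N X \<zeta>)"
    using norm_le_vec_norm[OF ij(1), of "mat_act N X \<zeta>"] by simp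
  also have "\<dots> \<le> mat_norm N X * vec_norm N \<zeta>" by (rule mat_act_bound)
  also have "vec_norm N \<zeta> \<le> (\<Sum>k<N. norm (\<zeta> k))" by (rule vec_norm_le_sum)
  also have "(\<Sum>k<N. norm (\<zeta> k)) = (\<Sum>k<N. if k = j then norm \<xi> else 0)"
    by (intro sum.cong) (auto simp: \<zeta>_def)
  also have "\<dots> = norm \<xi>" using ij by simp
  finally show "norm (blinfun_apply (X (i, j)) \<xi>) \<le> mat_norm N X * norm \<xi>"
    by (simp add: mult_left_mono mat_norm_nonneg)
qed

lemma op_mat_simps:
  "carrier (op_mat N) = carrier (mat_cstar N bounded_ops)" "\<one>\<^bsub>op_mat N\<^esub> = \<one>\<^bsub>mat_cstar N bounded_ops\<^esub>"
  "\<zero>\<^bsub>op_mat N\<^esub> = \<zero>\<^bsub>mat_cstar N bounded_ops\<^esub>" "X \<otimes>\<^bsub>op_mat N\<^esub> Y = X \<otimes>\<^bsub>mat_cstar N bounded_ops\<^esub> Y"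
  "X \<oplus>\<^bsub>op_mat N\<^esub> Y = X \<oplus>\<^bsub>mat_cstar N bounded_ops\<^esub> Y" "c \<odot>\<^bsub>op_mat N\<^esub> X = c \<odot>\<^bsub>mat_cstar N bounded_ops\<^esub> X"
  "star (op_mat N) = star (mat_cstar N bounded_ops)" "nrm (op_mat N) = mat_norm N"
  by (simp_all add: op_mat_def)

lemma unital_star_algebra_nrm_update:
  assumes "unital_star_algebra B"
  shows "unital_star_algebra (B\<lparr>nrm := f\<rparr>)"
proof -
  interpret unital_star_algebra B by (rule assms)
  have ag: "abelian_group (B\<lparr>nrm := f\<rparr>)"
  proof (rule abelian_groupI)
    fix x assume "x \<in> carrier (B\<lparr>nrm := f\<rparr>)"
    then show "\<exists>y\<in>carrier (B\<lparr>nrm := f\<rparr>). y \<oplus>\<^bsub>B\<lparr>nrm := f\<rparr>\<^esub> x = \<zero>\<^bsub>B\<lparr>nrm := f\<rparr>\<^esub>"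
      by (intro bexI[of _ "\<ominus>\<^bsub>B\<^esub> x"]) (simp_all add: l_neg)
  qed (simp_all add: a_ac)
  show ?thesis
  proof (intro unital_star_algebra.intro star_module.intro ag)
    show "ring (B\<lparr>nrm := f\<rparr>)"
      by (intro ringI ag Group.monoidI) (simp_all add: m_assoc l_distr r_distr)
    show "star_module_axioms (B\<lparr>nrm := f\<rparr>)"
      by (rule star_module_axioms.intro)
        (simp_all add: smult_add_right smult_add_left smult_smult smult_one star_star star_add star_smult)
    show "unital_star_algebra_axioms (B\<lparr>nrm := f\<rparr>)"
      by (rule unital_star_algebra_axioms.intro) (simp_all add: smult_mult_left smult_mult_right star_mult)
  qed
qed

lemma op_mat_star_algebra: "unital_star_algebra (op_mat N :: (nat \<times> nat \<Rightarrow> 'h::chilbert_space \<Rightarrow>\<^sub>L 'h) cstar)"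
proof -
  interpret B: unital_star_algebra "bounded_ops :: ('h \<Rightarrow>\<^sub>L 'h) cstar" by (rule bounded_ops_star_algebra)
  show ?thesis unfolding op_mat_def by (intro unital_star_algebra_nrm_update B.mat_star_algebra)
qed

lemma op_mat_entry: "X \<in> carrier (op_mat N) \<Longrightarrow> i < N \<Longrightarrow> j < N \<Longrightarrow> X (i, j) \<in> bounded_clinear_ops"
  using mat_cstar_entry[of X N bounded_ops i j] by (simp add: op_mat_simps)

lemma op_mat_mult_apply:
  assumes "X \<in> carrier (op_mat N)" "Y \<in> carrier (op_mat N)" "i < N" "j < N"
  shows "(X \<otimes>\<^bsub>op_mat N\<^esub> Y) (i, j) = (\<Sum>k<N. X (i, k) o\<^sub>L Y (k, j))"
proof -
  have "(X \<otimes>\<^bsub>op_mat N\<^esub> Y) (i, j) = (\<Oplus>\<^bsub>bounded_ops\<^esub>k\<in>{..<N}. X (i, k) o\<^sub>L Y (k, j))"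
    using assms(3,4) by (simp add: op_mat_simps mat_cstar_apply)
  also have "\<dots> = (\<Sum>k<N. X (i, k) o\<^sub>L Y (k, j))"
    by (intro bounded_ops_finsum) (use assms in \<open>auto intro!: bounded_clinear_ops_closed op_mat_entry\<close>)
  finally show ?thesis .
qed

lemma mat_act_mult:
  assumes "X \<in> carrier (op_mat N)" "Y \<in> carrier (op_mat N)" "i < N"
  shows "mat_act N (X \<otimes>\<^bsub>op_mat N\<^esub> Y) \<zeta> i = mat_act N X (mat_act N Y \<zeta>) i"
proof -
  have "mat_act N (X \<otimes>\<^bsub>op_mat N\<^esub> Y) \<zeta> i = (\<Sum>j<N. \<Sum>k<N. blinfun_apply (X (i, k)) (blinfun_apply (Y (k, j)) (\<zeta> j)))"
    unfolding mat_act_def using assms by (intro sum.cong refl) (simp add: op_mat_mult_apply blinfun.sum_left)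
  also have "\<dots> = (\<Sum>k<N. \<Sum>j<N. blinfun_apply (X (i, k)) (blinfun_apply (Y (k, j)) (\<zeta> j)))"
    by (rule sum.swap)
  finally show ?thesis by (simp add: mat_act_def blinfun.sum_right)
qed

lemma mat_act_adjoint:
  assumes X: "X \<in> carrier (op_mat N)"
  shows "(\<Sum>i<N. cinner (\<zeta> i) (mat_act N (star (op_mat N) X) \<zeta>' i)) = (\<Sum>j<N. cinner (mat_act N X \<zeta> j) (\<zeta>' j))"
proof -
  have "(\<Sum>i<N. cinner (\<zeta> i) (mat_act N (star (op_mat N) X) \<zeta>' i))
      = (\<Sum>i<N. \<Sum>j<N. cinner (blinfun_apply (X (j, i)) (\<zeta> i)) (\<zeta>' j))"
    unfolding mat_act_def cinner_sum_right
    by (intro sum.cong refl) (simp add: op_mat_simps mat_cstar_apply cinner_adjoint_right op_mat_entry[OF X])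
  also have "\<dots> = (\<Sum>j<N. \<Sum>i<N. cinner (blinfun_apply (X (j, i)) (\<zeta> i)) (\<zeta>' j))"
    by (rule sum.swap)
  finally show ?thesis by (simp add: mat_act_def cinner_sum_left)
qed

lemma vec_norm_cong: "(\<And>i. i < N \<Longrightarrow> \<zeta> i = \<zeta>' i) \<Longrightarrow> vec_norm N \<zeta> = vec_norm N \<zeta>'"
  unfolding vec_norm_def by (rule L2_set_cong) auto

lemma mat_norm_mult:
  assumes X: "X \<in> carrier (op_mat N)" and Y: "Y \<in> carrier (op_mat N)"
  shows "mat_norm N (X \<otimes>\<^bsub>op_mat N\<^esub> Y) \<le> mat_norm N X * mat_norm N Y"
proof (rule mat_norm_le)
  fix \<zeta>
  have "vec_norm N (mat_act N (X \<otimes>\<^bsub>op_mat N\<^esub> Y) \<zeta>) = vec_norm N (mat_act N X (mat_act N Y \<zeta>))"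
    by (rule vec_norm_cong) (rule mat_act_mult[OF X Y])
  also have "\<dots> \<le> mat_norm N X * vec_norm N (mat_act N Y \<zeta>)" by (rule mat_act_bound)
  also have "\<dots> \<le> mat_norm N X * (mat_norm N Y * vec_norm N \<zeta>)"
    by (intro mult_left_mono mat_act_bound mat_norm_nonneg)
  finally show "vec_norm N (mat_act N (X \<otimes>\<^bsub>op_mat N\<^esub> Y) \<zeta>) \<le> mat_norm N X * mat_norm N Y * vec_norm N \<zeta>"
    by (simp add: mult.assoc)
qed (simp add: mat_norm_nonneg)

lemma mat_norm_cstar_identity:
  assumes X: "X \<in> carrier (op_mat N)"
  shows "mat_norm N (star (op_mat N) X \<otimes>\<^bsub>op_mat N\<^esub> X) = (mat_norm N X)\<^sup>2"
proof -
  interpret C: unital_star_algebra "op_mat N :: (nat \<times> nat \<Rightarrow> 'a \<Rightarrow>\<^sub>L 'a) cstar" by (rule op_mat_star_algebra)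
  have sX: "star (op_mat N) X \<in> carrier (op_mat N)" using X by simp
  have star_le: "mat_norm N (star (op_mat N) Y) \<le> mat_norm N Y" if Y: "Y \<in> carrier (op_mat N)" for Y :: "nat \<times> nat \<Rightarrow> 'a \<Rightarrow>\<^sub>L 'a"
  proof (rule mat_norm_le[OF mat_norm_nonneg])
    fix \<zeta>
    define w where "w = mat_act N (star (op_mat N) Y) \<zeta>"
    have "complex_of_real ((vec_norm N w)\<^sup>2) = (\<Sum>j<N. cinner (mat_act N Y w j) (\<zeta> j))"
      unfolding vec_norm_square mat_act_adjoint[OF Y, symmetric] by (simp add: w_def)
    then have "(vec_norm N w)\<^sup>2 = cmod (\<Sum>j<N. cinner (mat_act N Y w j) (\<zeta> j))"
      by (metis abs_of_nonneg norm_of_real zero_le_power2)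
    also have "\<dots> \<le> vec_norm N (mat_act N Y w) * vec_norm N \<zeta>" by (rule vec_cauchy_schwarz)
    also have "\<dots> \<le> (mat_norm N Y * vec_norm N w) * vec_norm N \<zeta>"
      by (intro mult_right_mono mat_act_bound) simp
    finally have "vec_norm N w * vec_norm N w \<le> vec_norm N w * (mat_norm N Y * vec_norm N \<zeta>)"
      by (simp add: power2_eq_square mult_ac)
    then show "vec_norm N (mat_act N (star (op_mat N) Y) \<zeta>) \<le> mat_norm N Y * vec_norm N \<zeta>"
      unfolding w_def[symmetric] using mat_norm_nonneg[of N Y]
      by (cases "vec_norm N w = 0") (auto simp: less_le[of 0])
  qed
  have "mat_norm N X \<le> sqrt (mat_norm N (star (op_mat N) X \<otimes>\<^bsub>op_mat N\<^esub> X))" (is "_ \<le> sqrt ?s")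
  proof (rule mat_norm_le)
    fix \<zeta>
    have "complex_of_real ((vec_norm N (mat_act N X \<zeta>))\<^sup>2) = (\<Sum>i<N. cinner (\<zeta> i) (mat_act N (star (op_mat N) X) (mat_act N X \<zeta>) i))"
      unfolding vec_norm_square mat_act_adjoint[OF X] ..
    also have "\<dots> = (\<Sum>i<N. cinner (\<zeta> i) (mat_act N (star (op_mat N) X \<otimes>\<^bsub>op_mat N\<^esub> X) \<zeta> i))"
      by (intro sum.cong refl) (simp add: mat_act_mult[OF sX X])
    finally have "(vec_norm N (mat_act N X \<zeta>))\<^sup>2 = cmod (\<Sum>i<N. cinner (\<zeta> i) (mat_act N (star (op_mat N) X \<otimes>\<^bsub>op_mat N\<^esub> X) \<zeta> i))"
      by (metis abs_of_nonneg norm_of_real zero_le_power2)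
    also have "\<dots> \<le> vec_norm N \<zeta> * vec_norm N (mat_act N (star (op_mat N) X \<otimes>\<^bsub>op_mat N\<^esub> X) \<zeta>)"
      by (rule vec_cauchy_schwarz)
    also have "\<dots> \<le> vec_norm N \<zeta> * (?s * vec_norm N \<zeta>)"
      by (intro mult_left_mono mat_act_bound) simp
    also have "\<dots> = (sqrt ?s * vec_norm N \<zeta>)\<^sup>2"
      using mat_norm_nonneg[of N "star (op_mat N) X \<otimes>\<^bsub>op_mat N\<^esub> X"] by (simp add: power_mult_distrib) (simp add: power2_eq_square)
    finally show "vec_norm N (mat_act N X \<zeta>) \<le> sqrt ?s * vec_norm N \<zeta>"
      by (rule power2_le_imp_le) (simp add: mat_norm_nonneg)
  qed (simp add: mat_norm_nonneg)
  then have "(mat_norm N X)\<^sup>2 \<le> ?s"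
    using mat_norm_nonneg[of N X] mat_norm_nonneg[of N "star (op_mat N) X \<otimes>\<^bsub>op_mat N\<^esub> X"]
    by (metis power_mono real_sqrt_pow2)
  moreover have "?s \<le> (mat_norm N X)\<^sup>2"
    using mat_norm_mult[OF sX X] mult_right_mono[OF star_le[OF X] mat_norm_nonneg[of N X]]
    by (simp add: power2_eq_square)
  ultimately show ?thesis by simp
qed

lemma closed_bounded_clinear_ops: "closed (bounded_clinear_ops :: ('h::chilbert_space \<Rightarrow>\<^sub>L 'h) set)"
  unfolding closed_sequential_limits
proof (intro allI impI, elim conjE)
  fix T and S :: "'h \<Rightarrow>\<^sub>L 'h"
  assume T: "\<forall>n. T n \<in> bounded_clinear_ops" and lim: "T \<longlonglongrightarrow> S"
  have pt: "(\<lambda>n. blinfun_apply (T n) x) \<longlonglongrightarrow> blinfun_apply S x" for x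
    by (intro blinfun.tendsto lim tendsto_const)
  have sc: "bounded_linear (\<lambda>x::'h. c *\<^sub>C x)" for c
    by (rule bounded_linear_intro[where K = "cmod c"])
      (simp_all add: scaleC_add_right scaleR_scaleC scaleC_scaleC norm_scaleC mult.commute)
  have "blinfun_apply S (c *\<^sub>C x) = c *\<^sub>C blinfun_apply S x" for c x
  proof (rule LIMSEQ_unique[OF pt])
    have "(\<lambda>n. c *\<^sub>C blinfun_apply (T n) x) \<longlonglongrightarrow> c *\<^sub>C blinfun_apply S x"
      by (rule bounded_linear.tendsto[OF sc pt])
    then show "(\<lambda>n. blinfun_apply (T n) (c *\<^sub>C x)) \<longlonglongrightarrow> c *\<^sub>C blinfun_apply S x"
      using T by (simp add: bounded_clinear_opsD)
  qed
  then show "S \<in> bounded_clinear_ops" by (simp add: bounded_clinear_ops_def)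
qed

text \<open>The norm lies between the norm of each entry and the sum of the norms of all entries, so
  completeness is inherited from the entries.\<close>

lemma op_mat_cstar: "unital_cstar_algebra (op_mat N :: (nat \<times> nat \<Rightarrow> 'h::chilbert_space \<Rightarrow>\<^sub>L 'h) cstar)"
proof -
  let ?C = "op_mat N :: (nat \<times> nat \<Rightarrow> 'h \<Rightarrow>\<^sub>L 'h) cstar"
  interpret B: unital_star_algebra "bounded_ops :: ('h \<Rightarrow>\<^sub>L 'h) cstar" by (rule bounded_ops_star_algebra)
  interpret C: unital_star_algebra ?C by (rule op_mat_star_algebra)
  have minus_apply: "(X \<ominus>\<^bsub>?C\<^esub> Y) (i, j) = X (i, j) - Y (i, j)"
    if X: "X \<in> carrier ?C" and Y: "Y \<in> carrier ?C" and ij: "i < N" "j < N" for X Y i j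
  proof -
    have "Y \<oplus>\<^bsub>?C\<^esub> (-1) \<odot>\<^bsub>?C\<^esub> Y = \<zero>\<^bsub>?C\<^esub>" using Y by simp
    then have "\<ominus>\<^bsub>?C\<^esub> Y = (-1) \<odot>\<^bsub>?C\<^esub> Y"
      using Y C.minus_equality[of "(-1) \<odot>\<^bsub>?C\<^esub> Y" Y] by (simp add: C.a_comm)
    then show ?thesis
      using ij by (simp add: a_minus_def op_mat_simps mat_cstar_apply scaleC_blinfun_minus1)
  qed
  have nrm_zero_iff: "mat_norm N X = 0 \<longleftrightarrow> X = \<zero>\<^bsub>?C\<^esub>" if X: "X \<in> carrier ?C" for X
  proof
    assume "mat_norm N X = 0"
    then have "X (i, j) = 0" if "i < N" "j < N" for i j
      using entry_le_mat_norm[OF that, of X] by simp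
    then show "X = \<zero>\<^bsub>?C\<^esub>"
      using X C.zero_closed unfolding op_mat_simps
      by (intro mat_cstar_eqI[of _ N bounded_ops]) (auto simp: mat_cstar_apply)
  next
    assume "X = \<zero>\<^bsub>?C\<^esub>"
    then show "mat_norm N X = 0"
      using mat_norm_le_sum[of N X] mat_norm_nonneg[of N X] by (simp add: op_mat_simps mat_cstar_apply)
  qed
  have nrm_add: "mat_norm N (X \<oplus>\<^bsub>?C\<^esub> Y) \<le> mat_norm N X + mat_norm N Y" for X Y
  proof (rule mat_norm_le)
    fix \<zeta> :: "nat \<Rightarrow> 'h"
    have "vec_norm N (mat_act N (X \<oplus>\<^bsub>?C\<^esub> Y) \<zeta>) = vec_norm N (\<lambda>i. mat_act N X \<zeta> i + mat_act N Y \<zeta> i)"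
      by (rule vec_norm_cong)
        (simp add: mat_act_def op_mat_simps mat_cstar_apply blinfun.add_left sum.distrib)
    also have "\<dots> \<le> vec_norm N (mat_act N X \<zeta>) + vec_norm N (mat_act N Y \<zeta>)" by (rule vec_norm_add)
    also have "\<dots> \<le> mat_norm N X * vec_norm N \<zeta> + mat_norm N Y * vec_norm N \<zeta>"
      by (intro add_mono mat_act_bound)
    finally show "vec_norm N (mat_act N (X \<oplus>\<^bsub>?C\<^esub> Y) \<zeta>) \<le> (mat_norm N X + mat_norm N Y) * vec_norm N \<zeta>"
      by (simp add: distrib_right)
  qed (simp add: mat_norm_nonneg)
  have nrm_smult: "mat_norm N (c \<odot>\<^bsub>?C\<^esub> X) = cmod c * mat_norm N X" if X: "X \<in> carrier ?C" for c X
  proof -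
    have le: "mat_norm N (c \<odot>\<^bsub>?C\<^esub> X) \<le> cmod c * mat_norm N X" for c X
    proof (rule mat_norm_le)
      fix \<zeta> :: "nat \<Rightarrow> 'h"
      have "vec_norm N (mat_act N (c \<odot>\<^bsub>?C\<^esub> X) \<zeta>) = vec_norm N (\<lambda>i. c *\<^sub>C mat_act N X \<zeta> i)"
        by (rule vec_norm_cong)
          (simp add: mat_act_def op_mat_simps mat_cstar_apply scaleC_blinfun.rep_eq complex_vector.scale_sum_right)
      also have "\<dots> = cmod c * vec_norm N (mat_act N X \<zeta>)"
        by (simp add: vec_norm_def norm_scaleC L2_set_right_distrib)
      also have "\<dots> \<le> cmod c * (mat_norm N X * vec_norm N \<zeta>)"
        by (intro mult_left_mono mat_act_bound) simp
      finally show "vec_norm N (mat_act N (c \<odot>\<^bsub>?C\<^esub> X) \<zeta>) \<le> cmod c * mat_norm N X * vec_norm N \<zeta>"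
        by (simp add: mult.assoc)
    qed (simp add: mat_norm_nonneg)
    show ?thesis
    proof (cases "c = 0")
      case True
      then show ?thesis using nrm_zero_iff[OF C.zero_closed] X by simp
    next
      case False
      have "mat_norm N X = mat_norm N ((1 / c) \<odot>\<^bsub>?C\<^esub> (c \<odot>\<^bsub>?C\<^esub> X))"
        using X False by (simp add: C.smult_smult C.smult_one)
      also have "\<dots> \<le> cmod (1 / c) * mat_norm N (c \<odot>\<^bsub>?C\<^esub> X)" by (rule le)
      finally have "cmod c * mat_norm N X \<le> mat_norm N (c \<odot>\<^bsub>?C\<^esub> X)"
        using False by (simp add: norm_divide field_simps)
      then show ?thesis using le[of c X] by simp
    qed
  qed
  have nrm_minus: "mat_norm N (X \<ominus>\<^bsub>?C\<^esub> Y) = mat_norm N (Y \<ominus>\<^bsub>?C\<^esub> X)" if XY: "X \<in> carrier ?C" "Y \<in> carrier ?C" for X Y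
  proof -
    have "X \<ominus>\<^bsub>?C\<^esub> Y = (-1) \<odot>\<^bsub>?C\<^esub> (Y \<ominus>\<^bsub>?C\<^esub> X)"
      using XY C.minus_closed[OF XY] C.smult_closed[OF C.minus_closed[OF XY(2,1)], of "-1"] unfolding op_mat_simps(1)
      by (intro mat_cstar_eqI[of _ N bounded_ops])
        (auto simp: minus_apply[unfolded op_mat_simps(1)] op_mat_simps(6) mat_cstar_apply scaleC_blinfun_minus1)
    then show ?thesis using nrm_smult[OF C.minus_closed[OF XY(2,1)], of "-1"] by simp
  qed
  have metric: "Metric_space (carrier ?C) (cstar_dist ?C)"
  proof
    fix X Y Z
    show "0 \<le> cstar_dist ?C X Y" by (simp add: cstar_dist_def op_mat_simps(8) mat_norm_nonneg)
    show "cstar_dist ?C X Y = cstar_dist ?C Y X"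
      by (auto simp: cstar_dist_def op_mat_simps(8) nrm_minus)
    show "(cstar_dist ?C X Y = 0) = (X = Y)" if "X \<in> carrier ?C" "Y \<in> carrier ?C"
      using that nrm_zero_iff[OF C.minus_closed[OF that]] by (simp add: cstar_dist_def op_mat_simps(8))
    show "cstar_dist ?C X Z \<le> cstar_dist ?C X Y + cstar_dist ?C Y Z"
      if "X \<in> carrier ?C" "Y \<in> carrier ?C" "Z \<in> carrier ?C"
    proof -
      have "X \<ominus>\<^bsub>?C\<^esub> Z = (X \<ominus>\<^bsub>?C\<^esub> Y) \<oplus>\<^bsub>?C\<^esub> (Y \<ominus>\<^bsub>?C\<^esub> Z)"
        using that by (simp add: a_minus_def C.a_assoc C.r_neg1)
      then show ?thesis
        using that nrm_add[of "X \<ominus>\<^bsub>?C\<^esub> Y" "Y \<ominus>\<^bsub>?C\<^esub> Z"] by (simp add: cstar_dist_def op_mat_simps(8))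
    qed
  qed
  interpret Met: Metric_space "carrier ?C" "cstar_dist ?C" by (rule metric)
  have dist: "cstar_dist ?C X Y = mat_norm N (X \<ominus>\<^bsub>?C\<^esub> Y)" if "X \<in> carrier ?C" "Y \<in> carrier ?C" for X Y
    using that by (simp add: cstar_dist_def op_mat_simps(8))
  have complete: "Met.mcomplete"
    unfolding Met.mcomplete_def
  proof (intro allI impI)
    fix s assume "Met.MCauchy s"
    then have sc: "\<And>n. s n \<in> carrier ?C"
      and cau: "\<And>\<epsilon>. \<epsilon> > 0 \<Longrightarrow> \<exists>n0. \<forall>n n'. n0 \<le> n \<longrightarrow> n0 \<le> n' \<longrightarrow> cstar_dist ?C (s n) (s n') < \<epsilon>"
      by (auto simp: Met.MCauchy_def)
    have "\<exists>T\<in>bounded_clinear_ops. (\<lambda>n. s n (i, j)) \<longlonglongrightarrow> T" if ij: "i < N" "j < N" for i j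
    proof -
      have "Cauchy (\<lambda>n. s n (i, j))"
      proof (rule metric_CauchyI)
        fix \<epsilon> :: real assume "\<epsilon> > 0"
        then obtain n0 where n0: "\<And>n n'. n0 \<le> n \<Longrightarrow> n0 \<le> n' \<Longrightarrow> cstar_dist ?C (s n) (s n') < \<epsilon>"
          using cau by blast
        have "dist (s n (i, j)) (s n' (i, j)) < \<epsilon>" if "n0 \<le> n" "n0 \<le> n'" for n n'
          using entry_le_mat_norm[OF ij, of "s n \<ominus>\<^bsub>?C\<^esub> s n'"] n0[OF that] dist[OF sc sc, of n n']
          by (simp add: minus_apply[OF sc sc ij] dist_norm)
        then show "\<exists>M. \<forall>m\<ge>M. \<forall>n\<ge>M. dist (s m (i, j)) (s n (i, j)) < \<epsilon>" by blast
      qed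
      then obtain T where T: "(\<lambda>n. s n (i, j)) \<longlonglongrightarrow> T"
        by (auto dest!: Cauchy_convergent simp: convergent_def)
      moreover have "T \<in> bounded_clinear_ops"
        by (rule closed_sequentially[OF closed_bounded_clinear_ops _ T]) (rule op_mat_entry[OF sc ij])
      ultimately show ?thesis by blast
    qed
    then obtain T where T: "\<And>i j. i < N \<Longrightarrow> j < N \<Longrightarrow> T i j \<in> bounded_clinear_ops \<and> (\<lambda>n. s n (i, j)) \<longlonglongrightarrow> T i j"
      by metis
    define L where "L = (\<lambda>(i, j)\<in>{..<N} \<times> {..<N}. T i j)"
    have L: "L \<in> carrier ?C" using T by (auto simp: L_def op_mat_simps mat_cstar_carrier)
    have L_apply: "L (i, j) = T i j" if "i < N" "j < N" for i j using that by (simp add: L_def)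
    have "(\<lambda>n. \<Sum>i<N. \<Sum>j<N. norm (s n (i, j) - T i j)) \<longlonglongrightarrow> (\<Sum>i<N. \<Sum>j<N. 0)"
    proof (intro tendsto_sum)
      fix i j assume "i \<in> {..<N}" "j \<in> {..<N}"
      then show "(\<lambda>n. norm (s n (i, j) - T i j)) \<longlonglongrightarrow> 0"
        using T[of i j] by (simp add: tendsto_norm_zero LIM_zero)
    qed
    then have small: "(\<lambda>n. \<Sum>i<N. \<Sum>j<N. norm (s n (i, j) - T i j)) \<longlonglongrightarrow> 0" by simp
    have le: "cstar_dist ?C (s n) L \<le> (\<Sum>i<N. \<Sum>j<N. norm (s n (i, j) - T i j))" for n
    proof -
      have "mat_norm N (s n \<ominus>\<^bsub>?C\<^esub> L) \<le> (\<Sum>i<N. \<Sum>j<N. norm ((s n \<ominus>\<^bsub>?C\<^esub> L) (i, j)))" by (rule mat_norm_le_sum)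
      also have "\<dots> = (\<Sum>i<N. \<Sum>j<N. norm (s n (i, j) - T i j))"
        by (intro sum.cong refl) (simp add: minus_apply[OF sc L] L_apply)
      finally show ?thesis by (simp add: dist[OF sc L])
    qed
    have "limitin Met.mtopology s L sequentially"
      unfolding Met.limitin_metric
    proof (intro conjI L allI impI)
      fix \<epsilon> :: real assume "\<epsilon> > 0"
      then have "\<forall>\<^sub>F n in sequentially. (\<Sum>i<N. \<Sum>j<N. norm (s n (i, j) - T i j)) < \<epsilon>"
        using small by (rule order_tendstoD(2)[rotated])
      then show "\<forall>\<^sub>F n in sequentially. s n \<in> carrier ?C \<and> cstar_dist ?C (s n) L < \<epsilon>"
        by (rule eventually_mono) (use le sc in \<open>auto intro: le_less_trans\<close>)
    qed
    then show "\<exists>x. limitin Met.mtopology s x sequentially" by blast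
  qed
  show ?thesis
  proof (intro unital_cstar_algebra.intro unital_cstar_algebra_axioms.intro)
    show "ring ?C" by unfold_locales
    show "Module.module (class_ring :: complex ring) ?C" by (rule C.module_class_ring)
  qed (simp_all add: C.smult_mult_left C.smult_mult_right C.star_star C.star_add C.star_smult C.star_mult
      op_mat_simps(8) mat_norm_nonneg nrm_zero_iff nrm_add nrm_smult mat_norm_mult mat_norm_cstar_identity complete)
qed


section \<open>Failure of the lifting property\<close>

lemma compact_ops_limit:
  assumes T: "T \<in> bounded_clinear_ops" and approx: "\<And>\<delta>. \<delta> > 0 \<Longrightarrow> \<exists>K\<in>compact_ops. norm (T - K) \<le> \<delta>"
  shows "T \<in> compact_ops"
proof (rule compact_opsI_approx[OF T])
  fix \<epsilon> :: real assume \<epsilon>: "\<epsilon> > 0"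
  define \<delta> where "\<delta> = sqrt (\<epsilon> / 2)"
  obtain K where K: "K \<in> compact_ops" "norm (T - K) \<le> \<delta>"
    using approx[of \<delta>] \<epsilon> by (auto simp: \<delta>_def)
  have "(norm (blinfun_apply T z))\<^sup>2 \<le> \<epsilon> * (norm z)\<^sup>2 + (2 * norm K) * norm z * norm (blinfun_apply K z)" for z
  proof -
    have "(norm (blinfun_apply T z))\<^sup>2 = (norm (blinfun_apply (T - K) z + blinfun_apply K z))\<^sup>2"
      by (simp add: blinfun.diff_left)
    also have "\<dots> \<le> 2 * (norm (blinfun_apply (T - K) z))\<^sup>2 + 2 * (norm (blinfun_apply K z))\<^sup>2"
      by (rule power2_norm_add_le)
    also have "(norm (blinfun_apply (T - K) z))\<^sup>2 \<le> (\<delta> * norm z)\<^sup>2"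
      by (intro power_mono order_trans[OF norm_blinfun] mult_right_mono K(2)) auto
    also have "(\<delta> * norm z)\<^sup>2 = \<epsilon> / 2 * (norm z)\<^sup>2"
      using \<epsilon> by (simp add: \<delta>_def power_mult_distrib)
    also have "(norm (blinfun_apply K z))\<^sup>2 \<le> (norm K * norm z) * norm (blinfun_apply K z)"
      unfolding power2_eq_square by (intro mult_right_mono norm_blinfun) simp
    finally show ?thesis by simp
  qed
  then show "\<exists>K\<in>compact_ops. \<exists>M\<ge>0. \<forall>z. (norm (blinfun_apply T z))\<^sup>2
      \<le> \<epsilon> * (norm z)\<^sup>2 + M * norm z * norm (blinfun_apply K z)"
    using K(1) by (intro bexI[of _ K] exI[of _ "2 * norm K"]) auto
qed

definition compact_mats :: "nat \<Rightarrow> (nat \<times> nat \<Rightarrow> 'h::chilbert_space \<Rightarrow>\<^sub>L 'h) set" where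
  "compact_mats N = {X \<in> carrier (op_mat N). \<forall>i<N. \<forall>j<N. X (i, j) \<in> compact_ops}"

lemma op_mat_minus_apply:
  assumes "X \<in> carrier (op_mat N)" "Y \<in> carrier (op_mat N)" "i < N" "j < N"
  shows "(X \<ominus>\<^bsub>op_mat N\<^esub> Y) (i, j) = X (i, j) - Y (i, j)"
  using assms
  by (simp add: unital_cstar_algebra.a_minus_smult[OF op_mat_cstar] op_mat_simps(5,6) mat_cstar_apply scaleC_blinfun_minus1)

lemma compact_mats_ideal:
  "cstar_ideal (compact_mats N :: (nat \<times> nat \<Rightarrow> 'h::chilbert_space \<Rightarrow>\<^sub>L 'h) set) (op_mat N)"
  unfolding cstar_ideal_def
proof
  let ?I = "compact_mats N :: (nat \<times> nat \<Rightarrow> 'h \<Rightarrow>\<^sub>L 'h) set"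
  let ?C = "op_mat N :: (nat \<times> nat \<Rightarrow> 'h \<Rightarrow>\<^sub>L 'h) cstar"
  interpret unital_cstar_algebra ?C by (rule op_mat_cstar)
  show "ideal ?I ?C"
  proof (rule idealI)
    show "subgroup ?I (add_monoid ?C)"
    proof (rule add.subgroupI)
      show "?I \<subseteq> carrier ?C" by (auto simp: compact_mats_def)
      have "\<zero>\<^bsub>?C\<^esub> \<in> ?I"
        using zero_closed by (auto simp: compact_mats_def op_mat_simps(3) mat_cstar_apply compact_ops_zero)
      then show "?I \<noteq> {}" by blast
      show "\<ominus>\<^bsub>?C\<^esub> X \<in> ?I" if X: "X \<in> ?I" for X
      proof -
        have Xc: "X \<in> carrier ?C" using X by (simp add: compact_mats_def)
        have "\<zero>\<^bsub>?C\<^esub> \<ominus>\<^bsub>?C\<^esub> X \<in> ?I"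
          using X Xc minus_closed[OF zero_closed Xc] op_mat_minus_apply[OF zero_closed Xc]
          by (auto simp: compact_mats_def op_mat_simps(3) mat_cstar_apply compact_ops_minus)
        then show ?thesis using Xc by (simp add: a_minus_def)
      qed
      show "X \<oplus>\<^bsub>?C\<^esub> Y \<in> ?I" if "X \<in> ?I" "Y \<in> ?I" for X Y
        using that a_closed[of X Y]
        by (auto simp: compact_mats_def op_mat_simps(5) mat_cstar_apply compact_ops_add)
    qed
    show "Y \<otimes>\<^bsub>?C\<^esub> X \<in> ?I" "X \<otimes>\<^bsub>?C\<^esub> Y \<in> ?I" if X: "X \<in> ?I" and Y: "Y \<in> carrier ?C" for X Y
    proof -
      have Xc: "X \<in> carrier ?C" and Xe: "\<And>i j. i < N \<Longrightarrow> j < N \<Longrightarrow> X (i, j) \<in> compact_ops"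
        using X by (auto simp: compact_mats_def)
      show "Y \<otimes>\<^bsub>?C\<^esub> X \<in> ?I"
        using m_closed[OF Y Xc] op_mat_entry[OF Y] Xe
        by (auto simp: compact_mats_def op_mat_mult_apply[OF Y Xc] intro!: compact_ops_sum compact_ops_compose_left)
      show "X \<otimes>\<^bsub>?C\<^esub> Y \<in> ?I"
        using m_closed[OF Xc Y] op_mat_entry[OF Y] Xe
        by (auto simp: compact_mats_def op_mat_mult_apply[OF Xc Y] intro!: compact_ops_sum compact_ops_compose_right)
    qed
  qed (rule ring_axioms)
  interpret Met: Metric_space "carrier ?C" "cstar_dist ?C" by (rule cstar_metric)
  show "cstar_closed ?C ?I"
    unfolding Met.metric_closedin_iff_sequentially_closed
  proof (intro conjI allI impI)
    show "?I \<subseteq> carrier ?C" by (auto simp: compact_mats_def)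
    fix \<sigma> L assume "range \<sigma> \<subseteq> ?I \<and> limitin Met.mtopology \<sigma> L sequentially"
    then have \<sigma>: "\<And>n. \<sigma> n \<in> ?I" and lim: "limitin Met.mtopology \<sigma> L sequentially" by auto
    have \<sigma>c: "\<sigma> n \<in> carrier ?C" for n using \<sigma>[of n] by (simp add: compact_mats_def)
    have L: "L \<in> carrier ?C" using lim by (simp add: Met.limitin_metric)
    have "L (i, j) \<in> compact_ops" if ij: "i < N" "j < N" for i j
    proof (rule compact_ops_limit[OF op_mat_entry[OF L ij]])
      fix \<delta> :: real assume "\<delta> > 0"
      then have "\<forall>\<^sub>F n in sequentially. \<sigma> n \<in> carrier ?C \<and> cstar_dist ?C (\<sigma> n) L < \<delta>"
        using lim unfolding Met.limitin_metric by blast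
      then obtain n where n: "cstar_dist ?C (\<sigma> n) L < \<delta>"
        unfolding eventually_sequentially by blast
      have "norm (\<sigma> n (i, j) - L (i, j)) \<le> mat_norm N (\<sigma> n \<ominus>\<^bsub>?C\<^esub> L)"
        using entry_le_mat_norm[OF ij, of "\<sigma> n \<ominus>\<^bsub>?C\<^esub> L"] by (simp add: op_mat_minus_apply[OF \<sigma>c L ij])
      also have "\<dots> = cstar_dist ?C (\<sigma> n) L" using \<sigma>c L by (simp add: cstar_dist_def op_mat_simps(8))
      finally have "norm (L (i, j) - \<sigma> n (i, j)) \<le> \<delta>" using n by (simp add: norm_minus_commute)
      then show "\<exists>K\<in>compact_ops. norm (L (i, j) - K) \<le> \<delta>"
        using \<sigma>[of n] ij by (intro bexI[of _ "\<sigma> n (i, j)"]) (simp_all add: compact_mats_def)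
    qed
    then show "L \<in> ?I" using L by (simp add: compact_mats_def)
  qed
qed

lemma op_mat_finsum: "finsum (op_mat N) = finsum (mat_cstar N bounded_ops)"
  by (intro ext) (simp add: finsum_def op_mat_def)

text \<open>Positivity in matrix algebras means to be a square, and squares do not involve the norm.\<close>

lemma ucp_map_op_mat:
  fixes \<psi> :: "'a \<Rightarrow> nat \<times> nat \<Rightarrow> 'h::chilbert_space \<Rightarrow>\<^sub>L 'h"
  shows "ucp_map M S (op_mat N) \<psi> \<longleftrightarrow> ucp_map M S (mat_cstar N bounded_ops) \<psi>"
proof -
  have "positive_cone (mat_cstar k (op_mat N)) =
      positive_cone (mat_cstar k (mat_cstar N (bounded_ops :: ('h \<Rightarrow>\<^sub>L 'h) cstar)))" for k
    by (simp add: positive_cone_def mat_cstar_def[of k] op_mat_simps op_mat_finsum)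
  then show ?thesis by (simp add: ucp_map_def module_hom_def op_mat_simps)
qed

context calkin_hom
begin

text \<open>The amplification of \<open>R\<close> as a map into the quotient of the operator matrices by the compact ones.\<close>

definition mat_lifts :: "nat \<Rightarrow> (nat \<times> nat \<Rightarrow> 'a) \<Rightarrow> (nat \<times> nat \<Rightarrow> 'h \<Rightarrow>\<^sub>L 'h) set" where
  "mat_lifts N X = {T \<in> carrier (op_mat N). \<forall>i<N. \<forall>j<N. T (i, j) \<in> R (X (i, j))}"

lemma mat_lifts_ex:
  assumes X: "X \<in> carrier (mat_cstar N A)"
  shows "\<exists>T. T \<in> mat_lifts N X"
proof -
  have "\<exists>T. T \<in> R (X (i, j))" if "i < N" "j < N" for i j
    using lift_ex[OF mat_cstar_entry[OF X that]] .
  then obtain t where t: "\<And>i j. i < N \<Longrightarrow> j < N \<Longrightarrow> t i j \<in> R (X (i, j))" by metis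
  have "t i j \<in> bounded_clinear_ops" if "i < N" "j < N" for i j
    using lift_bounded[OF mat_cstar_entry[OF X that] t[OF that]] .
  then have "(\<lambda>(i, j)\<in>{..<N} \<times> {..<N}. t i j) \<in> mat_lifts N X"
    using t by (auto simp: mat_lifts_def op_mat_simps(1) mat_cstar_carrier)
  then show ?thesis by blast
qed

lemma mat_lifts_coset:
  assumes X: "X \<in> carrier (mat_cstar N A)" and T: "T \<in> mat_lifts N X"
  shows "mat_lifts N X = compact_mats N +>\<^bsub>op_mat N\<^esub> T"
proof -
  interpret C: unital_cstar_algebra "op_mat N :: (nat \<times> nat \<Rightarrow> 'h \<Rightarrow>\<^sub>L 'h) cstar" by (rule op_mat_cstar)
  have Tc: "T \<in> carrier (op_mat N)" and Te: "\<And>i j. i < N \<Longrightarrow> j < N \<Longrightarrow> T (i, j) \<in> R (X (i, j))"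
    using T by (auto simp: mat_lifts_def)
  have "S \<in> compact_mats N +>\<^bsub>op_mat N\<^esub> T" if S: "S \<in> mat_lifts N X" for S
  proof -
    have Sc: "S \<in> carrier (op_mat N)" using S by (simp add: mat_lifts_def)
    have "S \<ominus>\<^bsub>op_mat N\<^esub> T \<in> compact_mats N"
      using C.minus_closed[OF Sc Tc] S lift_iff[OF mat_cstar_entry[OF X] Te]
      by (auto simp: compact_mats_def mat_lifts_def op_mat_minus_apply[OF Sc Tc])
    moreover have "S = (S \<ominus>\<^bsub>op_mat N\<^esub> T) \<oplus>\<^bsub>op_mat N\<^esub> T"
      using Sc Tc by (simp add: a_minus_def C.a_assoc C.l_neg)
    ultimately show ?thesis unfolding a_r_coset_def' by blast
  qed
  moreover have "K \<oplus>\<^bsub>op_mat N\<^esub> T \<in> mat_lifts N X" if K: "K \<in> compact_mats N" for K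
  proof -
    have "K \<in> carrier (op_mat N)" using K by (simp add: compact_mats_def)
    then show ?thesis
      using C.a_closed[OF _ Tc] K lift_compact_perturb[OF mat_cstar_entry[OF X] Te]
      by (auto simp: mat_lifts_def compact_mats_def op_mat_simps(5) mat_cstar_apply add.commute)
  qed
  ultimately show ?thesis unfolding a_r_coset_def' by blast
qed

lemma mat_lifts_ops:
  assumes X: "X \<in> carrier (mat_cstar N A)" and T: "T \<in> mat_lifts N X"
  shows "Y \<in> carrier (mat_cstar N A) \<Longrightarrow> S \<in> mat_lifts N Y \<Longrightarrow>
      T \<oplus>\<^bsub>op_mat N\<^esub> S \<in> mat_lifts N (X \<oplus>\<^bsub>mat_cstar N A\<^esub> Y)"
    and "Y \<in> carrier (mat_cstar N A) \<Longrightarrow> S \<in> mat_lifts N Y \<Longrightarrow>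
      T \<otimes>\<^bsub>op_mat N\<^esub> S \<in> mat_lifts N (X \<otimes>\<^bsub>mat_cstar N A\<^esub> Y)"
    and "c \<odot>\<^bsub>op_mat N\<^esub> T \<in> mat_lifts N (c \<odot>\<^bsub>mat_cstar N A\<^esub> X)"
    and "star (op_mat N) T \<in> mat_lifts N (star (mat_cstar N A) X)"
proof -
  interpret C: unital_cstar_algebra "op_mat N :: (nat \<times> nat \<Rightarrow> 'h \<Rightarrow>\<^sub>L 'h) cstar" by (rule op_mat_cstar)
  have Tc: "T \<in> carrier (op_mat N)" and Te: "\<And>i j. i < N \<Longrightarrow> j < N \<Longrightarrow> T (i, j) \<in> R (X (i, j))"
    using T by (auto simp: mat_lifts_def)
  note Xe = mat_cstar_entry[OF X]
  show "c \<odot>\<^bsub>op_mat N\<^esub> T \<in> mat_lifts N (c \<odot>\<^bsub>mat_cstar N A\<^esub> X)"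
    using C.M.smult_closed[OF _ Tc, of c] lift_smult[OF Xe Te]
    by (auto simp: mat_lifts_def op_mat_simps(6) mat_cstar_apply class_ring_simps)
  show "star (op_mat N) T \<in> mat_lifts N (star (mat_cstar N A) X)"
    using C.star_closed[OF Tc] lift_star[OF Xe Te]
    by (auto simp: mat_lifts_def op_mat_simps(7) mat_cstar_apply)
  assume Y: "Y \<in> carrier (mat_cstar N A)" and S: "S \<in> mat_lifts N Y"
  have Sc: "S \<in> carrier (op_mat N)" and Se: "\<And>i j. i < N \<Longrightarrow> j < N \<Longrightarrow> S (i, j) \<in> R (Y (i, j))"
    using S by (auto simp: mat_lifts_def)
  note Ye = mat_cstar_entry[OF Y]
  show "T \<oplus>\<^bsub>op_mat N\<^esub> S \<in> mat_lifts N (X \<oplus>\<^bsub>mat_cstar N A\<^esub> Y)"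
    using C.a_closed[OF Tc Sc] lift_add[OF Xe Ye Te Se]
    by (auto simp: mat_lifts_def op_mat_simps(5) mat_cstar_apply)
  have "(T \<otimes>\<^bsub>op_mat N\<^esub> S) (i, j) \<in> R ((X \<otimes>\<^bsub>mat_cstar N A\<^esub> Y) (i, j))" if ij: "i < N" "j < N" for i j
    unfolding op_mat_mult_apply[OF Tc Sc ij] mat_cstar_apply(1)[OF ij]
    using ij by (intro lift_finsum m_closed Xe Ye lift_mult Te Se)
  then show "T \<otimes>\<^bsub>op_mat N\<^esub> S \<in> mat_lifts N (X \<otimes>\<^bsub>mat_cstar N A\<^esub> Y)"
    using C.m_closed[OF Tc Sc] by (simp add: mat_lifts_def)
qed

text \<open>Two lifts of the same matrix differ by a compact one, so the set of lifts of \<open>X\<close> is a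
  coset; the operations of the quotient can then be computed on representatives.\<close>

lemma mat_lifts_hom:
  fixes N :: nat
  defines "Q \<equiv> cstar_quotient (op_mat N) (compact_mats N) :: (nat \<times> nat \<Rightarrow> 'h \<Rightarrow>\<^sub>L 'h) set cstar"
  assumes X: "X \<in> carrier (mat_cstar N A)"
  shows "mat_lifts N X \<in> carrier Q"
    and "Y \<in> carrier (mat_cstar N A) \<Longrightarrow>
      mat_lifts N (X \<oplus>\<^bsub>mat_cstar N A\<^esub> Y) = mat_lifts N X \<oplus>\<^bsub>Q\<^esub> mat_lifts N Y"
    and "Y \<in> carrier (mat_cstar N A) \<Longrightarrow>
      mat_lifts N (X \<otimes>\<^bsub>mat_cstar N A\<^esub> Y) = mat_lifts N X \<otimes>\<^bsub>Q\<^esub> mat_lifts N Y"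
    and "mat_lifts N (c \<odot>\<^bsub>mat_cstar N A\<^esub> X) = c \<odot>\<^bsub>Q\<^esub> mat_lifts N X"
    and "mat_lifts N (star (mat_cstar N A) X) = star Q (mat_lifts N X)"
proof -
  let ?C = "op_mat N :: (nat \<times> nat \<Rightarrow> 'h \<Rightarrow>\<^sub>L 'h) cstar"
  interpret C: unital_cstar_algebra ?C by (rule op_mat_cstar)
  interpret I: ideal "compact_mats N" ?C by (rule conjunct1[OF compact_mats_ideal[unfolded cstar_ideal_def]])
  interpret MA: unital_star_algebra "mat_cstar N A" by (rule S.mat_star_algebra)
  obtain T where T: "T \<in> mat_lifts N X" using mat_lifts_ex[OF X] by blast
  then have Tc: "T \<in> carrier ?C" by (simp add: mat_lifts_def)
  show "mat_lifts N X \<in> carrier Q"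
    using Tc by (auto simp: Q_def cstar_quotient_def mat_lifts_coset[OF X T] A_RCOSETS_def')
  show "mat_lifts N (c \<odot>\<^bsub>mat_cstar N A\<^esub> X) = c \<odot>\<^bsub>Q\<^esub> mat_lifts N X"
  proof -
    have "compact_mats N +>\<^bsub>?C\<^esub> (c \<odot>\<^bsub>?C\<^esub> S) = mat_lifts N (c \<odot>\<^bsub>mat_cstar N A\<^esub> X)" if "S \<in> mat_lifts N X" for S
      using mat_lifts_coset[OF _ mat_lifts_ops(3)[OF X that]] X by simp
    then show ?thesis using T by (auto simp: Q_def cstar_quotient_def)
  qed
  show "mat_lifts N (star (mat_cstar N A) X) = star Q (mat_lifts N X)"
  proof -
    have "S \<in> star ?C ` mat_lifts N X" if S: "S \<in> mat_lifts N (star (mat_cstar N A) X)" for S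
    proof (rule image_eqI)
      show "S = star ?C (star ?C S)" using S by (simp add: mat_lifts_def C.star_star)
      show "star ?C S \<in> mat_lifts N X" using mat_lifts_ops(4)[OF _ S] X by (simp add: MA.star_star)
    qed
    then show ?thesis using mat_lifts_ops(4)[OF X] by (auto simp: Q_def cstar_quotient_def)
  qed
  assume Y: "Y \<in> carrier (mat_cstar N A)"
  obtain S where S: "S \<in> mat_lifts N Y" using mat_lifts_ex[OF Y] by blast
  then have Sc: "S \<in> carrier ?C" by (simp add: mat_lifts_def)
  show "mat_lifts N (X \<oplus>\<^bsub>mat_cstar N A\<^esub> Y) = mat_lifts N X \<oplus>\<^bsub>Q\<^esub> mat_lifts N Y"
    using mat_lifts_coset[OF _ mat_lifts_ops(1)[OF X T Y S]] X Y I.a_rcos_sum[OF Tc Sc]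
    by (simp add: Q_def cstar_quotient_def mat_lifts_coset[OF X T] mat_lifts_coset[OF Y S])
  show "mat_lifts N (X \<otimes>\<^bsub>mat_cstar N A\<^esub> Y) = mat_lifts N X \<otimes>\<^bsub>Q\<^esub> mat_lifts N Y"
    using mat_lifts_coset[OF _ mat_lifts_ops(2)[OF X T Y S]] X Y I.rcoset_mult_add[OF Tc Sc]
    by (simp add: Q_def cstar_quotient_def mat_lifts_coset[OF X T] mat_lifts_coset[OF Y S])
qed

text \<open>A *-homomorphism maps squares of matrices to squares of matrices.\<close>

lemma mat_lifts_ucp:
  fixes N :: nat
  defines "Q \<equiv> cstar_quotient (op_mat N) (compact_mats N) :: (nat \<times> nat \<Rightarrow> 'h \<Rightarrow>\<^sub>L 'h) set cstar"
  assumes sys: "operator_subsystem (mat_cstar N A) S"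
  shows "ucp_map (mat_cstar N A) S Q (mat_lifts N)"
proof -
  let ?C = "op_mat N :: (nat \<times> nat \<Rightarrow> 'h \<Rightarrow>\<^sub>L 'h) cstar"
  let ?M = "mat_cstar N A"
  interpret C: unital_cstar_algebra ?C by (rule op_mat_cstar)
  interpret I: ideal "compact_mats N" ?C by (rule conjunct1[OF compact_mats_ideal[unfolded cstar_ideal_def]])
  interpret MA: unital_star_algebra ?M by (rule S.mat_star_algebra)
  note hom = mat_lifts_hom[where N = N, folded Q_def]
  note SD = operator_subsystemD[OF sys]
  have Q_ring: "carrier Q = carrier (?C Quot compact_mats N)" "(\<oplus>\<^bsub>Q\<^esub>) = (\<oplus>\<^bsub>?C Quot compact_mats N\<^esub>)"
    "\<zero>\<^bsub>Q\<^esub> = \<zero>\<^bsub>?C Quot compact_mats N\<^esub>"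
    by (simp_all add: Q_def cstar_quotient_def FactRing_def)
  interpret CQ: ring "?C Quot compact_mats N" by (rule I.quotient_is_ring)
  interpret Q: abelian_monoid Q
    by (rule abelian_monoidI) (simp_all add: Q_ring CQ.a_ac)
  have one: "mat_lifts N \<one>\<^bsub>?M\<^esub> = \<one>\<^bsub>Q\<^esub>"
  proof -
    have "\<one>\<^bsub>?C\<^esub> (i, j) \<in> R (\<one>\<^bsub>?M\<^esub> (i, j))" if "i < N" "j < N" for i j
      using that by (simp add: op_mat_simps(2) mat_cstar_apply lift_one lift_zero compact_ops_zero)
    then have "\<one>\<^bsub>?C\<^esub> \<in> mat_lifts N \<one>\<^bsub>?M\<^esub>"
      using C.one_closed by (simp add: mat_lifts_def)
    from mat_lifts_coset[OF MA.one_closed this] show ?thesis by (simp add: Q_def cstar_quotient_def)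
  qed
  have zero: "mat_lifts N \<zero>\<^bsub>?M\<^esub> = \<zero>\<^bsub>Q\<^esub>"
  proof -
    have "R (\<zero>\<^bsub>?M\<^esub> (i, j)) = compact_ops" if "i < N" "j < N" for i j
      using that by (simp only: mat_cstar_apply lift_zero)
    then have "mat_lifts N \<zero>\<^bsub>?M\<^esub> = compact_mats N"
      unfolding mat_lifts_def compact_mats_def by (intro Collect_cong conj_cong refl all_cong) simp
    then show ?thesis by (simp add: Q_def cstar_quotient_def)
  qed
  have sum: "mat_lifts N (\<Oplus>\<^bsub>?M\<^esub>l\<in>L. F l) = (\<Oplus>\<^bsub>Q\<^esub>l\<in>L. mat_lifts N (F l))"
    if "finite L" "\<And>l. l \<in> L \<Longrightarrow> F l \<in> carrier ?M" for L :: "nat set" and F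
    using that
  proof (induction L rule: finite_induct)
    case empty
    then show ?case by (simp add: zero)
  next
    case (insert l L)
    have "(\<Oplus>\<^bsub>?M\<^esub>l\<in>insert l L. F l) = F l \<oplus>\<^bsub>?M\<^esub> (\<Oplus>\<^bsub>?M\<^esub>l\<in>L. F l)"
      using insert by (intro MA.finsum_insert) auto
    moreover have "(\<Oplus>\<^bsub>Q\<^esub>l\<in>insert l L. mat_lifts N (F l)) = mat_lifts N (F l) \<oplus>\<^bsub>Q\<^esub> (\<Oplus>\<^bsub>Q\<^esub>l\<in>L. mat_lifts N (F l))"
      using insert hom(1) by (intro Q.finsum_insert) auto
    ultimately show ?case using insert hom(2)[of "F l" "\<Oplus>\<^bsub>?M\<^esub>l\<in>L. F l"] by simp
  qed
  have pos: "mat_map k (mat_lifts N) X \<in> positive_cone (mat_cstar k Q)"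
    if X: "X \<in> mat_carrier k S \<inter> positive_cone (mat_cstar k ?M)" for k X
  proof -
    obtain B where B: "B \<in> carrier (mat_cstar k ?M)" "X = star (mat_cstar k ?M) B \<otimes>\<^bsub>mat_cstar k ?M\<^esub> B"
      using X by (auto simp: positive_cone_def)
    let ?D = "mat_map k (mat_lifts N) B"
    note Be = mat_cstar_entry[OF B(1)]
    have Dc: "?D \<in> carrier (mat_cstar k Q)"
      using hom(1)[OF Be] by (auto simp: mat_cstar_carrier mat_map_def)
    have De: "?D (i, j) = mat_lifts N (B (i, j))" if "i < k" "j < k" for i j
      using that by (simp add: mat_map_def)
    have "mat_lifts N (X (i, j)) = (star (mat_cstar k Q) ?D \<otimes>\<^bsub>mat_cstar k Q\<^esub> ?D) (i, j)" if ij: "i < k" "j < k" for i j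
    proof -
      have "X (i, j) = (\<Oplus>\<^bsub>?M\<^esub>l\<in>{..<k}. star ?M (B (l, i)) \<otimes>\<^bsub>?M\<^esub> B (l, j))"
        unfolding B(2) mat_cstar_apply(1)[OF ij]
        using ij Be by (intro MA.finsum_cong') (auto simp: mat_cstar_apply(6))
      then have "mat_lifts N (X (i, j)) = (\<Oplus>\<^bsub>Q\<^esub>l\<in>{..<k}. mat_lifts N (star ?M (B (l, i)) \<otimes>\<^bsub>?M\<^esub> B (l, j)))"
        using ij Be by (simp only:) (intro sum, auto)
      also have "\<dots> = (\<Oplus>\<^bsub>Q\<^esub>l\<in>{..<k}. star (mat_cstar k Q) ?D (i, l) \<otimes>\<^bsub>Q\<^esub> ?D (l, j))"
      proof (rule Q.finsum_cong'[OF refl])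
        have entry: "mat_lifts N (star ?M (B (l, i)) \<otimes>\<^bsub>?M\<^esub> B (l, j)) = star (mat_cstar k Q) ?D (i, l) \<otimes>\<^bsub>Q\<^esub> ?D (l, j)"
          if "l < k" for l
          using that ij hom(3)[OF MA.star_closed[OF Be] Be] hom(5)[OF Be]
          by (simp add: mat_cstar_apply(6) De)
        then show "mat_lifts N (star ?M (B (l, i)) \<otimes>\<^bsub>?M\<^esub> B (l, j)) = star (mat_cstar k Q) ?D (i, l) \<otimes>\<^bsub>Q\<^esub> ?D (l, j)"
          if "l \<in> {..<k}" for l using that by simp
        show "(\<lambda>l. star (mat_cstar k Q) ?D (i, l) \<otimes>\<^bsub>Q\<^esub> ?D (l, j)) \<in> {..<k} \<rightarrow> carrier Q"
          using ij hom(1)[OF MA.m_closed[OF MA.star_closed[OF Be] Be]] by (auto simp: entry[symmetric])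
      qed
      finally show ?thesis by (simp add: mat_cstar_apply(1)[OF ij])
    qed
    then have "mat_map k (mat_lifts N) X = star (mat_cstar k Q) ?D \<otimes>\<^bsub>mat_cstar k Q\<^esub> ?D"
      by (auto simp: mat_map_def fun_eq_iff mat_cstar_def[of k Q])
    then show ?thesis using Dc by (auto simp: positive_cone_def)
  qed
  show ?thesis
    unfolding ucp_map_def module_hom_def
    using one pos by (auto simp: hom(1,2,4)[OF subsetD[OF SD(1)]] subsetD[OF SD(1)] simp del: Int_iff)
qed

text \<open>A ucp lift of the amplified map through the quotient by the compact matrices is a ucp lift of
  \<open>R \<otimes> id\<close>.\<close>

lemma no_lifting_property:
  assumes sys: "operator_subsystem (mat_cstar N A) S"
    and R: "\<And>a T. a \<in> carrier A \<Longrightarrow> T \<in> R a \<Longrightarrow> R a = calkin_map T"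
    and no_lift: "\<not> has_ucp_lift (mat_cstar N A) S (mat_cstar N bounded_ops) (mat_map N calkin_map) (mat_map N R)"
  shows "\<not> lifting_property TYPE(nat \<times> nat \<Rightarrow> 'h \<Rightarrow>\<^sub>L 'h) (mat_cstar N A) S"
proof
  let ?C = "op_mat N :: (nat \<times> nat \<Rightarrow> 'h \<Rightarrow>\<^sub>L 'h) cstar"
  interpret C: unital_cstar_algebra ?C by (rule op_mat_cstar)
  interpret I: ideal "compact_mats N" ?C by (rule conjunct1[OF compact_mats_ideal[unfolded cstar_ideal_def]])
  note SD = operator_subsystemD[OF sys]
  assume "lifting_property TYPE(nat \<times> nat \<Rightarrow> 'h \<Rightarrow>\<^sub>L 'h) (mat_cstar N A) S"
  then have "has_ucp_lift (mat_cstar N A) S ?C (\<lambda>x. compact_mats N +>\<^bsub>?C\<^esub> x) (mat_lifts N)"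
    unfolding lifting_property_def using op_mat_cstar compact_mats_ideal mat_lifts_ucp[OF sys] by blast
  then obtain \<psi> where \<psi>: "ucp_map (mat_cstar N A) S ?C \<psi>"
    and lift: "\<And>s. s \<in> S \<Longrightarrow> compact_mats N +>\<^bsub>?C\<^esub> \<psi> s = mat_lifts N s"
    by (auto simp: has_ucp_lift_def)
  have "mat_map N calkin_map (\<psi> s) = mat_map N R s" if s: "s \<in> S" for s
  proof -
    have "\<psi> s \<in> carrier ?C" using \<psi> s by (auto simp: ucp_map_def module_hom_def)
    then have "\<psi> s \<in> mat_lifts N s" using I.a_rcos_self lift[OF s] by blast
    then show ?thesis
      using R[OF mat_cstar_entry] s SD(1) by (auto simp: mat_lifts_def mat_map_def fun_eq_iff)
  qed
  then show False using no_lift \<psi> by (auto simp: has_ucp_lift_def ucp_map_op_mat)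
qed

end

section \<open>A four-dimensional operator system without ucp lift\<close>

theorem theorem2:
  fixes A :: "'a cstar"
    and \<rho> :: "'a \<Rightarrow> ('h::chilbert_space \<Rightarrow>\<^sub>L 'h) set"
  assumes separable: "separable_space (euclidean :: 'h topology)"
    and infinite_dim: "\<not> (\<exists>B :: 'h set. finite B \<and> complex_vector.span B = UNIV)"
    and A: "unital_cstar_algebra A"
    and fin_gen: "finitely_generated_cstar A"
    and hom: "unital_star_hom A calkin \<rho>"
    and no_lift: "\<not> has_ucp_lift A (carrier A) bounded_ops calkin_map \<rho>"
  shows "\<exists>(n::nat) S.
      operator_subsystem (mat_cstar (n + 1) A) S \<and>
      has_dimension (mat_cstar (n + 1) A) S 4 \<and>
      \<not> has_ucp_lift (mat_cstar (n + 1) A) S (mat_cstar (n + 1) bounded_ops)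
          (mat_map (n + 1) calkin_map) (mat_map (n + 1) \<rho>) \<and>
      \<not> lifting_property TYPE(nat \<times> nat \<Rightarrow> ('h \<Rightarrow>\<^sub>L 'h)) (mat_cstar (n + 1) A) S"
proof -
  interpret calkin_hom A \<rho> by (rule calkin_hom_of_star_hom[OF A hom])
  obtain e :: "nat \<Rightarrow> 'h" where e: "\<And>i j. cinner (e i) (e j) = (if i = j then 1 else 0)"
    using exists_orthonormal_sequence[OF infinite_dim] by blast
  have nontrivial: "\<one>\<^bsub>A\<^esub> \<noteq> \<zero>\<^bsub>A\<^esub>"
    using lift_one lift_zero id_not_compact[OF e] by metis
  obtain G where G: "finite G" "G \<subseteq> carrier A" "cstar_generated A G = carrier A"
    using fin_gen by (auto simp: finitely_generated_cstar_def)
  obtain g and m :: nat where G_eq: "G = g ` {..<m}"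
    using finite_imp_nat_seg_image_inj_on[OF G(1)] unfolding lessThan_def by blast
  interpret single_generator A m g
    by (intro single_generator.intro single_generator_axioms.intro) (use G_eq G(2) in \<open>auto intro: S.unital_star_algebra_axioms\<close>)
  interpret MA: unital_star_algebra "mat_cstar (m + 4) A" by (rule S.mat_star_algebra)
  obtain S where S: "operator_subsystem M S" "has_dimension M S 4" "x \<in> S" "star M x \<in> S"
      "star M x \<otimes>\<^bsub>M\<^esub> x \<oplus>\<^bsub>M\<^esub> x \<otimes>\<^bsub>M\<^esub> star M x \<in> S"
    using MA.four_dimensional_system[OF gen_mat_closed refl gen_mat_independent[OF nontrivial]] by blast
  have no_system_lift: "\<not> has_ucp_lift M S (mat_cstar N bounded_ops) (mat_map N calkin_map) (mat_map N \<rho>)"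
  proof
    assume "has_ucp_lift M S (mat_cstar N bounded_ops) (mat_map N calkin_map) (mat_map N \<rho>)"
    then have "has_ucp_lift A (carrier A) bounded_ops calkin_map \<rho>"
      using G(2,3) unfolding G_eq
      by (intro lift_of_system_lift[OF calkin_hom_axioms _ _ e separable S(1,3,4,5)]) auto
    then show False using no_lift by contradiction
  qed
  have "\<rho> a = calkin_map T" if "a \<in> carrier A" "T \<in> \<rho> a" for a T
    by (rule Set.set_eqI) (simp only: lift_iff[OF that] calkin_map_iff)
  then have "\<not> lifting_property TYPE(nat \<times> nat \<Rightarrow> ('h \<Rightarrow>\<^sub>L 'h)) M S"
    by (rule no_lifting_property[OF S(1) _ no_system_lift])
  \<comment> \<open>The matrix size \<open>m + 4\<close> of the single generator is \<open>n + 1\<close> for \<open>n = m + 3\<close>.\<close>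
  moreover have "m + 4 = (m + 3) + 1" by simp
  ultimately show ?thesis
    using S(1,2) no_system_lift by metis
qed

end
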